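(* Let $\nu\ge1$, $\omega>0$, $\lambda_1,\dots,\lambda_\nu\ge0$, $c_{\omega,\lambda}=(\omega^2+4\sum_j\lambda_j)^{1/2}$, and $v_h(\mu)=c_{\omega,\lambda}\max\left(\frac2\mu,e^{(\mu/2)+1}\right)$. Let $V\in C^1(\mathbb R)$ be real valued with $V'\in L^1(\mathbb R)$ and $\kappa_V=\int dw\,|\widehat{V'}(w)|\,|w|<\infty$. For a positive integer $L$ let $\Lambda_L=(-L,L]^\nu\cap\mathbb Z^\nu$, $H_L=H_L^h+\sum_{x\in\Lambda_L}V(q_x)$ and $\tau^L_t(A)=e^{itH_L}Ae^{-itH_L}$ (see context). Let $F_\mu(r)=e^{-\mu r}(1+r)^{-(\nu+1)}$ and $C_\nu=2^{\nu+1}\sum_{z\in\Lambda_L}(1+|z|)^{-(\nu+1)}$. Then for every $\mu\ge1$ and $\epsilon>0$, with $$C=\big(2+c_{\omega,\lambda}e^{(\mu+\epsilon)/2}+c_{\omega,\lambda}^{-1}\big)\sup_{s\ge0}\big[(1+s)^{\nu+1}e^{-\epsilon s}\big],\qquad v=v_h(\mu+\epsilon)+\frac{C\,C_\nu\,\kappa_V}{\mu+\epsilon},$$ for every pair of finite sets $X,Y\subset\mathbb Z^\nu$, every $L$ with $X,Y\subset\Lambda_L$, all bounded $f,g:\Lambda_L\to\mathbb C$ with $\operatorname{supp}f\subset X$, $\operatorname{supp}g\subset Y$, and all $t\in\mathbb R$, $$\|[\tau_t^L(W(f)),W(g)]\|\le C\,\|f\|_\infty\|g\|_\infty\,e^{(\mu+\epsilon)v|t|}\sum_{x\in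 X,y\in Y}F_\mu(d(x,y)).$$
   Context: $\mathcal H_{\Lambda_L}=\bigotimes_{x\in\Lambda_L}L^2(\mathbb R,dq_x)$; $q_x$, $p_x=-i\,d/dq_x$ act in the $x$-th factor. $H_L^h=\sum_{x\in\Lambda_L}\big(p_x^2+\omega^2q_x^2+\sum_{j=1}^\nu\lambda_j(q_x-q_{x+e_j})^2\big)$ with periodic boundary conditions $q_{x+e_j}:=q_{x-(2L-1)e_j}$ when $x+e_j\notin\Lambda_L$. Weyl operator: $W(f)=\exp\big(i\sum_{x}(q_x\,\mathrm{Re}f_x+p_x\,\mathrm{Im}f_x)\big)$. $d(x,y)=\sum_{j=1}^\nu\min_{\eta_j\in\mathbb Z}|x_j-y_j+2L\eta_j|$ (torus distance), $|z|=\sum_j|z_j|$. Fourier transform: $\widehat{V'}(w)=\frac1{2\pi}\int dq\,V'(q)e^{-iqw}$. *)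

theory Defs
  imports "HOL-Probability.Probability"
begin

definition Lam :: "nat \<Rightarrow> nat \<Rightarrow> int list set" where
  "Lam nu L = {x. length x = nu \<and> (\<forall>j<nu. - int L < x ! j \<and> x ! j \<le> int L)}"

definition Zpts :: "nat \<Rightarrow> int list set" where
  "Zpts nu = {x. length x = nu}"

text \<open>x + e_j with the periodic identification q_{x+e_j} := q_{x-(2L-1)e_j} outside Lambda_L.\<close>
definition nbr :: "nat \<Rightarrow> int list \<Rightarrow> nat \<Rightarrow> int list" where
  "nbr L x j = (if x ! j + 1 \<in> {- int L <.. int L} then x[j := x ! j + 1]
                else x[j := x ! j - (2 * int L - 1)])"

definition tdist :: "nat \<Rightarrow> nat \<Rightarrow> int list \<Rightarrow> int list \<Rightarrow> int" where
  "tdist nu L x y = (\<Sum>j<nu. (INF \<eta>::int. \<bar>x ! j - y ! j + 2 * int L * \<eta>\<bar>))"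

definition l1abs :: "nat \<Rightarrow> int list \<Rightarrow> int" where
  "l1abs nu z = (\<Sum>j<nu. \<bar>z ! j\<bar>)"

definition cfgM :: "nat \<Rightarrow> nat \<Rightarrow> (int list \<Rightarrow> real) measure" where
  "cfgM nu L = PiM (Lam nu L) (\<lambda>_. lborel)"

definition L2 :: "'a measure \<Rightarrow> ('a \<Rightarrow> complex) set" where
  "L2 M = {\<psi>. \<psi> \<in> borel_measurable M \<and> (\<integral>\<^sup>+ q. ennreal ((cmod (\<psi> q))\<^sup>2) \<partial>M) < \<infinity>}"

definition l2norm :: "'a measure \<Rightarrow> ('a \<Rightarrow> complex) \<Rightarrow> real" where
  "l2norm M \<psi> = sqrt (enn2real (\<integral>\<^sup>+ q. ennreal ((cmod (\<psi> q))\<^sup>2) \<partial>M))"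

text \<open>W(f) = exp(i sum_x (q_x Re f_x + p_x Im f_x)), p_x = -i d/dq_x, acts on wave functions as
 (W(f) psi)(q) = exp(i sum_x (Re f_x q_x + Re f_x Im f_x / 2)) psi(q + Im f).\<close>
definition Weyl :: "nat \<Rightarrow> nat \<Rightarrow> (int list \<Rightarrow> complex) \<Rightarrow> ((int list \<Rightarrow> real) \<Rightarrow> complex)
                     \<Rightarrow> ((int list \<Rightarrow> real) \<Rightarrow> complex)" where
  "Weyl nu L f \<psi> = (\<lambda>q. exp (\<i> * complex_of_real
        (\<Sum>x\<in>Lam nu L. Re (f x) * q x + Re (f x) * Im (f x) / 2))
      * \<psi> (restrict (\<lambda>y. q y + Im (f y)) (Lam nu L)))"

text \<open>Core: compactly supported functions on R^Lambda_L with continuous first and second partial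
 derivatives in each coordinate (contains C_c^infinity; H_L is essentially self-adjoint on it).\<close>
definition core :: "nat \<Rightarrow> nat \<Rightarrow> ((int list \<Rightarrow> real) \<Rightarrow> complex) set" where
  "core nu L = {\<psi>. \<psi> \<in> borel_measurable (cfgM nu L) \<and>
      continuous_on (PiE (Lam nu L) (\<lambda>_. UNIV)) \<psi> \<and>
      (\<exists>R. \<forall>q\<in>PiE (Lam nu L) (\<lambda>_. UNIV). (\<exists>x\<in>Lam nu L. \<bar>q x\<bar> > R) \<longrightarrow> \<psi> q = 0) \<and>
      (\<forall>x\<in>Lam nu L. \<exists>d1 d2.
         continuous_on (PiE (Lam nu L) (\<lambda>_. UNIV)) d1 \<and>
         continuous_on (PiE (Lam nu L) (\<lambda>_. UNIV)) d2 \<and>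
         (\<forall>q\<in>PiE (Lam nu L) (\<lambda>_. UNIV).
            ((\<lambda>s. \<psi> (q(x := s))) has_vector_derivative d1 q) (at (q x)) \<and>
            ((\<lambda>s. d1 (q(x := s))) has_vector_derivative d2 q) (at (q x))))}"

definition dxx :: "int list \<Rightarrow> ((int list \<Rightarrow> real) \<Rightarrow> complex) \<Rightarrow> (int list \<Rightarrow> real) \<Rightarrow> complex" where
  "dxx x \<psi> q = vector_derivative (\<lambda>s. vector_derivative (\<lambda>r. \<psi> (q(x := r))) (at s)) (at (q x))"

definition Ham :: "nat \<Rightarrow> real \<Rightarrow> (nat \<Rightarrow> real) \<Rightarrow> (real \<Rightarrow> real) \<Rightarrow> nat
                   \<Rightarrow> ((int list \<Rightarrow> real) \<Rightarrow> complex) \<Rightarrow> ((int list \<Rightarrow> real) \<Rightarrow> complex)" where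
  "Ham nu \<omega> lam V L \<psi> = (\<lambda>q. \<Sum>x\<in>Lam nu L.
      - dxx x \<psi> q
      + complex_of_real (\<omega>\<^sup>2 * (q x)\<^sup>2 + (\<Sum>j<nu. lam j * (q x - q (nbr L x j))\<^sup>2) + V (q x)) * \<psi> q)"

text \<open>U is the unitary group e^{-itH_L}: a strongly continuous one-parameter group of unitaries on
 L^2(R^Lambda_L) whose generator agrees with -i H_L on the core (which determines it uniquely).\<close>
definition is_dynamics :: "nat \<Rightarrow> real \<Rightarrow> (nat \<Rightarrow> real) \<Rightarrow> (real \<Rightarrow> real) \<Rightarrow> nat
      \<Rightarrow> (real \<Rightarrow> ((int list \<Rightarrow> real) \<Rightarrow> complex) \<Rightarrow> ((int list \<Rightarrow> real) \<Rightarrow> complex)) \<Rightarrow> bool" where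
  "is_dynamics nu \<omega> lam V L U \<longleftrightarrow> (let M = cfgM nu L in
     (\<forall>t. \<forall>\<psi>\<in>L2 M. U t \<psi> \<in> L2 M \<and> l2norm M (U t \<psi>) = l2norm M \<psi>) \<and>
     (\<forall>t. \<forall>\<phi>\<in>L2 M. \<exists>\<psi>\<in>L2 M. AE q in M. U t \<psi> q = \<phi> q) \<and>
     (\<forall>t a b. \<forall>\<psi>\<in>L2 M. \<forall>\<phi>\<in>L2 M.
         AE q in M. U t (\<lambda>r. a * \<psi> r + b * \<phi> r) q = a * U t \<psi> q + b * U t \<phi> q) \<and>
     (\<forall>\<psi>\<in>L2 M. AE q in M. U 0 \<psi> q = \<psi> q) \<and>
     (\<forall>s t. \<forall>\<psi>\<in>L2 M. AE q in M. U (s + t) \<psi> q = U s (U t \<psi>) q) \<and>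
     (\<forall>\<psi>\<in>L2 M. \<forall>t0. ((\<lambda>t. l2norm M (\<lambda>q. U t \<psi> q - U t0 \<psi> q)) \<longlongrightarrow> 0) (at t0)) \<and>
     (\<forall>\<psi>\<in>core nu L.
        ((\<lambda>h. l2norm M (\<lambda>q. (U h \<psi> q - \<psi> q) / complex_of_real h + \<i> * Ham nu \<omega> lam V L \<psi> q))
           \<longlongrightarrow> 0) (at 0)))"

definition Fourier :: "(real \<Rightarrow> real) \<Rightarrow> real \<Rightarrow> complex" where
  "Fourier h w = (1 / (2 * pi)) * (LINT q|lborel. complex_of_real (h q) * exp (- \<i> * complex_of_real (q * w)))"

definition c_ol :: "nat \<Rightarrow> real \<Rightarrow> (nat \<Rightarrow> real) \<Rightarrow> real" where
  "c_ol nu \<omega> lam = sqrt (\<omega>\<^sup>2 + 4 * (\<Sum>j<nu. lam j))"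

definition v_h :: "nat \<Rightarrow> real \<Rightarrow> (nat \<Rightarrow> real) \<Rightarrow> real \<Rightarrow> real" where
  "v_h nu \<omega> lam \<mu> = c_ol nu \<omega> lam * max (2 / \<mu>) (exp (\<mu> / 2 + 1))"

definition F_mu :: "nat \<Rightarrow> real \<Rightarrow> real \<Rightarrow> real" where
  "F_mu nu \<mu> r = exp (- \<mu> * r) * (1 + r) powr (- real (nu + 1))"

definition C_nu :: "nat \<Rightarrow> nat \<Rightarrow> real" where
  "C_nu nu L = 2 ^ (nu + 1) * (\<Sum>z\<in>Lam nu L. (1 + real_of_int (l1abs nu z)) powr (- real (nu + 1)))"

definition supnorm :: "nat \<Rightarrow> nat \<Rightarrow> (int list \<Rightarrow> complex) \<Rightarrow> real" where
  "supnorm nu L f = (SUP x\<in>Lam nu L. cmod (f x))"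

end

theory Submission
  imports Defs
begin

text \<open>
  Let \<open>\<tau>\<^sub>t\<close> be the full and \<open>f\<^sub>t\<close> the classical harmonic evolution. The harmonic dynamics maps \<open>W f\<close> to \<open>W f\<^sub>t\<close>,
  and powers of the nearest-neighbour matrix show that \<open>f\<^sub>t\<close> decays exponentially outside a light cone.
  The curve \<open>s \<mapsto> \<tau>\<^sub>s (W f\<^bsub>t-s\<^esub>)\<close> interpolates between \<open>W f\<^sub>t\<close> and \<open>\<tau>\<^sub>t (W f)\<close>; its derivative involves only the bounded
  multiplication operator \<open>\<Sum>\<^sub>x V(q\<^sub>x) - V(q\<^sub>x + Im f\<^bsub>t-s\<^esub>(x))\<close>, a superposition of the operators
  \<open>exp(i w q\<^sub>x) = W(w \<delta>\<^sub>x)\<close> with weights controlled by the Fourier transform of \<open>V'\<close>. The commutator with \<open>W g\<close> thus satisfies an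
  integral inequality that closes under convolution of \<open>F\<^sub>\<mu>\<close>.

  That the given group is differentiable along this curve is seen on coherent states: Gaussians built from the square root
  of the harmonic matrix evolve explicitly under the harmonic Hamiltonian, are limits of core functions, and span a
  dense subspace.
\<close>

section \<open>Square-integrable functions\<close>

text \<open>The group \<open>U\<close> is known only through its action on the core, and both
  Hamiltonians are unbounded. The harmonic dynamics is therefore never built as an operator: it
  enters only through curves of coherent states and through labels of Weyl operators. Estimates
  whose constants see a vector only through its norm pass to all of L^2. Constants: the harmonic
  matrix has range one and absolute row sums at most c^2, so against the weight exp(-(mu+eps) d) it
  is bounded by a^2 with a = c exp((mu+eps)/2). Alternating the two blocks of Hamilton's equations
  gives the growth exp(2 a |t|) and the prefactors 1 + a and 1 + 1/a, whose sum becomes the bracket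
  in C. A pure exponential has no volume-uniform convolution constant, since every site on a
  shortest path contributes fully; eps is spent, through the supremum in C, on the factor
  (1+r)^(-(nu+1)), which has one. In kappa, |w| is the size of the label w delta_x. The integral
  inequality is closed on these labels alone, because only they reappear under the integral; general
  f then costs one more step.\<close>

definition ip :: "'a measure \<Rightarrow> ('a \<Rightarrow> complex) \<Rightarrow> ('a \<Rightarrow> complex) \<Rightarrow> complex" where
  "ip M \<phi> \<psi> = (LINT q|M. cnj (\<phi> q) * \<psi> q)"

lemma measurable_cnj [measurable]: "cnj \<in> borel_measurable borel"
  by (intro borel_measurable_continuous_onI continuous_intros)

lemma L2_iff: "\<psi> \<in> L2 M \<longleftrightarrow> \<psi> \<in> borel_measurable M \<and> integrable M (\<lambda>q. (cmod (\<psi> q))\<^sup>2)"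
  unfolding L2_def by (auto simp: integrable_iff_bounded)

lemma L2_measurable [measurable_dest]: "\<psi> \<in> L2 M \<Longrightarrow> \<psi> \<in> borel_measurable M"
  by (simp add: L2_iff)

lemma L2_integrable: "\<psi> \<in> L2 M \<Longrightarrow> integrable M (\<lambda>q. (cmod (\<psi> q))\<^sup>2)"
  by (simp add: L2_iff)

lemma L2I_bound:
  assumes "\<psi> \<in> borel_measurable M" "integrable M (\<lambda>q. (w q)\<^sup>2)" "AE q in M. cmod (\<psi> q) \<le> w q"
  shows "\<psi> \<in> L2 M"
  unfolding L2_iff using assms
  by (auto intro!: Bochner_Integration.integrable_bound[OF assms(2)] simp: power_mono elim!: eventually_mono)

lemma l2norm_sq: "\<psi> \<in> L2 M \<Longrightarrow> (l2norm M \<psi>)\<^sup>2 = (LINT q|M. (cmod (\<psi> q))\<^sup>2)"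
  unfolding l2norm_def L2_iff by (subst integral_eq_nn_integral) auto

lemma l2norm_nonneg [simp]: "0 \<le> l2norm M \<psi>"
  unfolding l2norm_def by simp

lemma l2norm_cong_AE: "AE q in M. \<phi> q = \<psi> q \<Longrightarrow> l2norm M \<phi> = l2norm M \<psi>"
  unfolding l2norm_def
  by (intro arg_cong[where f=sqrt] arg_cong[where f=enn2real] nn_integral_cong_AE) (auto elim!: eventually_mono)

lemma l2norm_zero_AE:
  assumes "\<psi> \<in> L2 M" "l2norm M \<psi> = 0"
  shows "AE q in M. \<psi> q = 0"
proof -
  have "(LINT q|M. (cmod (\<psi> q))\<^sup>2) = 0" using l2norm_sq[OF assms(1)] assms(2) by simp
  then have "AE q in M. (cmod (\<psi> q))\<^sup>2 = 0"
    using integral_nonneg_eq_0_iff_AE[OF L2_integrable[OF assms(1)]] by auto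
  then show ?thesis by (auto elim!: eventually_mono)
qed

lemma l2norm_zero [simp]: "l2norm M (\<lambda>q. 0) = 0"
  by (simp add: l2norm_def)

lemma L2_cmult: "\<psi> \<in> L2 M \<Longrightarrow> (\<lambda>q. c * \<psi> q) \<in> L2 M"
  by (auto simp: L2_iff norm_mult power_mult_distrib)

lemma L2_uminus: "\<psi> \<in> L2 M \<Longrightarrow> (\<lambda>q. - \<psi> q) \<in> L2 M"
  by (auto simp: L2_iff)

lemma L2_add:
  assumes "\<phi> \<in> L2 M" "\<psi> \<in> L2 M"
  shows "(\<lambda>q. \<phi> q + \<psi> q) \<in> L2 M"
proof -
  have le: "(cmod (\<phi> q + \<psi> q))\<^sup>2 \<le> 2 * (cmod (\<phi> q))\<^sup>2 + 2 * (cmod (\<psi> q))\<^sup>2" for q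
  proof -
    have "(cmod (\<phi> q + \<psi> q))\<^sup>2 \<le> (cmod (\<phi> q) + cmod (\<psi> q))\<^sup>2"
      by (intro power_mono norm_triangle_ineq) auto
    also have "\<dots> \<le> 2 * (cmod (\<phi> q))\<^sup>2 + 2 * (cmod (\<psi> q))\<^sup>2"
      using sum_squares_bound[of "cmod (\<phi> q)" "cmod (\<psi> q)"] by (simp add: power2_sum)
    finally show ?thesis .
  qed
  have "integrable M (\<lambda>q. (cmod (\<phi> q + \<psi> q))\<^sup>2)"
  proof (rule Bochner_Integration.integrable_bound)
    show "integrable M (\<lambda>q. 2 * (cmod (\<phi> q))\<^sup>2 + 2 * (cmod (\<psi> q))\<^sup>2)"
      using assms by (auto simp: L2_iff)
    show "AE q in M. norm ((cmod (\<phi> q + \<psi> q))\<^sup>2) \<le> norm (2 * (cmod (\<phi> q))\<^sup>2 + 2 * (cmod (\<psi> q))\<^sup>2)"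
      using order_trans[OF le abs_ge_self] by (intro AE_I2) simp
  qed (use assms in measurable)
  then show ?thesis using assms by (simp add: L2_iff borel_measurable_add)
qed

lemma L2_diff: "\<phi> \<in> L2 M \<Longrightarrow> \<psi> \<in> L2 M \<Longrightarrow> (\<lambda>q. \<phi> q - \<psi> q) \<in> L2 M"
  using L2_add[OF _ L2_uminus] by force

lemma L2_mult_bounded:
  assumes "\<psi> \<in> L2 M" "h \<in> borel_measurable M" "AE q in M. cmod (h q) \<le> K"
  shows "(\<lambda>q. h q * \<psi> q) \<in> L2 M"
proof (rule L2I_bound[where w = "\<lambda>q. K * cmod (\<psi> q)"])
  show "integrable M (\<lambda>q. (K * cmod (\<psi> q))\<^sup>2)"
    using assms by (simp add: power_mult_distrib L2_iff)
  show "AE q in M. cmod (h q * \<psi> q) \<le> K * cmod (\<psi> q)"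
    using assms(3) by eventually_elim (auto simp: norm_mult intro: mult_right_mono)
qed (use assms in measurable)

lemma l2norm_mult_bounded:
  assumes "\<psi> \<in> L2 M" "h \<in> borel_measurable M" "AE q in M. cmod (h q) \<le> K" "0 \<le> K"
  shows "l2norm M (\<lambda>q. h q * \<psi> q) \<le> K * l2norm M \<psi>"
proof -
  have "(l2norm M (\<lambda>q. h q * \<psi> q))\<^sup>2 \<le> (LINT q|M. K\<^sup>2 * (cmod (\<psi> q))\<^sup>2)"
    unfolding l2norm_sq[OF L2_mult_bounded[OF assms(1-3)]]
  proof (rule integral_mono_AE)
    show "integrable M (\<lambda>q. (cmod (h q * \<psi> q))\<^sup>2)"
      by (rule L2_integrable[OF L2_mult_bounded[OF assms(1-3)]])
    show "integrable M (\<lambda>q. K\<^sup>2 * (cmod (\<psi> q))\<^sup>2)" using assms by (auto simp: L2_iff)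
    show "AE q in M. (cmod (h q * \<psi> q))\<^sup>2 \<le> K\<^sup>2 * (cmod (\<psi> q))\<^sup>2"
      using assms(3) by eventually_elim
        (auto simp: norm_mult power_mult_distrib[symmetric] intro!: power_mono mult_right_mono)
  qed
  also have "\<dots> = (K * l2norm M \<psi>)\<^sup>2" using assms by (simp add: l2norm_sq power_mult_distrib)
  finally show ?thesis by (rule power2_le_imp_le) (use assms(4) in simp)
qed

lemma l2norm_cmult: "\<psi> \<in> L2 M \<Longrightarrow> l2norm M (\<lambda>q. c * \<psi> q) = cmod c * l2norm M \<psi>"
proof -
  assume *: "\<psi> \<in> L2 M"
  have "(l2norm M (\<lambda>q. c * \<psi> q))\<^sup>2 = (cmod c * l2norm M \<psi>)\<^sup>2"
    by (simp add: l2norm_sq[OF *] l2norm_sq[OF L2_cmult[OF *]] power_mult_distrib norm_mult)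
  then show ?thesis by (simp add: power2_eq_iff_nonneg)
qed

lemma l2norm_minus_commute: "l2norm M (\<lambda>q. \<phi> q - \<psi> q) = l2norm M (\<lambda>q. \<psi> q - \<phi> q)"
  unfolding l2norm_def by (simp add: norm_minus_commute)

lemma ip_integrable:
  assumes "\<phi> \<in> L2 M" "\<psi> \<in> L2 M"
  shows "integrable M (\<lambda>q. cnj (\<phi> q) * \<psi> q)"
proof (rule Bochner_Integration.integrable_bound)
  show "integrable M (\<lambda>q. (cmod (\<phi> q))\<^sup>2 + (cmod (\<psi> q))\<^sup>2)" using assms by (auto simp: L2_iff)
  show "(\<lambda>q. cnj (\<phi> q) * \<psi> q) \<in> borel_measurable M"
    using assms by measurable
  have "cmod (\<phi> q) * cmod (\<psi> q) \<le> (cmod (\<phi> q))\<^sup>2 + (cmod (\<psi> q))\<^sup>2" for q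
    using sum_squares_bound[of "cmod (\<phi> q)" "cmod (\<psi> q)"]
      mult_nonneg_nonneg[OF norm_ge_zero[of "\<phi> q"] norm_ge_zero[of "\<psi> q"]] by linarith
  then show "AE q in M. norm (cnj (\<phi> q) * \<psi> q) \<le> norm ((cmod (\<phi> q))\<^sup>2 + (cmod (\<psi> q))\<^sup>2)"
    by (simp add: norm_mult)
qed

lemma ip_add_right: "\<phi> \<in> L2 M \<Longrightarrow> \<psi> \<in> L2 M \<Longrightarrow> \<xi> \<in> L2 M \<Longrightarrow> ip M \<phi> (\<lambda>q. \<psi> q + \<xi> q) = ip M \<phi> \<psi> + ip M \<phi> \<xi>"
  unfolding ip_def by (simp add: distrib_left ip_integrable)

lemma ip_diff_right: "\<phi> \<in> L2 M \<Longrightarrow> \<psi> \<in> L2 M \<Longrightarrow> \<xi> \<in> L2 M \<Longrightarrow> ip M \<phi> (\<lambda>q. \<psi> q - \<xi> q) = ip M \<phi> \<psi> - ip M \<phi> \<xi>"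
  unfolding ip_def by (simp add: right_diff_distrib ip_integrable)

lemma ip_cmult_right: "ip M \<phi> (\<lambda>q. c * \<psi> q) = c * ip M \<phi> \<psi>"
  unfolding ip_def by (simp add: mult.left_commute)

lemma ip_cong_AE:
  assumes "AE q in M. \<psi> q = \<psi>' q" "\<psi> \<in> borel_measurable M" "\<psi>' \<in> borel_measurable M" "\<phi> \<in> borel_measurable M"
  shows "ip M \<phi> \<psi> = ip M \<phi> \<psi>'"
  unfolding ip_def
proof (rule integral_cong_AE)
  show "(\<lambda>q. cnj (\<phi> q) * \<psi> q) \<in> borel_measurable M" "(\<lambda>q. cnj (\<phi> q) * \<psi>' q) \<in> borel_measurable M"
    using assms by measurable
qed (use assms(1) in \<open>auto elim!: eventually_mono\<close>)

lemma ip_self: "\<psi> \<in> L2 M \<Longrightarrow> ip M \<psi> \<psi> = complex_of_real ((l2norm M \<psi>)\<^sup>2)"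
proof -
  assume *: "\<psi> \<in> L2 M"
  have "ip M \<psi> \<psi> = (LINT q|M. complex_of_real ((cmod (\<psi> q))\<^sup>2))"
    unfolding ip_def by (simp add: complex_norm_square[symmetric] mult.commute[of "cnj _"])
  then show ?thesis by (simp only: l2norm_sq[OF *] integral_complex_of_real)
qed

text \<open>The inequality 2 s t <= r s^2 + t^2 / r is integrated for every r > 0 and used at
  \<open>r = ?b / ?a\<close>, where both terms balance; if a norm vanishes, the integrand is zero
  almost everywhere.\<close>

lemma ip_abs_le:
  assumes "\<phi> \<in> L2 M" "\<psi> \<in> L2 M"
  shows "(LINT q|M. cmod (\<phi> q) * cmod (\<psi> q)) \<le> l2norm M \<phi> * l2norm M \<psi>"
proof -
  let ?I = "LINT q|M. cmod (\<phi> q) * cmod (\<psi> q)" and ?a = "l2norm M \<phi>" and ?b = "l2norm M \<psi>"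
  have int: "integrable M (\<lambda>q. cmod (\<phi> q) * cmod (\<psi> q))"
    using integrable_norm[OF ip_integrable[OF assms]] by (simp add: norm_mult)
  have key: "?I \<le> (r * ?a\<^sup>2 + ?b\<^sup>2 / r) / 2" if "r > 0" for r
  proof -
    have "?I \<le> (LINT q|M. (r * (cmod (\<phi> q))\<^sup>2 + (cmod (\<psi> q))\<^sup>2 / r) / 2)"
    proof (rule integral_mono[OF int])
      show "integrable M (\<lambda>q. (r * (cmod (\<phi> q))\<^sup>2 + (cmod (\<psi> q))\<^sup>2 / r) / 2)" using assms by (auto simp: L2_iff)
      fix q
      have "0 \<le> (r * cmod (\<phi> q) - cmod (\<psi> q))\<^sup>2 / r" using that by simp
      also have "\<dots> = r * (cmod (\<phi> q))\<^sup>2 + (cmod (\<psi> q))\<^sup>2 / r - 2 * (cmod (\<phi> q) * cmod (\<psi> q))"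
        using that by (simp add: field_simps power2_eq_square)
      finally show "cmod (\<phi> q) * cmod (\<psi> q) \<le> (r * (cmod (\<phi> q))\<^sup>2 + (cmod (\<psi> q))\<^sup>2 / r) / 2" by simp
    qed
    also have "\<dots> = (r * ?a\<^sup>2 + ?b\<^sup>2 / r) / 2" using assms by (simp add: l2norm_sq L2_iff)
    finally show ?thesis .
  qed
  show ?thesis
  proof (cases "?a = 0 \<or> ?b = 0")
    case True
    then have "AE q in M. cmod (\<phi> q) * cmod (\<psi> q) = 0"
      using l2norm_zero_AE[OF assms(1)] l2norm_zero_AE[OF assms(2)] by (auto elim!: eventually_mono)
    then have "?I = 0" by (rule integral_eq_zero_AE)
    then show ?thesis by simp
  next
    case False
    then have "?a > 0" "?b > 0" by (auto simp: less_le)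
    with key[of "?b / ?a"] show ?thesis by (simp add: power2_eq_square)
  qed
qed

lemma ip_CS:
  assumes "\<phi> \<in> L2 M" "\<psi> \<in> L2 M"
  shows "cmod (ip M \<phi> \<psi>) \<le> l2norm M \<phi> * l2norm M \<psi>"
proof -
  have "cmod (ip M \<phi> \<psi>) \<le> (LINT q|M. cmod (\<phi> q) * cmod (\<psi> q))"
    unfolding ip_def by (rule order_trans[OF integral_norm_bound]) (simp add: norm_mult)
  then show ?thesis using ip_abs_le[OF assms] by simp
qed

lemma l2norm_triangle:
  assumes "\<phi> \<in> L2 M" "\<psi> \<in> L2 M"
  shows "l2norm M (\<lambda>q. \<phi> q + \<psi> q) \<le> l2norm M \<phi> + l2norm M \<psi>"
proof -
  let ?I = "LINT q|M. cmod (\<phi> q) * cmod (\<psi> q)"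
  have int: "integrable M (\<lambda>q. cmod (\<phi> q) * cmod (\<psi> q))"
    using integrable_norm[OF ip_integrable[OF assms]] by (simp add: norm_mult)
  have "(l2norm M (\<lambda>q. \<phi> q + \<psi> q))\<^sup>2 \<le> (LINT q|M. (cmod (\<phi> q))\<^sup>2 + (cmod (\<psi> q))\<^sup>2 + 2 * (cmod (\<phi> q) * cmod (\<psi> q)))"
    unfolding l2norm_sq[OF L2_add[OF assms]]
  proof (rule integral_mono)
    show "integrable M (\<lambda>q. (cmod (\<phi> q + \<psi> q))\<^sup>2)" by (rule L2_integrable[OF L2_add[OF assms]])
    show "integrable M (\<lambda>q. (cmod (\<phi> q))\<^sup>2 + (cmod (\<psi> q))\<^sup>2 + 2 * (cmod (\<phi> q) * cmod (\<psi> q)))"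
      using assms int by (auto simp: L2_iff)
    fix q
    have "(cmod (\<phi> q + \<psi> q))\<^sup>2 \<le> (cmod (\<phi> q) + cmod (\<psi> q))\<^sup>2"
      by (intro power_mono norm_triangle_ineq) auto
    then show "(cmod (\<phi> q + \<psi> q))\<^sup>2 \<le> (cmod (\<phi> q))\<^sup>2 + (cmod (\<psi> q))\<^sup>2 + 2 * (cmod (\<phi> q) * cmod (\<psi> q))"
      by (simp add: power2_sum)
  qed
  also have "\<dots> = (l2norm M \<phi>)\<^sup>2 + (l2norm M \<psi>)\<^sup>2 + 2 * ?I"
    using assms int by (simp add: l2norm_sq L2_iff)
  also have "\<dots> \<le> (l2norm M \<phi> + l2norm M \<psi>)\<^sup>2"
    using ip_abs_le[OF assms] by (simp add: power2_sum)
  finally show ?thesis by (rule power2_le_imp_le) simp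
qed

lemma l2norm_triangle_diff:
  assumes "\<phi> \<in> L2 M" "\<psi> \<in> L2 M" "\<xi> \<in> L2 M"
  shows "l2norm M (\<lambda>q. \<phi> q - \<xi> q) \<le> l2norm M (\<lambda>q. \<phi> q - \<psi> q) + l2norm M (\<lambda>q. \<psi> q - \<xi> q)"
  using l2norm_triangle[OF L2_diff[OF assms(1,2)] L2_diff[OF assms(2,3)]] by simp

lemma l2norm_diff_le: "\<phi> \<in> L2 M \<Longrightarrow> \<psi> \<in> L2 M \<Longrightarrow> l2norm M (\<lambda>q. \<phi> q - \<psi> q) \<le> l2norm M \<phi> + l2norm M \<psi>"
  using l2norm_triangle[OF _ L2_uminus, of \<phi> M \<psi>] by (simp add: l2norm_def)

lemma l2norm_le_add_diff: "\<phi> \<in> L2 M \<Longrightarrow> \<psi> \<in> L2 M \<Longrightarrow> l2norm M \<phi> \<le> l2norm M \<psi> + l2norm M (\<lambda>q. \<phi> q - \<psi> q)"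
  using l2norm_triangle[OF _ L2_diff, of \<psi> M \<phi> \<psi>] by simp

text \<open>Testing with \<open>\<psi>\<close> itself suffices. This is the passage back from scalar
  functions, for which differential calculus is available, to norms in L^2.\<close>

lemma l2norm_le_of_ip:
  assumes "\<psi> \<in> L2 M" "0 \<le> K" "\<And>\<phi>. \<phi> \<in> L2 M \<Longrightarrow> cmod (ip M \<phi> \<psi>) \<le> K * l2norm M \<phi>"
  shows "l2norm M \<psi> \<le> K"
proof (rule ccontr)
  assume "\<not> l2norm M \<psi> \<le> K"
  then have p: "K < l2norm M \<psi>" by simp
  have "(l2norm M \<psi>)\<^sup>2 \<le> K * l2norm M \<psi>"
    using assms(3)[OF assms(1)] unfolding ip_self[OF assms(1)] norm_of_real by simp
  moreover have "K * l2norm M \<psi> < l2norm M \<psi> * l2norm M \<psi>"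
    using p assms(2) by (intro mult_strict_right_mono) auto
  ultimately show False by (simp add: power2_eq_square)
qed

text \<open>The squared differences are dominated by 4 w^2, so ordinary dominated convergence
  applies to them.\<close>

lemma l2_dominated_convergence:
  assumes m: "\<And>n. u n \<in> borel_measurable M" "v \<in> borel_measurable M"
    and w: "integrable M (\<lambda>q. (w q)\<^sup>2)"
    and lim: "AE q in M. (\<lambda>n. u n q) \<longlonglongrightarrow> v q"
    and bd: "\<And>n. AE q in M. cmod (u n q) \<le> w q"
  shows "v \<in> L2 M" "(\<lambda>n. l2norm M (\<lambda>q. u n q - v q)) \<longlonglongrightarrow> 0"
proof -
  have bd': "AE q in M. \<forall>n. cmod (u n q) \<le> w q" using bd by (simp add: AE_all_countable)
  have bv: "AE q in M. cmod (v q) \<le> w q"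
    using lim bd' by eventually_elim (rule Lim_bounded[OF tendsto_norm], auto)
  show v: "v \<in> L2 M" by (rule L2I_bound[OF m(2) w bv])
  have u: "u n \<in> L2 M" for n by (rule L2I_bound[OF m(1) w bd])
  have "(\<lambda>n. LINT q|M. (cmod (u n q - v q))\<^sup>2) \<longlonglongrightarrow> (LINT q|M. 0)"
  proof (rule integral_dominated_convergence)
    show "integrable M (\<lambda>q. 4 * (w q)\<^sup>2)" using w by simp
    show "AE q in M. (\<lambda>n. (cmod (u n q - v q))\<^sup>2) \<longlonglongrightarrow> 0" using lim
    proof eventually_elim
      fix q assume "(\<lambda>n. u n q) \<longlonglongrightarrow> v q"
      then have "(\<lambda>n. (cmod (u n q - v q))\<^sup>2) \<longlonglongrightarrow> (cmod (v q - v q))\<^sup>2" by (intro tendsto_intros)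
      then show "(\<lambda>n. (cmod (u n q - v q))\<^sup>2) \<longlonglongrightarrow> 0" by simp
    qed
    show "AE q in M. norm ((cmod (u n q - v q))\<^sup>2) \<le> 4 * (w q)\<^sup>2" for n
      using bd[of n] bv
    proof eventually_elim
      fix q assume "cmod (u n q) \<le> w q" "cmod (v q) \<le> w q"
      then have "cmod (u n q - v q) \<le> 2 * w q" using norm_triangle_ineq4[of "u n q" "v q"] by simp
      then have "(cmod (u n q - v q))\<^sup>2 \<le> (2 * w q)\<^sup>2" by (intro power_mono) auto
      then show "norm ((cmod (u n q - v q))\<^sup>2) \<le> 4 * (w q)\<^sup>2" by (simp add: power_mult_distrib)
    qed
  qed (use m in auto)
  then have "(\<lambda>n. (l2norm M (\<lambda>q. u n q - v q))\<^sup>2) \<longlonglongrightarrow> 0"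
    by (simp add: l2norm_sq[OF L2_diff[OF u v]])
  then have "(\<lambda>n. sqrt ((l2norm M (\<lambda>q. u n q - v q))\<^sup>2)) \<longlonglongrightarrow> sqrt 0" by (rule tendsto_real_sqrt)
  then show "(\<lambda>n. l2norm M (\<lambda>q. u n q - v q)) \<longlonglongrightarrow> 0" by simp
qed

text \<open>Limits at a point reduce to sequences. The majorant is available only in a punctured
  interval around \<open>a\<close>, so each sequence is shifted past the index from which it stays
  there.\<close>

lemma l2_dominated_convergence_at:
  fixes u :: "real \<Rightarrow> 'a \<Rightarrow> complex"
  assumes m: "\<And>h. u h \<in> borel_measurable M" "v \<in> borel_measurable M"
    and w: "integrable M (\<lambda>q. (w q)\<^sup>2)"
    and lim: "\<And>q. q \<in> space M \<Longrightarrow> ((\<lambda>h. u h q) \<longlongrightarrow> v q) (at a)"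
    and d: "0 < d" and bd: "\<And>h q. q \<in> space M \<Longrightarrow> \<bar>h - a\<bar> < d \<Longrightarrow> h \<noteq> a \<Longrightarrow> cmod (u h q) \<le> w q"
  shows "((\<lambda>h. l2norm M (\<lambda>q. u h q - v q)) \<longlongrightarrow> 0) (at a)"
  unfolding tendsto_at_iff_sequentially
proof (intro allI impI)
  fix X :: "nat \<Rightarrow> real" assume X: "\<forall>i. X i \<in> UNIV - {a}" "X \<longlonglongrightarrow> a"
  obtain n0 where n0: "\<And>n. n \<ge> n0 \<Longrightarrow> \<bar>X n - a\<bar> < d"
    using X(2)[unfolded lim_sequentially, rule_format, OF d] unfolding dist_real_def by blast
  have "(\<lambda>n. l2norm M (\<lambda>q. u (X (n + n0)) q - v q)) \<longlonglongrightarrow> 0"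
  proof (rule l2_dominated_convergence(2)[OF m w])
    have "filterlim X (at a) sequentially" using X by (auto simp: filterlim_at)
    then have X': "filterlim (\<lambda>n. X (n + n0)) (at a) sequentially"
      by (rule filterlim_compose[OF _ filterlim_add_const_nat_at_top])
    show "AE q in M. (\<lambda>n. u (X (n + n0)) q) \<longlonglongrightarrow> v q"
      by (rule AE_I2) (rule filterlim_compose[OF lim X'], auto)
    show "AE q in M. cmod (u (X (n + n0)) q) \<le> w q" for n
      using X n0[of "n + n0"] by (intro AE_I2 bd) auto
  qed
  then show "((\<lambda>h. l2norm M (\<lambda>q. u h q - v q)) \<circ> X) \<longlonglongrightarrow> 0"
    unfolding o_def by (rule LIMSEQ_offset)
qed

section \<open>Square roots of matrices\<close>

text \<open>The iteration \<open>Y \<mapsto> (R + Y\<^sup>2) / 2\<close> with \<open>R = 1 - A / m\<close> increases entrywise, and its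
  limit satisfies \<open>(1 - Y)\<^sup>2 = A / m\<close>.\<close>

lemma matrix_sqrt:
  fixes A :: "'i \<Rightarrow> 'i \<Rightarrow> real"
  assumes fin: "finite I" and sym: "\<And>x y. x \<in> I \<Longrightarrow> y \<in> I \<Longrightarrow> A x y = A y x"
    and off: "\<And>x y. x \<in> I \<Longrightarrow> y \<in> I \<Longrightarrow> x \<noteq> y \<Longrightarrow> A x y \<le> 0"
    and diag: "\<And>x. x \<in> I \<Longrightarrow> A x x \<le> m"
    and row: "\<And>x. x \<in> I \<Longrightarrow> \<delta> \<le> (\<Sum>y\<in>I. A x y)" and \<delta>: "0 < \<delta>" "\<delta> \<le> m"
  obtains B \<beta> where "0 < \<beta>" "\<And>x y. x \<in> I \<Longrightarrow> y \<in> I \<Longrightarrow> B x y = B y x"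
    "\<And>x y. x \<in> I \<Longrightarrow> y \<in> I \<Longrightarrow> (\<Sum>z\<in>I. B x z * B z y) = A x y"
    "\<And>q. \<beta> * (\<Sum>x\<in>I. (q x)\<^sup>2) \<le> (\<Sum>x\<in>I. \<Sum>y\<in>I. B x y * q x * q y)"
proof -
  have m: "0 < m" using \<delta> by linarith
  define D :: "'i \<Rightarrow> 'i \<Rightarrow> real" where "D x y = (if x = y then 1 else 0)" for x y
  define R where "R x y = D x y - A x y / m" for x y
  \<comment> \<open>A row-sum bound r is reproduced by the iteration when r = (1 - delta/m + r^2) /
    2; the smaller root is 1 - sqrt(delta/m). It lies below 1 because delta > 0, and this gap
    becomes the positivity of the square root.\<close>
  define s where "s = sqrt (\<delta> / m)"
  define r where "r = 1 - s"
  have s: "0 < s" "s \<le> 1" "s\<^sup>2 = \<delta> / m" using \<delta> m by (auto simp: s_def)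
  have r: "0 \<le> r" "r < 1" "(1 - \<delta> / m + r * r) / 2 = r"
    using s by (auto simp: r_def power2_eq_square[symmetric] power2_diff)
  \<comment> \<open>Nonpositive off-diagonal entries and a diagonal of at most \<open>m\<close> make
    \<open>R\<close> nonnegative; nonnegativity and monotonicity of the iterates rest on
    this.\<close>
  have R0: "0 \<le> R x y" if "x \<in> I" "y \<in> I" for x y
    using that off[of x y] diag[of x] m by (auto simp: R_def D_def field_simps)
  have Rrow: "(\<Sum>y\<in>I. R x y) \<le> 1 - \<delta> / m" if "x \<in> I" for x
    using row[OF that] m that fin
    by (simp add: R_def D_def sum_subtractf sum_divide_distrib[symmetric] divide_right_mono)
  have Rsym: "R x y = R y x" if "x \<in> I" "y \<in> I" for x y using sym[OF that] by (auto simp: R_def D_def)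
  define Y where "Y n = ((\<lambda>Z x y. (R x y + (\<Sum>z\<in>I. Z x z * Z z y)) / 2) ^^ n) (\<lambda>x y. 0)" for n
  have Y0: "Y 0 = (\<lambda>x y. 0)" and YS: "Y (Suc n) x y = (R x y + (\<Sum>z\<in>I. Y n x z * Y n z y)) / 2" for n x y
    by (simp_all add: Y_def)
  have nn: "0 \<le> Y n x y" if "x \<in> I" "y \<in> I" for n x y
    using that
  proof (induction n arbitrary: x y)
    case (Suc n)
    then show ?case unfolding YS by (auto intro!: add_nonneg_nonneg R0 sum_nonneg mult_nonneg_nonneg)
  qed (simp add: Y0)
  have inc: "Y n x y \<le> Y (Suc n) x y" if "x \<in> I" "y \<in> I" for n x y
    using that
  proof (induction n arbitrary: x y)
    case 0
    then show ?case using nn[of x y "Suc 0"] by (simp add: Y0)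
  next
    case (Suc n)
    have "(\<Sum>z\<in>I. Y n x z * Y n z y) \<le> (\<Sum>z\<in>I. Y (Suc n) x z * Y (Suc n) z y)"
      using Suc by (intro sum_mono mult_mono nn) auto
    then show ?case unfolding YS[of "Suc n"] YS[of n x y] by simp
  qed
  have Ysym: "Y n x y = Y n y x" if "x \<in> I" "y \<in> I" for n x y
    using that
  proof (induction n arbitrary: x y)
    case (Suc n)
    have "(\<Sum>z\<in>I. Y n x z * Y n z y) = (\<Sum>z\<in>I. Y n y z * Y n z x)"
      using Suc by (intro sum.cong) (auto simp: mult.commute)
    then show ?case unfolding YS using Rsym Suc.prems by simp
  qed (simp add: Y0)
  have Yrow: "(\<Sum>y\<in>I. Y n x y) \<le> r" if "x \<in> I" for n x
    using that
  proof (induction n arbitrary: x)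
    case 0
    then show ?case using r by (simp add: Y0)
  next
    case (Suc n)
    have "(\<Sum>y\<in>I. \<Sum>z\<in>I. Y n x z * Y n z y) = (\<Sum>z\<in>I. Y n x z * (\<Sum>y\<in>I. Y n z y))"
      by (subst sum.swap) (simp add: sum_distrib_left)
    also have "\<dots> \<le> (\<Sum>z\<in>I. Y n x z * r)"
      using Suc by (intro sum_mono mult_left_mono nn) auto
    also have "\<dots> \<le> r * r"
      unfolding sum_distrib_right[symmetric] using Suc r by (intro mult_right_mono) auto
    finally have "(\<Sum>y\<in>I. R x y) + (\<Sum>y\<in>I. \<Sum>z\<in>I. Y n x z * Y n z y) \<le> (1 - \<delta> / m) + r * r"
      using Rrow[OF Suc.prems] by (intro add_mono)
    then have "((\<Sum>y\<in>I. R x y) + (\<Sum>y\<in>I. \<Sum>z\<in>I. Y n x z * Y n z y)) / 2 \<le> r"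
      using divide_right_mono[of _ "1 - \<delta> / m + r * r" 2] r(3) by (metis zero_le_numeral)
    then show ?case by (simp only: YS sum_divide_distrib[symmetric] sum.distrib)
  qed
  have conv: "convergent (\<lambda>n. Y n x y)" if "x \<in> I" "y \<in> I" for x y
  proof (rule Bseq_mono_convergent)
    have "Y n x y \<le> r" for n
      using member_le_sum[of y I "Y n x"] nn that fin Yrow[OF that(1), of n] by fastforce
    then show "Bseq (\<lambda>n. Y n x y)" using nn[OF that] by (intro BseqI'[of _ r]) auto
    show "\<forall>m n. m \<le> n \<longrightarrow> Y m x y \<le> Y n x y"
      using lift_Suc_mono_le[of "\<lambda>n. Y n x y", OF inc[OF that]] by blast
  qed
  define Z where "Z x y = lim (\<lambda>n. Y n x y)" for x y
  have Z: "(\<lambda>n. Y n x y) \<longlonglongrightarrow> Z x y" if "x \<in> I" "y \<in> I" for x y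
    using conv[OF that] unfolding Z_def by (simp add: convergent_LIMSEQ_iff)
  have Zeq: "Z x y = (R x y + (\<Sum>z\<in>I. Z x z * Z z y)) / 2" if xy: "x \<in> I" "y \<in> I" for x y
  proof (rule LIMSEQ_unique)
    show "(\<lambda>n. Y (Suc n) x y) \<longlonglongrightarrow> Z x y" using Z[OF xy] by (rule LIMSEQ_Suc)
    show "(\<lambda>n. Y (Suc n) x y) \<longlonglongrightarrow> (R x y + (\<Sum>z\<in>I. Z x z * Z z y)) / 2"
      unfolding YS using xy by (intro tendsto_intros Z) auto
  qed
  have Zsym: "Z x y = Z y x" if "x \<in> I" "y \<in> I" for x y
    using Ysym[OF that] by (simp add: Z_def)
  have Z0: "0 \<le> Z x y" if "x \<in> I" "y \<in> I" for x y
    using nn[OF that] by (intro LIMSEQ_le_const[OF Z[OF that]]) auto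
  have Zrow: "(\<Sum>y\<in>I. Z x y) \<le> r" if "x \<in> I" for x
    using Yrow[OF that] that by (intro LIMSEQ_le_const2[OF tendsto_sum[OF Z]]) auto
  define B where "B x y = sqrt m * (D x y - Z x y)" for x y
  show thesis
  proof
    show "0 < sqrt m * (1 - r)" using m r by simp
    show "B x y = B y x" if "x \<in> I" "y \<in> I" for x y using Zsym[OF that] by (auto simp: B_def D_def)
    show "(\<Sum>z\<in>I. B x z * B z y) = A x y" if xy: "x \<in> I" "y \<in> I" for x y
    proof -
      have d: "(\<Sum>z\<in>I. D x z * D z y) = D x y" "(\<Sum>z\<in>I. D x z * Z z y) = Z x y" "(\<Sum>z\<in>I. Z x z * D z y) = Z x y"
        using xy fin by (simp_all add: D_def if_distrib[of "\<lambda>a. a * _"] if_distrib[of "\<lambda>a. _ * a"] cong: if_cong)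
      have "(\<Sum>z\<in>I. B x z * B z y) = (\<Sum>z\<in>I. m * (D x z * D z y - D x z * Z z y - Z x z * D z y + Z x z * Z z y))"
      proof (intro sum.cong refl)
        fix z
        have "B x z * B z y = (sqrt m * sqrt m) * ((D x z - Z x z) * (D z y - Z z y))"
          by (simp add: B_def)
        also have "sqrt m * sqrt m = m" using m by simp
        finally show "B x z * B z y = m * (D x z * D z y - D x z * Z z y - Z x z * D z y + Z x z * Z z y)"
          by (simp add: algebra_simps)
      qed
      also have "\<dots> = m * (D x y - 2 * Z x y + (\<Sum>z\<in>I. Z x z * Z z y))"
        unfolding sum_distrib_left[symmetric] by (simp add: sum.distrib sum_subtractf d)
      also have "(\<Sum>z\<in>I. Z x z * Z z y) = 2 * Z x y - R x y" using Zeq[OF xy] by simp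
      finally show ?thesis using m by (simp add: R_def)
    qed
    show "sqrt m * (1 - r) * (\<Sum>x\<in>I. (q x)\<^sup>2) \<le> (\<Sum>x\<in>I. \<Sum>y\<in>I. B x y * q x * q y)" for q
    proof -
      \<comment> \<open>Schur test: 2 q_x q_y <= q_x^2 + q_y^2, weighted by the nonnegative
        symmetric \<open>Z\<close>, bounds its quadratic form by the row-sum bound
        \<open>r\<close>.\<close>
      have "(\<Sum>x\<in>I. \<Sum>y\<in>I. Z x y * q x * q y) \<le> (\<Sum>x\<in>I. \<Sum>y\<in>I. Z x y * (q x)\<^sup>2 / 2 + Z y x * (q y)\<^sup>2 / 2)"
      proof (intro sum_mono)
        fix x y assume xy: "x \<in> I" "y \<in> I"
        have "Z x y * (2 * q x * q y) \<le> Z x y * ((q x)\<^sup>2 + (q y)\<^sup>2)"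
          by (intro mult_left_mono Z0 xy sum_squares_bound)
        then show "Z x y * q x * q y \<le> Z x y * (q x)\<^sup>2 / 2 + Z y x * (q y)\<^sup>2 / 2"
          using Zsym[OF xy] by (simp add: algebra_simps)
      qed
      also have "\<dots> = (\<Sum>x\<in>I. \<Sum>y\<in>I. Z x y * (q x)\<^sup>2 / 2) + (\<Sum>x\<in>I. \<Sum>y\<in>I. Z y x * (q y)\<^sup>2 / 2)"
        by (simp add: sum.distrib)
      also have "(\<Sum>x\<in>I. \<Sum>y\<in>I. Z y x * (q y)\<^sup>2 / 2) = (\<Sum>x\<in>I. \<Sum>y\<in>I. Z x y * (q x)\<^sup>2 / 2)"
        by (rule sum.swap)
      also have "(\<Sum>x\<in>I. \<Sum>y\<in>I. Z x y * (q x)\<^sup>2 / 2) + (\<Sum>x\<in>I. \<Sum>y\<in>I. Z x y * (q x)\<^sup>2 / 2)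
          = (\<Sum>x\<in>I. (\<Sum>y\<in>I. Z x y) * (q x)\<^sup>2)"
        by (simp add: sum_distrib_right sum.distrib[symmetric])
      also have "\<dots> \<le> (\<Sum>x\<in>I. r * (q x)\<^sup>2)"
        by (intro sum_mono mult_right_mono Zrow) auto
      finally have le: "(\<Sum>x\<in>I. \<Sum>y\<in>I. Z x y * q x * q y) \<le> r * (\<Sum>x\<in>I. (q x)\<^sup>2)" by (simp add: sum_distrib_left)
      have "(\<Sum>x\<in>I. \<Sum>y\<in>I. D x y * q x * q y) = (\<Sum>x\<in>I. (q x)\<^sup>2)"
        using fin by (simp add: D_def if_distrib[of "\<lambda>a. a * _"] power2_eq_square cong: if_cong)
      moreover have "B x y * q x * q y = sqrt m * (D x y * q x * q y - Z x y * q x * q y)" for x y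
        by (simp add: B_def algebra_simps)
      ultimately have "(\<Sum>x\<in>I. \<Sum>y\<in>I. B x y * q x * q y)
          = sqrt m * ((\<Sum>x\<in>I. (q x)\<^sup>2) - (\<Sum>x\<in>I. \<Sum>y\<in>I. Z x y * q x * q y))"
        by (simp only: sum_distrib_left[symmetric] sum_subtractf)
      moreover have "sqrt m * ((1 - r) * (\<Sum>x\<in>I. (q x)\<^sup>2)) \<le> sqrt m * ((\<Sum>x\<in>I. (q x)\<^sup>2) - (\<Sum>x\<in>I. \<Sum>y\<in>I. Z x y * q x * q y))"
        using le m by (intro mult_left_mono) (auto simp: algebra_simps)
      ultimately show ?thesis by (simp add: mult.assoc)
    qed
  qed
qed

section \<open>Weyl operators\<close>

abbreviation shift_by :: "'i set \<Rightarrow> ('i \<Rightarrow> real) \<Rightarrow> ('i \<Rightarrow> real) \<Rightarrow> 'i \<Rightarrow> real" where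
  "shift_by I b q \<equiv> restrict (\<lambda>y. q y + b y) I"

lemma measurable_shift_by [measurable]: "shift_by I b \<in> measurable (PiM I (\<lambda>_. lborel)) (PiM I (\<lambda>_. lborel))"
  by (rule measurable_restrict) (simp add: measurable_component_singleton borel_measurable_add)

text \<open>The product measure is determined by its values on boxes, and there translation
  invariance factorises into that of one-dimensional Lebesgue measure.\<close>

lemma distr_shift_by:
  fixes b :: "'i \<Rightarrow> real"
  assumes fin: "finite I"
  shows "distr (PiM I (\<lambda>_. lborel)) (PiM I (\<lambda>_. lborel)) (shift_by I b) = PiM I (\<lambda>_. lborel)"
proof -
  interpret product_sigma_finite "\<lambda>_::'i. lborel :: real measure" ..
  show ?thesis
  proof (rule PiM_eqI[OF fin])
    fix A :: "'i \<Rightarrow> real set" assume A: "\<And>i. i \<in> I \<Longrightarrow> A i \<in> sets lborel"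
    then have m: "Pi\<^sub>E I A \<in> sets (PiM I (\<lambda>_. lborel))" using fin by (intro sets_PiM_I_finite) auto
    have eq: "shift_by I b -` Pi\<^sub>E I A \<inter> space (PiM I (\<lambda>_. lborel :: real measure)) = Pi\<^sub>E I (\<lambda>i. (\<lambda>x. b i + x) -` A i)"
      by (auto simp: space_PiM PiE_iff add.commute)
    have bi: "(\<lambda>x. b i + x) -` A i \<in> sets lborel" "emeasure lborel ((\<lambda>x. b i + x) -` A i) = emeasure lborel (A i)"
      if "i \<in> I" for i
    proof -
      have "(\<lambda>x. b i + x) -` A i \<inter> space borel \<in> sets borel"
        using A[OF that] by (intro measurable_sets[of _ borel borel]) auto
      then show "(\<lambda>x. b i + x) -` A i \<in> sets lborel" by simp
      have "emeasure (distr lborel borel ((+) (b i))) (A i) = emeasure lborel ((\<lambda>x. b i + x) -` A i)"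
        using A[OF that] by (subst emeasure_distr) auto
      then show "emeasure lborel ((\<lambda>x. b i + x) -` A i) = emeasure lborel (A i)"
        by (simp add: lborel_distr_plus)
    qed
    show "emeasure (distr (PiM I (\<lambda>_. lborel)) (PiM I (\<lambda>_. lborel)) (shift_by I b)) (Pi\<^sub>E I A) = (\<Prod>i\<in>I. emeasure lborel (A i))"
      by (subst emeasure_distr[OF measurable_shift_by m], subst eq, subst emeasure_PiM[OF fin])
         (use bi in \<open>auto intro!: prod.cong\<close>)
  qed simp
qed

lemma finite_Lam [simp]: "finite (Lam nu L)"
proof (rule finite_subset)
  show "Lam nu L \<subseteq> {xs. set xs \<subseteq> {- int L..int L} \<and> length xs = nu}"
    by (auto simp: Lam_def in_set_conv_nth) fastforce+
  show "finite {xs. set xs \<subseteq> {- int L..int L} \<and> length xs = nu}" by (rule finite_lists_length_eq) simp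
qed

lemma space_cfgM: "space (cfgM nu L) = PiE (Lam nu L) (\<lambda>_. UNIV)"
  by (simp add: cfgM_def space_PiM)

lemma measurable_cfgM_component: "x \<in> Lam nu L \<Longrightarrow> (\<lambda>q. q x) \<in> borel_measurable (cfgM nu L)"
  using measurable_component_singleton[of x "Lam nu L" "\<lambda>_. lborel :: real measure"]
  by (simp add: cfgM_def)

lemma measurable_cfgM_shift: "shift_by (Lam nu L) b \<in> measurable (cfgM nu L) (cfgM nu L)"
  unfolding cfgM_def by (rule measurable_shift_by)

lemma distr_cfgM_shift: "distr (cfgM nu L) (cfgM nu L) (shift_by (Lam nu L) b) = cfgM nu L"
  unfolding cfgM_def by (rule distr_shift_by) simp

text \<open>The symplectic form, equal to minus the imaginary part of the sum of
  \<open>cnj (f x) * g x\<close>; the sign is the one for which half of it is the phase in the Weyl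
  relation below.\<close>

definition sympl :: "nat \<Rightarrow> nat \<Rightarrow> (int list \<Rightarrow> complex) \<Rightarrow> (int list \<Rightarrow> complex) \<Rightarrow> real" where
  "sympl nu L f g = (\<Sum>x\<in>Lam nu L. Im (f x) * Re (g x) - Re (f x) * Im (g x))"

definition phase :: "nat \<Rightarrow> nat \<Rightarrow> (int list \<Rightarrow> complex) \<Rightarrow> (int list \<Rightarrow> real) \<Rightarrow> real" where
  "phase nu L f q = (\<Sum>x\<in>Lam nu L. Re (f x) * q x + Re (f x) * Im (f x) / 2)"

lemma Weyl_eq: "Weyl nu L f \<psi> q = exp (\<i> * complex_of_real (phase nu L f q)) * \<psi> (shift_by (Lam nu L) (\<lambda>y. Im (f y)) q)"
  by (simp add: Weyl_def phase_def)

lemma phase_measurable: "(\<lambda>q. exp (\<i> * complex_of_real (phase nu L f q))) \<in> borel_measurable (cfgM nu L)"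
proof -
  have "(\<lambda>q. phase nu L f q) \<in> borel_measurable (cfgM nu L)"
    unfolding phase_def by (intro borel_measurable_sum borel_measurable_add borel_measurable_times measurable_cfgM_component) auto
  then show ?thesis by measurable
qed

lemma Weyl_measurable:
  assumes "\<psi> \<in> borel_measurable (cfgM nu L)" shows "Weyl nu L f \<psi> \<in> borel_measurable (cfgM nu L)"
  unfolding Weyl_eq[abs_def]
  by (intro borel_measurable_times phase_measurable measurable_compose[OF measurable_cfgM_shift assms])

lemma Weyl_l2norm:
  assumes [measurable]: "\<psi> \<in> borel_measurable (cfgM nu L)"
  shows "l2norm (cfgM nu L) (Weyl nu L f \<psi>) = l2norm (cfgM nu L) \<psi>"
proof -
  let ?s = "shift_by (Lam nu L) (\<lambda>y. Im (f y))" and ?M = "cfgM nu L"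
  have [measurable]: "?s \<in> measurable ?M ?M" by (rule measurable_cfgM_shift)
  have "(\<integral>\<^sup>+ q. ennreal ((cmod (\<psi> q))\<^sup>2) \<partial>?M) = (\<integral>\<^sup>+ q. ennreal ((cmod (\<psi> q))\<^sup>2) \<partial>distr ?M ?M ?s)"
    by (simp add: distr_cfgM_shift)
  also have "\<dots> = (\<integral>\<^sup>+ q. ennreal ((cmod (\<psi> (?s q)))\<^sup>2) \<partial>?M)"
    by (rule nn_integral_distr) measurable
  finally show ?thesis unfolding l2norm_def by (simp add: Weyl_eq norm_mult)
qed

lemma Weyl_L2:
  assumes "\<psi> \<in> L2 (cfgM nu L)" shows "Weyl nu L f \<psi> \<in> L2 (cfgM nu L)"
proof -
  let ?s = "shift_by (Lam nu L) (\<lambda>y. Im (f y))" and ?M = "cfgM nu L"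
  have "integrable (distr ?M ?M ?s) (\<lambda>q. (cmod (\<psi> q))\<^sup>2)"
    using assms by (simp add: distr_cfgM_shift L2_iff)
  then have "integrable ?M (\<lambda>q. (cmod (\<psi> (?s q)))\<^sup>2)"
    using assms by (subst (asm) integrable_distr_eq) (auto simp: measurable_cfgM_shift dest: L2_measurable)
  then show ?thesis using assms Weyl_measurable[of \<psi> nu L f] by (simp add: L2_iff Weyl_eq norm_mult)
qed

lemma Weyl_lin: "Weyl nu L f (\<lambda>r. a * \<psi> r + b * \<phi> r) = (\<lambda>q. a * Weyl nu L f \<psi> q + b * Weyl nu L f \<phi> q)"
  by (simp add: Weyl_eq fun_eq_iff algebra_simps)

lemma Weyl_diff: "Weyl nu L f (\<lambda>r. \<psi> r - \<phi> r) = (\<lambda>q. Weyl nu L f \<psi> q - Weyl nu L f \<phi> q)"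
  by (simp add: Weyl_eq fun_eq_iff algebra_simps)

text \<open>Shifting the argument of the second phase by Im f adds the sum of Re g Im f; after the
  symmetric halves contained in \<open>phase\<close> are taken off, half the symplectic form
  remains.\<close>

lemma Weyl_Weyl:
  assumes q: "q \<in> space (cfgM nu L)"
  shows "Weyl nu L f (Weyl nu L g \<psi>) q = exp (\<i> * complex_of_real (sympl nu L f g / 2)) * Weyl nu L (\<lambda>x. f x + g x) \<psi> q"
proof -
  let ?I = "Lam nu L"
  have "phase nu L f q + phase nu L g (shift_by ?I (\<lambda>y. Im (f y)) q) = sympl nu L f g / 2 + phase nu L (\<lambda>x. f x + g x) q"
    unfolding phase_def sympl_def sum_divide_distrib sum.distrib[symmetric]
    by (intro sum.cong refl) (simp add: field_simps)
  then have "exp (\<i> * complex_of_real (phase nu L f q)) * exp (\<i> * complex_of_real (phase nu L g (shift_by ?I (\<lambda>y. Im (f y)) q)))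
     = exp (\<i> * complex_of_real (sympl nu L f g / 2)) * exp (\<i> * complex_of_real (phase nu L (\<lambda>x. f x + g x) q))"
    by (simp only: exp_add[symmetric] distrib_left[symmetric] of_real_add[symmetric])
  moreover have "shift_by ?I (\<lambda>y. Im (g y)) (shift_by ?I (\<lambda>y. Im (f y)) q) = shift_by ?I (\<lambda>y. Im (f y + g y)) q"
    by (auto simp: fun_eq_iff restrict_def)
  ultimately show ?thesis unfolding Weyl_eq by (simp add: mult.assoc[symmetric])
qed

lemma sympl_commute: "sympl nu L g f = - sympl nu L f g"
  unfolding sympl_def sum_negf[symmetric] by (intro sum.cong) (auto simp: algebra_simps)

text \<open>Both orders give the same Weyl operator, with phases exp(i s/2) and exp(-i s/2) for s
  the symplectic form. Their difference has modulus |exp(i s) - 1| <= |s|.\<close>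

lemma Weyl_commutator_le:
  assumes "\<psi> \<in> L2 (cfgM nu L)"
  shows "l2norm (cfgM nu L) (\<lambda>q. Weyl nu L f (Weyl nu L g \<psi>) q - Weyl nu L g (Weyl nu L f \<psi>) q)
    \<le> \<bar>sympl nu L f g\<bar> * l2norm (cfgM nu L) \<psi>"
proof -
  let ?s = "sympl nu L f g" and ?M = "cfgM nu L"
  let ?c = "exp (\<i> * complex_of_real (?s / 2)) - exp (\<i> * complex_of_real (- ?s / 2))"
  have "(\<lambda>x. g x + f x) = (\<lambda>x. f x + g x)" by (simp add: add.commute)
  then have "l2norm ?M (\<lambda>q. Weyl nu L f (Weyl nu L g \<psi>) q - Weyl nu L g (Weyl nu L f \<psi>) q)
      = l2norm ?M (\<lambda>q. ?c * Weyl nu L (\<lambda>x. f x + g x) \<psi> q)"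
    by (intro l2norm_cong_AE AE_I2) (simp add: Weyl_Weyl sympl_commute[of nu L g f] left_diff_distrib)
  also have "\<dots> = cmod ?c * l2norm ?M \<psi>"
    using assms by (simp add: l2norm_cmult Weyl_L2 Weyl_l2norm L2_measurable)
  also have "cmod ?c \<le> \<bar>?s\<bar>"
  proof -
    have "\<i> * complex_of_real (?s / 2) = \<i> * complex_of_real (- ?s / 2) + \<i> * complex_of_real ?s"
      by (simp add: complex_eq_iff)
    then have "?c = exp (\<i> * complex_of_real (- ?s / 2)) * (exp (\<i> * complex_of_real ?s) - 1)"
      by (simp only: exp_add right_diff_distrib mult_1_right)
    then have "cmod ?c = cmod (exp (\<i> * complex_of_real (- ?s / 2))) * cmod (exp (\<i> * complex_of_real ?s) - 1)"
      by (simp only: norm_mult)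
    also have "\<dots> = cmod (exp (\<i> * complex_of_real ?s) - 1)" by (simp only: norm_exp_i_times mult_1_left)
    also have "\<dots> \<le> \<bar>?s\<bar>" using iexp_approx1[of ?s 0] by simp
    finally show ?thesis .
  qed
  finally show ?thesis by (simp add: mult_right_mono)
qed

section \<open>Unitary groups and their generators\<close>

text \<open>\<open>L2\<close> is a set of functions with a seminorm rather than a normed space, so
  strong differentiability is spelled out as convergence of difference quotients.\<close>

definition sder :: "'a measure \<Rightarrow> (real \<Rightarrow> 'a \<Rightarrow> complex) \<Rightarrow> ('a \<Rightarrow> complex) \<Rightarrow> real \<Rightarrow> bool" where
  "sder M y d t \<longleftrightarrow> (\<forall>s. y s \<in> L2 M) \<and> d \<in> L2 M \<and>
     ((\<lambda>h. l2norm M (\<lambda>q. (y (t + h) q - y t q) / complex_of_real h - d q)) \<longlongrightarrow> 0) (at 0)"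

lemma L2_divide: "\<psi> \<in> L2 M \<Longrightarrow> (\<lambda>q. \<psi> q / c) \<in> L2 M"
  using L2_cmult[of \<psi> M "1 / c"] by simp

lemma l2norm_divide: "\<psi> \<in> L2 M \<Longrightarrow> l2norm M (\<lambda>q. \<psi> q / c) = l2norm M \<psi> / cmod c"
  using l2norm_cmult[of \<psi> M "1 / c"] by (simp add: norm_divide)

lemma ip_divide_right: "ip M \<phi> (\<lambda>q. \<psi> q / c) = ip M \<phi> \<psi> / c"
  using ip_cmult_right[of M \<phi> "1 / c" \<psi>] by simp

lemma has_vector_derivative_at_0_iff:
  fixes f :: "real \<Rightarrow> 'b::real_normed_vector"
  shows "(f has_vector_derivative d) (at t) \<longleftrightarrow> ((\<lambda>h. (f (t + h) - f t) /\<^sub>R h) \<longlongrightarrow> d) (at 0)"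
  (is "?l \<longleftrightarrow> ?r")
proof -
  have "?l \<longleftrightarrow> ((\<lambda>h. norm (f (t + h) - f t - h *\<^sub>R d) / norm h) \<longlongrightarrow> 0) (at 0)"
    unfolding has_vector_derivative_def has_derivative_at by (simp add: bounded_linear_scaleR_left)
  also have "\<dots> \<longleftrightarrow> ((\<lambda>h. norm ((f (t + h) - f t) /\<^sub>R h - d)) \<longlongrightarrow> 0) (at 0)"
  proof (rule tendsto_cong)
    have "norm (f (t + h) - f t - h *\<^sub>R d) / norm h = norm ((f (t + h) - f t) /\<^sub>R h - d)" if "h \<noteq> 0" for h
    proof -
      have "(f (t + h) - f t) /\<^sub>R h - d = (f (t + h) - f t - h *\<^sub>R d) /\<^sub>R h"
        using that by (simp add: scaleR_diff_right)
      then show ?thesis by (simp add: divide_inverse mult.commute)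
    qed
    then show "\<forall>\<^sub>F h in at 0. norm (f (t + h) - f t - h *\<^sub>R d) / norm h = norm ((f (t + h) - f t) /\<^sub>R h - d)"
      by (auto simp: eventually_at_filter)
  qed
  also have "\<dots> \<longleftrightarrow> ?r" by (simp only: tendsto_norm_zero_iff LIM_zero_iff)
  finally show ?thesis .
qed

lemma sder_L2: "sder M y d t \<Longrightarrow> y s \<in> L2 M" "sder M y d t \<Longrightarrow> d \<in> L2 M"
  by (auto simp: sder_def)

lemma sder_quot_L2: "sder M y d t \<Longrightarrow> (\<lambda>q. (y (t + h) q - y t q) / complex_of_real h) \<in> L2 M"
  by (intro L2_divide L2_diff sder_L2)

lemma sder_ip:
  assumes "sder M y d t" "\<phi> \<in> L2 M"
  shows "((\<lambda>s. ip M \<phi> (y s)) has_vector_derivative ip M \<phi> d) (at t)"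
  unfolding has_vector_derivative_at_0_iff
proof (rule LIM_zero_cancel, rule Lim_null_comparison)
  note L = sder_L2[OF assms(1)] sder_quot_L2[OF assms(1)]
  have "norm ((ip M \<phi> (y (t + h)) - ip M \<phi> (y t)) /\<^sub>R h - ip M \<phi> d)
      \<le> l2norm M \<phi> * l2norm M (\<lambda>q. (y (t + h) q - y t q) / complex_of_real h - d q)" for h
  proof -
    have "(ip M \<phi> (y (t + h)) - ip M \<phi> (y t)) /\<^sub>R h - ip M \<phi> d
      = ip M \<phi> (\<lambda>q. (y (t + h) q - y t q) / complex_of_real h - d q)"
      by (simp add: ip_diff_right L assms(2) ip_divide_right L2_divide L2_diff scaleR_conv_of_real)
         (simp add: divide_inverse mult.commute)
    also have "norm \<dots> \<le> l2norm M \<phi> * l2norm M (\<lambda>q. (y (t + h) q - y t q) / complex_of_real h - d q)"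
      by (intro ip_CS assms L2_diff L)
    finally show ?thesis .
  qed
  then show "\<forall>\<^sub>F h in at 0. norm ((ip M \<phi> (y (t + h)) - ip M \<phi> (y t)) /\<^sub>R h - ip M \<phi> d)
      \<le> l2norm M \<phi> * l2norm M (\<lambda>q. (y (t + h) q - y t q) / complex_of_real h - d q)" by simp
  show "((\<lambda>h. l2norm M \<phi> * l2norm M (\<lambda>q. (y (t + h) q - y t q) / complex_of_real h - d q)) \<longlongrightarrow> 0) (at 0)"
    using assms(1) unfolding sder_def by (intro tendsto_mult_right_zero) blast
qed

lemma l2norm_sq_add:
  assumes "\<phi> \<in> L2 M" "\<psi> \<in> L2 M"
  shows "(l2norm M (\<lambda>q. \<phi> q + \<psi> q))\<^sup>2 = (l2norm M \<phi>)\<^sup>2 + (l2norm M \<psi>)\<^sup>2 + 2 * Re (ip M \<phi> \<psi>)"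
proof -
  have "Re (ip M \<phi> \<psi>) = (LINT q|M. Re (cnj (\<phi> q) * \<psi> q))"
    unfolding ip_def by (rule integral_Re[OF ip_integrable[OF assms], symmetric])
  moreover have "integrable M (\<lambda>q. Re (cnj (\<phi> q) * \<psi> q))"
    by (rule integrable_Re[OF ip_integrable[OF assms]])
  moreover have "(cmod (\<phi> q + \<psi> q))\<^sup>2 = (cmod (\<phi> q))\<^sup>2 + (cmod (\<psi> q))\<^sup>2 + 2 * Re (cnj (\<phi> q) * \<psi> q)" for q
    by (simp add: cmod_power2 power2_sum algebra_simps)
  ultimately show ?thesis
    using assms by (simp only: l2norm_sq L2_add Bochner_Integration.integral_add Bochner_Integration.integrable_add
       integrable_mult_right L2_integrable integral_mult_right_zero)
qed

text \<open>The increment of the squared norm is twice the real part of the scalar product of y(t)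
  with the increment, plus the square of the increment; the latter is quadratic in h and
  disappears.\<close>

lemma sder_norm_sq:
  assumes "sder M y d t"
  shows "((\<lambda>s. (l2norm M (y s))\<^sup>2) has_real_derivative 2 * Re (ip M (y t) d)) (at t)"
proof -
  note L = sder_L2[OF assms] sder_quot_L2[OF assms]
  let ?D = "\<lambda>h q. (y (t + h) q - y t q) / complex_of_real h"
  have lim0: "((\<lambda>h. l2norm M (\<lambda>q. ?D h q - d q)) \<longlongrightarrow> 0) (at 0)" using assms by (simp add: sder_def)
  have eq: "((l2norm M (y (t + h)))\<^sup>2 - (l2norm M (y t))\<^sup>2) /\<^sub>R h
      = 2 * Re ((ip M (y t) (y (t + h)) - ip M (y t) (y t)) /\<^sub>R h) + h * (l2norm M (?D h))\<^sup>2" if "h \<noteq> 0" for h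
  proof -
    have "(l2norm M (y (t + h)))\<^sup>2 = (l2norm M (\<lambda>q. y t q + (y (t + h) q - y t q)))\<^sup>2" by simp
    also have "\<dots> = (l2norm M (y t))\<^sup>2 + (l2norm M (\<lambda>q. y (t + h) q - y t q))\<^sup>2
        + 2 * Re (ip M (y t) (\<lambda>q. y (t + h) q - y t q))"
      by (intro l2norm_sq_add L2_diff L)
    also have "l2norm M (\<lambda>q. y (t + h) q - y t q) = \<bar>h\<bar> * l2norm M (?D h)"
      using that by (simp add: l2norm_divide L2_diff L)
    finally show ?thesis
      using that by (simp add: ip_diff_right L power_mult_distrib field_simps power2_eq_square)
  qed
  have b: "((\<lambda>h. h * (l2norm M (?D h))\<^sup>2) \<longlongrightarrow> 0) (at 0)"
  proof (rule Lim_null_comparison)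
    have "norm (h * (l2norm M (?D h))\<^sup>2) \<le> \<bar>h\<bar> * (l2norm M d + l2norm M (\<lambda>q. ?D h q - d q))\<^sup>2" for h
      using l2norm_le_add_diff[OF L(3)[of h] L(2)] by (auto simp: abs_mult intro!: mult_left_mono power_mono)
    then show "\<forall>\<^sub>F h in at 0. norm (h * (l2norm M (?D h))\<^sup>2) \<le> \<bar>h\<bar> * (l2norm M d + l2norm M (\<lambda>q. ?D h q - d q))\<^sup>2"
      by simp
    have "((\<lambda>h::real. \<bar>h\<bar> * (l2norm M d + l2norm M (\<lambda>q. ?D h q - d q))\<^sup>2) \<longlongrightarrow> \<bar>0\<bar> * (l2norm M d + 0)\<^sup>2) (at 0)"
      by (intro tendsto_intros lim0)
    then show "((\<lambda>h::real. \<bar>h\<bar> * (l2norm M d + l2norm M (\<lambda>q. ?D h q - d q))\<^sup>2) \<longlongrightarrow> 0) (at 0)" by simp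
  qed
  have "((\<lambda>h. 2 * Re ((ip M (y t) (y (t + h)) - ip M (y t) (y t)) /\<^sub>R h) + h * (l2norm M (?D h))\<^sup>2)
      \<longlongrightarrow> 2 * Re (ip M (y t) d) + 0) (at 0)"
    using sder_ip[OF assms L(1), of t] unfolding has_vector_derivative_at_0_iff
    by (intro tendsto_intros b)
  then have "((\<lambda>h. ((l2norm M (y (t + h)))\<^sup>2 - (l2norm M (y t))\<^sup>2) /\<^sub>R h) \<longlongrightarrow> 2 * Re (ip M (y t) d)) (at 0)"
    by (subst tendsto_cong[where g = "\<lambda>h. 2 * Re ((ip M (y t) (y (t + h)) - ip M (y t) (y t)) /\<^sub>R h) + h * (l2norm M (?D h))\<^sup>2"])
       (use eq in \<open>auto simp: eventually_at_filter\<close>)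
  then show ?thesis
    unfolding has_real_derivative_iff_has_vector_derivative has_vector_derivative_at_0_iff .
qed

lemma sder_lin:
  assumes "sder M y d t" "sder M z e t"
  shows "sder M (\<lambda>s q. a * y s q + b * z s q) (\<lambda>q. a * d q + b * e q) t"
  unfolding sder_def
proof (intro conjI allI)
  let ?Y = "\<lambda>h q. (y (t + h) q - y t q) / complex_of_real h - d q"
  let ?Z = "\<lambda>h q. (z (t + h) q - z t q) / complex_of_real h - e q"
  let ?S = "\<lambda>h q. (a * y (t + h) q + b * z (t + h) q - (a * y t q + b * z t q)) / complex_of_real h - (a * d q + b * e q)"
  have L: "?Y h \<in> L2 M" "?Z h \<in> L2 M" for h
    by (rule L2_diff[OF sder_quot_L2[OF assms(1)] sder_L2(2)[OF assms(1)]],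
        rule L2_diff[OF sder_quot_L2[OF assms(2)] sder_L2(2)[OF assms(2)]])
  show "((\<lambda>h. l2norm M (?S h)) \<longlongrightarrow> 0) (at 0)"
  proof (rule Lim_null_comparison)
    have "((\<lambda>h. cmod a * l2norm M (?Y h) + cmod b * l2norm M (?Z h)) \<longlongrightarrow> cmod a * 0 + cmod b * 0) (at 0)"
      using assms unfolding sder_def by (intro tendsto_add tendsto_mult tendsto_const) auto
    then show "((\<lambda>h. cmod a * l2norm M (?Y h) + cmod b * l2norm M (?Z h)) \<longlongrightarrow> 0) (at 0)" by simp
    have "l2norm M (?S h) \<le> cmod a * l2norm M (?Y h) + cmod b * l2norm M (?Z h)" for h
    proof -
      have "?S h = (\<lambda>q. a * ?Y h q + b * ?Z h q)"
        by (simp add: fun_eq_iff right_diff_distrib diff_divide_distrib add_divide_distrib)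
      then show ?thesis
        using l2norm_triangle[OF L2_cmult[OF L(1), of a] L2_cmult[OF L(2), of b], of h h] by (simp only: l2norm_cmult L)
    qed
    then show "\<forall>\<^sub>F h in at 0. norm (l2norm M (?S h)) \<le> cmod a * l2norm M (?Y h) + cmod b * l2norm M (?Z h)" by simp
  qed
qed (use assms in \<open>auto simp: sder_def intro!: L2_add L2_cmult\<close>)

lemma sder_diff:
  "sder M y d t \<Longrightarrow> sder M z e t \<Longrightarrow> sder M (\<lambda>s q. y s q - z s q) (\<lambda>q. d q - e q) t"
  using sder_lin[of M y d t z e 1 "-1"] by simp

lemma sder_cong:
  assumes "sder M y d t" "\<And>s. AE q in M. y s q = z s q" "\<And>s. z s \<in> L2 M" "AE q in M. d q = e q" "e \<in> L2 M"
  shows "sder M z e t"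
proof -
  have "l2norm M (\<lambda>q. (z (t + h) q - z t q) / complex_of_real h - e q)
     = l2norm M (\<lambda>q. (y (t + h) q - y t q) / complex_of_real h - d q)" for h
    using assms(2)[of "t + h"] assms(2)[of t] assms(4) by (intro l2norm_cong_AE) (auto elim!: eventually_elim2)
  then show ?thesis using assms(1,3,5) by (simp add: sder_def)
qed

text \<open>A linear isometry maps the error of the difference quotient to a vector of the same
  norm, so no continuity argument is needed.\<close>

lemma sder_isometry:
  assumes "sder M y d t" "\<And>\<psi>. \<psi> \<in> L2 M \<Longrightarrow> T \<psi> \<in> L2 M"
    and "\<And>\<psi>. \<psi> \<in> L2 M \<Longrightarrow> l2norm M (T \<psi>) = l2norm M \<psi>"
    and lin: "\<And>a b \<psi> \<phi>. \<psi> \<in> L2 M \<Longrightarrow> \<phi> \<in> L2 M \<Longrightarrow> AE q in M. T (\<lambda>r. a * \<psi> r + b * \<phi> r) q = a * T \<psi> q + b * T \<phi> q"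
  shows "sder M (\<lambda>s. T (y s)) (T d) t"
proof -
  note L = sder_L2[OF assms(1)] sder_quot_L2[OF assms(1)]
  have "l2norm M (\<lambda>q. (T (y (t + h)) q - T (y t) q) / complex_of_real h - T d q)
     = l2norm M (\<lambda>q. (y (t + h) q - y t q) / complex_of_real h - d q)" for h
  proof -
    let ?c = "1 / complex_of_real h"
    let ?e = "\<lambda>r. ?c * y (t + h) r + (- ?c) * y t r"
    have e: "?e \<in> L2 M" by (intro L2_add L2_cmult L)
    have "AE q in M. T (\<lambda>r. 1 * ?e r + (-1) * d r) q = (T (y (t + h)) q - T (y t) q) / complex_of_real h - T d q"
      using lin[OF e L(2), of 1 "-1"] lin[of "y (t + h)" "y t" ?c "- ?c", OF L(1) L(1)]
      by eventually_elim (simp add: diff_divide_distrib)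
    then have "l2norm M (\<lambda>q. (T (y (t + h)) q - T (y t) q) / complex_of_real h - T d q)
       = l2norm M (T (\<lambda>r. 1 * ?e r + (-1) * d r))"
      by (intro l2norm_cong_AE) (auto elim: eventually_mono)
    also have "\<dots> = l2norm M (\<lambda>r. 1 * ?e r + (-1) * d r)"
      by (intro assms(3) L2_add L2_cmult L)
    also have "\<dots> = l2norm M (\<lambda>q. (y (t + h) q - y t q) / complex_of_real h - d q)"
      by (simp add: diff_divide_distrib)
    finally show ?thesis .
  qed
  then show ?thesis using assms(1,2) by (simp add: sder_def)
qed

lemma vector_derivative_bound:
  fixes f :: "real \<Rightarrow> 'b::real_normed_vector"
  assumes "\<And>s. s \<in> closed_segment a b \<Longrightarrow> (f has_vector_derivative f' s) (at s)"
    and "\<And>s. s \<in> closed_segment a b \<Longrightarrow> norm (f' s) \<le> K"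
  shows "norm (f b - f a) \<le> K * \<bar>b - a\<bar>"
proof -
  have "norm (f b - f a) \<le> K * norm (b - a)"
  proof (rule differentiable_bound[of "closed_segment a b" f "\<lambda>s h. h *\<^sub>R f' s"])
    show "onorm (\<lambda>h. h *\<^sub>R f' s) \<le> K" if "s \<in> closed_segment a b" for s
      by (rule onorm_le) (use assms(2)[OF that] in \<open>auto simp: mult.commute[of K] intro!: mult_left_mono\<close>)
  qed (use assms(1) in \<open>auto simp: has_vector_derivative_def intro: has_derivative_at_withinI\<close>)
  then show ?thesis by simp
qed

text \<open>Duality replaces vector-valued integration: the mean value inequality is applied to the
  scalar product with each fixed vector.\<close>

lemma sder_bound:
  assumes "\<And>s. s \<in> closed_segment a b \<Longrightarrow> sder M y (d s) s"
    and "\<And>s. s \<in> closed_segment a b \<Longrightarrow> l2norm M (d s) \<le> K"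
  shows "l2norm M (\<lambda>q. y b q - y a q) \<le> K * \<bar>b - a\<bar>"
proof -
  have L: "y s \<in> L2 M" for s using sder_L2(1)[OF assms(1)[of a]] by simp
  have K: "0 \<le> K" using order_trans[OF l2norm_nonneg assms(2)[of a]] by simp
  show ?thesis
  proof (rule l2norm_le_of_ip)
    fix \<phi> assume \<phi>: "\<phi> \<in> L2 M"
    have "norm (ip M \<phi> (y b) - ip M \<phi> (y a)) \<le> (l2norm M \<phi> * K) * \<bar>b - a\<bar>"
    proof (rule vector_derivative_bound)
      show "((\<lambda>s. ip M \<phi> (y s)) has_vector_derivative ip M \<phi> (d s)) (at s)" if "s \<in> closed_segment a b" for s
        by (rule sder_ip[OF assms(1)[OF that] \<phi>])
      show "norm (ip M \<phi> (d s)) \<le> l2norm M \<phi> * K" if "s \<in> closed_segment a b" for s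
        using ip_CS[OF \<phi> sder_L2(2)[OF assms(1)[OF that]]] assms(2)[OF that]
        by (meson l2norm_nonneg mult_left_mono order_trans)
    qed
    then show "cmod (ip M \<phi> (\<lambda>q. y b q - y a q)) \<le> K * \<bar>b - a\<bar> * l2norm M \<phi>"
      by (simp add: ip_diff_right \<phi> L mult_ac)
  qed (use K L in \<open>auto intro: L2_diff\<close>)
qed

text \<open>Polarisation: norms of sums give the real part, and replacing \<open>\<psi>\<close> by
  -i times it gives the imaginary part.\<close>

lemma isometry_ip:
  assumes \<phi>: "\<phi> \<in> L2 M" and \<psi>: "\<psi> \<in> L2 M" and T: "\<And>\<psi>. \<psi> \<in> L2 M \<Longrightarrow> T \<psi> \<in> L2 M"
    and norm: "\<And>\<psi>. \<psi> \<in> L2 M \<Longrightarrow> l2norm M (T \<psi>) = l2norm M \<psi>"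
    and lin: "\<And>a b \<psi> \<phi>. \<psi> \<in> L2 M \<Longrightarrow> \<phi> \<in> L2 M \<Longrightarrow> AE q in M. T (\<lambda>r. a * \<psi> r + b * \<phi> r) q = a * T \<psi> q + b * T \<phi> q"
  shows "ip M (T \<phi>) (T \<psi>) = ip M \<phi> \<psi>"
proof -
  have Re: "Re (ip M (T \<phi>) (T \<psi>)) = Re (ip M \<phi> \<psi>)" if \<psi>: "\<psi> \<in> L2 M" for \<psi>
  proof -
    have "l2norm M (\<lambda>q. T \<phi> q + T \<psi> q) = l2norm M (T (\<lambda>q. 1 * \<phi> q + 1 * \<psi> q))"
      by (rule l2norm_cong_AE) (use lin[OF \<phi> \<psi>, of 1 1] in \<open>auto elim: eventually_mono\<close>)
    also have "\<dots> = l2norm M (\<lambda>q. \<phi> q + \<psi> q)" using \<phi> \<psi> by (simp add: norm L2_add)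
    finally show ?thesis
      using l2norm_sq_add[OF \<phi> \<psi>] l2norm_sq_add[OF T[OF \<phi>] T[OF \<psi>]] norm[OF \<phi>] norm[OF \<psi>] by simp
  qed
  have "ip M (T \<phi>) (T (\<lambda>q. - \<i> * \<psi> q)) = ip M (T \<phi>) (\<lambda>q. - \<i> * T \<psi> q)"
    using lin[OF \<psi> \<psi>, of "- \<i>" 0] by (intro ip_cong_AE L2_measurable T L2_cmult \<phi> \<psi>) simp
  then have "Im (ip M (T \<phi>) (T \<psi>)) = Im (ip M \<phi> \<psi>)"
    using Re[OF L2_cmult[OF \<psi>], of "- \<i>"] by (simp only: ip_cmult_right) simp
  then show ?thesis using Re[OF \<psi>] by (rule complex_eqI[rotated])
qed

section \<open>One-parameter unitary groups and closedness of their generators\<close>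

locale unitary_group =
  fixes M :: "'a measure" and U :: "real \<Rightarrow> ('a \<Rightarrow> complex) \<Rightarrow> 'a \<Rightarrow> complex"
  assumes U_L2: "\<psi> \<in> L2 M \<Longrightarrow> U t \<psi> \<in> L2 M"
    and U_norm: "\<psi> \<in> L2 M \<Longrightarrow> l2norm M (U t \<psi>) = l2norm M \<psi>"
    and U_lin: "\<psi> \<in> L2 M \<Longrightarrow> \<phi> \<in> L2 M \<Longrightarrow> AE q in M. U t (\<lambda>r. a * \<psi> r + b * \<phi> r) q = a * U t \<psi> q + b * U t \<phi> q"
    and U_0: "\<psi> \<in> L2 M \<Longrightarrow> AE q in M. U 0 \<psi> q = \<psi> q"
    and U_add: "\<psi> \<in> L2 M \<Longrightarrow> AE q in M. U (s + t) \<psi> q = U s (U t \<psi>) q"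
    and U_cont: "\<psi> \<in> L2 M \<Longrightarrow> ((\<lambda>t. l2norm M (\<lambda>q. U t \<psi> q - U t0 \<psi> q)) \<longlongrightarrow> 0) (at t0)"
begin

lemma U_diff: "\<psi> \<in> L2 M \<Longrightarrow> \<phi> \<in> L2 M \<Longrightarrow> AE q in M. U t (\<lambda>r. \<psi> r - \<phi> r) q = U t \<psi> q - U t \<phi> q"
  using U_lin[of \<psi> \<phi> t 1 "-1"] by simp

lemma U_diff_norm: "\<psi> \<in> L2 M \<Longrightarrow> \<phi> \<in> L2 M \<Longrightarrow> l2norm M (\<lambda>q. U t \<psi> q - U t \<phi> q) = l2norm M (\<lambda>q. \<psi> q - \<phi> q)"
proof -
  assume *: "\<psi> \<in> L2 M" "\<phi> \<in> L2 M"
  have "l2norm M (\<lambda>q. U t \<psi> q - U t \<phi> q) = l2norm M (U t (\<lambda>r. \<psi> r - \<phi> r))"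
    by (rule l2norm_cong_AE) (use U_diff[OF *, of t] in \<open>auto elim: eventually_mono\<close>)
  then show ?thesis using * by (simp add: U_norm L2_diff)
qed

lemma U_cong:
  assumes "\<psi> \<in> L2 M" "\<phi> \<in> L2 M" "AE q in M. \<psi> q = \<phi> q"
  shows "AE q in M. U t \<psi> q = U t \<phi> q"
proof -
  have "l2norm M (\<lambda>q. \<psi> q - \<phi> q) = l2norm M (\<lambda>q. 0)"
    by (rule l2norm_cong_AE) (use assms(3) in \<open>auto elim: eventually_mono\<close>)
  then have "l2norm M (\<lambda>q. U t \<psi> q - U t \<phi> q) = 0" using U_diff_norm[OF assms(1,2)] by simp
  then have "AE q in M. U t \<psi> q - U t \<phi> q = 0" by (intro l2norm_zero_AE L2_diff U_L2 assms)
  then show ?thesis by (auto elim: eventually_mono)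
qed

lemma U_inv: "\<psi> \<in> L2 M \<Longrightarrow> AE q in M. U t (U (- t) \<psi>) q = \<psi> q"
  using U_add[of \<psi> t "- t"] U_0[of \<psi>] by (auto elim: eventually_elim2)

lemma U_inv': "\<psi> \<in> L2 M \<Longrightarrow> AE q in M. U (- t) (U t \<psi>) q = \<psi> q"
  using U_inv[of \<psi> "- t"] by simp

lemma U_ip: "\<phi> \<in> L2 M \<Longrightarrow> \<psi> \<in> L2 M \<Longrightarrow> ip M (U t \<phi>) (U t \<psi>) = ip M \<phi> \<psi>"
  by (rule isometry_ip) (auto intro: U_L2 U_norm U_lin)

lemma U_adj:
  assumes "\<phi> \<in> L2 M" "\<psi> \<in> L2 M"
  shows "ip M \<phi> (U t \<psi>) = ip M (U (- t) \<phi>) \<psi>"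
proof -
  have "ip M (U (- t) \<phi>) \<psi> = ip M (U (- t) \<phi>) (U (- t) (U t \<psi>))"
    by (rule ip_cong_AE) (use U_inv'[OF assms(2), of t] in \<open>auto elim: eventually_mono intro!: L2_measurable U_L2 assms\<close>)
  also have "\<dots> = ip M \<phi> (U t \<psi>)" by (intro U_ip assms U_L2)
  finally show ?thesis by simp
qed

text \<open>States that \<open>v\<close> lies in the domain of the self-adjoint generator H with H v
  = w. It is a relation because w is determined only almost everywhere and no domain has to be fixed
  in advance.\<close>

definition gen :: "('a \<Rightarrow> complex) \<Rightarrow> ('a \<Rightarrow> complex) \<Rightarrow> bool" where
  "gen v w \<longleftrightarrow> v \<in> L2 M \<and> w \<in> L2 M \<and>
     ((\<lambda>h. l2norm M (\<lambda>q. (U h v q - v q) / complex_of_real h + \<i> * w q)) \<longlongrightarrow> 0) (at 0)"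

lemma gen_sder:
  assumes "gen v w"
  shows "sder M (\<lambda>t. U t v) (\<lambda>q. - \<i> * U t w q) t"
  unfolding sder_def
proof (intro conjI allI)
  have v: "v \<in> L2 M" and w: "w \<in> L2 M" using assms by (auto simp: gen_def)
  show "U s v \<in> L2 M" for s by (rule U_L2[OF v])
  show "(\<lambda>q. - \<i> * U t w q) \<in> L2 M" by (intro L2_cmult U_L2 w)
  have "l2norm M (\<lambda>q. (U (t + h) v q - U t v q) / complex_of_real h - - \<i> * U t w q)
      = l2norm M (\<lambda>q. (U h v q - v q) / complex_of_real h + \<i> * w q)" for h
  proof -
    let ?c = "1 / complex_of_real h" and ?e = "\<lambda>r. (1 / complex_of_real h) * U h v r + (- (1 / complex_of_real h)) * v r"
    have e: "?e \<in> L2 M" by (intro L2_add L2_cmult U_L2 v)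
    have "AE q in M. U t (\<lambda>r. 1 * ?e r + \<i> * w r) q = (U (t + h) v q - U t v q) / complex_of_real h - - \<i> * U t w q"
      using U_lin[OF e w, of t 1 \<i>] U_lin[OF U_L2[OF v] v, of t ?c h "- ?c"] U_add[OF v, of t h]
      by eventually_elim (simp add: diff_divide_distrib)
    then have "l2norm M (\<lambda>q. (U (t + h) v q - U t v q) / complex_of_real h - - \<i> * U t w q)
        = l2norm M (U t (\<lambda>r. 1 * ?e r + \<i> * w r))"
      by (intro l2norm_cong_AE) (auto elim: eventually_mono)
    also have "\<dots> = l2norm M (\<lambda>r. 1 * ?e r + \<i> * w r)" by (intro U_norm L2_add L2_cmult U_L2 v w)
    also have "\<dots> = l2norm M (\<lambda>q. (U h v q - v q) / complex_of_real h + \<i> * w q)" by (simp add: diff_divide_distrib)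
    finally show ?thesis .
  qed
  then show "((\<lambda>h. l2norm M (\<lambda>q. (U (t + h) v q - U t v q) / complex_of_real h - - \<i> * U t w q)) \<longlongrightarrow> 0) (at 0)"
    using assms by (simp add: gen_def)
qed

text \<open>In effect U_k u - u + i k w is the integral of -i (U_s w - w). Comparing w with a fixed
  \<open>z\<close> leaves a bound that depends on the pair (u, w) only through the distance from w
  to z, hence uniform along approximating sequences.\<close>

lemma gen_remainder:
  assumes g: "gen u w" and z: "z \<in> L2 M" and e: "\<And>k. \<bar>k\<bar> \<le> \<delta> \<Longrightarrow> l2norm M (\<lambda>q. U k z q - z q) \<le> e"
    and k: "\<bar>k\<bar> \<le> \<delta>"
  shows "l2norm M (\<lambda>q. U k u q - u q + \<i> * of_real k * w q) \<le> \<bar>k\<bar> * (e + 2 * l2norm M (\<lambda>q. w q - z q))"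
proof -
  have u: "u \<in> L2 M" and w: "w \<in> L2 M" using g by (auto simp: gen_def)
  let ?K = "e + 2 * l2norm M (\<lambda>q. w q - z q)"
  have e0: "0 \<le> e" using order_trans[OF l2norm_nonneg e[of 0]] order_trans[OF abs_ge_zero k] by simp
  have bd: "l2norm M (\<lambda>q. U s w q - w q) \<le> ?K" if "\<bar>s\<bar> \<le> \<delta>" for s
  proof -
    have "l2norm M (\<lambda>q. U s w q - w q) \<le> l2norm M (\<lambda>q. U s w q - U s z q) + l2norm M (\<lambda>q. U s z q - w q)"
      by (intro l2norm_triangle_diff U_L2 w z)
    also have "l2norm M (\<lambda>q. U s z q - w q) \<le> l2norm M (\<lambda>q. U s z q - z q) + l2norm M (\<lambda>q. z q - w q)"
      by (intro l2norm_triangle_diff U_L2 w z)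
    finally show ?thesis using e[OF that] U_diff_norm[OF w z, of s] l2norm_minus_commute[of M z w] by simp
  qed
  show ?thesis
  proof (rule l2norm_le_of_ip)
    show "(\<lambda>q. U k u q - u q + \<i> * of_real k * w q) \<in> L2 M" by (intro L2_add L2_diff L2_cmult U_L2 u w)
    show "0 \<le> \<bar>k\<bar> * ?K" using e0 by simp
    fix \<phi> assume \<phi>: "\<phi> \<in> L2 M"
    let ?f = "\<lambda>s. ip M \<phi> (U s u) + \<i> * of_real s * ip M \<phi> w"
    have "norm (?f k - ?f 0) \<le> (l2norm M \<phi> * ?K) * \<bar>k - 0\<bar>"
    proof (rule vector_derivative_bound)
      fix s assume "s \<in> closed_segment 0 k"
      then have s: "\<bar>s\<bar> \<le> \<delta>" using k by (auto simp: closed_segment_eq_real_ivl split: if_splits)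
      have "((\<lambda>s. \<i> * of_real s * ip M \<phi> w) has_vector_derivative \<i> * ip M \<phi> w) (at s)"
        by (auto intro!: derivative_eq_intros simp: has_vector_derivative_def scaleR_conv_of_real)
      then show "(?f has_vector_derivative (ip M \<phi> (\<lambda>q. - \<i> * U s w q) + \<i> * ip M \<phi> w)) (at s)"
        by (intro has_vector_derivative_add sder_ip[OF gen_sder[OF g] \<phi>])
      have "ip M \<phi> (\<lambda>q. - \<i> * U s w q) + \<i> * ip M \<phi> w = - \<i> * ip M \<phi> (\<lambda>q. U s w q - w q)"
        by (simp only: ip_cmult_right ip_diff_right[OF \<phi> U_L2[OF w] w]) (simp add: algebra_simps)
      then have "norm (ip M \<phi> (\<lambda>q. - \<i> * U s w q) + \<i> * ip M \<phi> w) = cmod (ip M \<phi> (\<lambda>q. U s w q - w q))"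
        by (simp add: norm_mult)
      also have "\<dots> \<le> l2norm M \<phi> * l2norm M (\<lambda>q. U s w q - w q)" by (intro ip_CS \<phi> L2_diff U_L2 w)
      also have "\<dots> \<le> l2norm M \<phi> * ?K" by (intro mult_left_mono bd s l2norm_nonneg)
      finally show "norm (ip M \<phi> (\<lambda>q. - \<i> * U s w q) + \<i> * ip M \<phi> w) \<le> l2norm M \<phi> * ?K" .
    qed
    moreover have "ip M \<phi> (U 0 u) = ip M \<phi> u" by (intro ip_cong_AE U_0 u L2_measurable U_L2 \<phi>)
    moreover have "ip M \<phi> (\<lambda>q. U k u q - u q + \<i> * of_real k * w q) = ip M \<phi> (U k u) - ip M \<phi> u + \<i> * of_real k * ip M \<phi> w"
      by (simp only: ip_add_right[OF \<phi> L2_diff[OF U_L2[OF u] u] L2_cmult[OF w]] ip_cmult_right ip_diff_right[OF \<phi> U_L2[OF u] u])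
    ultimately show "cmod (ip M \<phi> (\<lambda>q. U k u q - u q + \<i> * of_real k * w q)) \<le> \<bar>k\<bar> * ?K * l2norm M \<phi>"
      by (simp add: mult_ac add_diff_eq diff_add_eq)
  qed
qed

text \<open>The graph of the generator is closed. The limits n to infinity and h to 0 may be
  exchanged because \<open>gen_remainder\<close> controls the quotients uniformly in n.\<close>

lemma gen_closed:
  assumes g: "\<And>n. gen (u n) (w n)" and v: "v \<in> L2 M" and z: "z \<in> L2 M"
    and lu: "(\<lambda>n. l2norm M (\<lambda>q. u n q - v q)) \<longlonglongrightarrow> 0"
    and lw: "(\<lambda>n. l2norm M (\<lambda>q. w n q - z q)) \<longlonglongrightarrow> 0"
  shows "gen v z"
  unfolding gen_def
proof (intro conjI v z)
  have L: "u n \<in> L2 M" "w n \<in> L2 M" for n using g[of n] by (auto simp: gen_def)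
  have main: "l2norm M (\<lambda>q. (U k v q - v q) / complex_of_real k + \<i> * z q) \<le> e"
    if e: "\<And>k. \<bar>k\<bar> \<le> \<delta> \<Longrightarrow> l2norm M (\<lambda>q. U k z q - z q) \<le> e" and k: "\<bar>k\<bar> \<le> \<delta>" "k \<noteq> 0" for e \<delta> k
  proof -
    have vk: "(\<lambda>q. U k v q - v q + \<i> * of_real k * z q) \<in> L2 M" by (intro L2_add L2_diff L2_cmult U_L2 v z)
    have bd: "l2norm M (\<lambda>q. U k v q - v q + \<i> * of_real k * z q)
      \<le> \<bar>k\<bar> * (e + 2 * l2norm M (\<lambda>q. w n q - z q)) + (2 * l2norm M (\<lambda>q. u n q - v q) + \<bar>k\<bar> * l2norm M (\<lambda>q. w n q - z q))" for n
    proof -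
      have un: "(\<lambda>q. U k (u n) q - u n q + \<i> * of_real k * w n q) \<in> L2 M" by (intro L2_add L2_diff L2_cmult U_L2 L)
      have "l2norm M (\<lambda>q. U k v q - v q + \<i> * of_real k * z q)
        \<le> l2norm M (\<lambda>q. U k (u n) q - u n q + \<i> * of_real k * w n q) +
          l2norm M (\<lambda>q. (U k v q - v q + \<i> * of_real k * z q) - (U k (u n) q - u n q + \<i> * of_real k * w n q))"
        by (rule l2norm_le_add_diff[OF vk un])
      also have "(\<lambda>q. (U k v q - v q + \<i> * of_real k * z q) - (U k (u n) q - u n q + \<i> * of_real k * w n q))
         = (\<lambda>q. ((U k v q - U k (u n) q) - (v q - u n q)) - \<i> * of_real k * (w n q - z q))"
        by (simp add: fun_eq_iff algebra_simps)
      also have "l2norm M \<dots> \<le> l2norm M (\<lambda>q. (U k v q - U k (u n) q) - (v q - u n q)) + l2norm M (\<lambda>q. \<i> * of_real k * (w n q - z q))"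
        by (intro l2norm_diff_le L2_diff L2_cmult U_L2 v z L)
      also have "l2norm M (\<lambda>q. (U k v q - U k (u n) q) - (v q - u n q)) \<le> l2norm M (\<lambda>q. U k v q - U k (u n) q) + l2norm M (\<lambda>q. v q - u n q)"
        by (intro l2norm_diff_le L2_diff U_L2 v L)
      also have "l2norm M (\<lambda>q. \<i> * of_real k * (w n q - z q)) = \<bar>k\<bar> * l2norm M (\<lambda>q. w n q - z q)"
        by (subst l2norm_cmult) (auto intro: L2_diff L z simp: norm_mult)
      finally show ?thesis
        using gen_remainder[OF g z e k(1), of n] U_diff_norm[OF v L(1), of k n] l2norm_minus_commute[of M v "u n"] by simp
    qed
    have "(\<lambda>n. \<bar>k\<bar> * (e + 2 * l2norm M (\<lambda>q. w n q - z q)) + (2 * l2norm M (\<lambda>q. u n q - v q) + \<bar>k\<bar> * l2norm M (\<lambda>q. w n q - z q)))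
      \<longlonglongrightarrow> \<bar>k\<bar> * (e + 2 * 0) + (2 * 0 + \<bar>k\<bar> * 0)"
      by (intro tendsto_add tendsto_mult tendsto_const lu lw)
    from LIMSEQ_le_const[OF this] have "l2norm M (\<lambda>q. U k v q - v q + \<i> * of_real k * z q) \<le> \<bar>k\<bar> * (e + 2 * 0) + (2 * 0 + \<bar>k\<bar> * 0)"
      using bd by blast
    then have "l2norm M (\<lambda>q. U k v q - v q + \<i> * of_real k * z q) \<le> \<bar>k\<bar> * e" by simp
    moreover have "(\<lambda>q. (U k v q - v q) / complex_of_real k + \<i> * z q) = (\<lambda>q. (U k v q - v q + \<i> * of_real k * z q) / complex_of_real k)"
      using k by (simp add: add_divide_distrib)
    ultimately show ?thesis using k l2norm_divide[OF vk, of "complex_of_real k"] by (simp add: divide_le_eq mult.commute[of e])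
  qed
  show "((\<lambda>h. l2norm M (\<lambda>q. (U h v q - v q) / complex_of_real h + \<i> * z q)) \<longlongrightarrow> 0) (at 0)"
  proof (rule LIM_I)
    fix r :: real assume r: "0 < r"
    have "((\<lambda>t. l2norm M (\<lambda>q. U t z q - U 0 z q)) \<longlongrightarrow> 0) (at 0)" by (rule U_cont[OF z])
    then obtain s where s: "s > 0" "\<And>t. t \<noteq> 0 \<Longrightarrow> \<bar>t\<bar> < s \<Longrightarrow> l2norm M (\<lambda>q. U t z q - U 0 z q) < r / 2"
      using LIM_D[of _ 0 0 "r / 2"] r by force
    have eq: "l2norm M (\<lambda>q. U t z q - z q) = l2norm M (\<lambda>q. U t z q - U 0 z q)" for t
      by (rule l2norm_cong_AE) (use U_0[OF z] in \<open>auto elim: eventually_mono\<close>)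
    have e: "l2norm M (\<lambda>q. U t z q - z q) \<le> r / 2" if "\<bar>t\<bar> \<le> s / 2" for t
      using s that r unfolding eq by (cases "t = 0") (auto intro: less_imp_le)
    show "\<exists>s>0. \<forall>x. x \<noteq> 0 \<and> norm (x - 0) < s \<longrightarrow>
        norm (l2norm M (\<lambda>q. (U x v q - v q) / complex_of_real x + \<i> * z q) - 0) < r"
    proof (intro exI conjI allI impI)
      show "0 < s / 2" using s by simp
      fix x :: real assume "x \<noteq> 0 \<and> norm (x - 0) < s / 2"
      then have "l2norm M (\<lambda>q. (U x v q - v q) / complex_of_real x + \<i> * z q) \<le> r / 2"
        by (intro main[OF e]) auto
      then show "norm (l2norm M (\<lambda>q. (U x v q - v q) / complex_of_real x + \<i> * z q) - 0) < r"
        using r by simp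
    qed
  qed
qed

text \<open>Product rule. Since U acts isometrically, the error splits into that of the generator at
  u(t), that of the quotient of u, and the strong continuity of U at the vector
  \<open>d\<close>.\<close>

lemma sder_U_path:
  assumes g: "gen (u t) w" and u: "sder M u d t"
  shows "sder M (\<lambda>s. U (- s) (u s)) (U (- t) (\<lambda>q. \<i> * w q + d q)) t"
  unfolding sder_def
proof (intro conjI allI)
  note L = sder_L2[OF u] sder_quot_L2[OF u]
  have w: "w \<in> L2 M" using g by (simp add: gen_def)
  show "U (- s) (u s) \<in> L2 M" for s by (intro U_L2 L)
  show "U (- t) (\<lambda>q. \<i> * w q + d q) \<in> L2 M" by (intro U_L2 L2_add L2_cmult L w)
  let ?D = "\<lambda>h q. (u (t + h) q - u t q) / complex_of_real h"
  let ?E = "\<lambda>h q. (U (- h) (u t) q - u t q) / complex_of_real h"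
  show "((\<lambda>h. l2norm M (\<lambda>q. (U (- (t + h)) (u (t + h)) q - U (- t) (u t) q) / complex_of_real h
      - U (- t) (\<lambda>q. \<i> * w q + d q) q)) \<longlongrightarrow> 0) (at 0)"
  proof (rule Lim_null_comparison)
    have "l2norm M (\<lambda>q. (U (- (t + h)) (u (t + h)) q - U (- t) (u t) q) / complex_of_real h - U (- t) (\<lambda>q. \<i> * w q + d q) q)
      \<le> l2norm M (\<lambda>q. ?E h q - \<i> * w q) + (l2norm M (\<lambda>q. ?D h q - d q) + l2norm M (\<lambda>q. U (- h) d q - U 0 d q))" for h
    proof -
      let ?a = "\<lambda>q. (1 / complex_of_real h) * U (- h) (u (t + h)) q + (- 1 / complex_of_real h) * u t q"
      let ?b = "\<lambda>q. \<i> * w q + d q"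
      have a: "?a \<in> L2 M" by (intro L2_add L2_cmult U_L2 L)
      have b: "?b \<in> L2 M" by (intro L2_add L2_cmult L w)
      have "AE q in M. (U (- (t + h)) (u (t + h)) q - U (- t) (u t) q) / complex_of_real h - U (- t) ?b q = U (- t) ?a q - U (- t) ?b q"
        using U_lin[OF U_L2[OF L(1)] L(1), of "- t" "1 / complex_of_real h" "- h" "t + h" "- 1 / complex_of_real h" t] U_add[OF L(1), of "- t" "- h" "t + h"]
        by eventually_elim (simp add: diff_divide_distrib)
      then have "l2norm M (\<lambda>q. (U (- (t + h)) (u (t + h)) q - U (- t) (u t) q) / complex_of_real h - U (- t) ?b q)
         = l2norm M (\<lambda>q. U (- t) ?a q - U (- t) ?b q)" by (rule l2norm_cong_AE)
      also have "\<dots> = l2norm M (\<lambda>q. ?a q - ?b q)" by (rule U_diff_norm[OF a b])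
      also have "(\<lambda>q. ?a q - ?b q) = (\<lambda>q. (?E h q - \<i> * w q) + ((U (- h) (u (t + h)) q - U (- h) (u t) q) / complex_of_real h - d q))"
        by (simp add: fun_eq_iff diff_divide_distrib)
      also have "l2norm M \<dots> \<le> l2norm M (\<lambda>q. ?E h q - \<i> * w q) + l2norm M (\<lambda>q. (U (- h) (u (t + h)) q - U (- h) (u t) q) / complex_of_real h - d q)"
        by (intro l2norm_triangle L2_diff L2_divide L2_cmult U_L2 L w)
      also have "l2norm M (\<lambda>q. (U (- h) (u (t + h)) q - U (- h) (u t) q) / complex_of_real h - d q)
         = l2norm M (\<lambda>q. U (- h) (?D h) q - d q)"
      proof (rule l2norm_cong_AE)
        have "AE q in M. U (- h) (\<lambda>r. (1 / complex_of_real h) * u (t + h) r + (- 1 / complex_of_real h) * u t r) q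
          = (1 / complex_of_real h) * U (- h) (u (t + h)) q + (- 1 / complex_of_real h) * U (- h) (u t) q"
          by (rule U_lin[OF L(1) L(1)])
        moreover have "(\<lambda>r. (1 / complex_of_real h) * u (t + h) r + (- 1 / complex_of_real h) * u t r) = ?D h"
          by (simp add: fun_eq_iff diff_divide_distrib)
        ultimately show "AE q in M. (U (- h) (u (t + h)) q - U (- h) (u t) q) / complex_of_real h - d q = U (- h) (?D h) q - d q"
          by (auto simp: diff_divide_distrib elim!: eventually_mono)
      qed
      also have "l2norm M (\<lambda>q. U (- h) (?D h) q - d q) \<le> l2norm M (\<lambda>q. U (- h) (?D h) q - U (- h) d q) + l2norm M (\<lambda>q. U (- h) d q - d q)"
        by (intro l2norm_triangle_diff U_L2 L)
      also have "l2norm M (\<lambda>q. U (- h) (?D h) q - U (- h) d q) = l2norm M (\<lambda>q. ?D h q - d q)" by (intro U_diff_norm L)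
      also have "l2norm M (\<lambda>q. U (- h) d q - d q) = l2norm M (\<lambda>q. U (- h) d q - U 0 d q)"
        by (rule l2norm_cong_AE) (use U_0[OF L(2)] in \<open>auto elim: eventually_mono\<close>)
      finally show ?thesis by simp
    qed
    then show "\<forall>\<^sub>F h in at 0. norm (l2norm M (\<lambda>q. (U (- (t + h)) (u (t + h)) q - U (- t) (u t) q) / complex_of_real h - U (- t) (\<lambda>q. \<i> * w q + d q) q))
      \<le> l2norm M (\<lambda>q. ?E h q - \<i> * w q) + (l2norm M (\<lambda>q. ?D h q - d q) + l2norm M (\<lambda>q. U (- h) d q - U 0 d q))" by simp
    have m: "filterlim (\<lambda>h::real. - h) (at 0) (at 0)"
      by (auto simp: filterlim_at eventually_at_filter intro!: tendsto_eq_intros)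
    have "((\<lambda>h. l2norm M (\<lambda>q. (U (- h) (u t) q - u t q) / complex_of_real (- h) + \<i> * w q)) \<longlongrightarrow> 0) (at 0)"
      using g filterlim_compose[OF _ m] unfolding gen_def by blast
    moreover have "l2norm M (\<lambda>q. ?E h q - \<i> * w q) = l2norm M (\<lambda>q. (U (- h) (u t) q - u t q) / complex_of_real (- h) + \<i> * w q)" for h
      using l2norm_minus_commute[of M "?E h" "\<lambda>q. \<i> * w q"] by simp
    moreover have "((\<lambda>h. l2norm M (\<lambda>q. U (- h) d q - U 0 d q)) \<longlongrightarrow> 0) (at 0)"
      by (rule filterlim_compose[OF U_cont[OF L(2)] m])
    ultimately show "((\<lambda>h. l2norm M (\<lambda>q. ?E h q - \<i> * w q) + (l2norm M (\<lambda>q. ?D h q - d q) + l2norm M (\<lambda>q. U (- h) d q - U 0 d q))) \<longlongrightarrow> 0) (at 0)"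
      using u unfolding sder_def by (intro tendsto_add_zero) auto
  qed
qed

end

section \<open>Gaussian wave functions\<close>

text \<open>Completing the square gives a multiple of a normal density; the absolute value is
  absorbed by adding the integrands for both signs of k.\<close>

lemma integrable_exp_abs_square:
  assumes "0 < (b::real)"
  shows "integrable lborel (\<lambda>s::real. exp (k * \<bar>s\<bar> - b * s\<^sup>2))"
proof -
  have *: "integrable lborel (\<lambda>s::real. exp (a * s - b * s\<^sup>2))" for a :: real
  proof -
    define \<sigma> where "\<sigma> = sqrt (1 / (2 * b))"
    have \<sigma>: "0 < \<sigma>" "\<sigma>\<^sup>2 = 1 / (2 * b)" using assms by (auto simp: \<sigma>_def)
    have "exp (a * s - b * s\<^sup>2) = (exp (a\<^sup>2 / (4 * b)) * sqrt (2 * pi * \<sigma>\<^sup>2)) * normal_density (a / (2 * b)) \<sigma> s" for s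
    proof -
      have "- (s - a / (2 * b))\<^sup>2 / (2 * \<sigma>\<^sup>2) = a * s - b * s\<^sup>2 - a\<^sup>2 / (4 * b)"
        using assms unfolding \<sigma>(2) by (simp add: field_simps power2_eq_square)
      then show ?thesis using \<sigma> assms by (simp add: normal_density_def exp_diff)
    qed
    moreover have "integrable lborel (\<lambda>s. (exp (a\<^sup>2 / (4 * b)) * sqrt (2 * pi * \<sigma>\<^sup>2)) * normal_density (a / (2 * b)) \<sigma> s)"
      using \<sigma>(1) by (intro integrable_mult_right integrable_normal_density)
    ultimately show ?thesis by simp
  qed
  show ?thesis
  proof (rule Bochner_Integration.integrable_bound)
    show "integrable lborel (\<lambda>s::real. exp (k * s - b * s\<^sup>2) + exp ((- k) * s - b * s\<^sup>2))"
      by (intro Bochner_Integration.integrable_add *)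
    show "AE s in lborel. norm (exp (k * \<bar>s\<bar> - b * s\<^sup>2)) \<le> norm (exp (k * s - b * s\<^sup>2) + exp ((- k) * s - b * s\<^sup>2))"
    proof (rule AE_I2)
      fix s :: real
      have "exp (k * \<bar>s\<bar> - b * s\<^sup>2) \<le> exp (k * s - b * s\<^sup>2) + exp ((- k) * s - b * s\<^sup>2)"
        by (cases "s \<ge> 0") auto
      then show "norm (exp (k * \<bar>s\<bar> - b * s\<^sup>2)) \<le> norm (exp (k * s - b * s\<^sup>2) + exp ((- k) * s - b * s\<^sup>2))"
        by (simp only: real_norm_def abs_exp_cancel order_trans[OF _ abs_ge_self])
    qed
  qed simp
qed

text \<open>From exponent 2 on, the powers of the positive part have a zero of order above one at
  the kink, so the one-sided derivatives agree there.\<close>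

lemma max_power_derivative:
  fixes r :: real
  shows "((\<lambda>r. (max 0 r) ^ Suc (Suc k)) has_real_derivative real (Suc (Suc k)) * (max 0 r) ^ Suc k) (at r)"
proof -
  consider "r > 0" | "r < 0" | "r = 0" by linarith
  then show ?thesis
  proof cases
    case 1
    have "((\<lambda>r. r ^ Suc (Suc k)) has_real_derivative real (Suc (Suc k)) * r ^ Suc k) (at r)"
      by (rule DERIV_cong[OF DERIV_pow]) simp
    then have "((\<lambda>r. (max 0 r) ^ Suc (Suc k)) has_real_derivative real (Suc (Suc k)) * r ^ Suc k) (at r)"
      by (rule has_field_derivative_transform_within_open[where S = "{0<..}"]) (use 1 in auto)
    then show ?thesis using 1 by simp
  next
    case 2
    have "((\<lambda>r::real. 0) has_real_derivative 0) (at r)" by simp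
    then have "((\<lambda>r. (max 0 r) ^ Suc (Suc k)) has_real_derivative 0) (at r)"
      by (rule has_field_derivative_transform_within_open[where S = "{..<0}"]) (use 2 in auto)
    then show ?thesis using 2 by (simp add: max_def)
  next
    case 3
    have "((\<lambda>r::real. (max 0 r) ^ Suc (Suc k)) has_real_derivative 0) (at 0)"
    proof (rule CARAT_DERIV[THEN iffD2], intro exI conjI allI)
      show "(max 0 z) ^ Suc (Suc k) - (max 0 0) ^ Suc (Suc k) = (max 0 z) ^ Suc k * (z - 0)" for z :: real
        by (cases "z \<ge> 0") (auto simp: max_def)
      show "isCont (\<lambda>z::real. (max 0 z) ^ Suc k) 0" by (intro continuous_intros)
    qed simp
    then show ?thesis using 3 by simp
  qed
qed

lemma measurable_of_real_compose: "f \<in> borel_measurable M \<Longrightarrow> (\<lambda>x. complex_of_real (f x)) \<in> borel_measurable M"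
  by measurable

locale gaussian =
  fixes nu L :: nat and B :: "int list \<Rightarrow> int list \<Rightarrow> real" and \<beta> :: real
  assumes \<beta>: "0 < \<beta>"
    and B_sym: "\<And>x y. x \<in> Lam nu L \<Longrightarrow> y \<in> Lam nu L \<Longrightarrow> B x y = B y x"
    and B_pd: "\<And>q. \<beta> * (\<Sum>x\<in>Lam nu L. (q x)\<^sup>2) \<le> (\<Sum>x\<in>Lam nu L. \<Sum>y\<in>Lam nu L. B x y * q x * q y)"
begin

abbreviation "I \<equiv> Lam nu L"
abbreviation "M \<equiv> cfgM nu L"
abbreviation "N \<equiv> l2norm M"
abbreviation "W \<equiv> Weyl nu L"

definition Bv :: "(int list \<Rightarrow> real) \<Rightarrow> int list \<Rightarrow> real" where
  "Bv q x = (\<Sum>y\<in>I. B x y * q y)"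

text \<open>All Gaussians in use share the quadratic part \<open>B\<close>. Once \<open>B\<close>
  squares to the harmonic matrix, z = 0 gives the ground state, and phase-space displacement or
  harmonic evolution changes only \<open>z\<close> and \<open>c\<close>.\<close>

definition gs :: "(int list \<Rightarrow> complex) \<Rightarrow> complex \<Rightarrow> (int list \<Rightarrow> real) \<Rightarrow> complex" where
  "gs z c q = exp (c + (\<Sum>x\<in>I. z x * of_real (q x)) - of_real (\<Sum>x\<in>I. \<Sum>y\<in>I. B x y * q x * q y) / 2)"

text \<open>Majorant in product form, so that its square is integrable by one-dimensional integrals;
  \<open>\<beta> / 2\<close> is the decay that \<open>B_pd\<close> guarantees for
  \<open>gs\<close>.\<close>

definition dom :: "real \<Rightarrow> (int list \<Rightarrow> real) \<Rightarrow> real" where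
  "dom K q = (\<Prod>x\<in>I. exp (K * \<bar>q x\<bar> - \<beta> / 2 * (q x)\<^sup>2))"

definition pol :: "(int list \<Rightarrow> real) \<Rightarrow> real" where
  "pol q = 1 + (\<Sum>x\<in>I. \<bar>q x\<bar>)"

text \<open>Polynomial growth in \<open>q\<close>, uniformly in the parameter \<open>p \<in> P\<close>; against \<open>gs\<close> such a factor is dominated by \<open>dom\<close>.\<close>

definition pbd :: "'p set \<Rightarrow> ('p \<Rightarrow> (int list \<Rightarrow> real) \<Rightarrow> complex) \<Rightarrow> bool" where
  "pbd P f \<longleftrightarrow> (\<exists>C k. 0 \<le> C \<and> (\<forall>p\<in>P. \<forall>q. cmod (f p q) \<le> C * pol q ^ k))"

lemma dom_nonneg: "0 \<le> dom K q" by (simp add: dom_def prod_nonneg)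

lemma dom_sq_integrable: "integrable M (\<lambda>q. (C * dom K q)\<^sup>2)"
proof -
  interpret product_sigma_finite "\<lambda>_::int list. lborel :: real measure" ..
  have "integrable M (\<lambda>q. \<Prod>x\<in>I. exp ((2 * K) * \<bar>q x\<bar> - \<beta> * (q x)\<^sup>2))"
    unfolding cfgM_def by (rule product_integrable_prod) (auto intro!: integrable_exp_abs_square \<beta>)
  moreover have "(C * dom K q)\<^sup>2 = C\<^sup>2 * (\<Prod>x\<in>I. exp ((2 * K) * \<bar>q x\<bar> - \<beta> * (q x)\<^sup>2))" for q
    unfolding dom_def power_mult_distrib prod_power_distrib
    by (intro arg_cong2[where f="(*)"] refl prod.cong) (simp add: exp_double[symmetric] algebra_simps)
  ultimately show ?thesis by simp
qed

lemma pol_ge_1: "1 \<le> pol q" by (simp add: pol_def sum_nonneg)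

lemma coord_le_pol: "x \<in> I \<Longrightarrow> \<bar>q x\<bar> \<le> pol q"
  using member_le_sum[of x I "\<lambda>x. \<bar>q x\<bar>"] by (simp add: pol_def)

text \<open>By 1 + s <= exp s each polynomial factor is absorbed by raising the linear rate
  \<open>K\<close> by one.\<close>

lemma pol_dom_le: "pol q ^ k * dom K q \<le> dom (K + real k) q"
proof -
  have "pol q ^ k \<le> exp (\<Sum>x\<in>I. \<bar>q x\<bar>) ^ k"
    using exp_ge_add_one_self[of "\<Sum>x\<in>I. \<bar>q x\<bar>"] pol_ge_1[of q] by (intro power_mono) (auto simp: pol_def)
  also have "\<dots> = (\<Prod>x\<in>I. exp (real k * \<bar>q x\<bar>))"
    by (simp add: exp_sum prod_power_distrib exp_of_nat_mult)
  finally have "pol q ^ k * dom K q \<le> (\<Prod>x\<in>I. exp (real k * \<bar>q x\<bar>)) * dom K q"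
    by (intro mult_right_mono dom_nonneg)
  also have "\<dots> = dom (K + real k) q"
    unfolding dom_def prod.distrib[symmetric] exp_add[symmetric] by (intro prod.cong) (auto simp: algebra_simps)
  finally show ?thesis .
qed

lemma gs_bound:
  assumes "\<And>x. x \<in> I \<Longrightarrow> \<bar>Re (z x)\<bar> \<le> K"
  shows "cmod (gs z c q) \<le> exp (Re c) * dom K q"
proof -
  have "cmod (gs z c q) = exp (Re c + (\<Sum>x\<in>I. Re (z x) * q x) - (\<Sum>x\<in>I. \<Sum>y\<in>I. B x y * q x * q y) / 2)"
    by (simp add: gs_def)
  also have "\<dots> \<le> exp (Re c + (\<Sum>x\<in>I. K * \<bar>q x\<bar>) - \<beta> * (\<Sum>x\<in>I. (q x)\<^sup>2) / 2)"
  proof -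
    have "(\<Sum>x\<in>I. Re (z x) * q x) \<le> (\<Sum>x\<in>I. K * \<bar>q x\<bar>)"
    proof (rule sum_mono)
      fix x assume "x \<in> I"
      have "Re (z x) * q x \<le> \<bar>Re (z x)\<bar> * \<bar>q x\<bar>" by (metis abs_ge_self abs_mult)
      also have "\<dots> \<le> K * \<bar>q x\<bar>" by (intro mult_right_mono assms \<open>x \<in> I\<close>) simp
      finally show "Re (z x) * q x \<le> K * \<bar>q x\<bar>" .
    qed
    then show ?thesis using B_pd[of q] by simp
  qed
  also have "\<dots> = exp (Re c) * dom K q"
    by (simp add: dom_def exp_sum[symmetric] exp_add[symmetric] sum_subtractf sum_distrib_left sum_divide_distrib mult.commute)
  finally show ?thesis .
qed

lemma pbd_const: "bounded (g ` P) \<Longrightarrow> pbd P (\<lambda>p q. g p)"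
proof -
  assume "bounded (g ` P)"
  then obtain C where "\<And>p. p \<in> P \<Longrightarrow> cmod (g p) \<le> C" by (auto simp: bounded_iff)
  then show ?thesis unfolding pbd_def by (intro exI[of _ "max 0 C"] exI[of _ 0]) (auto simp: max.coboundedI2)
qed

lemma pbd_const' [intro]: "pbd P (\<lambda>p q. c)"
  by (rule pbd_const) (auto simp: bounded_iff)

lemma pbd_coord [intro]: "x \<in> I \<Longrightarrow> pbd P (\<lambda>p q. of_real (q x))"
  unfolding pbd_def by (intro exI[of _ 1]) (auto simp: coord_le_pol intro!: exI[of _ 1])

lemma pbd_bounded: "(\<And>p q. p \<in> P \<Longrightarrow> cmod (f p q) \<le> C) \<Longrightarrow> pbd P f"
  unfolding pbd_def by (intro exI[of _ "max 0 C"] exI[of _ 0]) (auto simp: max.coboundedI2)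

lemma pbd_add [intro]:
  assumes "pbd P f" "pbd P g" shows "pbd P (\<lambda>p q. f p q + g p q)"
proof -
  from assms obtain C k D l where C: "0 \<le> C" "\<And>p q. p \<in> P \<Longrightarrow> cmod (f p q) \<le> C * pol q ^ k"
    and D: "0 \<le> D" "\<And>p q. p \<in> P \<Longrightarrow> cmod (g p q) \<le> D * pol q ^ l" unfolding pbd_def by blast
  have "cmod (f p q + g p q) \<le> (C + D) * pol q ^ (k + l)" if "p \<in> P" for p q
  proof -
    have "cmod (f p q + g p q) \<le> C * pol q ^ k + D * pol q ^ l"
      using norm_triangle_ineq[of "f p q" "g p q"] C(2)[OF that, of q] D(2)[OF that, of q] by linarith
    also have "\<dots> \<le> C * pol q ^ (k + l) + D * pol q ^ (k + l)"
      by (intro add_mono mult_left_mono power_increasing pol_ge_1 C D) auto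
    finally show ?thesis by (simp add: distrib_right)
  qed
  then show ?thesis unfolding pbd_def using C D by (intro exI[of _ "C + D"] exI[of _ "k + l"]) auto
qed

lemma pbd_mult [intro]:
  assumes "pbd P f" "pbd P g" shows "pbd P (\<lambda>p q. f p q * g p q)"
proof -
  from assms obtain C k D l where C: "0 \<le> C" "\<And>p q. p \<in> P \<Longrightarrow> cmod (f p q) \<le> C * pol q ^ k"
    and D: "0 \<le> D" "\<And>p q. p \<in> P \<Longrightarrow> cmod (g p q) \<le> D * pol q ^ l" unfolding pbd_def by blast
  have "cmod (f p q * g p q) \<le> (C * D) * pol q ^ (k + l)" if "p \<in> P" for p q
  proof -
    have "cmod (f p q * g p q) \<le> (C * pol q ^ k) * (D * pol q ^ l)"
      unfolding norm_mult using C(1) pol_ge_1[of q] by (intro mult_mono C D that) auto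
    then show ?thesis by (simp add: power_add mult_ac)
  qed
  then show ?thesis unfolding pbd_def using C D by (intro exI[of _ "C * D"] exI[of _ "k + l"]) auto
qed

lemma pbd_uminus [intro]: "pbd P f \<Longrightarrow> pbd P (\<lambda>p q. - f p q)"
  by (simp add: pbd_def)

lemma pbd_diff [intro]: "pbd P f \<Longrightarrow> pbd P g \<Longrightarrow> pbd P (\<lambda>p q. f p q - g p q)"
  using pbd_add[OF _ pbd_uminus] by fastforce

lemma pbd_power: "pbd P f \<Longrightarrow> pbd P (\<lambda>p q. f p q ^ n)"
  by (induction n) auto

lemma pbd_sum [intro]: "(\<And>i. i \<in> J \<Longrightarrow> pbd P (f i)) \<Longrightarrow> pbd P (\<lambda>p q. \<Sum>i\<in>J. f i p q)"
  by (induction J rule: infinite_finite_induct) auto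

text \<open>One square-integrable majorant serves all parameters at once. It is used with the cutoff
  parameter as well as with time as \<open>p\<close>.\<close>

lemma pbd_gs_dom:
  assumes "pbd P f" "\<And>p x. p \<in> P \<Longrightarrow> x \<in> I \<Longrightarrow> \<bar>Re (z p x)\<bar> \<le> K" "\<And>p. p \<in> P \<Longrightarrow> Re (c p) \<le> K0"
  obtains C K' where "\<And>p q. p \<in> P \<Longrightarrow> cmod (f p q * gs (z p) (c p) q) \<le> C * dom K' q"
proof -
  from assms(1) obtain C k where C: "0 \<le> C" "\<And>p q. p \<in> P \<Longrightarrow> cmod (f p q) \<le> C * pol q ^ k"
    unfolding pbd_def by blast
  have "cmod (f p q * gs (z p) (c p) q) \<le> (C * exp K0) * dom (K + real k) q" if p: "p \<in> P" for p q
  proof -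
    have "cmod (f p q * gs (z p) (c p) q) \<le> (C * pol q ^ k) * (exp (Re (c p)) * dom K q)"
      unfolding norm_mult using C(1) pol_ge_1[of q] by (intro mult_mono C p gs_bound assms) auto
    also have "\<dots> \<le> (C * pol q ^ k) * (exp K0 * dom K q)"
      using C(1) pol_ge_1[of q] assms(3)[OF p] by (intro mult_left_mono mult_right_mono dom_nonneg mult_nonneg_nonneg) auto
    also have "\<dots> = (C * exp K0) * (pol q ^ k * dom K q)" by (simp add: mult_ac)
    also have "\<dots> \<le> (C * exp K0) * dom (K + real k) q" using C(1) by (intro mult_left_mono pol_dom_le) auto
    finally show ?thesis .
  qed
  then show thesis by (rule that)
qed

lemma gs_measurable: "gs z c \<in> borel_measurable M"
proof -
  have [measurable]: "(\<lambda>q. q x) \<in> borel_measurable M" if "x \<in> I" for x by (rule measurable_cfgM_component[OF that])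
  have "(\<lambda>q. \<Sum>x\<in>I. z x * complex_of_real (q x)) \<in> borel_measurable M"
    by (intro borel_measurable_sum borel_measurable_times) (auto intro!: measurable_of_real_compose measurable_cfgM_component)
  moreover have "(\<lambda>q. complex_of_real (\<Sum>x\<in>I. \<Sum>y\<in>I. B x y * q x * q y)) \<in> borel_measurable M"
    by (intro measurable_of_real_compose borel_measurable_sum borel_measurable_times) (auto intro!: measurable_cfgM_component)
  ultimately show ?thesis unfolding gs_def[abs_def] by measurable
qed

lemma pbd_gs_L2:
  assumes "pbd {()} (\<lambda>_. f)" "f \<in> borel_measurable M"
  shows "(\<lambda>q. f q * gs z c q) \<in> L2 M"
proof -
  obtain C K' where b: "\<And>p q. p \<in> {()} \<Longrightarrow> cmod (f q * gs z c q) \<le> C * dom K' q"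
  proof (rule pbd_gs_dom[OF assms(1), of "\<lambda>_. z" "Max (insert 0 ((\<lambda>x. \<bar>Re (z x)\<bar>) ` I))" "\<lambda>_. c" "Re c"])
    show "\<bar>Re (z x)\<bar> \<le> Max (insert 0 ((\<lambda>x. \<bar>Re (z x)\<bar>) ` I))" if "x \<in> I" for x
      using that by (intro Max_ge) auto
  qed auto
  show ?thesis
    by (rule L2I_bound[OF _ dom_sq_integrable[of C K']]) (use assms b gs_measurable in \<open>auto\<close>)
qed

lemma gs_L2: "gs z c \<in> L2 M"
  using pbd_gs_L2[of "\<lambda>_. 1" z c] by auto

lemma has_vector_derivative_upd:
  "((\<lambda>s. (q(x := s)) u) has_real_derivative (if u = x then 1 else 0)) (at s)"
  by (auto simp: fun_upd_def)

lemma Bv_upd_derivative: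
  assumes x: "x \<in> I"
  shows "((\<lambda>s. Bv (q(x := s)) u) has_real_derivative B u x) (at s)"
proof -
  have "((\<lambda>s. \<Sum>y\<in>I. B u y * (q(x := s)) y) has_real_derivative (\<Sum>y\<in>I. B u y * (if y = x then 1 else 0))) (at s)"
    by (intro DERIV_sum DERIV_cmult has_vector_derivative_upd)
  moreover have "(\<Sum>y\<in>I. B u y * (if y = x then 1 else 0)) = B u x"
    using x by (simp add: if_distrib[of "\<lambda>a. _ * a"] cong: if_cong)
  ultimately show ?thesis by (simp add: Bv_def)
qed

lemma quad_upd_derivative:
  assumes x: "x \<in> I"
  shows "((\<lambda>s. \<Sum>u\<in>I. \<Sum>v\<in>I. B u v * (q(x := s)) u * (q(x := s)) v) has_real_derivative 2 * Bv q x) (at (q x))"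
proof -
  have "((\<lambda>s. \<Sum>u\<in>I. (q(x := s)) u * Bv (q(x := s)) u) has_real_derivative
      (\<Sum>u\<in>I. (if u = x then 1 else 0) * Bv (q(x := q x)) u + B u x * (q(x := q x)) u)) (at (q x))"
    by (intro DERIV_sum DERIV_mult has_vector_derivative_upd Bv_upd_derivative x)
  moreover have "(\<Sum>u\<in>I. (if u = x then 1 else 0) * Bv (q(x := q x)) u + B u x * (q(x := q x)) u) = 2 * Bv q x"
  proof -
    have "(\<Sum>u\<in>I. B u x * q u) = Bv q x" unfolding Bv_def using B_sym[OF x] by (intro sum.cong) auto
    then show ?thesis using x by (simp add: sum.distrib if_distrib[of "\<lambda>a. a * _"] cong: if_cong)
  qed
  moreover have "(\<Sum>u\<in>I. (q(x := s)) u * Bv (q(x := s)) u) = (\<Sum>u\<in>I. \<Sum>v\<in>I. B u v * (q(x := s)) u * (q(x := s)) v)" for s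
    unfolding Bv_def sum_distrib_left by (intro sum.cong refl) (simp add: mult_ac)
  ultimately show ?thesis by simp
qed

lemma gs_derivative:
  assumes x: "x \<in> I"
  shows "((\<lambda>s. gs z c (q(x := s))) has_vector_derivative (z x - of_real (Bv q x)) * gs z c q) (at (q x))"
proof -
  have lin: "((\<lambda>s. \<Sum>u\<in>I. z u * of_real ((q(x := s)) u)) has_vector_derivative (\<Sum>u\<in>I. z u * of_real (if u = x then 1 else 0))) (at (q x))"
    by (intro has_vector_derivative_sum has_vector_derivative_mult_right has_vector_derivative_of_real has_vector_derivative_upd)
  have e: "(\<Sum>u\<in>I. z u * of_real (if u = x then 1 else 0)) = z x"
    using x by (simp add: if_distrib[of complex_of_real] if_distrib[of "\<lambda>a. _ * a"] cong: if_cong)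
  have "((\<lambda>s. c + (\<Sum>u\<in>I. z u * of_real ((q(x := s)) u)) - of_real (\<Sum>u\<in>I. \<Sum>v\<in>I. B u v * (q(x := s)) u * (q(x := s)) v) / 2)
     has_vector_derivative (0 + z x - of_real (2 * Bv q x) / 2)) (at (q x))"
    by (intro has_vector_derivative_diff has_vector_derivative_add has_vector_derivative_const lin[unfolded e]
        has_vector_derivative_divide has_vector_derivative_of_real quad_upd_derivative x)
  from field_vector_diff_chain_at[OF this DERIV_exp]
  show ?thesis by (simp add: o_def gs_def)
qed

text \<open>The cube of \<open>cut\<close> is the cheapest \<open>C\<^sup>2\<close> cutoff: it is compactly supported and tends to 1 as \<open>k\<close> tends to 0.\<close>

definition cut :: "real \<Rightarrow> (int list \<Rightarrow> real) \<Rightarrow> real" where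
  "cut k q = max 0 (1 - k * (\<Sum>x\<in>I. (q x)\<^sup>2))"

lemma cut_power_derivative:
  assumes x: "x \<in> I"
  shows "((\<lambda>s. cut k (q(x := s)) ^ Suc (Suc n)) has_real_derivative
     real (Suc (Suc n)) * cut k q ^ Suc n * (- 2 * k * q x)) (at (q x))"
proof -
  have "((\<lambda>s. 1 - k * (\<Sum>u\<in>I. ((q(x := s)) u)\<^sup>2)) has_real_derivative
      (0 - k * (\<Sum>u\<in>I. real 2 * ((if u = x then 1 else 0) * (q(x := q x)) u ^ (2 - Suc 0))))) (at (q x))"
    by (intro DERIV_diff DERIV_const DERIV_cmult DERIV_sum DERIV_power has_vector_derivative_upd)
  moreover have "(\<Sum>u\<in>I. real 2 * ((if u = x then 1 else 0) * (q(x := q x)) u ^ (2 - Suc 0))) = 2 * q x"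
    using x by (simp add: if_distrib[of "\<lambda>a. a * _"] if_distrib[of "\<lambda>a. _ * a"] cong: if_cong)
  ultimately have "((\<lambda>s. 1 - k * (\<Sum>u\<in>I. ((q(x := s)) u)\<^sup>2)) has_real_derivative (- 2 * k * q x)) (at (q x))"
    by (simp add: mult_ac)
  from DERIV_chain2[OF max_power_derivative this] show ?thesis by (simp add: cut_def)
qed

lemma cut_measurable: "cut k \<in> borel_measurable M"
  unfolding cut_def[abs_def]
  by (intro borel_measurable_max borel_measurable_const borel_measurable_diff borel_measurable_times borel_measurable_sum borel_measurable_power measurable_cfgM_component)

lemma cut_cube_measurable: "(\<lambda>q. complex_of_real (cut k q ^ 3)) \<in> borel_measurable M"
  by (intro measurable_of_real_compose borel_measurable_power cut_measurable)

lemma Bv_measurable: "(\<lambda>q. Bv q x) \<in> borel_measurable M"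
  unfolding Bv_def by (intro borel_measurable_sum borel_measurable_times borel_measurable_const measurable_cfgM_component)

lemma cut_bounds: "0 \<le> k \<Longrightarrow> 0 \<le> cut k q \<and> cut k q \<le> 1"
  by (auto simp: cut_def intro!: mult_nonneg_nonneg sum_nonneg)

section \<open>Cut-off Gaussians and their membership in the core\<close>

definition cgs :: "real \<Rightarrow> (int list \<Rightarrow> complex) \<Rightarrow> complex \<Rightarrow> (int list \<Rightarrow> real) \<Rightarrow> complex" where
  "cgs k z c q = of_real (cut k q ^ 3) * gs z c q"

text \<open>The first derivative of \<open>cgs\<close> in the coordinate x; the terms with -6 k come
  from differentiating the cube of \<open>cut\<close>.\<close>

definition cgs1 where
  "cgs1 x k z c q = (of_real (- 6 * k * (q x * cut k q ^ 2)) + of_real (cut k q ^ 3) * (z x - of_real (Bv q x))) * gs z c q"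

text \<open>The factor multiplying \<open>gs\<close> in the second derivative of \<open>cgs\<close>.
  Keeping the Gaussian apart leaves an expression of polynomial growth, uniformly for cutoffs in
  [0, 1].\<close>

definition cgs2f where
  "cgs2f x k z q = of_real (- 6 * k * (cut k q ^ 2 + q x * (2 * cut k q * (- 2 * k * q x))))
      + 2 * of_real (- 6 * k * (q x * cut k q ^ 2)) * (z x - of_real (Bv q x))
      + of_real (cut k q ^ 3) * ((z x - of_real (Bv q x))\<^sup>2 - of_real (B x x))"

lemma cgs_derivative:
  assumes x: "x \<in> I"
  shows "((\<lambda>s. cgs k z c (q(x := s))) has_vector_derivative cgs1 x k z c q) (at (q x))"
proof -
  have "((\<lambda>s. cgs k z c (q(x := s))) has_vector_derivative
    of_real (cut k (q(x := q x)) ^ 3) * ((z x - of_real (Bv q x)) * gs z c q) + of_real (real 3 * cut k q ^ 2 * (- 2 * k * q x)) * gs z c (q(x := q x))) (at (q x))"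
    unfolding cgs_def
    by (intro has_vector_derivative_mult gs_derivative x has_vector_derivative_of_real)
       (use cut_power_derivative[OF x, of k q 1] in \<open>simp add: eval_nat_numeral\<close>)
  then show ?thesis by (simp add: cgs1_def algebra_simps)
qed

lemma cgs1_derivative:
  assumes x: "x \<in> I"
  shows "((\<lambda>s. cgs1 x k z c (q(x := s))) has_vector_derivative cgs2f x k z q * gs z c q) (at (q x))"
proof -
  have c2: "((\<lambda>s. cut k (q(x := s)) ^ 2) has_real_derivative 2 * cut k q * (- 2 * k * q x)) (at (q x))"
    using cut_power_derivative[OF x, of k q 0] by (simp add: eval_nat_numeral)
  have c3: "((\<lambda>s. cut k (q(x := s)) ^ 3) has_real_derivative 3 * cut k q ^ 2 * (- 2 * k * q x)) (at (q x))"
    using cut_power_derivative[OF x, of k q 1] by (simp add: eval_nat_numeral)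
  have a: "((\<lambda>s. - 6 * k * ((q(x := s)) x * cut k (q(x := s)) ^ 2)) has_real_derivative
      - 6 * k * (1 * cut k q ^ 2 + (2 * cut k q * (- 2 * k * q x)) * q x)) (at (q x))"
    using has_vector_derivative_upd[of q x x "q x"] c2 DERIV_mult[OF has_vector_derivative_upd[of q x x "q x"] c2]
    by (intro DERIV_cmult) simp
  have l: "((\<lambda>s. z x - of_real (Bv (q(x := s)) x)) has_vector_derivative (0 - of_real (B x x))) (at (q x))"
    by (intro has_vector_derivative_diff has_vector_derivative_const has_vector_derivative_of_real Bv_upd_derivative x)
  have "((\<lambda>s. cgs1 x k z c (q(x := s))) has_vector_derivative
     (of_real (- 6 * k * ((q(x := q x)) x * cut k (q(x := q x)) ^ 2)) + of_real (cut k (q(x := q x)) ^ 3) * (z x - of_real (Bv (q(x := q x)) x))) * ((z x - of_real (Bv q x)) * gs z c q)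
     + (of_real (- 6 * k * (1 * cut k q ^ 2 + (2 * cut k q * (- 2 * k * q x)) * q x))
        + (of_real (cut k (q(x := q x)) ^ 3) * (0 - of_real (B x x)) + of_real (3 * cut k q ^ 2 * (- 2 * k * q x)) * (z x - of_real (Bv (q(x := q x)) x)))) * gs z c (q(x := q x))) (at (q x))"
    unfolding cgs1_def
    by (intro has_vector_derivative_mult has_vector_derivative_add gs_derivative x has_vector_derivative_of_real a l c3)
  then show ?thesis by (simp add: cgs2f_def algebra_simps power2_eq_square)
qed

lemma dxx_cgs:
  assumes x: "x \<in> I" shows "dxx x (cgs k z c) q = cgs2f x k z q * gs z c q"
proof -
  have "vector_derivative (\<lambda>r. cgs k z c (q(x := r))) (at s) = cgs1 x k z c (q(x := s))" for s
    using cgs_derivative[OF x, of k z c "q(x := s)"] by (intro vector_derivative_at) simp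
  then show ?thesis unfolding dxx_def
    by (simp only:) (rule vector_derivative_at[OF cgs1_derivative[OF x]])
qed

lemma continuous_coord: "continuous_on S (\<lambda>q::int list \<Rightarrow> real. q x)"
  by (rule continuous_on_subset[OF continuous_on_product_coordinates]) simp

lemma cgs_core:
  assumes k: "0 < k" shows "cgs k z c \<in> core nu L"
  unfolding core_def
proof (intro CollectI conjI ballI)
  show "cgs k z c \<in> borel_measurable M" unfolding cgs_def[abs_def]
    by (intro borel_measurable_times measurable_of_real_compose borel_measurable_power cut_measurable gs_measurable)
  have cc: "continuous_on S (cut k)" for S unfolding cut_def[abs_def]
    by (intro continuous_intros continuous_coord)
  have bc: "continuous_on S (\<lambda>q. Bv q x)" for S x unfolding Bv_def
    by (intro continuous_intros continuous_coord)
  have gc: "continuous_on S (gs z c)" for S unfolding gs_def[abs_def]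
    by (intro continuous_intros continuous_coord) auto
  show "continuous_on (PiE I (\<lambda>_. UNIV)) (cgs k z c)" unfolding cgs_def[abs_def]
    by (intro continuous_intros cc gc)
  show "\<exists>R. \<forall>q\<in>PiE I (\<lambda>_. UNIV). (\<exists>x\<in>I. \<bar>q x\<bar> > R) \<longrightarrow> cgs k z c q = 0"
  proof (intro exI ballI impI)
    \<comment> \<open>The support radius is 1 / sqrt k: beyond it a single coordinate already makes
      k |q|^2 at least 1, where \<open>cut\<close> vanishes.\<close>
    fix q :: "int list \<Rightarrow> real" assume "\<exists>x\<in>I. \<bar>q x\<bar> > 1 / sqrt k"
    then obtain x where x: "x \<in> I" "\<bar>q x\<bar> > 1 / sqrt k" by blast
    have "1 / k = (1 / sqrt k)\<^sup>2" using k by (simp add: power_divide)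
    also have "\<dots> \<le> \<bar>q x\<bar>\<^sup>2" using x k by (intro power_mono) auto
    also have "\<dots> = (q x)\<^sup>2" by simp
    also have "\<dots> \<le> (\<Sum>x\<in>I. (q x)\<^sup>2)" using x by (intro member_le_sum) auto
    finally have "1 \<le> k * (\<Sum>x\<in>I. (q x)\<^sup>2)" using k by (simp add: field_simps)
    then show "cgs k z c q = 0" by (simp add: cgs_def cut_def)
  qed
  fix x assume x: "x \<in> I"
  show "\<exists>d1 d2. continuous_on (PiE I (\<lambda>_. UNIV)) d1 \<and> continuous_on (PiE I (\<lambda>_. UNIV)) d2 \<and>
     (\<forall>q\<in>PiE I (\<lambda>_. UNIV). ((\<lambda>s. cgs k z c (q(x := s))) has_vector_derivative d1 q) (at (q x)) \<and>
        ((\<lambda>s. d1 (q(x := s))) has_vector_derivative d2 q) (at (q x)))"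
  proof (intro exI conjI ballI)
    show "continuous_on (PiE I (\<lambda>_. UNIV)) (cgs1 x k z c)" unfolding cgs1_def[abs_def]
      by (intro continuous_intros cc gc bc continuous_coord)
    show "continuous_on (PiE I (\<lambda>_. UNIV)) (\<lambda>q. cgs2f x k z q * gs z c q)" unfolding cgs2f_def[abs_def]
      by (intro continuous_intros cc gc bc continuous_coord)
  qed (use cgs_derivative[OF x] cgs1_derivative[OF x] in auto)
qed

end

section \<open>Coherent states\<close>

lemma nbr_Lam:
  assumes "1 \<le> L" "x \<in> Lam nu L" "j < nu"
  shows "nbr L x j \<in> Lam nu L"
proof -
  have x: "length x = nu" "\<And>i. i < nu \<Longrightarrow> - int L < x ! i \<and> x ! i \<le> int L" using assms by (auto simp: Lam_def)
  have r: "- int L < (if x ! j + 1 \<in> {- int L<..int L} then x ! j + 1 else x ! j - (2 * int L - 1))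
      \<and> (if x ! j + 1 \<in> {- int L<..int L} then x ! j + 1 else x ! j - (2 * int L - 1)) \<le> int L"
    using x(2)[OF assms(3)] assms(1) by auto
  have "nbr L x j = x[j := if x ! j + 1 \<in> {- int L<..int L} then x ! j + 1 else x ! j - (2 * int L - 1)]"
    by (simp add: nbr_def)
  then have "- int L < nbr L x j ! i \<and> nbr L x j ! i \<le> int L" if "i < nu" for i
    using r x(2)[OF that] x(1) assms(3) by (cases "i = j") simp_all
  then show ?thesis using x(1) by (auto simp: Lam_def nbr_def)
qed

text \<open>\<open>potential\<close> says that \<open>B\<close> is a square root of the harmonic
  matrix, and \<open>V_bound\<close>, a consequence of integrability of V', makes the perturbation a
  bounded operator. The group enters through its axioms and its derivative on the core.\<close>

locale anharmonic = gaussian nu L B \<beta> + unitary_group "cfgM nu L" U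
  for nu L :: nat and B :: "int list \<Rightarrow> int list \<Rightarrow> real" and \<beta> :: real
    and U :: "real \<Rightarrow> ((int list \<Rightarrow> real) \<Rightarrow> complex) \<Rightarrow> (int list \<Rightarrow> real) \<Rightarrow> complex" +
  fixes \<omega> :: real and lam :: "nat \<Rightarrow> real" and V :: "real \<Rightarrow> real" and Vb :: real
  assumes L1: "1 \<le> L"
    and core_gen: "\<And>\<psi>. \<psi> \<in> core nu L \<Longrightarrow>
        ((\<lambda>h. l2norm (cfgM nu L) (\<lambda>q. (U h \<psi> q - \<psi> q) / complex_of_real h + \<i> * Ham nu \<omega> lam V L \<psi> q)) \<longlongrightarrow> 0) (at 0)"
    and V_measurable: "V \<in> borel_measurable borel"
    and V_bound: "\<And>s. \<bar>V s\<bar> \<le> Vb"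
    and potential: "\<And>q. (\<Sum>x\<in>Lam nu L. \<omega>\<^sup>2 * (q x)\<^sup>2 + (\<Sum>j<nu. lam j * (q x - q (nbr L x j))\<^sup>2))
        = (\<Sum>x\<in>Lam nu L. (\<Sum>y\<in>Lam nu L. B x y * q y)\<^sup>2)"
begin

section \<open>The Hamiltonian on Gaussians\<close>

definition pot :: "int list \<Rightarrow> (int list \<Rightarrow> real) \<Rightarrow> real" where
  "pot x q = \<omega>\<^sup>2 * (q x)\<^sup>2 + (\<Sum>j<nu. lam j * (q x - q (nbr L x j))\<^sup>2)"

definition Vs :: "(int list \<Rightarrow> real) \<Rightarrow> real" where "Vs q = (\<Sum>x\<in>I. V (q x))"

definition trB :: real where "trB = (\<Sum>x\<in>I. B x x)"

text \<open>The harmonic Hamiltonian applied to \<open>gs z c\<close>, divided by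
  \<open>gs z c\<close>; it is affine in q.\<close>

definition HH :: "(int list \<Rightarrow> complex) \<Rightarrow> (int list \<Rightarrow> real) \<Rightarrow> complex" where
  "HH z q = of_real trB - (\<Sum>x\<in>I. (z x)\<^sup>2) + 2 * (\<Sum>x\<in>I. z x * of_real (Bv q x))"

definition HC :: "real \<Rightarrow> (int list \<Rightarrow> complex) \<Rightarrow> (int list \<Rightarrow> real) \<Rightarrow> complex" where
  "HC k z q = (\<Sum>x\<in>I. - cgs2f x k z q + of_real (pot x q + V (q x)) * of_real (cut k q ^ 3))"

lemma Ham_cgs: "Ham nu \<omega> lam V L (cgs k z c) q = HC k z q * gs z c q"
  unfolding Ham_def HC_def sum_distrib_right
  by (intro sum.cong refl) (simp add: dxx_cgs cgs_def pot_def algebra_simps)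

text \<open>This is where \<open>potential\<close> enters: the sum of (B q)_x^2 produced by the
  second derivatives cancels the harmonic potential, so no quadratic term survives.\<close>

lemma HC_0: "HC 0 z q = HH z q + of_real (Vs q)"
proof -
  have c: "cut 0 q = 1" by (simp add: cut_def)
  have "HC 0 z q = (\<Sum>x\<in>I. - ((z x)\<^sup>2 - 2 * (z x * of_real (Bv q x)) + (of_real (Bv q x))\<^sup>2 - of_real (B x x)) + of_real (pot x q) + of_real (V (q x)))"
    unfolding HC_def by (intro sum.cong refl) (simp add: c cgs2f_def power2_diff algebra_simps)
  also have "\<dots> = HH z q + of_real (Vs q) + (of_real (\<Sum>x\<in>I. pot x q) - of_real (\<Sum>x\<in>I. (Bv q x)\<^sup>2))"
    unfolding HH_def Vs_def trB_def by (simp add: sum.distrib sum_subtractf sum_distrib_left)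
  also have "(\<Sum>x\<in>I. pot x q) = (\<Sum>x\<in>I. (Bv q x)\<^sup>2)"
    using potential[of q] by (simp add: pot_def Bv_def)
  finally show ?thesis by simp
qed

lemma Vs_bound: "\<bar>Vs q\<bar> \<le> real (card I) * Vb"
proof -
  have "\<bar>Vs q\<bar> \<le> (\<Sum>x\<in>I. \<bar>V (q x)\<bar>)" unfolding Vs_def by (rule sum_abs)
  also have "\<dots> \<le> (\<Sum>x\<in>I. Vb)" by (intro sum_mono V_bound)
  finally show ?thesis by simp
qed

lemma Vs_measurable: "Vs \<in> borel_measurable M"
  unfolding Vs_def[abs_def]
  by (intro borel_measurable_sum measurable_compose[OF measurable_cfgM_component V_measurable])

lemma pbd_Bv: "pbd P (\<lambda>p q. of_real (Bv q x))"
proof -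
  have "pbd P (\<lambda>p q. \<Sum>y\<in>I. of_real (B x y) * of_real (q y))" by (intro pbd_sum pbd_mult pbd_const' pbd_coord)
  then show ?thesis by (simp add: Bv_def)
qed

lemma pbd_pot: assumes "x \<in> I" shows "pbd P (\<lambda>p q. of_real (pot x q))"
proof -
  have "pbd P (\<lambda>p q. of_real (\<omega>\<^sup>2) * (of_real (q x))\<^sup>2 + (\<Sum>j<nu. of_real (lam j) * (of_real (q x) - of_real (q (nbr L x j)))\<^sup>2))"
    by (intro pbd_sum pbd_add pbd_mult pbd_const' pbd_power pbd_diff pbd_coord assms nbr_Lam[OF L1]) auto
  then show ?thesis by (simp add: pot_def)
qed

lemma pbd_cut: "pbd {0..1} (\<lambda>k q. of_real (cut k q ^ n))"
  by (rule pbd_bounded[of _ _ 1]) (use cut_bounds in \<open>auto intro!: power_le_one simp: norm_power\<close>)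

lemma pbd_id: "pbd {0..1} (\<lambda>k q. of_real k)"
  by (rule pbd_bounded[of _ _ 1]) auto

lemma pbd_HC: "pbd {0..1} (\<lambda>k q. HC k z q)"
proof -
  have cut1: "pbd {0..1} (\<lambda>k q. of_real (cut k q))" using pbd_cut[of 1] by simp
  have cut: "pbd {0..1} (\<lambda>k q. of_real (cut k q) ^ n)" for n using pbd_cut[of n] by simp
  have V: "pbd {0..1} (\<lambda>k q. complex_of_real (V (q x)))" for x
    by (rule pbd_bounded[of _ _ Vb]) (simp add: V_bound)
  show ?thesis unfolding HC_def cgs2f_def of_real_mult of_real_add of_real_power of_real_minus of_real_numeral
    by (intro pbd_sum pbd_add pbd_mult pbd_uminus pbd_diff pbd_const' pbd_power pbd_coord pbd_pot V pbd_Bv cut1 cut pbd_id)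
qed

lemma pot_measurable: assumes "x \<in> I" shows "pot x \<in> borel_measurable M"
  unfolding pot_def[abs_def]
  by (intro borel_measurable_add borel_measurable_sum borel_measurable_times borel_measurable_power borel_measurable_diff
      borel_measurable_const measurable_cfgM_component assms nbr_Lam[OF L1]) auto

lemma HC_measurable: "HC k z \<in> borel_measurable M"
proof -
  show ?thesis unfolding HC_def[abs_def] cgs2f_def
    by (intro borel_measurable_sum borel_measurable_add borel_measurable_times borel_measurable_uminus borel_measurable_diff
        borel_measurable_const borel_measurable_power measurable_of_real_compose cut_measurable Bv_measurable pot_measurable measurable_cfgM_component
        measurable_compose[OF measurable_cfgM_component V_measurable])
qed

lemma HC_tendsto: "(\<lambda>n. HC (1 / real (Suc n)) z q) \<longlonglongrightarrow> HC 0 z q"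
proof -
  have k: "(\<lambda>n. 1 / real (Suc n)) \<longlonglongrightarrow> 0" by (rule LIMSEQ_Suc[OF lim_1_over_n])
  have c: "(\<lambda>n. cut (1 / real (Suc n)) q) \<longlonglongrightarrow> cut 0 q" unfolding cut_def by (intro tendsto_intros k)
  show ?thesis unfolding HC_def cgs2f_def by (intro tendsto_intros k c)
qed

lemma gen_cgs: "0 < k \<Longrightarrow> k \<le> 1 \<Longrightarrow> gen (cgs k z c) (\<lambda>q. HC k z q * gs z c q)"
proof -
  assume k: "0 < k" "k \<le> 1"
  have 1: "pbd {()} (\<lambda>_. HC k z)" "pbd {()} (\<lambda>_ q. of_real (cut k q ^ 3))"
    using pbd_HC[of z] pbd_cut[of 3] k unfolding pbd_def by fastforce+
  show ?thesis unfolding gen_def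
  proof (intro conjI)
    show "cgs k z c \<in> L2 M" unfolding cgs_def[abs_def] by (rule pbd_gs_L2[OF 1(2) cut_cube_measurable])
    show "(\<lambda>q. HC k z q * gs z c q) \<in> L2 M" by (rule pbd_gs_L2[OF 1(1) HC_measurable])
    show "((\<lambda>h. N (\<lambda>q. (U h (cgs k z c) q - cgs k z c q) / complex_of_real h + \<i> * (HC k z q * gs z c q))) \<longlongrightarrow> 0) (at 0)"
      using core_gen[OF cgs_core[OF k(1)], of z c] by (simp only: Ham_cgs)
  qed
qed

text \<open>Gaussians are not compactly supported, hence not in the core. The cutoff is removed
  along k = 1/(n+1); a majorant uniform in k makes the functions and their images under H converge,
  and closedness of the generator concludes.\<close>

lemma gen_gs: "gen (gs z c) (\<lambda>q. (HH z q + of_real (Vs q)) * gs z c q)"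
proof -
  let ?k = "\<lambda>n. 1 / real (Suc n)" and ?K = "Max (insert 0 ((\<lambda>x. \<bar>Re (z x)\<bar>) ` I))"
  have K: "\<bar>Re (z x)\<bar> \<le> ?K" if "x \<in> I" for x using that by (intro Max_ge) auto
  have k: "0 < ?k n" "?k n \<le> 1" "?k n \<in> {0..1}" for n by auto
  obtain C K' where b: "\<And>k q. k \<in> {0..1} \<Longrightarrow> cmod (HC k z q * gs z c q) \<le> C * dom K' q"
    by (rule pbd_gs_dom[OF pbd_HC[of z], of "\<lambda>_. z" ?K "\<lambda>_. c" "Re c"]) (use K in auto)
  obtain D K'' where d: "\<And>k q. k \<in> {0..1} \<Longrightarrow> cmod (of_real (cut k q ^ 3) * gs z c q) \<le> D * dom K'' q"
    by (rule pbd_gs_dom[OF pbd_cut[of 3], of "\<lambda>_. z" ?K "\<lambda>_. c" "Re c"]) (use K in auto)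
  have "(\<lambda>n. 1 / real (Suc n)) \<longlonglongrightarrow> 0" by (rule LIMSEQ_Suc[OF lim_1_over_n])
  then have "(\<lambda>n. cut (?k n) q) \<longlonglongrightarrow> cut 0 q" for q unfolding cut_def by (intro tendsto_intros)
  then have cut: "(\<lambda>n. cut (?k n) q) \<longlonglongrightarrow> 1" for q by (simp add: cut_def)
  have "gen (gs z c) (\<lambda>q. HC 0 z q * gs z c q)"
  proof (rule gen_closed[OF gen_cgs[OF k(1,2)]])
    show "gs z c \<in> L2 M" by (rule gs_L2)
    have l1: "AE q in M. (\<lambda>n. HC (?k n) z q * gs z c q) \<longlonglongrightarrow> HC 0 z q * gs z c q"
      by (intro AE_I2 tendsto_mult tendsto_const HC_tendsto)
    have m: "(\<lambda>q. HC k z q * gs z c q) \<in> borel_measurable M" for k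
      by (intro borel_measurable_times HC_measurable gs_measurable)
    have bd: "AE q in M. cmod (HC (?k n) z q * gs z c q) \<le> C * dom K' q" for n
      by (intro AE_I2 b k(3))
    show "(\<lambda>q. HC 0 z q * gs z c q) \<in> L2 M"
      by (rule l2_dominated_convergence(1)[OF m m dom_sq_integrable[of C K'] l1 bd])
    show "(\<lambda>n. N (\<lambda>q. HC (?k n) z q * gs z c q - HC 0 z q * gs z c q)) \<longlonglongrightarrow> 0"
      by (rule l2_dominated_convergence(2)[OF m m dom_sq_integrable[of C K'] l1 bd])
    have l2: "AE q in M. (\<lambda>n. cgs (?k n) z c q) \<longlonglongrightarrow> gs z c q"
    proof (rule AE_I2)
      fix q
      have "(\<lambda>n. of_real (cut (?k n) q ^ 3) * gs z c q) \<longlonglongrightarrow> of_real (1 ^ 3) * gs z c q"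
        by (intro tendsto_intros cut)
      then show "(\<lambda>n. cgs (?k n) z c q) \<longlonglongrightarrow> gs z c q" by (simp add: cgs_def)
    qed
    show "(\<lambda>n. N (\<lambda>q. cgs (?k n) z c q - gs z c q)) \<longlonglongrightarrow> 0"
      by (rule l2_dominated_convergence(2)[OF _ gs_measurable dom_sq_integrable[of D K''] l2])
         (use d k(3) in \<open>auto simp: cgs_def[abs_def] intro!: borel_measurable_times cut_cube_measurable[simplified] gs_measurable\<close>)
  qed
  then show ?thesis by (simp only: HC_0)
qed

text \<open>Hamilton's equations run backwards in time, for the labels of the Weyl operators, with \<open>Bv (Bv _)\<close> the harmonic matrix.\<close>

definition sol :: "(real \<Rightarrow> int list \<Rightarrow> complex) \<Rightarrow> bool" where
  "sol g \<longleftrightarrow> (\<forall>t. \<forall>x\<in>I. ((\<lambda>t. Re (g t x)) has_real_derivative 2 * Bv (Bv (\<lambda>y. Im (g t y))) x) (at t) \<and>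
      ((\<lambda>t. Im (g t x)) has_real_derivative - 2 * Re (g t x)) (at t))"

text \<open>With \<open>cc\<close>, the Gaussian parameters of \<open>W g \<Omega>\<close>: the
  imaginary part of the linear coefficient displaces momentum, the real part displaces position,
  seen through \<open>B\<close>.\<close>

definition zc :: "(int list \<Rightarrow> complex) \<Rightarrow> int list \<Rightarrow> complex" where
  "zc g x = \<i> * of_real (Re (g x)) - of_real (Bv (\<lambda>y. Im (g y)) x)"

definition cc :: "(int list \<Rightarrow> complex) \<Rightarrow> complex" where
  "cc g = \<i> * of_real (\<Sum>x\<in>I. Re (g x) * Im (g x)) / 2 - of_real (\<Sum>x\<in>I. Im (g x) * Bv (\<lambda>y. Im (g y)) x) / 2"

text \<open>The harmonic ground state, left unnormalised because only the linear span of its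
  displacements matters.\<close>

definition \<Omega> :: "(int list \<Rightarrow> real) \<Rightarrow> complex" where "\<Omega> = gs (\<lambda>_. 0) 0"

lemma Bv_swap: "(\<Sum>x\<in>I. p x * Bv q x) = (\<Sum>x\<in>I. q x * Bv p x)"
proof -
  have "(\<Sum>x\<in>I. p x * Bv q x) = (\<Sum>x\<in>I. \<Sum>y\<in>I. q y * (B y x * p x))"
    unfolding Bv_def sum_distrib_left by (intro sum.cong refl) (simp add: B_sym)
  also have "\<dots> = (\<Sum>y\<in>I. q y * Bv p y)" by (subst sum.swap) (simp add: Bv_def sum_distrib_left)
  finally show ?thesis .
qed

text \<open>Translating the quadratic form by Im g yields itself, a linear term and a constant;
  symmetry of \<open>B\<close> merges the two cross terms.\<close>

lemma Weyl_\<Omega>: "W g \<Omega> = gs (zc g) (cc g)"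
proof
  fix q
  let ?b = "\<lambda>y. Im (g y)"
  have q1: "(\<Sum>x\<in>I. \<Sum>y\<in>I. B x y * (q x + ?b x) * (q y + ?b y))
      = (\<Sum>x\<in>I. \<Sum>y\<in>I. B x y * q x * q y) + 2 * (\<Sum>x\<in>I. q x * Bv ?b x) + (\<Sum>x\<in>I. ?b x * Bv ?b x)"
  proof -
    have "(\<Sum>x\<in>I. \<Sum>y\<in>I. B x y * (q x + ?b x) * (q y + ?b y))
      = (\<Sum>x\<in>I. \<Sum>y\<in>I. B x y * q x * q y + q x * (B x y * ?b y) + ?b x * (B x y * q y) + ?b x * (B x y * ?b y))"
      by (intro sum.cong refl) (simp add: algebra_simps)
    also have "\<dots> = (\<Sum>x\<in>I. \<Sum>y\<in>I. B x y * q x * q y) + (\<Sum>x\<in>I. q x * Bv ?b x) + (\<Sum>x\<in>I. ?b x * Bv q x) + (\<Sum>x\<in>I. ?b x * Bv ?b x)"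
      by (simp only: sum.distrib sum_distrib_left[symmetric] Bv_def)
    finally show ?thesis using Bv_swap[of ?b q] by simp
  qed
  have "\<Omega> (shift_by I ?b q) = exp (- of_real (\<Sum>x\<in>I. \<Sum>y\<in>I. B x y * (q x + ?b x) * (q y + ?b y)) / 2)"
    unfolding \<Omega>_def gs_def by (simp cong: sum.cong)
  then have "W g \<Omega> q = exp (\<i> * of_real (phase nu L g q) - of_real (\<Sum>x\<in>I. \<Sum>y\<in>I. B x y * (q x + ?b x) * (q y + ?b y)) / 2)"
    by (simp add: Weyl_eq exp_add[symmetric])
  also have "\<i> * of_real (phase nu L g q) - of_real (\<Sum>x\<in>I. \<Sum>y\<in>I. B x y * (q x + ?b x) * (q y + ?b y)) / 2
      = cc g + (\<Sum>x\<in>I. zc g x * of_real (q x)) - of_real (\<Sum>x\<in>I. \<Sum>y\<in>I. B x y * q x * q y) / 2"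
    unfolding q1 by (simp add: complex_eq_iff cc_def zc_def phase_def sum.distrib sum_subtractf sum_divide_distrib[symmetric] sum_negf algebra_simps)
  finally show "W g \<Omega> q = gs (zc g) (cc g) q" by (simp add: gs_def)
qed

text \<open>\<open>trB\<close> is the ground-state energy, one eigenvalue of \<open>B\<close> per
  normal mode. With this phase a coherent state whose label follows \<open>sol\<close> solves the
  harmonic Schroedinger equation exactly.\<close>

definition coh :: "(real \<Rightarrow> int list \<Rightarrow> complex) \<Rightarrow> real \<Rightarrow> (int list \<Rightarrow> real) \<Rightarrow> complex" where
  "coh g t q = exp (- \<i> * of_real (trB * t)) * W (g t) \<Omega> q"

lemma coh_gs: "coh g t = gs (zc (g t)) (cc (g t) - \<i> * of_real (trB * t))"
  by (simp add: coh_def Weyl_\<Omega> gs_def fun_eq_iff exp_add[symmetric] algebra_simps)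

lemma coh_L2: "coh g t \<in> L2 M"
  unfolding coh_gs by (rule gs_L2)

lemma zc_derivative:
  assumes "sol g" "x \<in> I"
  shows "((\<lambda>t. zc (g t) x) has_vector_derivative
     2 * of_real (Bv (\<lambda>y. Re (g t y)) x) + 2 * \<i> * of_real (Bv (Bv (\<lambda>y. Im (g t y))) x)) (at t)"
proof -
  have "((\<lambda>t. \<Sum>y\<in>I. B x y * Im (g t y)) has_real_derivative (\<Sum>y\<in>I. B x y * (- 2 * Re (g t y)))) (at t)"
    using assms by (intro DERIV_sum DERIV_cmult) (auto simp: sol_def)
  moreover have "(\<Sum>y\<in>I. B x y * (- 2 * Re (g t y))) = - 2 * Bv (\<lambda>y. Re (g t y)) x"
    by (simp add: Bv_def sum_distrib_left mult_ac)
  ultimately have "((\<lambda>t. Bv (\<lambda>y. Im (g t y)) x) has_real_derivative - 2 * Bv (\<lambda>y. Re (g t y)) x) (at t)"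
    by (simp add: Bv_def)
  then have "((\<lambda>t. zc (g t) x) has_vector_derivative
     \<i> * of_real (2 * Bv (Bv (\<lambda>y. Im (g t y))) x) - of_real (- 2 * Bv (\<lambda>y. Re (g t y)) x)) (at t)"
    unfolding zc_def using assms
    by (intro has_vector_derivative_diff has_vector_derivative_mult_right has_vector_derivative_of_real) (auto simp: sol_def)
  then show ?thesis by (simp add: algebra_simps)
qed

lemma cc_derivative:
  assumes "sol g"
  shows "((\<lambda>t. cc (g t)) has_vector_derivative
     \<i> * of_real ((\<Sum>x\<in>I. (Bv (\<lambda>y. Im (g t y)) x)\<^sup>2) - (\<Sum>x\<in>I. (Re (g t x))\<^sup>2))
       + 2 * of_real (\<Sum>x\<in>I. Re (g t x) * Bv (\<lambda>y. Im (g t y)) x)) (at t)"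
proof -
  let ?r = "\<lambda>x. Re (g t x)" and ?m = "\<lambda>x. Im (g t x)"
  have dr: "((\<lambda>t. Re (g t x)) has_real_derivative 2 * Bv (Bv ?m) x) (at t)"
    and dm: "((\<lambda>t. Im (g t x)) has_real_derivative - 2 * ?r x) (at t)" if "x \<in> I" for x
    using assms that by (auto simp: sol_def)
  have db: "((\<lambda>t. Bv (\<lambda>y. Im (g t y)) x) has_real_derivative - 2 * Bv ?r x) (at t)" for x
  proof -
    have "((\<lambda>t. \<Sum>y\<in>I. B x y * Im (g t y)) has_real_derivative (\<Sum>y\<in>I. B x y * (- 2 * Re (g t y)))) (at t)"
      by (intro DERIV_sum DERIV_cmult dm)
    moreover have "(\<Sum>y\<in>I. B x y * (- 2 * Re (g t y))) = - 2 * Bv ?r x"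
      by (simp add: Bv_def sum_distrib_left mult_ac)
    ultimately show ?thesis by (simp add: Bv_def)
  qed
  have 1: "((\<lambda>t. \<Sum>x\<in>I. Re (g t x) * Im (g t x)) has_real_derivative
      (\<Sum>x\<in>I. 2 * Bv (Bv ?m) x * ?m x + (- 2 * ?r x) * ?r x)) (at t)"
    by (intro DERIV_sum DERIV_mult dr dm)
  have 2: "((\<lambda>t. \<Sum>x\<in>I. Im (g t x) * Bv (\<lambda>y. Im (g t y)) x) has_real_derivative
      (\<Sum>x\<in>I. (- 2 * ?r x) * Bv ?m x + (- 2 * Bv ?r x) * ?m x)) (at t)"
    by (intro DERIV_sum DERIV_mult dm db)
  have s1: "(\<Sum>x\<in>I. 2 * Bv (Bv ?m) x * ?m x + (- 2 * ?r x) * ?r x) = 2 * ((\<Sum>x\<in>I. (Bv ?m x)\<^sup>2) - (\<Sum>x\<in>I. (?r x)\<^sup>2))"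
  proof -
    have "(\<Sum>x\<in>I. 2 * Bv (Bv ?m) x * ?m x + (- 2 * ?r x) * ?r x) = 2 * (\<Sum>x\<in>I. ?m x * Bv (Bv ?m) x) - 2 * (\<Sum>x\<in>I. (?r x)\<^sup>2)"
      by (simp add: sum_subtractf sum_distrib_left power2_eq_square mult_ac)
    also have "(\<Sum>x\<in>I. ?m x * Bv (Bv ?m) x) = (\<Sum>x\<in>I. (Bv ?m x)\<^sup>2)"
      using Bv_swap[of ?m "Bv ?m"] by (simp add: power2_eq_square)
    finally show ?thesis by simp
  qed
  have s2: "(\<Sum>x\<in>I. (- 2 * ?r x) * Bv ?m x + (- 2 * Bv ?r x) * ?m x) = - 4 * (\<Sum>x\<in>I. ?r x * Bv ?m x)"
  proof -
    have "(\<Sum>x\<in>I. (- 2 * ?r x) * Bv ?m x + (- 2 * Bv ?r x) * ?m x) = - 2 * (\<Sum>x\<in>I. ?r x * Bv ?m x) - 2 * (\<Sum>x\<in>I. ?m x * Bv ?r x)"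
      by (simp add: sum_subtractf sum_distrib_left sum_negf mult_ac)
    then show ?thesis using Bv_swap[of ?m ?r] by simp
  qed
  have "((\<lambda>t. cc (g t)) has_vector_derivative
      \<i> * of_real (2 * ((\<Sum>x\<in>I. (Bv ?m x)\<^sup>2) - (\<Sum>x\<in>I. (?r x)\<^sup>2))) / 2 - of_real (- 4 * (\<Sum>x\<in>I. ?r x * Bv ?m x)) / 2) (at t)"
    unfolding cc_def
    by (intro has_vector_derivative_diff has_vector_derivative_divide has_vector_derivative_mult_right has_vector_derivative_of_real
        1[unfolded s1] 2[unfolded s2])
  moreover have "\<i> * complex_of_real (2 * a) / 2 - complex_of_real (- 4 * b) / 2 = \<i> * complex_of_real a + 2 * complex_of_real b" for a b
    by (simp add: complex_eq_iff)
  ultimately show ?thesis by (simp only:)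
qed

text \<open>The exponent is affine in the parameters of the Gaussian. Comparing its constant and
  linear coefficients with those of -i \<open>HH\<close> uses exactly Hamilton's equations for the
  label and the symmetry of \<open>B\<close>.\<close>

lemma coh_derivative:
  assumes "sol g"
  shows "((\<lambda>t. coh g t q) has_vector_derivative (- \<i> * HH (zc (g t)) q) * coh g t q) (at t)"
proof -
  let ?r = "\<lambda>x. Re (g t x)" and ?m = "\<lambda>x. Im (g t x)"
  let ?dz = "\<lambda>x. 2 * complex_of_real (Bv ?r x) + 2 * \<i> * of_real (Bv (Bv ?m) x)"
  let ?dc = "\<i> * complex_of_real ((\<Sum>x\<in>I. (Bv ?m x)\<^sup>2) - (\<Sum>x\<in>I. (?r x)\<^sup>2)) + 2 * of_real (\<Sum>x\<in>I. ?r x * Bv ?m x)"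
  have "((\<lambda>t. cc (g t) - \<i> * of_real (trB * t) + (\<Sum>x\<in>I. zc (g t) x * of_real (q x)) - of_real (\<Sum>x\<in>I. \<Sum>y\<in>I. B x y * q x * q y) / 2)
     has_vector_derivative (?dc - \<i> * of_real trB + (\<Sum>x\<in>I. ?dz x * of_real (q x)) - 0)) (at t)"
    by (intro has_vector_derivative_diff has_vector_derivative_add has_vector_derivative_const has_vector_derivative_sum
        has_vector_derivative_mult_left has_vector_derivative_mult_right has_vector_derivative_of_real cc_derivative zc_derivative assms)
       (auto intro!: derivative_eq_intros)
  moreover have "?dc - \<i> * of_real trB + (\<Sum>x\<in>I. ?dz x * of_real (q x)) - 0 = - \<i> * HH (zc (g t)) q"
  proof -
    have z2: "(\<Sum>x\<in>I. (zc (g t) x)\<^sup>2) = - of_real (\<Sum>x\<in>I. (?r x)\<^sup>2) - 2 * \<i> * of_real (\<Sum>x\<in>I. ?r x * Bv ?m x) + of_real (\<Sum>x\<in>I. (Bv ?m x)\<^sup>2)"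
    proof -
      have "(zc (g t) x)\<^sup>2 = - of_real ((?r x)\<^sup>2) - 2 * \<i> * of_real (?r x * Bv ?m x) + of_real ((Bv ?m x)\<^sup>2)" for x
        by (simp add: zc_def power2_diff power_mult_distrib)
      then show ?thesis by (simp add: sum.distrib sum_subtractf sum_distrib_left sum_negf)
    qed
    have zb: "(\<Sum>x\<in>I. zc (g t) x * of_real (Bv q x)) = \<i> * of_real (\<Sum>x\<in>I. q x * Bv ?r x) - of_real (\<Sum>x\<in>I. q x * Bv (Bv ?m) x)"
    proof -
      have "(\<Sum>x\<in>I. zc (g t) x * of_real (Bv q x)) = \<i> * of_real (\<Sum>x\<in>I. ?r x * Bv q x) - of_real (\<Sum>x\<in>I. Bv ?m x * Bv q x)"
        by (simp add: zc_def algebra_simps sum_subtractf sum_distrib_left)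
      then show ?thesis unfolding Bv_swap[of ?r q] Bv_swap[of "Bv ?m" q] .
    qed
    have dz: "(\<Sum>x\<in>I. ?dz x * of_real (q x)) = 2 * of_real (\<Sum>x\<in>I. q x * Bv ?r x) + 2 * \<i> * of_real (\<Sum>x\<in>I. q x * Bv (Bv ?m) x)"
      by (simp add: sum_distrib_left sum.distrib algebra_simps)
    show ?thesis unfolding HH_def z2 zb dz by (simp add: algebra_simps)
  qed
  ultimately have "((\<lambda>t. cc (g t) - \<i> * of_real (trB * t) + (\<Sum>x\<in>I. zc (g t) x * of_real (q x)) - of_real (\<Sum>x\<in>I. \<Sum>y\<in>I. B x y * q x * q y) / 2)
     has_vector_derivative - \<i> * HH (zc (g t)) q) (at t)" by simp
  from field_vector_diff_chain_at[OF this DERIV_exp]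
  show ?thesis by (simp add: o_def coh_gs gs_def)
qed

text \<open>From pointwise to L^2 differentiability: on [t-1, t+1] the derivative has a common
  square-integrable majorant, which by the mean value inequality also dominates the difference
  quotients.\<close>

lemma coh_sder:
  assumes "sol g"
  shows "sder M (coh g) (\<lambda>q. (- \<i> * HH (zc (g t)) q) * coh g t q) t"
proof -
  let ?P = "{t - 1..t + 1}"
  have bz: "bounded ((\<lambda>s. zc (g s) x) ` ?P)" if "x \<in> I" for x
    by (intro compact_imp_bounded compact_continuous_image continuous_at_imp_continuous_on ballI
        has_vector_derivative_continuous[OF zc_derivative[OF assms that]]) auto
  have bc: "bounded ((\<lambda>s. cc (g s)) ` ?P)"
    by (intro compact_imp_bounded compact_continuous_image continuous_at_imp_continuous_on ballI
        has_vector_derivative_continuous[OF cc_derivative[OF assms]]) auto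
  from bc obtain K0 where K0: "\<And>s. s \<in> ?P \<Longrightarrow> cmod (cc (g s)) \<le> K0" unfolding bounded_iff by blast
  have "\<exists>K. \<forall>x\<in>I. \<forall>s\<in>?P. cmod (zc (g s) x) \<le> K"
  proof -
    have "\<forall>x\<in>I. \<exists>K. \<forall>s\<in>?P. cmod (zc (g s) x) \<le> K" using bz by (fastforce simp: bounded_iff)
    then obtain K where K: "\<And>x s. x \<in> I \<Longrightarrow> s \<in> ?P \<Longrightarrow> cmod (zc (g s) x) \<le> K x" by metis
    have "K x \<le> Max (insert 0 (K ` I))" if "x \<in> I" for x using that by (intro Max_ge) auto
    then show ?thesis using K by (meson order_trans)
  qed
  then obtain K where K: "\<And>x s. x \<in> I \<Longrightarrow> s \<in> ?P \<Longrightarrow> cmod (zc (g s) x) \<le> K" by blast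
  have "pbd ?P (\<lambda>s q. - \<i> * HH (zc (g s)) q)" unfolding HH_def
    by (intro pbd_mult pbd_add pbd_diff pbd_sum pbd_const' pbd_Bv pbd_power pbd_const bz)
  then obtain C K' where b: "\<And>s q. s \<in> ?P \<Longrightarrow>
      cmod ((- \<i> * HH (zc (g s)) q) * gs (zc (g s)) (cc (g s) - \<i> * of_real (trB * s)) q) \<le> C * dom K' q"
  proof (rule pbd_gs_dom[where z = "\<lambda>s. zc (g s)" and K = K and c = "\<lambda>s. cc (g s) - \<i> * of_real (trB * s)" and ?K0.0 = K0])
    show "\<bar>Re (zc (g s) x)\<bar> \<le> K" if "s \<in> ?P" "x \<in> I" for s x
      using K[OF that(2,1)] abs_Re_le_cmod order_trans by blast
    show "Re (cc (g s) - \<i> * of_real (trB * s)) \<le> K0" if "s \<in> ?P" for s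
      using K0[OF that] complex_Re_le_cmod[of "cc (g s)"] by simp
  qed blast
  have b': "cmod ((- \<i> * HH (zc (g s)) q) * coh g s q) \<le> C * dom K' q" if "s \<in> ?P" for s q
    using b[OF that, of q] by (simp only: coh_gs)
  have m: "(\<lambda>q. (- \<i> * HH (zc (g s)) q) * coh g s q) \<in> borel_measurable M" for s
    unfolding HH_def
    by (intro borel_measurable_times borel_measurable_add borel_measurable_diff borel_measurable_sum borel_measurable_const
       measurable_of_real_compose Bv_measurable L2_measurable[OF coh_L2])
  show ?thesis unfolding sder_def
  proof (intro conjI allI coh_L2)
    show "(\<lambda>q. (- \<i> * HH (zc (g t)) q) * coh g t q) \<in> L2 M"
      by (rule L2I_bound[OF m dom_sq_integrable[of C K']]) (intro AE_I2 b', simp)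
    show "((\<lambda>h. N (\<lambda>q. (coh g (t + h) q - coh g t q) / complex_of_real h - (- \<i> * HH (zc (g t)) q) * coh g t q)) \<longlongrightarrow> 0) (at 0)"
    proof (rule l2_dominated_convergence_at[OF _ m dom_sq_integrable[of C K'], where d = 1])
      show "(\<lambda>q. (coh g (t + h) q - coh g t q) / complex_of_real h) \<in> borel_measurable M" for h
        by (intro L2_measurable L2_divide L2_diff coh_L2)
      show "((\<lambda>h. (coh g (t + h) q - coh g t q) / complex_of_real h) \<longlongrightarrow> (- \<i> * HH (zc (g t)) q) * coh g t q) (at 0)" for q
        using coh_derivative[OF assms, of q t] unfolding has_vector_derivative_at_0_iff
        by (simp add: scaleR_conv_of_real divide_inverse mult.commute)
      show "cmod ((coh g (t + h) q - coh g t q) / complex_of_real h) \<le> C * dom K' q" if "\<bar>h - 0\<bar> < 1" "h \<noteq> 0" for h q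
      proof -
        have "norm (coh g (t + h) q - coh g t q) \<le> (C * dom K' q) * \<bar>(t + h) - t\<bar>"
        proof (rule vector_derivative_bound)
          fix s assume "s \<in> closed_segment t (t + h)"
          then have "s \<in> ?P" using that by (auto simp: closed_segment_eq_real_ivl split: if_splits)
          then show "norm ((- \<i> * HH (zc (g s)) q) * coh g s q) \<le> C * dom K' q" by (rule b')
        qed (rule coh_derivative[OF assms])
        then show ?thesis using that by (simp add: norm_divide divide_le_eq)
      qed
    qed auto
  qed
qed

text \<open>Interaction picture: on a Gaussian the generator is harmonic part plus
  \<open>Vs\<close>, and the harmonic part cancels against the motion of the coherent state.\<close>

lemma coh_U_sder:
  assumes "sol g"
  shows "sder M (\<lambda>s. U (- s) (coh g s)) (U (- t) (\<lambda>q. (\<i> * of_real (Vs q)) * coh g t q)) t"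
proof -
  have "gen (coh g t) (\<lambda>q. (HH (zc (g t)) q + of_real (Vs q)) * coh g t q)"
    unfolding coh_gs by (rule gen_gs)
  from sder_U_path[OF this coh_sder[OF assms]]
  show ?thesis by (simp add: algebra_simps)
qed

end

section \<open>The classical harmonic flow\<close>

text \<open>Exponential generating function of a real sequence. With coefficients from powers of a
  linear map it gives single entries of the matrix exponential.\<close>

definition egf :: "(nat \<Rightarrow> real) \<Rightarrow> real \<Rightarrow> real" where
  "egf a t = (\<Sum>k. a k / fact k * t ^ k)"

lemma egf_norm_summable:
  fixes a :: "nat \<Rightarrow> real" and t :: real
  assumes "\<And>k. \<bar>a k\<bar> \<le> D * C ^ k"
  shows "summable (\<lambda>k. \<bar>a k / fact k * t ^ k\<bar>)" "(\<Sum>k. \<bar>a k / fact k * t ^ k\<bar>) \<le> D * exp (C * \<bar>t\<bar>)"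
proof -
  have s: "(\<lambda>k. D * ((C * \<bar>t\<bar>) ^ k / fact k)) sums (D * exp (C * \<bar>t\<bar>))"
    using exp_converges[of "C * \<bar>t\<bar>"] by (intro sums_mult) (simp add: divide_inverse mult.commute)
  have le: "\<bar>a k / fact k * t ^ k\<bar> \<le> D * ((C * \<bar>t\<bar>) ^ k / fact k)" for k
  proof -
    have "\<bar>a k / fact k * t ^ k\<bar> = \<bar>a k\<bar> * (\<bar>t\<bar> ^ k / fact k)" by (simp add: abs_mult power_abs)
    also have "\<dots> \<le> (D * C ^ k) * (\<bar>t\<bar> ^ k / fact k)" by (intro mult_right_mono assms) auto
    finally show ?thesis by (simp add: power_mult_distrib)
  qed
  show 1: "summable (\<lambda>k. \<bar>a k / fact k * t ^ k\<bar>)"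
    by (rule summable_comparison_test'[OF sums_summable[OF s]]) (use le in simp)
  show "(\<Sum>k. \<bar>a k / fact k * t ^ k\<bar>) \<le> D * exp (C * \<bar>t\<bar>)"
    using suminf_le[OF le 1 sums_summable[OF s]] sums_unique[OF s] by simp
qed

lemma egf_summable:
  fixes a :: "nat \<Rightarrow> real" and t :: real
  assumes "\<And>k. \<bar>a k\<bar> \<le> D * C ^ k" shows "summable (\<lambda>k. a k / fact k * t ^ k)"
  using egf_norm_summable(1)[OF assms] by (rule summable_rabs_cancel)

lemma egf_bound:
  assumes "\<And>k. \<bar>a k\<bar> \<le> D * C ^ k" shows "\<bar>egf a t\<bar> \<le> D * exp (C * \<bar>t\<bar>)"
  using summable_rabs[OF egf_norm_summable(1)[OF assms, of t]] egf_norm_summable(2)[OF assms, of t] unfolding egf_def by linarith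

text \<open>Differentiation drops the first coefficient, which for coefficients built from powers of
  a generator means one more application of it.\<close>

lemma egf_derivative:
  assumes "\<And>k. \<bar>a k\<bar> \<le> D * C ^ k"
  shows "(egf a has_real_derivative egf (\<lambda>k. a (Suc k)) t) (at t)"
proof -
  have "((\<lambda>x. \<Sum>n. a n / fact n * x ^ n) has_field_derivative (\<Sum>n. diffs (\<lambda>n. a n / fact n) n * t ^ n)) (at t)"
    by (rule termdiffs_strong_converges_everywhere) (rule egf_summable[OF assms])
  moreover have "diffs (\<lambda>n. a n / fact n) = (\<lambda>n. a (Suc n) / fact n)"
    by (auto simp: diffs_def fun_eq_iff simp del: of_nat_Suc)
  ultimately show ?thesis by (simp add: egf_def[abs_def])
qed

lemma egf_0: "egf a 0 = a 0"
  unfolding egf_def using powser_zero[of "\<lambda>k. a k / fact k"] by simp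

lemma egf_cmult:
  assumes "\<And>k. \<bar>a k\<bar> \<le> D * C ^ k" shows "egf (\<lambda>k. c * a k) t = c * egf a t"
proof -
  have "egf (\<lambda>k. c * a k) t = (\<Sum>k. c * (a k / fact k * t ^ k))" by (simp add: egf_def mult.assoc)
  then show ?thesis using suminf_mult[OF egf_summable[OF assms]] by (simp add: egf_def)
qed

lemma egf_sum:
  assumes "\<And>i k. i \<in> J \<Longrightarrow> \<bar>a i k\<bar> \<le> D i * C i ^ k"
  shows "egf (\<lambda>k. \<Sum>i\<in>J. a i k) t = (\<Sum>i\<in>J. egf (a i) t)"
proof -
  have "egf (\<lambda>k. \<Sum>i\<in>J. a i k) t = (\<Sum>k. \<Sum>i\<in>J. a i k / fact k * t ^ k)"
    by (simp add: egf_def sum_divide_distrib sum_distrib_right)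
  also have "\<dots> = (\<Sum>i\<in>J. \<Sum>k. a i k / fact k * t ^ k)" by (rule suminf_sum) (rule egf_summable[OF assms])
  finally show ?thesis by (simp add: egf_def)
qed

section \<open>The label flow as a power series, and the curves it generates\<close>

context anharmonic
begin

text \<open>The linear vector field of \<open>sol\<close>; \<open>flow\<close> below is its
  exponential, written entrywise.\<close>

definition Gop :: "(int list \<Rightarrow> complex) \<Rightarrow> int list \<Rightarrow> complex" where
  "Gop f x = Complex (2 * Bv (Bv (\<lambda>y. Im (f y))) x) (- 2 * Re (f x))"

definition flow :: "(int list \<Rightarrow> complex) \<Rightarrow> real \<Rightarrow> int list \<Rightarrow> complex" where
  "flow f t x = Complex (egf (\<lambda>k. Re ((Gop ^^ k) f x)) t) (egf (\<lambda>k. Im ((Gop ^^ k) f x)) t)"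

lemma flow_0: "flow f 0 = f"
  by (simp add: flow_def egf_0 fun_eq_iff)

text \<open>The constants depend on the volume. They serve only for convergence and termwise
  differentiation of the series; spatial decay is the matter of \<open>flow_bound\<close>.\<close>

lemma Gop_crude_bound:
  "\<exists>C D. \<forall>k. \<forall>x\<in>I. \<bar>Re ((Gop ^^ k) f x)\<bar> \<le> D * C ^ k \<and> \<bar>Im ((Gop ^^ k) f x)\<bar> \<le> D * C ^ k"
proof -
  define b where "b = 1 + (\<Sum>x\<in>I. \<Sum>y\<in>I. \<bar>B x y\<bar>)"
  define D where "D = (\<Sum>x\<in>I. cmod (f x))"
  have b: "1 \<le> b" by (simp add: b_def sum_nonneg)
  have Bvb: "\<bar>Bv q x\<bar> \<le> b * m" if "\<And>y. y \<in> I \<Longrightarrow> \<bar>q y\<bar> \<le> m" "x \<in> I" "0 \<le> m" for q x m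
  proof -
    have "\<bar>Bv q x\<bar> \<le> (\<Sum>y\<in>I. \<bar>B x y * q y\<bar>)" unfolding Bv_def by (rule sum_abs)
    also have "\<dots> \<le> (\<Sum>y\<in>I. \<bar>B x y\<bar> * m)" by (intro sum_mono) (auto simp: abs_mult that intro!: mult_left_mono)
    also have "\<dots> = (\<Sum>y\<in>I. \<bar>B x y\<bar>) * m" by (simp add: sum_distrib_right)
    also have "\<dots> \<le> b * m"
    proof (rule mult_right_mono[OF _ that(3)])
      have "(\<Sum>y\<in>I. \<bar>B x y\<bar>) \<le> (\<Sum>x\<in>I. \<Sum>y\<in>I. \<bar>B x y\<bar>)" using that(2) by (intro member_le_sum) (auto intro: sum_nonneg)
      then show "(\<Sum>y\<in>I. \<bar>B x y\<bar>) \<le> b" by (simp add: b_def)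
    qed
    finally show ?thesis .
  qed
  have D0: "0 \<le> D" by (simp add: D_def sum_nonneg)
  have "\<forall>x\<in>I. \<bar>Re ((Gop ^^ k) f x)\<bar> \<le> D * (2 * b\<^sup>2) ^ k \<and> \<bar>Im ((Gop ^^ k) f x)\<bar> \<le> D * (2 * b\<^sup>2) ^ k" for k
  proof (induction k)
    case 0
    have "cmod (f x) \<le> D" if "x \<in> I" for x unfolding D_def using that by (intro member_le_sum) auto
    then show ?case using abs_Re_le_cmod abs_Im_le_cmod order_trans by fastforce
  next
    case (Suc k)
    let ?m = "D * (2 * b\<^sup>2) ^ k"
    have m0: "0 \<le> ?m" using D0 b by simp
    have 1: "\<bar>Bv (Bv (\<lambda>y. Im ((Gop ^^ k) f y))) x\<bar> \<le> b * (b * ?m)" if "x \<in> I" for x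
      using Suc b m0 that by (intro Bvb) auto
    have 2: "?m \<le> b\<^sup>2 * ?m" using m0 b by (metis mult_le_cancel_right1 not_less one_le_power)
    show ?case
    proof (intro ballI conjI)
      fix x assume x: "x \<in> I"
      show "\<bar>Re ((Gop ^^ Suc k) f x)\<bar> \<le> D * (2 * b\<^sup>2) ^ Suc k"
        using 1[OF x] by (simp add: Gop_def abs_mult power2_eq_square mult_ac)
      have "\<bar>Re ((Gop ^^ k) f x)\<bar> \<le> ?m" using Suc x by blast
      then show "\<bar>Im ((Gop ^^ Suc k) f x)\<bar> \<le> D * (2 * b\<^sup>2) ^ Suc k"
        using 2 by (simp add: Gop_def abs_mult mult_ac)
    qed
  qed
  then show ?thesis by blast
qed

lemma sol_flow: "sol (flow f)"
  unfolding sol_def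
proof (intro allI ballI)
  fix t x assume x: "x \<in> I"
  obtain C D where CD: "\<forall>k. \<forall>x\<in>I. \<bar>Re ((Gop ^^ k) f x)\<bar> \<le> D * C ^ k \<and> \<bar>Im ((Gop ^^ k) f x)\<bar> \<le> D * C ^ k"
    using Gop_crude_bound[of f] by blast
  have R: "\<bar>Re ((Gop ^^ k) f x)\<bar> \<le> D * C ^ k" and J: "\<bar>Im ((Gop ^^ k) f x)\<bar> \<le> D * C ^ k" if "x \<in> I" for k x
    using CD that by blast+
  let ?a = "\<lambda>y k. Im ((Gop ^^ k) f y)"
  have b1: "\<bar>B z y * ?a y k\<bar> \<le> (\<bar>B z y\<bar> * D) * C ^ k" if "y \<in> I" for y k z
    using mult_left_mono[OF J[OF that, of k], of "\<bar>B z y\<bar>"] by (simp add: abs_mult mult_ac)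
  have e1: "egf (\<lambda>k. Bv (\<lambda>y. ?a y k) z) t = Bv (\<lambda>y. egf (?a y) t) z" for z
    unfolding Bv_def using egf_sum[of I "\<lambda>y k. B z y * ?a y k" "\<lambda>y. \<bar>B z y\<bar> * D" "\<lambda>_. C" t, OF b1] egf_cmult[OF J] by simp
  have b2: "\<bar>Bv (\<lambda>y. ?a y k) z\<bar> \<le> (\<Sum>y\<in>I. \<bar>B z y\<bar> * D) * C ^ k" for z k
    unfolding Bv_def sum_distrib_right by (rule order_trans[OF sum_abs]) (intro sum_mono b1)
  have b3: "\<bar>B x z * Bv (\<lambda>y. ?a y k) z\<bar> \<le> (\<bar>B x z\<bar> * (\<Sum>y\<in>I. \<bar>B z y\<bar> * D)) * C ^ k" for z k
    using mult_left_mono[OF b2[of k z], of "\<bar>B x z\<bar>"] by (simp add: abs_mult mult_ac)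
  have b4: "\<bar>Bv (Bv (\<lambda>y. ?a y k)) x\<bar> \<le> (\<Sum>z\<in>I. \<bar>B x z\<bar> * (\<Sum>y\<in>I. \<bar>B z y\<bar> * D)) * C ^ k" for k
    unfolding Bv_def[of "Bv _"] sum_distrib_right[of _ I "C ^ k"] by (rule order_trans[OF sum_abs]) (intro sum_mono b3)
  have "egf (\<lambda>k. Bv (Bv (\<lambda>y. ?a y k)) x) t = (\<Sum>z\<in>I. egf (\<lambda>k. B x z * Bv (\<lambda>y. ?a y k) z) t)"
    unfolding Bv_def[of "Bv _"] by (rule egf_sum[OF b3])
  also have "\<dots> = (\<Sum>z\<in>I. B x z * egf (\<lambda>k. Bv (\<lambda>y. ?a y k) z) t)"
    by (intro sum.cong refl egf_cmult[OF b2])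
  also have "\<dots> = Bv (Bv (\<lambda>y. egf (?a y) t)) x" unfolding e1 Bv_def[of "Bv _"] ..
  finally have e2: "egf (\<lambda>k. 2 * Bv (Bv (\<lambda>y. ?a y k)) x) t = 2 * Bv (Bv (\<lambda>y. egf (?a y) t)) x"
    using egf_cmult[OF b4, of 2 t] by simp
  show "((\<lambda>t. Re (flow f t x)) has_real_derivative 2 * Bv (Bv (\<lambda>y. Im (flow f t y))) x) (at t) \<and>
      ((\<lambda>t. Im (flow f t x)) has_real_derivative - 2 * Re (flow f t x)) (at t)"
  proof
    show "((\<lambda>t. Re (flow f t x)) has_real_derivative 2 * Bv (Bv (\<lambda>y. Im (flow f t y))) x) (at t)"
      using egf_derivative[OF R[OF x], of t] e2 by (simp add: flow_def Gop_def)
    show "((\<lambda>t. Im (flow f t x)) has_real_derivative - 2 * Re (flow f t x)) (at t)"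
      using egf_derivative[OF J[OF x], of t] egf_cmult[OF R[OF x], of "-2" t] by (simp add: flow_def Gop_def)
  qed
qed

lemma sol_add:
  assumes "sol f" "sol g" shows "sol (\<lambda>t x. f t x + g t x)"
proof -
  have Bva: "Bv (\<lambda>y. p y + q y) = (\<lambda>x. Bv p x + Bv q x)" for p q
    by (simp add: Bv_def fun_eq_iff algebra_simps sum.distrib)
  show ?thesis unfolding sol_def
  proof (intro allI ballI conjI)
    fix t x assume x: "x \<in> I"
    have "((\<lambda>t. Re (f t x) + Re (g t x)) has_real_derivative 2 * Bv (Bv (\<lambda>y. Im (f t y))) x + 2 * Bv (Bv (\<lambda>y. Im (g t y))) x) (at t)"
      using assms x by (intro DERIV_add) (auto simp: sol_def)
    then show "((\<lambda>t. Re (f t x + g t x)) has_real_derivative 2 * Bv (Bv (\<lambda>y. Im (f t y + g t y))) x) (at t)"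
      by (simp add: Bva algebra_simps)
    have "((\<lambda>t. Im (f t x) + Im (g t x)) has_real_derivative - 2 * Re (f t x) + - 2 * Re (g t x)) (at t)"
      using assms x by (intro DERIV_add) (auto simp: sol_def)
    then show "((\<lambda>t. Im (f t x + g t x)) has_real_derivative - 2 * Re (f t x + g t x)) (at t)"
      by (simp add: algebra_simps)
  qed
qed

lemma sol_shift: assumes "sol f" shows "sol (\<lambda>t. f (s + t))"
  unfolding sol_def
proof (intro allI ballI conjI)
  fix t x assume x: "x \<in> I"
  have d: "((\<lambda>t. s + t) has_real_derivative 1) (at t)" by (auto intro!: derivative_eq_intros)
  have "((\<lambda>t. Re (f t x)) has_real_derivative 2 * Bv (Bv (\<lambda>y. Im (f (s + t) y))) x) (at (s + t))"
    "((\<lambda>t. Im (f t x)) has_real_derivative - 2 * Re (f (s + t) x)) (at (s + t))" using assms x by (auto simp: sol_def)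
  from DERIV_chain2[OF this(1) d] DERIV_chain2[OF this(2) d]
  show "((\<lambda>t. Re (f (s + t) x)) has_real_derivative 2 * Bv (Bv (\<lambda>y. Im (f (s + t) y))) x) (at t)"
    "((\<lambda>t. Im (f (s + t) x)) has_real_derivative - 2 * Re (f (s + t) x)) (at t)" by auto
qed

text \<open>The label flow is canonical: in the derivative the products of real parts cancel
  directly, and the remaining ones because the square of \<open>B\<close> is symmetric. Phases in
  the Weyl relation thus stay constant in time.\<close>

lemma sympl_const:
  assumes "sol f" "sol g" shows "sympl nu L (f t) (g t) = sympl nu L (f 0) (g 0)"
proof -
  have "((\<lambda>t. sympl nu L (f t) (g t)) has_real_derivative 0) (at t)" for t
  proof -
    let ?fr = "\<lambda>x. Re (f t x)" and ?fi = "\<lambda>x. Im (f t x)" and ?gr = "\<lambda>x. Re (g t x)" and ?gi = "\<lambda>x. Im (g t x)"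
    have "((\<lambda>t. sympl nu L (f t) (g t)) has_real_derivative
      (\<Sum>x\<in>I. ((- 2 * ?fr x) * ?gr x + (2 * Bv (Bv ?gi) x) * ?fi x) - ((2 * Bv (Bv ?fi) x) * ?gi x + (- 2 * ?gr x) * ?fr x))) (at t)"
      unfolding sympl_def using assms by (intro DERIV_sum DERIV_diff DERIV_mult) (auto simp: sol_def)
    moreover have "(\<Sum>x\<in>I. ((- 2 * ?fr x) * ?gr x + (2 * Bv (Bv ?gi) x) * ?fi x) - ((2 * Bv (Bv ?fi) x) * ?gi x + (- 2 * ?gr x) * ?fr x))
       = 2 * (\<Sum>x\<in>I. ?fi x * Bv (Bv ?gi) x) - 2 * (\<Sum>x\<in>I. ?gi x * Bv (Bv ?fi) x)"
      unfolding sum_distrib_left sum_subtractf[symmetric] by (intro sum.cong refl) (simp add: algebra_simps)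
    moreover have "(\<Sum>x\<in>I. ?fi x * Bv (Bv ?gi) x) = (\<Sum>x\<in>I. ?gi x * Bv (Bv ?fi) x)"
      using Bv_swap[of ?fi "Bv ?gi"] Bv_swap[of ?gi "Bv ?fi"] by (simp add: mult.commute)
    ultimately show ?thesis by simp
  qed
  then have "\<forall>x. ((\<lambda>t. sympl nu L (f t) (g t)) has_real_derivative 0) (at x)" by blast
  from DERIV_isconst_all[OF this] show ?thesis by blast
qed

text \<open>The linear span of coherent solutions, taken as whole curves: a curve carries its own
  harmonic evolution, and statements about the span follow by induction over the two rules.\<close>

inductive cohpath :: "(real \<Rightarrow> (int list \<Rightarrow> real) \<Rightarrow> complex) \<Rightarrow> bool" where
  base: "sol g \<Longrightarrow> cohpath (coh g)"
| lin: "cohpath u \<Longrightarrow> cohpath v \<Longrightarrow> cohpath (\<lambda>t q. a * u t q + b * v t q)"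

lemma Vs_mult_L2: "\<psi> \<in> L2 M \<Longrightarrow> (\<lambda>q. (\<i> * of_real (Vs q)) * \<psi> q) \<in> L2 M"
  by (rule L2_mult_bounded[where K = "real (card I) * Vb"])
     (auto simp: norm_mult Vs_bound intro!: borel_measurable_times measurable_of_real_compose Vs_measurable)

lemma Vs_mult_norm: "\<psi> \<in> L2 M \<Longrightarrow> N (\<lambda>q. (\<i> * of_real (Vs q)) * \<psi> q) \<le> (real (card I) * Vb) * N \<psi>"
  using order_trans[OF abs_ge_zero V_bound[of 0]]
  by (intro l2norm_mult_bounded)
     (auto simp: norm_mult Vs_bound intro!: borel_measurable_times measurable_of_real_compose Vs_measurable)

lemma cohpath_L2: "cohpath u \<Longrightarrow> u t \<in> L2 M"
  by (induction rule: cohpath.induct) (auto intro: coh_L2 L2_add L2_cmult)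

lemma cohpath_sder:
  "cohpath u \<Longrightarrow> sder M (\<lambda>s. U (- s) (u s)) (U (- t) (\<lambda>q. (\<i> * of_real (Vs q)) * u t q)) t"
proof (induction rule: cohpath.induct)
  case (base g)
  then show ?case by (rule coh_U_sder)
next
  case (lin u v a b)
  have L: "u s \<in> L2 M" "v s \<in> L2 M" for s using lin cohpath_L2 by auto
  have "AE q in M. a * U (- t) (\<lambda>q. (\<i> * of_real (Vs q)) * u t q) q + b * U (- t) (\<lambda>q. (\<i> * of_real (Vs q)) * v t q) q
      = U (- t) (\<lambda>q. a * ((\<i> * of_real (Vs q)) * u t q) + b * ((\<i> * of_real (Vs q)) * v t q)) q"
    using U_lin[OF Vs_mult_L2[OF L(1)] Vs_mult_L2[OF L(2)], of "- t" a t b t] by (auto elim: eventually_mono)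
  moreover have "(\<lambda>q. a * ((\<i> * of_real (Vs q)) * u t q) + b * ((\<i> * of_real (Vs q)) * v t q))
      = (\<lambda>q. (\<i> * of_real (Vs q)) * (a * u t q + b * v t q))" by (simp add: fun_eq_iff algebra_simps)
  ultimately have e: "AE q in M. a * U (- t) (\<lambda>q. (\<i> * of_real (Vs q)) * u t q) q + b * U (- t) (\<lambda>q. (\<i> * of_real (Vs q)) * v t q) q
      = U (- t) (\<lambda>q. (\<i> * of_real (Vs q)) * (a * u t q + b * v t q)) q" by simp
  have f: "AE q in M. a * U (- s) (u s) q + b * U (- s) (v s) q = U (- s) (\<lambda>q. a * u s q + b * v s q) q" for s
    using U_lin[OF L(1) L(2), of "- s" a s b s] by (auto elim: eventually_mono)
  show ?case
    by (rule sder_cong[OF sder_lin[OF lin.IH, of a b] f _ e]) (intro U_L2 Vs_mult_L2 L2_add L2_cmult L)+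
qed

text \<open>No Gaussian integral is needed to see that the harmonic evolution is isometric: it differs from the
  unitary group \<open>U\<close> only by the multiplication operator \<open>Vs\<close>, which is symmetric.\<close>

lemma cohpath_norm: assumes "cohpath u" shows "N (u t) = N (u 0)"
proof -
  let ?y = "\<lambda>s. U (- s) (u s)"
  note L = cohpath_L2[OF assms]
  have "((\<lambda>s. (N (?y s))\<^sup>2) has_real_derivative 0) (at s)" for s
  proof -
    have "ip M (?y s) (U (- s) (\<lambda>q. (\<i> * of_real (Vs q)) * u s q)) = ip M (u s) (\<lambda>q. (\<i> * of_real (Vs q)) * u s q)"
      by (intro U_ip L Vs_mult_L2)
    also have "\<dots> = (CLINT q|M. \<i> * complex_of_real (Vs q * (cmod (u s q))\<^sup>2))"
      unfolding ip_def by (intro Bochner_Integration.integral_cong refl) (simp add: complex_norm_square mult_ac del: of_real_power)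
    also have "\<dots> = \<i> * complex_of_real (LINT q|M. Vs q * (cmod (u s q))\<^sup>2)"
      by (simp only: integral_mult_right_zero integral_complex_of_real)
    finally have "Re (ip M (?y s) (U (- s) (\<lambda>q. (\<i> * of_real (Vs q)) * u s q))) = 0" by simp
    then show ?thesis using sder_norm_sq[OF cohpath_sder[OF assms, of s]] by simp
  qed
  then have "\<forall>s. ((\<lambda>s. (N (?y s))\<^sup>2) has_real_derivative 0) (at s)" by blast
  from DERIV_isconst_all[OF this] have "(N (?y t))\<^sup>2 = (N (?y 0))\<^sup>2" by blast
  then show ?thesis using U_norm[OF L] by (simp add: power2_eq_iff_nonneg)
qed

text \<open>The derivative is \<open>Vs\<close> applied to a vector of constant norm. That the curve
  enters the constant only through N (u 0) is what allows extension by density.\<close>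

lemma cohpath_lipschitz:
  assumes "cohpath u"
  shows "N (\<lambda>q. U (- h) (u h) q - u 0 q) \<le> (real (card I) * Vb * N (u 0)) * \<bar>h\<bar>"
proof -
  note L = cohpath_L2[OF assms]
  have "N (\<lambda>q. U (- h) (u h) q - U (- 0) (u 0) q) \<le> (real (card I) * Vb * N (u 0)) * \<bar>h - 0\<bar>"
  proof (rule sder_bound)
    show "sder M (\<lambda>s. U (- s) (u s)) (U (- s) (\<lambda>q. (\<i> * of_real (Vs q)) * u s q)) s" for s by (rule cohpath_sder[OF assms])
    show "N (U (- s) (\<lambda>q. (\<i> * of_real (Vs q)) * u s q)) \<le> real (card I) * Vb * N (u 0)" for s
      using Vs_mult_norm[OF L, of s] by (simp add: U_norm Vs_mult_L2 L cohpath_norm[OF assms, of s])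
  qed
  moreover have "N (\<lambda>q. U (- h) (u h) q - U (- 0) (u 0) q) = N (\<lambda>q. U (- h) (u h) q - u 0 q)"
    by (rule l2norm_cong_AE) (use U_0[OF L, of 0] in \<open>auto elim: eventually_mono\<close>)
  ultimately show ?thesis by simp
qed

text \<open>Stands in for the statement that the harmonic dynamics maps Weyl operators to Weyl
  operators: labels add, sums of solutions are solutions, and the extra phase is frozen by
  \<open>sympl_const\<close>.\<close>

lemma cohpath_Weyl:
  assumes "cohpath u" "sol f"
  shows "\<exists>v. cohpath v \<and> (\<forall>t. \<forall>q\<in>space M. v t q = W (f t) (u t) q)"
  using assms(1)
proof (induction rule: cohpath.induct)
  case (base g)
  let ?s = "exp (\<i> * complex_of_real (sympl nu L (f 0) (g 0) / 2))"
  \<comment> \<open>The zero summand merely casts a scalar multiple into the shape of the rule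
    \<open>lin\<close>.\<close>
  have "cohpath (\<lambda>t q. ?s * coh (\<lambda>t x. f t x + g t x) t q + 0 * coh g t q)"
    by (intro cohpath.intros sol_add base assms)
  moreover have "?s * coh (\<lambda>t x. f t x + g t x) t q + 0 * coh g t q = W (f t) (coh g t) q" if "q \<in> space M" for t q
  proof -
    have "W (f t) (coh g t) q = exp (- \<i> * of_real (trB * t)) * W (f t) (W (g t) \<Omega>) q"
      by (simp add: Weyl_eq coh_def)
    also have "\<dots> = exp (- \<i> * of_real (trB * t)) * (exp (\<i> * complex_of_real (sympl nu L (f t) (g t) / 2)) * W (\<lambda>x. f t x + g t x) \<Omega> q)"
      by (simp only: Weyl_Weyl[OF that])
    finally show ?thesis by (simp add: coh_def sympl_const[OF assms(2) base, of t] mult_ac)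
  qed
  ultimately show ?case by (intro exI[where x = "\<lambda>t q. ?s * coh (\<lambda>t x. f t x + g t x) t q + 0 * coh g t q"]) simp
next
  case (lin u v a b)
  then obtain u' v' where "cohpath u'" "cohpath v'" "\<forall>t. \<forall>q\<in>space M. u' t q = W (f t) (u t) q" "\<forall>t. \<forall>q\<in>space M. v' t q = W (f t) (v t) q"
    by blast
  then show ?case by (intro exI[where x = "\<lambda>t q. a * u' t q + b * v' t q"]) (auto simp: Weyl_lin intro: cohpath.intros)
qed

end

section \<open>Density of the coherent states\<close>

context anharmonic
begin

definition cl :: "((int list \<Rightarrow> real) \<Rightarrow> complex) set" where
  "cl = {\<psi> \<in> L2 M. \<forall>e>0. \<exists>u. cohpath u \<and> N (\<lambda>q. \<psi> q - u 0 q) < e}"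

lemma clE:
  assumes "\<psi> \<in> cl" "0 < e" obtains u where "cohpath u" "N (\<lambda>q. \<psi> q - u 0 q) < e"
  using assms unfolding cl_def by blast

lemma cl_L2: "\<psi> \<in> cl \<Longrightarrow> \<psi> \<in> L2 M"
  by (simp add: cl_def)

lemma cl_closed:
  assumes \<psi>: "\<psi> \<in> L2 M" and "\<And>n. \<phi> n \<in> cl" and "(\<lambda>n. N (\<lambda>q. \<phi> n q - \<psi> q)) \<longlonglongrightarrow> 0"
  shows "\<psi> \<in> cl"
  unfolding cl_def
proof (intro CollectI conjI \<psi> allI impI)
  fix e :: real assume e: "0 < e"
  from assms(3) e obtain n where "N (\<lambda>q. \<phi> n q - \<psi> q) < e / 2"
    unfolding lim_sequentially dist_real_def by (metis abs_of_nonneg diff_zero half_gt_zero l2norm_nonneg order_refl)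
  moreover obtain u where u: "cohpath u" "N (\<lambda>q. \<phi> n q - u 0 q) < e / 2"
    using clE[OF assms(2)] e by (metis half_gt_zero)
  moreover have "N (\<lambda>q. \<psi> q - u 0 q) \<le> N (\<lambda>q. \<psi> q - \<phi> n q) + N (\<lambda>q. \<phi> n q - u 0 q)"
    by (intro l2norm_triangle_diff \<psi> cl_L2 assms cohpath_L2 u)
  ultimately show "\<exists>u. cohpath u \<and> N (\<lambda>q. \<psi> q - u 0 q) < e"
    using l2norm_minus_commute[of M \<psi> "\<phi> n"] by (intro exI[of _ u]) auto
qed

lemma L2_cong: "\<psi> \<in> L2 M \<Longrightarrow> (\<And>q. q \<in> space M \<Longrightarrow> \<phi> q = \<psi> q) \<Longrightarrow> \<phi> \<in> L2 M"
  unfolding L2_iff by (simp cong: measurable_cong Bochner_Integration.integrable_cong)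

lemma cl_cong: "\<psi> \<in> cl \<Longrightarrow> (\<And>q. q \<in> space M \<Longrightarrow> \<phi> q = \<psi> q) \<Longrightarrow> \<phi> \<in> cl"
proof (rule cl_closed[of \<phi> "\<lambda>_. \<psi>"])
  assume "\<psi> \<in> cl" and *: "\<And>q. q \<in> space M \<Longrightarrow> \<phi> q = \<psi> q"
  have "N (\<lambda>q. \<psi> q - \<phi> q) = N (\<lambda>q. 0)" by (intro l2norm_cong_AE AE_I2) (simp add: *)
  then show "(\<lambda>n. N (\<lambda>q. \<psi> q - \<phi> q)) \<longlonglongrightarrow> 0" by simp
qed (auto intro: L2_cong cl_L2)

lemma cl_lin:
  assumes "\<psi> \<in> cl" "\<phi> \<in> cl" shows "(\<lambda>q. a * \<psi> q + b * \<phi> q) \<in> cl"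
  unfolding cl_def
proof (intro CollectI conjI allI impI)
  note L = cl_L2[OF assms(1)] cl_L2[OF assms(2)]
  show "(\<lambda>q. a * \<psi> q + b * \<phi> q) \<in> L2 M" by (intro L2_add L2_cmult L)
  fix e :: real assume e: "0 < e"
  define r where "r = e / (cmod a + cmod b + 1)"
  have d: "0 < cmod a + cmod b + 1" by (simp add: add_nonneg_pos)
  then have r: "0 < r" using e by (simp add: r_def)
  obtain u where u: "cohpath u" "N (\<lambda>q. \<psi> q - u 0 q) < r" using clE[OF assms(1) r] .
  obtain v where v: "cohpath v" "N (\<lambda>q. \<phi> q - v 0 q) < r" using clE[OF assms(2) r] .
  note Lu = cohpath_L2[OF u(1), of 0] cohpath_L2[OF v(1), of 0]
  have "N (\<lambda>q. (a * \<psi> q + b * \<phi> q) - (a * u 0 q + b * v 0 q)) = N (\<lambda>q. a * (\<psi> q - u 0 q) + b * (\<phi> q - v 0 q))"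
    by (simp add: algebra_simps)
  also have "\<dots> \<le> N (\<lambda>q. a * (\<psi> q - u 0 q)) + N (\<lambda>q. b * (\<phi> q - v 0 q))"
    by (intro l2norm_triangle L2_cmult L2_diff L Lu)
  also have "\<dots> = cmod a * N (\<lambda>q. \<psi> q - u 0 q) + cmod b * N (\<lambda>q. \<phi> q - v 0 q)"
    by (simp add: l2norm_cmult L2_diff L Lu)
  also have "\<dots> \<le> cmod a * r + cmod b * r" using u v by (intro add_mono mult_left_mono) auto
  also have "\<dots> < (cmod a + cmod b + 1) * r" using r by (simp add: algebra_simps)
  also have "\<dots> = e" using d by (simp add: r_def)
  finally show "\<exists>u. cohpath u \<and> N (\<lambda>q. (a * \<psi> q + b * \<phi> q) - u 0 q) < e"
    using cohpath.lin[OF u(1) v(1), of a b] by blast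
qed

text \<open>Weyl operators are isometric and map coherent curves to coherent curves; the label
  \<open>f\<close> is extended to a solution by \<open>flow\<close>.\<close>

lemma cl_Weyl: assumes "\<psi> \<in> cl" shows "W f \<psi> \<in> cl"
  unfolding cl_def
proof (intro CollectI conjI allI impI)
  show "W f \<psi> \<in> L2 M" by (intro Weyl_L2 cl_L2 assms)
  fix e :: real assume "0 < e"
  then obtain u where u: "cohpath u" "N (\<lambda>q. \<psi> q - u 0 q) < e" using clE[OF assms] by blast
  obtain v where v: "cohpath v" "\<And>t q. q \<in> space M \<Longrightarrow> v t q = W (flow f t) (u t) q"
    using cohpath_Weyl[OF u(1) sol_flow[of f]] by blast
  have "N (\<lambda>q. W f \<psi> q - v 0 q) = N (W f (\<lambda>q. \<psi> q - u 0 q))"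
    by (intro l2norm_cong_AE AE_I2) (simp add: v flow_0 Weyl_diff)
  also have "\<dots> = N (\<lambda>q. \<psi> q - u 0 q)" by (intro Weyl_l2norm L2_measurable L2_diff cl_L2 assms cohpath_L2 u)
  finally show "\<exists>u. cohpath u \<and> N (\<lambda>q. W f \<psi> q - u 0 q) < e" using u v by auto
qed

lemma cl_\<Omega>: "\<Omega> \<in> cl"
  unfolding cl_def
proof (intro CollectI conjI allI impI)
  show "\<Omega> \<in> L2 M" by (simp add: \<Omega>_def gs_L2)
  have "W (\<lambda>_. 0) \<Omega> = \<Omega>" unfolding Weyl_\<Omega> by (simp add: \<Omega>_def zc_def[abs_def] cc_def Bv_def)
  then have "coh (flow (\<lambda>_. 0)) 0 = \<Omega>" by (simp add: coh_def fun_eq_iff flow_0)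
  then show "\<exists>u. cohpath u \<and> N (\<lambda>q. \<Omega> q - u 0 q) < e" if "0 < e" for e
    using that cohpath.base[OF sol_flow] by (intro exI[of _ "coh (flow (\<lambda>_. 0))"]) auto
qed

text \<open>Bounded multiplication operators that preserve the closure. They form an algebra closed
  under bounded pointwise limits, which leads from exponentials to indicators of all measurable
  sets.\<close>

definition mlt :: "((int list \<Rightarrow> real) \<Rightarrow> complex) \<Rightarrow> bool" where
  "mlt h \<longleftrightarrow> h \<in> borel_measurable M \<and> (\<exists>K. \<forall>q\<in>space M. cmod (h q) \<le> K) \<and> (\<forall>\<psi>\<in>cl. (\<lambda>q. h q * \<psi> q) \<in> cl)"

lemma mlt_const: "mlt (\<lambda>_. c)"
  unfolding mlt_def using cl_lin[of _ _ c 0] by (auto intro: cl_cong)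

lemma mlt_cong: "mlt h \<Longrightarrow> (\<And>q. q \<in> space M \<Longrightarrow> g q = h q) \<Longrightarrow> mlt g"
  unfolding mlt_def by (auto intro: cl_cong cong: measurable_cong)

lemma mlt_add: assumes "mlt g" "mlt h" shows "mlt (\<lambda>q. g q + h q)"
  unfolding mlt_def
proof (intro conjI ballI)
  show "(\<lambda>q. g q + h q) \<in> borel_measurable M" using assms by (auto simp: mlt_def)
  from assms obtain K J where "\<forall>q\<in>space M. cmod (g q) \<le> K" "\<forall>q\<in>space M. cmod (h q) \<le> J" by (auto simp: mlt_def)
  then show "\<exists>K. \<forall>q\<in>space M. cmod (g q + h q) \<le> K" by (intro exI[of _ "K + J"]) (auto intro: norm_triangle_mono)
  fix \<psi> assume "\<psi> \<in> cl"
  then show "(\<lambda>q. (g q + h q) * \<psi> q) \<in> cl"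
    using cl_lin[of "\<lambda>q. g q * \<psi> q" "\<lambda>q. h q * \<psi> q" 1 1] assms by (auto simp: mlt_def algebra_simps)
qed

lemma mlt_mult: assumes "mlt g" "mlt h" shows "mlt (\<lambda>q. g q * h q)"
  unfolding mlt_def
proof (intro conjI ballI)
  show "(\<lambda>q. g q * h q) \<in> borel_measurable M" using assms by (auto simp: mlt_def)
  from assms obtain K J where *: "\<forall>q\<in>space M. cmod (g q) \<le> K" "\<forall>q\<in>space M. cmod (h q) \<le> J" by (auto simp: mlt_def)
  show "\<exists>K. \<forall>q\<in>space M. cmod (g q * h q) \<le> K"
  proof (intro exI ballI)
    fix q assume "q \<in> space M"
    then show "cmod (g q * h q) \<le> \<bar>K\<bar> * \<bar>J\<bar>" using * unfolding norm_mult by (intro mult_mono) force+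
  qed
  fix \<psi> assume "\<psi> \<in> cl"
  then have "(\<lambda>q. h q * \<psi> q) \<in> cl" using assms(2) by (simp add: mlt_def)
  then have "(\<lambda>q. g q * (h q * \<psi> q)) \<in> cl"
    by (rule bspec[OF conjunct2[OF conjunct2[OF assms(1)[unfolded mlt_def]]]])
  then show "(\<lambda>q. (g q * h q) * \<psi> q) \<in> cl" by (simp add: mult.assoc)
qed

lemma mlt_diff: "mlt g \<Longrightarrow> mlt h \<Longrightarrow> mlt (\<lambda>q. g q - h q)"
  using mlt_add[OF _ mlt_mult[OF mlt_const[of "-1"]], of g h] by simp

lemma mlt_sum: "(\<And>i. i \<in> J \<Longrightarrow> mlt (h i)) \<Longrightarrow> mlt (\<lambda>q. \<Sum>i\<in>J. h i q)"
  by (induction J rule: infinite_finite_induct) (simp_all add: mlt_const mlt_add)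

text \<open>A uniform bound K makes K |psi| a majorant, so the products converge in L^2 and the
  closed set \<open>cl\<close> contains the limit.\<close>

lemma mlt_limit:
  assumes "\<And>n. mlt (h n)" and bd: "\<And>n q. q \<in> space M \<Longrightarrow> cmod (h n q) \<le> K"
    and lim: "\<And>q. q \<in> space M \<Longrightarrow> (\<lambda>n. h n q) \<longlonglongrightarrow> g q"
  shows "mlt g"
  unfolding mlt_def
proof (intro conjI ballI)
  have hm: "h n \<in> borel_measurable M" for n using assms(1) by (simp add: mlt_def)
  show gm: "g \<in> borel_measurable M" by (rule borel_measurable_LIMSEQ_metric[OF hm lim])
  have "cmod (g q) \<le> K" if "q \<in> space M" for q
    by (rule Lim_bounded[OF tendsto_norm[OF lim[OF that]]]) (use bd that in auto)
  then show "\<exists>K. \<forall>q\<in>space M. cmod (g q) \<le> K" by blast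
  fix \<psi> assume \<psi>: "\<psi> \<in> cl"
  have \<psi>m: "\<psi> \<in> borel_measurable M" by (rule L2_measurable[OF cl_L2[OF \<psi>]])
  have w: "integrable M (\<lambda>q. (K * cmod (\<psi> q))\<^sup>2)" using L2_integrable[OF cl_L2[OF \<psi>]] by (simp add: power_mult_distrib)
  have l: "AE q in M. (\<lambda>n. h n q * \<psi> q) \<longlonglongrightarrow> g q * \<psi> q" by (intro AE_I2 tendsto_mult tendsto_const lim)
  have b: "AE q in M. cmod (h n q * \<psi> q) \<le> K * cmod (\<psi> q)" for n
    by (rule AE_I2) (auto simp: norm_mult intro!: mult_right_mono bd)
  note dc = l2_dominated_convergence[OF borel_measurable_times[OF hm \<psi>m] borel_measurable_times[OF gm \<psi>m] w l b]
  show "(\<lambda>q. g q * \<psi> q) \<in> cl"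
    using assms(1) \<psi> by (intro cl_closed[OF dc(1) _ dc(2)]) (auto simp: mlt_def)
qed

text \<open>Multiplication by exp(i k q_x) is the Weyl operator with label k delta_x, which
  preserves the closure.\<close>

lemma mlt_exp: assumes x: "x \<in> I" shows "mlt (\<lambda>q. exp (\<i> * complex_of_real (k * q x)))"
  unfolding mlt_def
proof (intro conjI ballI)
  show "(\<lambda>q. exp (\<i> * complex_of_real (k * q x))) \<in> borel_measurable M"
    using measurable_cfgM_component[OF x] by measurable
  show "\<exists>K. \<forall>q\<in>space M. cmod (exp (\<i> * complex_of_real (k * q x))) \<le> K" by (intro exI[of _ 1]) (simp only: norm_exp_i_times order_refl simp_thms ball_triv)
  fix \<psi> assume \<psi>: "\<psi> \<in> cl"
  let ?f = "\<lambda>y. if y = x then complex_of_real k else 0"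
  show "(\<lambda>q. exp (\<i> * complex_of_real (k * q x)) * \<psi> q) \<in> cl"
  proof (rule cl_cong[OF cl_Weyl[OF \<psi>, of ?f]])
    fix q assume q: "q \<in> space M"
    have "phase nu L ?f q = k * q x" unfolding phase_def using x by (simp add: if_distrib[of Re] if_distrib[of Im] if_distrib[of "\<lambda>a. a * _"] cong: if_cong)
    moreover have "shift_by I (\<lambda>y. Im (?f y)) q = q" using q by (auto simp: space_cfgM restrict_def PiE_def extensional_def)
    ultimately show "exp (\<i> * complex_of_real (k * q x)) * \<psi> q = W ?f \<psi> q" by (simp only: Weyl_eq)
  qed
qed

lemma mlt_sin: assumes x: "x \<in> I" shows "mlt (\<lambda>q. complex_of_real (sin (k * (q x - a))))"
proof -
  have "mlt (\<lambda>q. (exp (\<i> * complex_of_real (- k * a)) / (2 * \<i>)) * exp (\<i> * complex_of_real (k * q x))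
      - (exp (\<i> * complex_of_real (k * a)) / (2 * \<i>)) * exp (\<i> * complex_of_real (- k * q x)))"
    by (intro mlt_diff mlt_mult mlt_const mlt_exp x)
  moreover have "complex_of_real (sin (k * (r - a))) = (exp (\<i> * complex_of_real (- k * a)) / (2 * \<i>)) * exp (\<i> * complex_of_real (k * r))
      - (exp (\<i> * complex_of_real (k * a)) / (2 * \<i>)) * exp (\<i> * complex_of_real (- k * r))" for r
  proof -
    have "complex_of_real (sin (k * (r - a))) = (exp (\<i> * complex_of_real (k * (r - a))) - exp (- (\<i> * complex_of_real (k * (r - a))))) / (2 * \<i>)"
      by (simp only: sin_of_real[symmetric] sin_exp_eq)
    also have "\<i> * complex_of_real (k * (r - a)) = \<i> * complex_of_real (- k * a) + \<i> * complex_of_real (k * r)"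
      by (simp add: complex_eq_iff algebra_simps)
    also have "- (\<i> * complex_of_real (- k * a) + \<i> * complex_of_real (k * r)) = \<i> * complex_of_real (k * a) + \<i> * complex_of_real (- k * r)"
      by (simp add: complex_eq_iff)
    finally show ?thesis by (simp only: exp_add diff_divide_distrib times_divide_eq_left)
  qed
  ultimately show ?thesis by simp
qed

lemma mlt_polynomial:
  assumes "real_polynomial_function p" "mlt (\<lambda>q. complex_of_real (h q))"
  shows "mlt (\<lambda>q. complex_of_real (p (h q)))"
  using assms(1)
proof (induction rule: real_polynomial_function.induct)
  case (linear f)
  interpret f: bounded_linear f by fact
  have "f s = s * f 1" for s using f.scaleR[of s 1] by simp
  then have "(\<lambda>q. complex_of_real (f (h q))) = (\<lambda>q. of_real (h q) * of_real (f 1))" by (metis of_real_mult)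
  then show ?case using mlt_mult[OF assms(2) mlt_const[of "of_real (f 1)"]] by simp
qed (simp_all add: mlt_const mlt_add mlt_mult)

text \<open>The ramps \<open>\<phi> m\<close> increase to the indicator of the positive reals.
  Weierstrass approximation on [-1, 1] within 1/(m+1) replaces them by polynomials bounded by 2,
  which are admissible in h.\<close>

lemma mlt_pos:
  assumes h: "mlt (\<lambda>q. complex_of_real (h q))" and b: "\<And>q. q \<in> space M \<Longrightarrow> \<bar>h q\<bar> \<le> 1"
  shows "mlt (\<lambda>q. if 0 < h q then 1 else 0)"
proof -
  define \<phi> where "\<phi> m s = min 1 (max 0 (real m * s))" for m s
  have "\<exists>p. real_polynomial_function p \<and> (\<forall>s\<in>{-1..1}. \<bar>\<phi> m s - p s\<bar> < 1 / real (Suc m))" for m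
  proof -
    have "continuous_on {-1..1} (\<phi> m)" unfolding \<phi>_def by (intro continuous_intros)
    then obtain p where "real_polynomial_function p" "\<And>s. s \<in> {-1..1} \<Longrightarrow> \<bar>\<phi> m s - p s\<bar> < 1 / real (Suc m)"
      using Stone_Weierstrass_real_polynomial_function[of "{-1..1}" "\<phi> m" "1 / real (Suc m)"] by auto
    then show ?thesis by blast
  qed
  then obtain p where p: "\<And>m. real_polynomial_function (p m)" "\<And>m s. s \<in> {-1..1} \<Longrightarrow> \<bar>\<phi> m s - p m s\<bar> < 1 / real (Suc m)"
    by metis
  show ?thesis
  proof (rule mlt_limit[of "\<lambda>m q. complex_of_real (p m (h q))" 2])
    show "mlt (\<lambda>q. complex_of_real (p m (h q)))" for m by (rule mlt_polynomial[OF p(1) h])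
    fix q assume q: "q \<in> space M"
    have hq: "h q \<in> {-1..1}" using b[OF q] by auto
    show "cmod (complex_of_real (p m (h q))) \<le> 2" for m
    proof -
      have "\<bar>\<phi> m (h q) - p m (h q)\<bar> < 1" using p(2)[OF hq, of m] by (rule order.strict_trans2) simp
      moreover have "\<bar>\<phi> m (h q)\<bar> \<le> 1" by (auto simp: \<phi>_def)
      ultimately show ?thesis by simp
    qed
    have "(\<lambda>m. \<phi> m (h q)) \<longlonglongrightarrow> (if 0 < h q then 1 else 0)"
    proof (cases "0 < h q")
      case True
      obtain n0 :: nat where n0: "1 / h q \<le> real n0" using real_arch_simple by blast
      have "\<phi> m (h q) = 1" if "n0 \<le> m" for m
      proof -
        have "1 / h q \<le> real m" using n0 that by linarith
        then have "1 \<le> real m * h q" using True by (simp add: divide_le_eq)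
        then show ?thesis by (simp add: \<phi>_def)
      qed
      then have "\<forall>\<^sub>F m in sequentially. \<phi> m (h q) = 1" by (auto simp: eventually_sequentially)
      then show ?thesis using True by (simp add: tendsto_eventually)
    next
      case False
      then have "real m * h q \<le> 0" for m by (simp add: mult_nonneg_nonpos)
      then have "\<phi> m (h q) = 0" for m by (simp add: \<phi>_def max_absorb1)
      then show ?thesis using False by simp
    qed
    moreover have "(\<lambda>m. \<phi> m (h q) - p m (h q)) \<longlonglongrightarrow> 0"
    proof (rule Lim_null_comparison)
      show "\<forall>\<^sub>F m in sequentially. norm (\<phi> m (h q) - p m (h q)) \<le> 1 / real (Suc m)"
        using p(2)[OF hq] by (intro always_eventually allI) (auto intro: less_imp_le)
      show "(\<lambda>m. 1 / real (Suc m)) \<longlonglongrightarrow> 0" by (rule LIMSEQ_Suc[OF lim_1_over_n])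
    qed
    ultimately have "(\<lambda>m. \<phi> m (h q) - (\<phi> m (h q) - p m (h q))) \<longlonglongrightarrow> (if 0 < h q then 1 else 0) - 0"
      by (rule tendsto_diff)
    then have "(\<lambda>m. p m (h q)) \<longlonglongrightarrow> (if 0 < h q then 1 else 0)" by simp
    then have "(\<lambda>m. complex_of_real (p m (h q))) \<longlonglongrightarrow> of_real (if 0 < h q then 1 else 0)" by (rule tendsto_of_real)
    then show "(\<lambda>m. complex_of_real (p m (h q))) \<longlonglongrightarrow> (if 0 < h q then 1 else 0)" by (cases "0 < h q") auto
  qed
qed

text \<open>For large \<open>n\<close> the sign of \<open>q x - a\<close> is that of \<open>sin ((q x - a) / n)\<close>, a trigonometric polynomial.\<close>

lemma mlt_halfline: assumes x: "x \<in> I" shows "mlt (\<lambda>q. if a < q x then 1 else 0)"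
proof (rule mlt_limit[of "\<lambda>n q. if 0 < sin (1 / real (Suc n) * (q x - a)) then 1 else 0" 1])
  show "mlt (\<lambda>q. if 0 < sin (1 / real (Suc n) * (q x - a)) then 1 else 0)" for n
    by (rule mlt_pos[OF mlt_sin[OF x]]) (simp add: abs_sin_le_one)
  fix q
  obtain n0 :: nat where n0: "\<bar>q x - a\<bar> / pi < real n0" using reals_Archimedean2 by blast
  have "(0 < sin (1 / real (Suc n) * (q x - a))) = (a < q x)" if "n0 \<le> n" for n
  proof -
    let ?s = "1 / real (Suc n) * (q x - a)"
    have "\<bar>q x - a\<bar> / pi < real (Suc n)" using n0 that by linarith
    then have "\<bar>q x - a\<bar> < pi * real (Suc n)" by (simp add: divide_less_eq mult.commute)
    then have "\<bar>?s\<bar> < pi" by (simp add: abs_mult divide_less_eq)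
    then have s: "- pi < ?s" "?s < pi" unfolding abs_less_iff by linarith+
    have "0 < sin ?s" if "0 < ?s" using sin_gt_zero[OF that s(2)] .
    moreover have "sin ?s \<le> 0" if "?s \<le> 0" using sin_ge_zero[of "- ?s"] s that by (simp only: sin_minus) linarith
    moreover have "0 < ?s \<longleftrightarrow> a < q x" by (simp add: zero_less_divide_iff)
    ultimately show ?thesis by linarith
  qed
  then have "\<forall>\<^sub>F n in sequentially. (if 0 < sin (1 / real (Suc n) * (q x - a)) then 1 else 0) = (if a < q x then 1 else (0::complex))"
    unfolding eventually_sequentially by (intro exI[of _ n0]) simp
  then show "(\<lambda>n. if 0 < sin (1 / real (Suc n) * (q x - a)) then 1 else 0) \<longlonglongrightarrow> (if a < q x then 1 else (0::complex))"
    by (rule tendsto_eventually)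
qed auto

definition mltset where "mltset A \<longleftrightarrow> mlt (\<lambda>q. if q \<in> A then 1 else 0)"

lemma mltset_Compl: "mltset A \<Longrightarrow> mltset (space M - A)"
  unfolding mltset_def by (rule mlt_cong[OF mlt_diff[OF mlt_const[of 1]]]) auto

lemma mltset_Un: "mltset A \<Longrightarrow> mltset C \<Longrightarrow> mltset (A \<union> C)"
  unfolding mltset_def
  by (rule mlt_cong[OF mlt_diff[OF mlt_add mlt_mult, of "\<lambda>q. if q \<in> A then 1 else 0" "\<lambda>q. if q \<in> C then 1 else 0"
     "\<lambda>q. if q \<in> A then 1 else 0" "\<lambda>q. if q \<in> C then 1 else 0"]]) auto

lemma mltset_UN: assumes "\<And>n::nat. mltset (A n)" shows "mltset (\<Union>n. A n)"
proof -
  have fin: "mltset (\<Union>i<n. A i)" for n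
  proof (induction n)
    case 0
    then show ?case using mlt_const[of 0] by (simp add: mltset_def)
  next
    case (Suc n)
    have "(\<Union>i<Suc n. A i) = (\<Union>i<n. A i) \<union> A n" by (auto simp: less_Suc_eq)
    then show ?case using mltset_Un[OF Suc assms[of n]] by simp
  qed
  show ?thesis unfolding mltset_def
  proof (rule mlt_limit[of "\<lambda>n q. if q \<in> (\<Union>i<n. A i) then 1 else 0" 1])
    show "mlt (\<lambda>q. if q \<in> (\<Union>i<n. A i) then 1 else 0)" for n using fin[of n] by (simp only: mltset_def)
    fix q
    have "\<forall>\<^sub>F n in sequentially. (if q \<in> (\<Union>i<n. A i) then 1 else 0) = (if q \<in> (\<Union>n. A n) then 1 else (0::complex))"
    proof (cases "q \<in> (\<Union>n. A n)")
      case True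
      then obtain m where "q \<in> A m" by blast
      then have "q \<in> (\<Union>i<n. A i)" if "Suc m \<le> n" for n using that by auto
      then show ?thesis using True unfolding eventually_sequentially by (intro exI[of _ "Suc m"]) auto
    qed auto
    then show "(\<lambda>n. if q \<in> (\<Union>i<n. A i) then 1 else 0) \<longlonglongrightarrow> (if q \<in> (\<Union>n. A n) then 1 else (0::complex))"
      by (rule tendsto_eventually)
  qed auto
qed

text \<open>Open half-lines generate the Borel sets, and the admissible sets are closed under
  complements and countable unions.\<close>

lemma mltset_component:
  assumes x: "x \<in> I" and A: "A \<in> sets borel"
  shows "mltset {q \<in> space M. q x \<in> A}"
proof -
  have "A \<in> sigma_sets UNIV (range greaterThan)"
    using A by (simp add: borel_Ioi[where 'a=real] sets_measure_of)
  then show ?thesis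
  proof (induction rule: sigma_sets.induct)
    case (Basic A)
    then obtain a where "A = {a<..}" by blast
    then show ?case unfolding mltset_def by (intro mlt_cong[OF mlt_halfline[OF x, of a]]) auto
  next
    case Empty
    then show ?case using mlt_const[of 0] by (simp add: mltset_def)
  next
    case (Compl A)
    have "{q \<in> space M. q x \<in> UNIV - A} = space M - {q \<in> space M. q x \<in> A}" by auto
    then show ?case using mltset_Compl[OF Compl.IH] by simp
  next
    case (Union A)
    have "{q \<in> space M. q x \<in> (\<Union>i. A i)} = (\<Union>i. {q \<in> space M. q x \<in> A i})" by auto
    then show ?case using mltset_UN[OF Union.IH] by simp
  qed
qed

lemma mltset_sets: assumes "A \<in> sets M" shows "mltset A"
proof -
  have "A \<in> sigma_sets (space M) {{f \<in> space M. f i \<in> A} | i A. i \<in> I \<and> A \<in> sets borel}"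
    using assms sets_PiM_single[of I "\<lambda>_. lborel :: real measure"] by (simp add: cfgM_def space_PiM)
  then show ?thesis
  proof (induction rule: sigma_sets.induct)
    case (Basic A)
    then show ?case using mltset_component by blast
  next
    case Empty
    then show ?case using mlt_const[of 0] by (simp add: mltset_def)
  qed (auto intro: mltset_Compl mltset_UN)
qed

text \<open>The ground state vanishes nowhere. The quotient psi / \<open>\<Omega>\<close> is a
  pointwise limit of simple functions of at most twice its modulus; multiplied by
  \<open>\<Omega>\<close>, they lie in the closure and are dominated by 2 |psi|.\<close>

lemma cl_eq_L2: "cl = L2 M"
proof
  show "cl \<subseteq> L2 M" by (auto simp: cl_L2)
  show "L2 M \<subseteq> cl"
  proof
    fix \<psi> assume \<psi>: "\<psi> \<in> L2 M"
    have \<Omega>0: "\<Omega> q \<noteq> 0" for q by (simp add: \<Omega>_def gs_def)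
    have \<Omega>m: "\<Omega> \<in> borel_measurable M" by (simp add: \<Omega>_def gs_measurable)
    have "(\<lambda>q. \<psi> q / \<Omega> q) \<in> borel_measurable M" using L2_measurable[OF \<psi>] \<Omega>m by measurable
    from borel_measurable_implies_sequence_metric[OF this, of 0]
    obtain F where F0: "\<forall>i. simple_function M (F i)" "\<forall>q\<in>space M. (\<lambda>i. F i q) \<longlonglongrightarrow> \<psi> q / \<Omega> q"
      "\<forall>i. \<forall>q\<in>space M. dist (F i q) 0 \<le> 2 * dist (\<psi> q / \<Omega> q) 0" by blast
    have F: "simple_function M (F i)" "q \<in> space M \<Longrightarrow> (\<lambda>i. F i q) \<longlonglongrightarrow> \<psi> q / \<Omega> q"
      "q \<in> space M \<Longrightarrow> cmod (F i q) \<le> 2 * cmod (\<psi> q / \<Omega> q)" for i q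
      using F0 unfolding dist_0_norm norm_conv_dist[symmetric] by (blast, blast, blast)
    have "mlt (F i)" for i
    proof (rule mlt_cong)
      show "mlt (\<lambda>q. \<Sum>y\<in>F i ` space M. y * (if q \<in> F i -` {y} \<inter> space M then 1 else 0))"
      proof (intro mlt_sum mlt_mult mlt_const)
        fix y
        have "mltset (F i -` {y} \<inter> space M)"
          by (rule mltset_sets) (use simple_functionD(2)[OF F(1)] in blast)
        then show "mlt (\<lambda>q. if q \<in> F i -` {y} \<inter> space M then 1 else 0)" by (simp only: mltset_def)
      qed
      fix q assume "q \<in> space M"
      then show "F i q = (\<Sum>y\<in>F i ` space M. y * (if q \<in> F i -` {y} \<inter> space M then 1 else 0))"
        using simple_functionD(1)[OF F(1)[of i]]
        by (simp add: if_distrib[of "\<lambda>a. _ * a"] cong: if_cong)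
    qed
    then have in_cl: "(\<lambda>q. F i q * \<Omega> q) \<in> cl" for i using cl_\<Omega> by (auto simp: mlt_def)
    have w: "integrable M (\<lambda>q. (2 * cmod (\<psi> q))\<^sup>2)" using L2_integrable[OF \<psi>] by (simp add: power_mult_distrib)
    show "\<psi> \<in> cl"
    proof (rule cl_closed[OF \<psi> in_cl])
      show "(\<lambda>n. N (\<lambda>q. F n q * \<Omega> q - \<psi> q)) \<longlonglongrightarrow> 0"
      proof (rule l2_dominated_convergence(2)[OF L2_measurable[OF cl_L2[OF in_cl]] L2_measurable[OF \<psi>] w])
        show "AE q in M. (\<lambda>n. F n q * \<Omega> q) \<longlonglongrightarrow> \<psi> q"
        proof (rule AE_I2)
          fix q assume "q \<in> space M"
          then have "(\<lambda>n. F n q * \<Omega> q) \<longlonglongrightarrow> \<psi> q / \<Omega> q * \<Omega> q" by (intro tendsto_intros F)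
          then show "(\<lambda>n. F n q * \<Omega> q) \<longlonglongrightarrow> \<psi> q" using \<Omega>0[of q] by simp
        qed
        show "AE q in M. cmod (F n q * \<Omega> q) \<le> 2 * cmod (\<psi> q)" for n
        proof (rule AE_I2)
          fix q assume q: "q \<in> space M"
          have "cmod (F n q * \<Omega> q) \<le> 2 * cmod (\<psi> q / \<Omega> q) * cmod (\<Omega> q)"
            unfolding norm_mult by (intro mult_right_mono F q) simp
          then show "cmod (F n q * \<Omega> q) \<le> 2 * cmod (\<psi> q)" using \<Omega>0[of q] by (simp add: norm_divide)
        qed
      qed
    qed
  qed
qed

lemma coherent_dense:
  assumes "\<psi> \<in> L2 M" "0 < e" obtains u where "cohpath u" "N (\<lambda>q. \<psi> q - u 0 q) < e"
  using clE[of \<psi> e] assms unfolding cl_eq_L2 by blast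

end

section \<open>Evolution of Weyl operators\<close>

context anharmonic
begin

text \<open>A Weyl operator with moving label, evolved by the full dynamics. If the label follows
  \<open>sol\<close>, the harmonic motion is compensated and only the potential moves this
  curve.\<close>

definition heis :: "(real \<Rightarrow> int list \<Rightarrow> complex) \<Rightarrow> real \<Rightarrow> ((int list \<Rightarrow> real) \<Rightarrow> complex) \<Rightarrow> (int list \<Rightarrow> real) \<Rightarrow> complex" where
  "heis f h \<psi> = U (- h) (W (f h) (U h \<psi>))"

text \<open>Arises from moving the potential past a Weyl operator: the commutator of
  \<open>Vs\<close> with \<open>W f\<close> is \<open>Ms\<close> times \<open>W f\<close>, as
  \<open>Weyl_Vs\<close> records with the factor i.\<close>

definition Ms :: "(int list \<Rightarrow> real) \<Rightarrow> (int list \<Rightarrow> real) \<Rightarrow> real" where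
  "Ms b q = Vs q - Vs (shift_by I b q)"

definition KV :: real where "KV = real (card I) * Vb"

lemma KV_nonneg: "0 \<le> KV"
  using order_trans[OF abs_ge_zero Vs_bound] by (simp add: KV_def)

lemma Ms_measurable: "Ms b \<in> borel_measurable M"
  unfolding Ms_def[abs_def]
  by (intro borel_measurable_diff Vs_measurable measurable_compose[OF measurable_cfgM_shift Vs_measurable])

lemma Ms_bound: "\<bar>Ms b q\<bar> \<le> 2 * KV"
  using Vs_bound[of q] Vs_bound[of "shift_by I b q"] by (simp add: Ms_def KV_def)

lemma Ms_mult_L2: "\<psi> \<in> L2 M \<Longrightarrow> (\<lambda>q. (\<i> * of_real (Ms b q)) * \<psi> q) \<in> L2 M"
  by (rule L2_mult_bounded[where K = "2 * KV"])
     (auto simp: norm_mult Ms_bound intro!: borel_measurable_times measurable_of_real_compose Ms_measurable)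

lemma Ms_mult_norm: "\<psi> \<in> L2 M \<Longrightarrow> N (\<lambda>q. (\<i> * of_real (Ms b q)) * \<psi> q) \<le> 2 * KV * N \<psi>"
  using KV_nonneg by (intro l2norm_mult_bounded)
     (auto simp: norm_mult Ms_bound intro!: borel_measurable_times measurable_of_real_compose Ms_measurable)

lemma heis_L2: "\<psi> \<in> L2 M \<Longrightarrow> heis f h \<psi> \<in> L2 M"
  unfolding heis_def by (intro U_L2 Weyl_L2)

lemma heis_norm: "\<psi> \<in> L2 M \<Longrightarrow> N (heis f h \<psi>) = N \<psi>"
  unfolding heis_def by (simp add: U_norm U_L2 Weyl_L2 Weyl_l2norm L2_measurable)

section \<open>Differentiability of the Heisenberg curve\<close>

lemma Weyl_cong:
  assumes "\<psi> \<in> L2 M" "\<phi> \<in> L2 M" "AE q in M. \<psi> q = \<phi> q"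
  shows "AE q in M. W f \<psi> q = W f \<phi> q"
proof -
  have "N (W f (\<lambda>q. \<psi> q - \<phi> q)) = N (\<lambda>q. \<psi> q - \<phi> q)" by (intro Weyl_l2norm L2_measurable L2_diff assms)
  also have "\<dots> = N (\<lambda>q. 0)" by (rule l2norm_cong_AE) (use assms(3) in \<open>auto elim: eventually_mono\<close>)
  finally have "N (\<lambda>q. W f \<psi> q - W f \<phi> q) = 0" by (simp add: Weyl_diff)
  then have "AE q in M. W f \<psi> q - W f \<phi> q = 0" by (intro l2norm_zero_AE L2_diff Weyl_L2 assms)
  then show ?thesis by (auto elim: eventually_mono)
qed

lemma heis_lin:
  assumes "\<psi> \<in> L2 M" "\<phi> \<in> L2 M"
  shows "AE q in M. heis f h (\<lambda>q. a * \<psi> q + b * \<phi> q) q = a * heis f h \<psi> q + b * heis f h \<phi> q"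
proof -
  have L: "U h (\<lambda>q. a * \<psi> q + b * \<phi> q) \<in> L2 M" "(\<lambda>q. a * U h \<psi> q + b * U h \<phi> q) \<in> L2 M"
    by (intro U_L2 L2_add L2_cmult assms)+
  have "AE q in M. W (f h) (U h (\<lambda>q. a * \<psi> q + b * \<phi> q)) q = W (f h) (\<lambda>q. a * U h \<psi> q + b * U h \<phi> q) q"
    by (rule Weyl_cong[OF L U_lin[OF assms]])
  from U_cong[OF Weyl_L2[OF L(1)] Weyl_L2[OF L(2)] this, of "- h"]
  show ?thesis unfolding heis_def Weyl_lin
    using U_lin[OF Weyl_L2[OF U_L2[OF assms(1)]] Weyl_L2[OF U_L2[OF assms(2)]]]
    by eventually_elim simp
qed

lemma heis_lin': 
  assumes "\<psi> \<in> L2 M" "\<phi> \<in> L2 M"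
  shows "AE q in M. heis f h (\<lambda>q. \<psi> q - \<phi> q) q = heis f h \<psi> q - heis f h \<phi> q"
  using heis_lin[OF assms, of f h 1 "-1"] by simp

lemma heis_diff_norm:
  assumes "\<psi> \<in> L2 M" "\<phi> \<in> L2 M"
  shows "N (\<lambda>q. heis f h \<psi> q - heis f h \<phi> q) = N (\<lambda>q. \<psi> q - \<phi> q)"
proof -
  have "N (\<lambda>q. heis f h \<psi> q - heis f h \<phi> q) = N (heis f h (\<lambda>q. \<psi> q - \<phi> q))"
    by (rule l2norm_cong_AE) (use heis_lin'[OF assms, of f h] in \<open>auto elim: eventually_mono\<close>)
  then show ?thesis by (simp add: heis_norm L2_diff assms)
qed

text \<open>U_h u(0) leaves the coherent span, so it is compared with u(h), which the Weyl operator
  sends to v(h). The correction U_(-h) u(h) - u(0) is of order h by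
  \<open>cohpath_lipschitz\<close>.\<close>

lemma heis_coherent:
  assumes "cohpath u" "sol f"
  obtains v where "cohpath v" "AE q in M. v 0 q = W (f 0) (u 0) q" "N (v 0) = N (u 0)"
    "\<And>h. AE q in M. heis f h (u 0) q = U (- h) (v h) q - heis f h (\<lambda>q. U (- h) (u h) q - u 0 q) q"
proof -
  note Lu = cohpath_L2[OF assms(1)]
  obtain v where v: "cohpath v" "\<And>t q. q \<in> space M \<Longrightarrow> v t q = W (f t) (u t) q"
    using cohpath_Weyl[OF assms] by blast
  note Lv = cohpath_L2[OF v(1)]
  have vA: "AE q in M. v t q = W (f t) (u t) q" for t by (rule AE_I2) (rule v)
  have "N (v 0) = N (W (f 0) (u 0))" by (rule l2norm_cong_AE[OF vA])
  then have n: "N (v 0) = N (u 0)" by (simp add: Weyl_l2norm L2_measurable Lu)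
  have "AE q in M. heis f h (u 0) q = U (- h) (v h) q - heis f h (\<lambda>q. U (- h) (u h) q - u 0 q) q" for h
  proof -
    have "AE q in M. W (f h) (U h (U (- h) (u h))) q = W (f h) (u h) q"
      by (intro Weyl_cong U_inv U_L2 Lu)
    then have "AE q in M. W (f h) (U h (U (- h) (u h))) q = v h q" using vA[of h] by eventually_elim simp
    then have "AE q in M. heis f h (U (- h) (u h)) q = U (- h) (v h) q"
      unfolding heis_def by (intro U_cong Weyl_L2 U_L2 Lu Lv)
    then show ?thesis using heis_lin'[OF U_L2[OF Lu] Lu, of f h "- h" h 0] by eventually_elim simp
  qed
  then show thesis by (intro that[OF v(1) vA n])
qed

lemma heis_lipschitz_coherent:
  assumes "cohpath u" "sol f"
  shows "N (\<lambda>q. heis f h (u 0) q - W (f 0) (u 0) q) \<le> 2 * KV * \<bar>h\<bar> * N (u 0)"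
proof -
  obtain v where v: "cohpath v" "AE q in M. v 0 q = W (f 0) (u 0) q" "N (v 0) = N (u 0)"
    "\<And>h. AE q in M. heis f h (u 0) q = U (- h) (v h) q - heis f h (\<lambda>q. U (- h) (u h) q - u 0 q) q"
    using heis_coherent[OF assms] by blast
  note Lu = cohpath_L2[OF assms(1)] and Lv = cohpath_L2[OF v(1)]
  let ?D = "\<lambda>q. U (- h) (u h) q - u 0 q"
  have D: "?D \<in> L2 M" by (intro L2_diff U_L2 Lu)
  have "N (\<lambda>q. heis f h (u 0) q - W (f 0) (u 0) q) = N (\<lambda>q. (U (- h) (v h) q - v 0 q) - heis f h ?D q)"
    by (rule l2norm_cong_AE) (use v(2) v(4)[of h] in \<open>eventually_elim, simp\<close>)
  also have "\<dots> \<le> N (\<lambda>q. U (- h) (v h) q - v 0 q) + N (heis f h ?D)"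
    by (intro l2norm_diff_le L2_diff U_L2 Lv heis_L2 D)
  also have "N (heis f h ?D) = N ?D" by (rule heis_norm[OF D])
  finally show ?thesis
    using cohpath_lipschitz[OF assms(1), of h] cohpath_lipschitz[OF v(1), of h] v(3) by (simp add: KV_def mult_ac)
qed

text \<open>The bound is uniform on coherent states, hence holds on all of \<open>L\<^sup>2\<close> by density; this takes the place of
  essential self-adjointness of the Hamiltonian.\<close>

lemma heis_lipschitz:
  assumes \<psi>: "\<psi> \<in> L2 M" and f: "sol f"
  shows "N (\<lambda>q. heis f h \<psi> q - W (f 0) \<psi> q) \<le> 2 * KV * \<bar>h\<bar> * N \<psi>"
proof (rule field_le_epsilon)
  fix e :: real assume e: "0 < e"
  define r where "r = e / (2 + 2 * KV * \<bar>h\<bar>)"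
  have d: "0 < 2 + 2 * KV * \<bar>h\<bar>" using KV_nonneg by (simp add: add_pos_nonneg)
  have "0 < r" using e d by (simp add: r_def)
  then obtain u where u: "cohpath u" "N (\<lambda>q. \<psi> q - u 0 q) < r" by (rule coherent_dense[OF \<psi>])
  note Lu = cohpath_L2[OF u(1), of 0]
  have "N (\<lambda>q. heis f h \<psi> q - W (f 0) \<psi> q) \<le> N (\<lambda>q. heis f h \<psi> q - heis f h (u 0) q) + N (\<lambda>q. heis f h (u 0) q - W (f 0) \<psi> q)"
    by (intro l2norm_triangle_diff heis_L2 Weyl_L2 \<psi> Lu)
  also have "N (\<lambda>q. heis f h (u 0) q - W (f 0) \<psi> q) \<le> N (\<lambda>q. heis f h (u 0) q - W (f 0) (u 0) q) + N (\<lambda>q. W (f 0) (u 0) q - W (f 0) \<psi> q)"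
    by (intro l2norm_triangle_diff heis_L2 Weyl_L2 \<psi> Lu)
  also have "N (\<lambda>q. W (f 0) (u 0) q - W (f 0) \<psi> q) = N (\<lambda>q. u 0 q - \<psi> q)"
    using Weyl_l2norm[OF L2_measurable[OF L2_diff[OF Lu \<psi>]], of "f 0"] by (simp add: Weyl_diff)
  also have "N (\<lambda>q. heis f h \<psi> q - heis f h (u 0) q) = N (\<lambda>q. \<psi> q - u 0 q)" by (rule heis_diff_norm[OF \<psi> Lu])
  also have "N (\<lambda>q. heis f h (u 0) q - W (f 0) (u 0) q) \<le> 2 * KV * \<bar>h\<bar> * (N \<psi> + r)"
  proof (rule order_trans[OF heis_lipschitz_coherent[OF u(1) f]])
    have "N (u 0) \<le> N \<psi> + r" using l2norm_le_add_diff[OF Lu \<psi>] u(2) l2norm_minus_commute[of M \<psi> "u 0"] by simp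
    then show "2 * KV * \<bar>h\<bar> * N (u 0) \<le> 2 * KV * \<bar>h\<bar> * (N \<psi> + r)" using KV_nonneg by (intro mult_left_mono) auto
  qed
  finally have "N (\<lambda>q. heis f h \<psi> q - W (f 0) \<psi> q) \<le> 2 * KV * \<bar>h\<bar> * N \<psi> + (2 + 2 * KV * \<bar>h\<bar>) * r"
    using u(2) l2norm_minus_commute[of M \<psi> "u 0"] by (simp add: algebra_simps)
  also have "(2 + 2 * KV * \<bar>h\<bar>) * r = e" using d by (simp add: r_def)
  finally show "N (\<lambda>q. heis f h \<psi> q - W (f 0) \<psi> q) \<le> 2 * KV * \<bar>h\<bar> * N \<psi> + e" .
qed

lemma Weyl_Vs:
  "(\<i> * of_real (Vs q)) * W f \<psi> q - W f (\<lambda>q. (\<i> * of_real (Vs q)) * \<psi> q) q = (\<i> * of_real (Ms (\<lambda>y. Im (f y)) q)) * W f \<psi> q"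
  by (simp add: Weyl_eq Ms_def algebra_simps)

text \<open>The curve v contributes i \<open>Vs\<close> W u(0), the correction contributes -W (i
  \<open>Vs\<close> u(0)), and together they form the commutator. Continuity of \<open>heis\<close>
  at i \<open>Vs\<close> u(0) is needed, a vector outside the coherent span, hence the Lipschitz
  bound on all of L^2.\<close>

lemma heis_sder_coherent:
  assumes u: "cohpath u" and f: "sol f"
  shows "((\<lambda>h. N (\<lambda>q. (heis f h (u 0) q - W (f 0) (u 0) q) / of_real h
     - (\<i> * of_real (Ms (\<lambda>y. Im (f 0 y)) q)) * W (f 0) (u 0) q)) \<longlongrightarrow> 0) (at 0)"
proof -
  obtain v where v: "cohpath v" "AE q in M. v 0 q = W (f 0) (u 0) q" "N (v 0) = N (u 0)"
    "\<And>h. AE q in M. heis f h (u 0) q = U (- h) (v h) q - heis f h (\<lambda>q. U (- h) (u h) q - u 0 q) q"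
    using heis_coherent[OF assms] by blast
  note Lu = cohpath_L2[OF assms(1)] and Lv = cohpath_L2[OF v(1)]
  let ?e = "\<lambda>w q. (\<i> * of_real (Vs q)) * w q"
  let ?Q = "\<lambda>w h q. (U (- h) (w h) q - w 0 q) / complex_of_real h"
  have LQ: "?Q u h \<in> L2 M" "?Q v h \<in> L2 M" for h by (intro L2_divide L2_diff U_L2 Lu Lv)+
  have lim: "((\<lambda>h. N (\<lambda>q. ?Q w h q - ?e (w 0) q)) \<longlongrightarrow> 0) (at 0)" if w: "cohpath w" for w
  proof -
    have "N (\<lambda>q. (U (- (0 + h)) (w (0 + h)) q - U (- 0) (w 0) q) / complex_of_real h - U (- 0) (?e (w 0)) q) = N (\<lambda>q. ?Q w h q - ?e (w 0) q)" for h
      by (rule l2norm_cong_AE)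
         (use U_0[OF cohpath_L2[OF w], of 0] U_0[OF Vs_mult_L2[OF cohpath_L2[OF w]], of 0] in \<open>eventually_elim, simp\<close>)
    then show ?thesis using cohpath_sder[OF w, of 0] by (simp add: sder_def)
  qed
  let ?b = "\<lambda>h. N (\<lambda>q. ?Q v h q - ?e (v 0) q) + (N (\<lambda>q. ?Q u h q - ?e (u 0) q) + 2 * KV * \<bar>h\<bar> * N (?e (u 0)))"
  have "N (\<lambda>q. (heis f h (u 0) q - W (f 0) (u 0) q) / of_real h - (\<i> * of_real (Ms (\<lambda>y. Im (f 0 y)) q)) * W (f 0) (u 0) q) \<le> ?b h" for h
  proof -
    let ?D = "\<lambda>q. U (- h) (u h) q - u 0 q"
    have D: "?D \<in> L2 M" by (intro L2_diff U_L2 Lu)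
    have hQ: "AE q in M. heis f h ?D q / of_real h = heis f h (?Q u h) q"
      using heis_lin[OF D D, of f h "1 / complex_of_real h" 0] by (auto elim!: eventually_mono)
    have "N (\<lambda>q. (heis f h (u 0) q - W (f 0) (u 0) q) / of_real h - (\<i> * of_real (Ms (\<lambda>y. Im (f 0 y)) q)) * W (f 0) (u 0) q)
       = N (\<lambda>q. (?Q v h q - ?e (v 0) q) - (heis f h (?Q u h) q - W (f 0) (?e (u 0)) q))"
      by (rule l2norm_cong_AE) (use v(2) v(4)[of h] hQ in \<open>eventually_elim, simp add: Weyl_Vs[symmetric] diff_divide_distrib\<close>)
    also have "\<dots> \<le> N (\<lambda>q. ?Q v h q - ?e (v 0) q) + N (\<lambda>q. heis f h (?Q u h) q - W (f 0) (?e (u 0)) q)"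
      by (intro l2norm_diff_le L2_diff[OF LQ(2)] L2_diff[OF heis_L2[OF LQ(1)]] Weyl_L2 Vs_mult_L2 Lu Lv)
    also have "N (\<lambda>q. heis f h (?Q u h) q - W (f 0) (?e (u 0)) q) \<le> N (\<lambda>q. heis f h (?Q u h) q - heis f h (?e (u 0)) q) + N (\<lambda>q. heis f h (?e (u 0)) q - W (f 0) (?e (u 0)) q)"
      by (rule l2norm_triangle_diff[OF heis_L2[OF LQ(1)] heis_L2[OF Vs_mult_L2[OF Lu]] Weyl_L2[OF Vs_mult_L2[OF Lu]]])
    also have "N (\<lambda>q. heis f h (?Q u h) q - heis f h (?e (u 0)) q) = N (\<lambda>q. ?Q u h q - ?e (u 0) q)"
      by (rule heis_diff_norm[OF LQ(1) Vs_mult_L2[OF Lu]])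
    also have "N (\<lambda>q. heis f h (?e (u 0)) q - W (f 0) (?e (u 0)) q) \<le> 2 * KV * \<bar>h\<bar> * N (?e (u 0))"
      by (rule heis_lipschitz[OF Vs_mult_L2[OF Lu] f])
    finally show ?thesis by simp
  qed
  then have ev: "\<forall>\<^sub>F h in at 0. norm (N (\<lambda>q. (heis f h (u 0) q - W (f 0) (u 0) q) / of_real h
     - (\<i> * of_real (Ms (\<lambda>y. Im (f 0 y)) q)) * W (f 0) (u 0) q)) \<le> ?b h" by simp
  have "((\<lambda>h::real. 2 * KV * \<bar>h\<bar> * N (?e (u 0))) \<longlongrightarrow> 2 * KV * \<bar>0\<bar> * N (?e (u 0))) (at 0)"
    by (intro tendsto_intros)
  then have "(?b \<longlongrightarrow> 0) (at 0)"
    by (intro tendsto_add_zero lim u v(1)) simp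
  with ev show ?thesis by (rule Lim_null_comparison)
qed

text \<open>The error of the difference quotient is linear in the vector and bounded by 4
  \<open>KV\<close> times its norm, uniformly in h. Differentiability therefore extends from the
  dense coherent states.\<close>

lemma heis_sder_0:
  assumes \<psi>: "\<psi> \<in> L2 M" and f: "sol f"
  shows "((\<lambda>h. N (\<lambda>q. (heis f h \<psi> q - W (f 0) \<psi> q) / of_real h
     - (\<i> * of_real (Ms (\<lambda>y. Im (f 0 y)) q)) * W (f 0) \<psi> q)) \<longlongrightarrow> 0) (at 0)"
proof (rule LIM_I)
  fix r :: real assume r: "0 < r"
  define c where "c = 4 * KV + 1"
  define e where "e = r / (2 * c)"
  have c: "0 < c" using KV_nonneg by (simp add: c_def)
  have e: "0 < e" using r c by (simp add: e_def)
  obtain u where u: "cohpath u" "N (\<lambda>q. \<psi> q - u 0 q) < e" by (rule coherent_dense[OF \<psi> e])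
  note Lu = cohpath_L2[OF u(1), of 0]
  let ?m = "\<lambda>\<psi> q. (\<i> * of_real (Ms (\<lambda>y. Im (f 0 y)) q)) * W (f 0) \<psi> q"
  let ?R = "\<lambda>\<psi> h q. (heis f h \<psi> q - W (f 0) \<psi> q) / of_real h - ?m \<psi> q"
  have LR: "?R \<phi> h \<in> L2 M" if "\<phi> \<in> L2 M" for \<phi> h
    by (intro L2_diff L2_divide heis_L2 Weyl_L2 Ms_mult_L2 that)
  obtain s where s: "0 < s" "\<And>h. h \<noteq> 0 \<Longrightarrow> norm (h - 0) < s \<Longrightarrow> norm (N (?R (u 0) h) - 0) < r / 2"
    using LIM_D[OF heis_sder_coherent[OF u(1) f], of "r / 2"] r by auto
  show "\<exists>s>0. \<forall>h. h \<noteq> 0 \<and> norm (h - 0) < s \<longrightarrow> norm (N (?R \<psi> h) - 0) < r"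
  proof (intro exI conjI allI impI)
    show "0 < s" by fact
    fix h :: real assume h: "h \<noteq> 0 \<and> norm (h - 0) < s"
    let ?\<delta> = "\<lambda>q. \<psi> q - u 0 q"
    have \<delta>: "?\<delta> \<in> L2 M" by (intro L2_diff \<psi> Lu)
    have "N (\<lambda>q. ?R \<psi> h q - ?R (u 0) h q) = N (?R ?\<delta> h)"
      by (rule l2norm_cong_AE)
         (use heis_lin'[OF \<psi> Lu, of f h] in \<open>eventually_elim, simp add: Weyl_diff diff_divide_distrib right_diff_distrib\<close>)
    also have "\<dots> \<le> N (\<lambda>q. (heis f h ?\<delta> q - W (f 0) ?\<delta> q) / of_real h) + N (?m ?\<delta>)"
      by (intro l2norm_diff_le L2_divide L2_diff[OF heis_L2[OF \<delta>]] Weyl_L2 Ms_mult_L2 \<delta>)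
    also have "N (\<lambda>q. (heis f h ?\<delta> q - W (f 0) ?\<delta> q) / of_real h) \<le> 2 * KV * N ?\<delta>"
      using heis_lipschitz[OF \<delta> f, of h] h
      by (subst l2norm_divide[OF L2_diff[OF heis_L2[OF \<delta>] Weyl_L2[OF \<delta>]]]) (simp add: divide_le_eq mult_ac)
    also have "N (?m ?\<delta>) \<le> 2 * KV * N ?\<delta>"
      using Ms_mult_norm[OF Weyl_L2[OF \<delta>]] by (simp add: Weyl_l2norm L2_measurable[OF \<delta>])
    finally have "N (\<lambda>q. ?R \<psi> h q - ?R (u 0) h q) \<le> 4 * KV * N ?\<delta>" by simp
    also have "\<dots> \<le> 4 * KV * e" using u(2) KV_nonneg by (intro mult_left_mono) auto
    also have "\<dots> < c * e" using e by (simp add: c_def algebra_simps)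
    also have "\<dots> = r / 2" using c by (simp add: e_def)
    finally have "N (\<lambda>q. ?R \<psi> h q - ?R (u 0) h q) < r / 2" .
    moreover have "N (?R (u 0) h) < r / 2" using s(2)[of h] h by simp
    moreover have "N (?R \<psi> h) \<le> N (?R (u 0) h) + N (\<lambda>q. ?R \<psi> h q - ?R (u 0) h q)"
      by (rule l2norm_le_add_diff[OF LR[OF \<psi>] LR[OF Lu]])
    ultimately show "norm (N (?R \<psi> h) - 0) < r" by simp
  qed
qed

text \<open>The group law writes the increment at time t as U_(-t) applied to an increment at time 0
  for the vector U_t psi and the label shifted by t.\<close>

lemma heis_sder:
  assumes \<psi>: "\<psi> \<in> L2 M" and f: "sol f"
  shows "sder M (\<lambda>s. heis f s \<psi>) (U (- t) (\<lambda>q. (\<i> * of_real (Ms (\<lambda>y. Im (f t y)) q)) * W (f t) (U t \<psi>) q)) t"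
  unfolding sder_def
proof (intro conjI allI heis_L2 \<psi>)
  let ?g = "\<lambda>s. f (t + s)" and ?\<chi> = "U t \<psi>"
  let ?m = "\<lambda>q. (\<i> * of_real (Ms (\<lambda>y. Im (f t y)) q)) * W (f t) ?\<chi> q"
  have \<chi>: "?\<chi> \<in> L2 M" by (rule U_L2[OF \<psi>])
  have m: "?m \<in> L2 M" by (intro Ms_mult_L2 Weyl_L2 \<chi>)
  then show "U (- t) ?m \<in> L2 M" by (rule U_L2)
  have "N (\<lambda>q. (heis f (t + h) \<psi> q - heis f t \<psi> q) / of_real h - U (- t) ?m q)
      = N (\<lambda>q. (heis ?g h ?\<chi> q - W (f t) ?\<chi> q) / of_real h - ?m q)" for h
  proof -
    let ?a = "heis ?g h ?\<chi>" and ?b = "W (f t) ?\<chi>"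
    have a: "?a \<in> L2 M" and b: "?b \<in> L2 M" by (intro heis_L2 Weyl_L2 \<chi>)+
    have "AE q in M. W (f (t + h)) (U (t + h) \<psi>) q = W (f (t + h)) (U h ?\<chi>) q"
      using U_add[OF \<psi>, of h t] by (intro Weyl_cong U_L2 \<psi>) (simp_all add: add.commute)
    then have "AE q in M. U (- h) (W (f (t + h)) (U (t + h) \<psi>)) q = ?a q"
      unfolding heis_def by (intro U_cong Weyl_L2 U_L2 \<psi>)
    then have "AE q in M. U (- t) (U (- h) (W (f (t + h)) (U (t + h) \<psi>))) q = U (- t) ?a q"
      by (intro U_cong U_L2 Weyl_L2 \<psi> a)
    then have 1: "AE q in M. heis f (t + h) \<psi> q = U (- t) ?a q"
      using U_add[OF Weyl_L2[OF U_L2[OF \<psi>]], of "- t" "- h" "f (t + h)" "t + h"]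
      by eventually_elim (simp add: heis_def)
    have "AE q in M. U (- t) (\<lambda>q. (1 / of_real h) * ?a q + (- 1 / of_real h) * ?b q) q = (1 / of_real h) * U (- t) ?a q + (- 1 / of_real h) * U (- t) ?b q"
      by (rule U_lin[OF a b])
    moreover have e: "(\<lambda>q. (1 / of_real h) * ?a q + (- 1 / of_real h) * ?b q) = (\<lambda>q. (?a q - ?b q) / of_real h)"
      by (simp add: fun_eq_iff diff_divide_distrib)
    ultimately have 2: "AE q in M. U (- t) (\<lambda>q. (?a q - ?b q) / of_real h) q = (1 / of_real h) * U (- t) ?a q + (- 1 / of_real h) * U (- t) ?b q"
      by simp
    have "N (\<lambda>q. (heis f (t + h) \<psi> q - heis f t \<psi> q) / of_real h - U (- t) ?m q)
        = N (\<lambda>q. U (- t) (\<lambda>q. (?a q - ?b q) / of_real h) q - U (- t) ?m q)"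
      by (rule l2norm_cong_AE) (use 1 2 in \<open>eventually_elim, simp add: heis_def[of f t] diff_divide_distrib\<close>)
    also have "\<dots> = N (\<lambda>q. (?a q - ?b q) / of_real h - ?m q)"
      by (intro U_diff_norm L2_divide L2_diff a b m)
    finally show ?thesis .
  qed
  then show "((\<lambda>h. N (\<lambda>q. (heis f (t + h) \<psi> q - heis f t \<psi> q) / of_real h - U (- t) ?m q)) \<longlongrightarrow> 0) (at 0)"
    using heis_sder_0[OF \<chi> sol_shift[OF f, of t]] by simp
qed

text \<open>The multiplication operator i \<open>Ms\<close> in the Heisenberg picture. In these
  terms the curve \<open>heis\<close> obeys a linear equation with bounded time-dependent
  generator.\<close>

definition Lop :: "(int list \<Rightarrow> real) \<Rightarrow> real \<Rightarrow> ((int list \<Rightarrow> real) \<Rightarrow> complex) \<Rightarrow> (int list \<Rightarrow> real) \<Rightarrow> complex" where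
  "Lop b s \<psi> = U (- s) (\<lambda>q. (\<i> * of_real (Ms b q)) * U s \<psi> q)"

lemma Lop_L2: "\<psi> \<in> L2 M \<Longrightarrow> Lop b s \<psi> \<in> L2 M"
  unfolding Lop_def by (intro U_L2 Ms_mult_L2)

lemma Lop_diff:
  assumes "\<psi> \<in> L2 M" "\<phi> \<in> L2 M"
  shows "AE q in M. Lop b s (\<lambda>q. \<psi> q - \<phi> q) q = Lop b s \<psi> q - Lop b s \<phi> q"
proof -
  let ?m = "\<lambda>\<psi> q. (\<i> * of_real (Ms b q)) * U s \<psi> q"
  have L: "?m \<psi> \<in> L2 M" "?m \<phi> \<in> L2 M" "?m (\<lambda>q. \<psi> q - \<phi> q) \<in> L2 M" by (intro Ms_mult_L2 U_L2 L2_diff assms)+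
  have "AE q in M. ?m (\<lambda>q. \<psi> q - \<phi> q) q = ?m \<psi> q - ?m \<phi> q"
    using U_diff[OF assms, of s] by eventually_elim (simp add: right_diff_distrib)
  then have "AE q in M. U (- s) (?m (\<lambda>q. \<psi> q - \<phi> q)) q = U (- s) (\<lambda>q. ?m \<psi> q - ?m \<phi> q) q"
    by (intro U_cong L L2_diff)
  then show ?thesis unfolding Lop_def using U_diff[OF L(1,2), of "- s"] by eventually_elim simp
qed

text \<open>Conjugated by the unitary, this is the scalar product of a vector with i times a real
  multiple of itself.\<close>

lemma Lop_skew: assumes \<psi>: "\<psi> \<in> L2 M" shows "Re (ip M \<psi> (Lop b s \<psi>)) = 0"
proof -
  have "ip M \<psi> (Lop b s \<psi>) = ip M (U s \<psi>) (\<lambda>q. (\<i> * of_real (Ms b q)) * U s \<psi> q)"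
    unfolding Lop_def using U_adj[OF \<psi> Ms_mult_L2[OF U_L2[OF \<psi>]], of "- s"] by simp
  also have "\<dots> = (CLINT q|M. \<i> * complex_of_real (Ms b q * (cmod (U s \<psi> q))\<^sup>2))"
    unfolding ip_def by (intro Bochner_Integration.integral_cong refl) (simp add: complex_norm_square mult_ac del: of_real_power)
  also have "\<dots> = \<i> * complex_of_real (LINT q|M. Ms b q * (cmod (U s \<psi> q))\<^sup>2)"
    by (simp only: integral_mult_right_zero integral_complex_of_real)
  finally show ?thesis by simp
qed

lemma heis_derivative_Lop:
  assumes \<psi>: "\<psi> \<in> L2 M" and f: "sol f"
  shows "sder M (\<lambda>s. heis f s \<psi>) (Lop (\<lambda>y. Im (f t y)) t (heis f t \<psi>)) t"
proof (rule sder_cong[OF heis_sder[OF \<psi> f]])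
  let ?w = "W (f t) (U t \<psi>)"
  have w: "?w \<in> L2 M" by (intro Weyl_L2 U_L2 \<psi>)
  have "AE q in M. (\<i> * of_real (Ms (\<lambda>y. Im (f t y)) q)) * ?w q = (\<i> * of_real (Ms (\<lambda>y. Im (f t y)) q)) * U t (heis f t \<psi>) q"
    using U_inv[OF w, of t] unfolding heis_def by eventually_elim simp
  then show "AE q in M. U (- t) (\<lambda>q. (\<i> * of_real (Ms (\<lambda>y. Im (f t y)) q)) * ?w q) q = Lop (\<lambda>y. Im (f t y)) t (heis f t \<psi>) q"
    unfolding Lop_def by (intro U_cong Ms_mult_L2 U_L2 heis_L2 w \<psi>)
qed (intro AE_I2 refl heis_L2 Lop_L2 \<psi>)+

definition comm :: "(int list \<Rightarrow> complex) \<Rightarrow> (real \<Rightarrow> int list \<Rightarrow> complex) \<Rightarrow> real \<Rightarrow> ((int list \<Rightarrow> real) \<Rightarrow> complex) \<Rightarrow> (int list \<Rightarrow> real) \<Rightarrow> complex" where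
  "comm g f s \<psi> = (\<lambda>q. heis f s (W g \<psi>) q - W g (heis f s \<psi>) q)"

text \<open>\<open>d = comm g f s \<psi>\<close> satisfies \<open>d' = \<L> d + [\<L>, W g] (heis f s \<psi>)\<close> with \<open>\<L> = Lop\<close> skew-adjoint,
  so only the commutator term contributes to the growth of \<open>N d\<close>.\<close>

lemma comm_derivative:
  assumes \<psi>: "\<psi> \<in> L2 M" and f: "sol f"
    and r: "\<And>\<xi>. \<xi> \<in> L2 M \<Longrightarrow> N (\<lambda>q. Lop (\<lambda>y. Im (f s y)) s (W g \<xi>) q - W g (Lop (\<lambda>y. Im (f s y)) s \<xi>) q) \<le> \<rho> * N \<xi>"
  obtains D where "((\<lambda>s. (N (comm g f s \<psi>))\<^sup>2) has_real_derivative D) (at s)"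
    "\<bar>D\<bar> \<le> 2 * N (comm g f s \<psi>) * (\<rho> * N \<psi>)"
proof -
  let ?L = "Lop (\<lambda>y. Im (f s y)) s" and ?d = "comm g f s \<psi>" and ?b = "heis f s \<psi>" and ?a = "heis f s (W g \<psi>)"
  have La: "?a \<in> L2 M" and Lb: "?b \<in> L2 M" and LWb: "W g ?b \<in> L2 M" by (intro heis_L2 Weyl_L2 \<psi>)+
  have Ld: "?d \<in> L2 M" unfolding comm_def by (intro L2_diff La LWb)
  have sd: "sder M (\<lambda>s. comm g f s \<psi>) (\<lambda>q. ?L ?a q - W g (?L ?b) q) s"
    unfolding comm_def
  proof (rule sder_diff[OF heis_derivative_Lop[OF Weyl_L2[OF \<psi>] f] sder_isometry[OF heis_derivative_Lop[OF \<psi> f]]])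
    show "\<And>\<psi>. \<psi> \<in> L2 M \<Longrightarrow> W g \<psi> \<in> L2 M" by (rule Weyl_L2)
    show "\<And>\<psi>. \<psi> \<in> L2 M \<Longrightarrow> N (W g \<psi>) = N \<psi>" by (intro Weyl_l2norm L2_measurable)
    show "\<And>a b \<psi> \<phi>. AE q in M. W g (\<lambda>r. a * \<psi> r + b * \<phi> r) q = a * W g \<psi> q + b * W g \<phi> q" by (simp add: Weyl_lin)
  qed
  let ?c = "\<lambda>q. ?L (W g ?b) q - W g (?L ?b) q"
  have Lc: "?c \<in> L2 M" by (intro L2_diff Lop_L2 Weyl_L2 LWb Lb)
  have "AE q in M. ?L ?a q - W g (?L ?b) q = ?L ?d q + ?c q"
    using Lop_diff[OF La LWb, of "\<lambda>y. Im (f s y)" s] unfolding comm_def by eventually_elim simp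
  then have "ip M ?d (\<lambda>q. ?L ?a q - W g (?L ?b) q) = ip M ?d (\<lambda>q. ?L ?d q + ?c q)"
    by (intro ip_cong_AE L2_measurable L2_diff L2_add Lop_L2 Weyl_L2 La Lb LWb Ld Lc)
  also have "\<dots> = ip M ?d (?L ?d) + ip M ?d ?c" by (intro ip_add_right Ld Lop_L2 Lc)
  finally have e: "Re (ip M ?d (\<lambda>q. ?L ?a q - W g (?L ?b) q)) = Re (ip M ?d ?c)" using Lop_skew[OF Ld] by simp
  have "\<bar>Re (ip M ?d ?c)\<bar> \<le> N ?d * N ?c" using abs_Re_le_cmod ip_CS[OF Ld Lc] by (rule order_trans)
  also have "\<dots> \<le> N ?d * (\<rho> * N \<psi>)"
    using r[OF Lb] by (intro mult_left_mono) (auto simp: heis_norm \<psi>)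
  finally show thesis using sder_norm_sq[OF sd] e by (intro that[of "2 * Re (ip M ?d ?c)"]) auto
qed

text \<open>Integral inequality without integrals: \<open>P\<close> is any antiderivative of the
  rate. The sign \<open>\<sigma>\<close> covers both time directions at once.\<close>

lemma comm_growth:
  assumes \<psi>: "\<psi> \<in> L2 M" and f: "sol f" and \<sigma>: "\<bar>\<sigma>\<bar> = 1" and T: "0 \<le> T"
    and r: "\<And>s \<xi>. 0 \<le> s \<Longrightarrow> s \<le> T \<Longrightarrow> \<xi> \<in> L2 M \<Longrightarrow>
      N (\<lambda>q. Lop (\<lambda>y. Im (f (\<sigma> * s) y)) (\<sigma> * s) (W g \<xi>) q - W g (Lop (\<lambda>y. Im (f (\<sigma> * s) y)) (\<sigma> * s) \<xi>) q) \<le> \<rho> s * N \<xi>"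
    and P: "\<And>s. (P has_real_derivative \<rho> s) (at s)"
  shows "N (comm g f (\<sigma> * T) \<psi>) \<le> N (comm g f 0 \<psi>) + (P T - P 0) * N \<psi>"
proof (rule field_le_epsilon)
  fix e :: real assume e: "0 < e"
  let ?n = "\<lambda>s. N (comm g f (\<sigma> * s) \<psi>)"
  \<comment> \<open>The norm itself need not be differentiable where it vanishes; this smooth
    regularisation exceeds it by at most \<open>e\<close>.\<close>
  let ?z = "\<lambda>s. sqrt ((?n s)\<^sup>2 + e\<^sup>2)"
  have "?z T - P T * N \<psi> \<le> ?z 0 - P 0 * N \<psi>"
  proof (rule DERIV_nonpos_imp_nonincreasing[OF T])
    fix s assume s: "0 \<le> s" "s \<le> T"
    obtain D where D: "((\<lambda>s. (N (comm g f s \<psi>))\<^sup>2) has_real_derivative D) (at (\<sigma> * s))" "\<bar>D\<bar> \<le> 2 * ?n s * (\<rho> s * N \<psi>)"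
      by (rule comm_derivative[OF \<psi> f r[OF s]])
    have z0: "0 < (?n s)\<^sup>2 + e\<^sup>2" using e by (simp add: add_nonneg_pos)
    have "((\<lambda>s. (?n s)\<^sup>2) has_real_derivative D * \<sigma>) (at s)"
      by (rule DERIV_chain2[where f = "\<lambda>s. (N (comm g f s \<psi>))\<^sup>2" and g = "\<lambda>s. \<sigma> * s", OF D(1)]) (auto intro!: derivative_eq_intros)
    then have sq: "((\<lambda>s. (?n s)\<^sup>2 + e\<^sup>2) has_real_derivative D * \<sigma> + 0) (at s)" by (intro DERIV_add DERIV_const)
    have "((\<lambda>s. ?z s - P s * N \<psi>) has_real_derivative (D * \<sigma> + 0) * (inverse (?z s) / 2) - \<rho> s * N \<psi>) (at s)"
      using DERIV_chain2[where f = sqrt and g = "\<lambda>s. (?n s)\<^sup>2 + e\<^sup>2", OF DERIV_real_sqrt[OF z0] sq]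
      by (intro DERIV_diff DERIV_cmult_right P) (simp add: mult.commute)
    moreover have "(D * \<sigma> + 0) * (inverse (?z s) / 2) - \<rho> s * N \<psi> \<le> 0"
    proof -
      have zp: "0 < ?z s" using z0 by simp
      have nz: "?n s \<le> ?z s" by (rule real_le_rsqrt) simp
      have r0: "0 \<le> \<rho> s * N \<psi>" using r[OF s \<psi>] l2norm_nonneg order_trans by blast
      have "D * \<sigma> \<le> \<bar>D\<bar>" using \<sigma> by (metis abs_ge_self abs_mult mult.right_neutral)
      also have "\<dots> \<le> 2 * ?z s * (\<rho> s * N \<psi>)"
        by (rule order_trans[OF D(2)]) (intro mult_right_mono mult_left_mono nz r0, simp)
      finally have "D * \<sigma> * (inverse (?z s) / 2) \<le> 2 * ?z s * (\<rho> s * N \<psi>) * (inverse (?z s) / 2)"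
        using zp by (intro mult_right_mono) auto
      also have "\<dots> = \<rho> s * N \<psi>"
      proof -
        have "2 * z * c * (inverse z / 2) = c" if "0 < z" for z c :: real using that by (simp add: field_simps)
        then show ?thesis using zp by blast
      qed
      finally show ?thesis by simp
    qed
    ultimately show "\<exists>y. ((\<lambda>s. ?z s - P s * N \<psi>) has_real_derivative y) (at s) \<and> y \<le> 0" by blast
  qed
  moreover have "?n T \<le> ?z T" by (rule real_le_rsqrt) simp
  moreover have "?z 0 \<le> ?n 0 + e"
    using e by (intro real_le_lsqrt) (auto simp: power2_sum)
  ultimately have "?n T \<le> ?n 0 + (P T * N \<psi> - P 0 * N \<psi>) + e" by linarith
  then show "?n T \<le> N (comm g f 0 \<psi>) + (P T - P 0) * N \<psi> + e" by (simp add: left_diff_distrib)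
qed

end

section \<open>Fourier representation of the potential\<close>

text \<open>The Levy inversion kernel, for nonzero t the integral of exp(-i t q) over [a, b]. At t =
  0 division gives 0 instead of b - a, on a null set.\<close>

definition dirk :: "real \<Rightarrow> real \<Rightarrow> real \<Rightarrow> complex" where
  "dirk a b t = (iexp (-(t * a)) - iexp (-(t * b))) / (\<i> * t)"

text \<open>The convention of characteristic functions, with positive sign and no factor;
  \<open>Fourier\<close> is its reflection divided by 2 pi.\<close>

definition ft :: "(real \<Rightarrow> real) \<Rightarrow> real \<Rightarrow> complex" where
  "ft g t = (CLINT q|lborel. complex_of_real (g q) * iexp (t * q))"

lemma dirk_bound: "cmod (dirk a b t) \<le> \<bar>b - a\<bar>"
proof (cases "t = 0")
  case False
  have *: "cmod (dirk a b t) \<le> b - a" if "a \<le> b" for a b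
    using Levy_Inversion_aux2[of "-b" "-a" t] that False by (simp add: dirk_def)
  have "dirk a b t = - dirk b a t" by (simp add: dirk_def diff_divide_distrib)
  then show ?thesis using *[of a b] *[of b a] by (cases "a \<le> b") auto
qed (simp add: dirk_def)

lemma dirk_measurable [measurable]: "dirk a b \<in> borel_measurable borel"
  unfolding dirk_def[abs_def] by measurable

lemma ft_measurable [measurable]:
  assumes [measurable]: "g \<in> borel_measurable borel" shows "ft g \<in> borel_measurable borel"
  unfolding ft_def[abs_def] by measurable

lemma ft_bound: assumes "integrable lborel g" shows "cmod (ft g t) \<le> (LINT q|lborel. \<bar>g q\<bar>)"
  unfolding ft_def by (rule order_trans[OF integral_norm_bound]) (simp add: norm_mult)

text \<open>Normalised to mass one, g is the density of a probability measure whose characteristic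
  function is \<open>ft g\<close> divided by the mass, so Levy inversion applies. Zero mass cannot
  be normalised and is separate.\<close>

lemma levy_nonneg:
  fixes g :: "real \<Rightarrow> real"
  assumes g: "integrable lborel g" "\<And>q. 0 \<le> g q" and ab: "a \<le> b"
  shows "(\<lambda>T. 1 / (2 * pi) * (CLBINT t=-real T..real T. dirk a b t * ft g t)) \<longlonglongrightarrow> of_real (LINT q:{a<..b}|lborel. g q)"
proof (cases "(LINT q|lborel. g q) = 0")
  case True
  then have "AE q in lborel. g q = 0" using integral_nonneg_eq_0_iff_AE[OF g(1)] g(2) by auto
  then have "ft g t = 0" "(LINT q:{a<..b}|lborel. g q) = 0" for t
    unfolding ft_def set_lebesgue_integral_def by (auto intro!: integral_eq_zero_AE elim!: eventually_mono)
  then show ?thesis by simp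
next
  case False
  have [measurable]: "g \<in> borel_measurable borel" using g(1) by auto
  define m where "m = (LINT q|lborel. g q)"
  have m: "0 < m" using False g(2) Bochner_Integration.integral_nonneg[of lborel g] by (simp add: m_def less_le)
  define Q where "Q = density lborel (\<lambda>q. ennreal (g q / m))"
  have "emeasure Q (space Q) = (\<integral>\<^sup>+ q. ennreal (g q / m) \<partial>lborel)" by (simp add: Q_def emeasure_density)
  also have "\<dots> = ennreal (LINT q|lborel. g q / m)" using g m by (intro nn_integral_eq_integral) auto
  also have "\<dots> = 1" using m by (simp add: m_def)
  finally have "prob_space Q" by (rule prob_spaceI)
  then interpret Q: prob_space Q .
  interpret Q: real_distribution Q by standard (auto simp: Q_def)
  \<comment> \<open>Levy inversion requires endpoints without mass; a measure with a density has no
    atoms.\<close>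
  have null: "measure Q {c} = 0" for c
  proof -
    have "emeasure Q {c} = (\<integral>\<^sup>+ q. ennreal (g q / m) * indicator {c} q \<partial>lborel)" by (simp add: Q_def emeasure_density)
    also have "\<dots> = 0"
    proof (subst nn_integral_0_iff_AE)
      show "AE q in lborel. ennreal (g q / m) * indicator {c} q = 0"
        using AE_lborel_singleton[of c] by eventually_elim simp
    qed measurable
    finally show ?thesis by (simp add: measure_def)
  qed
  have ch: "char Q t = ft g t / of_real m" for t
  proof -
    have "char Q t = (CLINT q|lborel. (g q / m) *\<^sub>R iexp (t * q))"
      unfolding char_def Q_def using g m by (intro integral_density) auto
    also have "\<dots> = (CLINT q|lborel. (complex_of_real (g q) * iexp (t * q)) / of_real m)"
      by (intro Bochner_Integration.integral_cong refl) (simp add: scaleR_conv_of_real)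
    finally show ?thesis by (simp add: ft_def)
  qed
  have mq: "measure Q {a<..b} = (LINT q:{a<..b}|lborel. g q) / m"
  proof -
    have "emeasure Q {a<..b} = (\<integral>\<^sup>+ q. ennreal (g q / m) * indicator {a<..b} q \<partial>lborel)" by (simp add: Q_def emeasure_density)
    also have "\<dots> = (\<integral>\<^sup>+ q. ennreal (indicator {a<..b} q * g q / m) \<partial>lborel)"
      by (intro nn_integral_cong) (auto split: split_indicator)
    also have "\<dots> = ennreal (LINT q|lborel. indicator {a<..b} q * g q / m)"
      using integrable_mult_indicator[OF _ g(1), of "{a<..b}"] g(2) m by (intro nn_integral_eq_integral) auto
    also have "(LINT q|lborel. indicator {a<..b} q * g q / m) = (LINT q:{a<..b}|lborel. g q) / m"
      by (simp add: set_lebesgue_integral_def)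
    finally show ?thesis using g(2) m by (simp add: measure_def set_lebesgue_integral_def Bochner_Integration.integral_nonneg)
  qed
  have "(\<lambda>T. of_real m * (1 / (2 * pi) * (CLBINT t=-real T..real T. dirk a b t * char Q t))) \<longlonglongrightarrow> of_real m * of_real (measure Q {a<..b})"
    using Q.Levy_Inversion[OF ab null null] unfolding dirk_def by (intro tendsto_intros) auto
  moreover have "of_real m * (1 / (2 * pi) * (CLBINT t=-real T..real T. dirk a b t * char Q t)) = 1 / (2 * pi) * (CLBINT t=-real T..real T. dirk a b t * ft g t)" for T
    using m by (simp add: ch)
  ultimately show ?thesis using m by (simp add: mq)
qed

lemma dirk_ft_Ioo:
  "(CLBINT t=-real T..real T. dirk a b t * ft g t) = (CLINT t:{-real T<..<real T}|lborel. dirk a b t * ft g t)"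
  unfolding interval_lebesgue_integral_def by (simp add: einterval_eq)

lemma dirk_ft_set_integrable:
  assumes "integrable lborel g"
  shows "set_integrable lborel {-real T<..<real T} (\<lambda>t. dirk a b t * ft g t)"
  unfolding set_integrable_def
proof (rule Bochner_Integration.integrable_bound)
  have [measurable]: "g \<in> borel_measurable borel" using assms by auto
  show "integrable lborel (\<lambda>t. (\<bar>b - a\<bar> * (LINT q|lborel. \<bar>g q\<bar>)) * indicator {-real T<..<real T} t)"
    by (intro integrable_mult_right integrable_real_indicator) auto
  show "AE t in lborel. norm (indicator {-real T<..<real T} t *\<^sub>R (dirk a b t * ft g t))
      \<le> norm ((\<bar>b - a\<bar> * (LINT q|lborel. \<bar>g q\<bar>)) * indicator {-real T<..<real T} t)"
  proof (rule AE_I2)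
    fix t
    have "cmod (dirk a b t) * cmod (ft g t) \<le> \<bar>b - a\<bar> * (LINT q|lborel. \<bar>g q\<bar>)"
      by (intro mult_mono dirk_bound ft_bound assms) auto
    also have "\<dots> \<le> \<bar>\<bar>b - a\<bar> * (LINT q|lborel. \<bar>g q\<bar>)\<bar>" by (rule abs_ge_self)
    finally show "norm (indicator {-real T<..<real T} t *\<^sub>R (dirk a b t * ft g t))
      \<le> norm ((\<bar>b - a\<bar> * (LINT q|lborel. \<bar>g q\<bar>)) * indicator {-real T<..<real T} t)"
      by (simp add: norm_mult split: split_indicator)
  qed
  show "(\<lambda>t. indicator {-real T<..<real T} t *\<^sub>R (dirk a b t * ft g t)) \<in> borel_measurable lborel" by measurable
qed

text \<open>Only the transform of g itself is known to be integrable, not those of its two parts.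
  The parts are therefore split under the truncated integrals, and the limit T to infinity is
  evaluated on their difference.\<close>

lemma levy_signed:
  assumes g: "integrable lborel g" and ab: "a \<le> b" and i: "integrable lborel (ft g)"
  shows "of_real (LINT q:{a<..b}|lborel. g q) = 1 / (2 * pi) * (CLINT t|lborel. dirk a b t * ft g t)"
proof (rule LIMSEQ_unique)
  have [measurable]: "g \<in> borel_measurable borel" using g by auto
  let ?p = "\<lambda>q. max 0 (g q)" and ?n = "\<lambda>q. max 0 (- g q)"
  let ?A = "\<lambda>g T. 1 / (2 * pi) * (CLBINT t=-real T..real T. dirk a b t * ft g t)"
  have p: "integrable lborel ?p" "integrable lborel ?n" using g by auto
  have gp: "g q = ?p q - ?n q" for q by (simp add: max_def)
  have io: "integrable lborel (\<lambda>q. complex_of_real (h q) * iexp (t * q))" if "integrable lborel h" for h t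
    by (rule Bochner_Integration.integrable_bound[OF that]) (use that in \<open>auto simp: norm_mult\<close>)
  have ftd: "ft g t = ft ?p t - ft ?n t" for t
  proof -
    have "ft g t = (CLINT q|lborel. complex_of_real (?p q) * iexp (t * q) - complex_of_real (?n q) * iexp (t * q))"
      unfolding ft_def by (subst gp) (simp add: left_diff_distrib)
    also have "\<dots> = ft ?p t - ft ?n t" unfolding ft_def by (intro Bochner_Integration.integral_diff io p)
    finally show ?thesis .
  qed
  have A: "?A g T = ?A ?p T - ?A ?n T" for T
  proof -
    have "(CLBINT t=-real T..real T. dirk a b t * ft g t)
        = (CLINT t:{-real T<..<real T}|lborel. dirk a b t * ft ?p t - dirk a b t * ft ?n t)"
      unfolding dirk_ft_Ioo by (simp add: ftd right_diff_distrib)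
    also have "\<dots> = (CLBINT t=-real T..real T. dirk a b t * ft ?p t) - (CLBINT t=-real T..real T. dirk a b t * ft ?n t)"
      unfolding dirk_ft_Ioo by (intro set_integral_diff dirk_ft_set_integrable p)
    finally show ?thesis by (simp add: diff_divide_distrib)
  qed
  have "(\<lambda>T. ?A ?p T - ?A ?n T) \<longlonglongrightarrow> of_real (LINT q:{a<..b}|lborel. ?p q) - of_real (LINT q:{a<..b}|lborel. ?n q)"
    by (intro tendsto_diff levy_nonneg p ab) auto
  then have "(\<lambda>T. ?A g T) \<longlonglongrightarrow> of_real ((LINT q:{a<..b}|lborel. ?p q) - (LINT q:{a<..b}|lborel. ?n q))"
    by (simp only: A of_real_diff)
  also have "(LINT q:{a<..b}|lborel. ?p q) - (LINT q:{a<..b}|lborel. ?n q) = (LINT q:{a<..b}|lborel. g q)"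
  proof -
    have s: "set_integrable lborel {a<..b} ?p" "set_integrable lborel {a<..b} ?n"
      unfolding set_integrable_def by (intro integrable_mult_indicator p; simp)+
    show ?thesis using set_integral_diff(2)[OF s] by (simp add: gp[symmetric])
  qed
  finally show "(\<lambda>T. ?A g T) \<longlonglongrightarrow> of_real (LINT q:{a<..b}|lborel. g q)" .
  have "(\<lambda>T. CLINT t|lborel. indicator {-real T<..<real T} t *\<^sub>R (dirk a b t * ft g t)) \<longlonglongrightarrow> (CLINT t|lborel. dirk a b t * ft g t)"
  proof (rule integral_dominated_convergence)
    show "integrable lborel (\<lambda>t. \<bar>b - a\<bar> * cmod (ft g t))" using i by (intro integrable_mult_right integrable_norm)
    show "AE t in lborel. (\<lambda>T. indicator {-real T<..<real T} t *\<^sub>R (dirk a b t * ft g t)) \<longlonglongrightarrow> dirk a b t * ft g t"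
    proof (rule AE_I2, rule tendsto_eventually)
      fix t
      obtain n0 :: nat where n0: "\<bar>t\<bar> < real n0" using reals_Archimedean2 by blast
      then have "t \<in> {- real n<..<real n}" if "n0 \<le> n" for n using that by auto
      then show "\<forall>\<^sub>F T in sequentially. indicator {-real T<..<real T} t *\<^sub>R (dirk a b t * ft g t) = dirk a b t * ft g t"
        unfolding eventually_sequentially by (intro exI[of _ n0]) auto
    qed
    show "AE t in lborel. norm (indicator {-real T<..<real T} t *\<^sub>R (dirk a b t * ft g t)) \<le> \<bar>b - a\<bar> * cmod (ft g t)" for T :: nat
      by (rule AE_I2) (auto simp: norm_mult intro!: mult_right_mono dirk_bound split: split_indicator)
  qed measurable
  then show "(\<lambda>T. ?A g T) \<longlonglongrightarrow> 1 / (2 * pi) * (CLINT t|lborel. dirk a b t * ft g t)"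
    unfolding dirk_ft_Ioo set_lebesgue_integral_def by (intro tendsto_mult tendsto_const)
qed

lemma Fourier_eq_ft: "Fourier h w = 1 / (2 * pi) * ft h (- w)"
  unfolding Fourier_def ft_def by (simp add: mult.commute)

lemma Fourier_bound: "integrable lborel h \<Longrightarrow> cmod (Fourier h w) \<le> (LINT q|lborel. \<bar>h q\<bar>)"
proof -
  assume h: "integrable lborel h"
  have "cmod (Fourier h w) = 1 / (2 * pi) * cmod (ft h (- w))" by (simp add: Fourier_eq_ft norm_mult norm_divide)
  also have "\<dots> \<le> 1 * cmod (ft h (- w))" using pi_gt3 by (intro mult_right_mono) auto
  finally show ?thesis using ft_bound[OF h, of "- w"] by simp
qed

lemma Fourier_measurable:
  assumes [measurable]: "h \<in> borel_measurable borel" shows "Fourier h \<in> borel_measurable borel"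
proof -
  have "(\<lambda>w. ft h (- w)) \<in> borel_measurable borel" by measurable
  then show ?thesis unfolding Fourier_eq_ft[abs_def] by measurable
qed

text \<open>For |w| > 1 the weight |w| dominates 1; on [-1, 1] the transform is bounded by the L^1
  norm of h.\<close>

lemma Fourier_integrable:
  assumes h: "integrable lborel h" and k: "integrable lborel (\<lambda>w. cmod (Fourier h w) * \<bar>w\<bar>)"
  shows "integrable lborel (Fourier h)"
proof (rule Bochner_Integration.integrable_bound)
  show "integrable lborel (\<lambda>w. (LINT q|lborel. \<bar>h q\<bar>) * indicator {-1..1} w + cmod (Fourier h w) * \<bar>w\<bar>)"
    by (intro Bochner_Integration.integrable_add integrable_mult_right integrable_real_indicator k) auto
  show "Fourier h \<in> borel_measurable lborel" using h Fourier_measurable[of h] by auto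
  show "AE w in lborel. norm (Fourier h w) \<le> norm ((LINT q|lborel. \<bar>h q\<bar>) * indicator {-1..1} w + cmod (Fourier h w) * \<bar>w\<bar>)"
  proof (rule AE_I2)
    fix w :: real
    have "cmod (Fourier h w) \<le> (LINT q|lborel. \<bar>h q\<bar>) * indicator {-1..1} w + cmod (Fourier h w) * \<bar>w\<bar>"
    proof (cases "\<bar>w\<bar> \<le> 1")
      case True
      then have "w \<in> {-1..1}" by auto
      then show ?thesis using Fourier_bound[OF h, of w] by (simp add: add_increasing2)
    next
      case False
      then have "w \<notin> {-1..1}" by auto
      moreover have "cmod (Fourier h w) * 1 \<le> cmod (Fourier h w) * \<bar>w\<bar>" using False by (intro mult_left_mono) auto
      ultimately show ?thesis by simp
    qed
    then show "norm (Fourier h w) \<le> norm ((LINT q|lborel. \<bar>h q\<bar>) * indicator {-1..1} w + cmod (Fourier h w) * \<bar>w\<bar>)"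
      by (simp add: order_trans[OF _ abs_ge_self])
  qed
qed

text \<open>For nonzero w the integral of exp(i w u) over u from 0 to s. Its bound |s| will turn a
  displacement of a Weyl operator into the size of the perturbation.\<close>

definition fkern :: "real \<Rightarrow> real \<Rightarrow> complex" where
  "fkern s w = (iexp (w * s) - 1) / (\<i> * w)"

lemma fkern_bound: "cmod (fkern s w) \<le> \<bar>s\<bar>"
  using dirk_bound[of 0 s "- w"] by (simp add: dirk_def fkern_def minus_divide_right[symmetric] minus_divide_left norm_minus_commute)

text \<open>Differences of \<open>V\<close> need no pointwise inversion of the transform of \<open>V'\<close>: Levy inversion of the positive and
  negative parts of \<open>V'\<close> yields their integrals over intervals.\<close>

lemma increment_Fourier:
  assumes der: "\<And>x. (V has_real_derivative V' x) (at x)" and cont: "continuous_on UNIV V'"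
    and L1: "integrable lborel V'" and k: "integrable lborel (\<lambda>w. cmod (Fourier V' w) * \<bar>w\<bar>)"
  shows "of_real (V (r + s) - V r) = (CLINT w|lborel. Fourier V' w * fkern s w * iexp (w * r))"
proof -
  note fi = Fourier_integrable[OF L1 k]
  have fti: "integrable lborel (ft V')"
  proof -
    have "integrable lborel (\<lambda>w. Fourier V' (0 + (-1) * w))"
      using fi by (rule lborel_integrable_real_affine) simp
    then have "integrable lborel (\<lambda>w. (2 * pi) * Fourier V' (- w))" by (intro integrable_mult_right) simp
    then show ?thesis by (simp add: Fourier_eq_ft)
  qed
  have main: "of_real (V b - V a) = (CLINT w|lborel. Fourier V' w * dirk a b (- w))" if "a \<le> b" for a b
  proof -
    have "(LINT q:{a<..b}|lborel. V' q) = (LINT q:{a..b}|lborel. V' q)"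
      unfolding set_lebesgue_integral_def using AE_lborel_singleton[of a] L1
      by (intro integral_cong_AE) (auto elim!: eventually_mono split: split_indicator)
    also have "\<dots> = V b - V a"
      unfolding set_lebesgue_integral_def real_scaleR_def
      using integral_FTC_Icc_real[OF that, of V V'] der cont
      by (simp add: mult.commute continuous_on_eq_continuous_within)
    finally have "of_real (V b - V a) = 1 / (2 * pi) * (CLINT t|lborel. dirk a b t * ft V' t)"
      using levy_signed[OF L1 that fti] by simp
    also have "\<dots> = 1 / (2 * pi) * (\<bar>-1\<bar> *\<^sub>R (CLINT w|lborel. dirk a b (0 + (-1) * w) * ft V' (0 + (-1) * w)))"
      by (subst lborel_integral_real_affine[where c = "-1" and t = 0]) simp_all
    also have "\<dots> = (CLINT w|lborel. 1 / (2 * pi) * (dirk a b (- w) * ft V' (- w)))"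
      by (simp only: integral_mult_right_zero) simp
    also have "\<dots> = (CLINT w|lborel. Fourier V' w * dirk a b (- w))"
      by (intro Bochner_Integration.integral_cong refl) (simp add: Fourier_eq_ft)
    finally show ?thesis .
  qed
  have main': "of_real (V b - V a) = (CLINT w|lborel. Fourier V' w * dirk a b (- w))" for a b
  proof (cases "a \<le> b")
    case False
    have "dirk a b (- w) = - dirk b a (- w)" for w by (simp add: dirk_def diff_divide_distrib)
    then show ?thesis using main[of b a] False by (simp add: minus_diff_eq[symmetric, of "complex_of_real (V b)"] del: minus_diff_eq)
  qed (rule main)
  have "dirk r (r + s) (- w) = fkern s w * iexp (w * r)" for w
    by (simp add: dirk_def fkern_def diff_divide_distrib exp_add distrib_left left_diff_distrib minus_divide_right[symmetric] mult.commute)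
       (simp add: right_diff_distrib)
  then show ?thesis using main'[of "r + s" r] by (simp add: mult.assoc)
qed

section \<open>The periodic lattice\<close>

definition td1 :: "nat \<Rightarrow> int \<Rightarrow> int" where
  "td1 L d = (INF \<eta>::int. \<bar>d + 2 * int L * \<eta>\<bar>)"

text \<open>A set of nonnegative integers attains its infimum, so each later fact about the distance
  is proved by choosing a suitable multiple of the period.\<close>

lemma td1_attained: "\<exists>\<eta>. td1 L d = \<bar>d + 2 * int L * \<eta>\<bar>" and td1_le: "td1 L d \<le> \<bar>d + 2 * int L * k\<bar>"
proof -
  have "\<exists>\<eta>. \<forall>k. nat \<bar>d + 2 * int L * \<eta>\<bar> \<le> nat \<bar>d + 2 * int L * k\<bar>"
    using ex_has_least_nat[of "\<lambda>_. True" _ "\<lambda>\<eta>. nat \<bar>d + 2 * int L * \<eta>\<bar>"] by blast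
  then obtain \<eta> where \<eta>: "\<And>k. \<bar>d + 2 * int L * \<eta>\<bar> \<le> \<bar>d + 2 * int L * k\<bar>" by (metis abs_ge_zero nat_le_eq_zle)
  have eq: "td1 L d = \<bar>d + 2 * int L * \<eta>\<bar>"
    unfolding td1_def by (rule cInf_eq_minimum) (use \<eta> in auto)
  then show "\<exists>\<eta>. td1 L d = \<bar>d + 2 * int L * \<eta>\<bar>" by blast
  show "td1 L d \<le> \<bar>d + 2 * int L * k\<bar>" using eq \<eta> by simp
qed

lemma td1_nonneg: "0 \<le> td1 L d" using td1_attained[of L d] by auto

lemma td1_triangle: "td1 L (a + b) \<le> td1 L a + td1 L b"
proof -
  obtain j k where j: "td1 L a = \<bar>a + 2 * int L * j\<bar>" and k: "td1 L b = \<bar>b + 2 * int L * k\<bar>" using td1_attained by metis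
  have "td1 L (a + b) \<le> \<bar>a + b + 2 * int L * (j + k)\<bar>" by (rule td1_le)
  also have "a + b + 2 * int L * (j + k) = (a + 2 * int L * j) + (b + 2 * int L * k)" by (simp add: algebra_simps)
  finally show ?thesis using j k abs_triangle_ineq[of "a + 2 * int L * j" "b + 2 * int L * k"] by simp
qed

lemma td1_minus_le: "td1 L (- d) \<le> td1 L d"
proof -
  obtain j where j: "td1 L d = \<bar>d + 2 * int L * j\<bar>" using td1_attained by metis
  have "td1 L (- d) \<le> \<bar>- d + 2 * int L * (- j)\<bar>" by (rule td1_le)
  also have "\<dots> = \<bar>- (d + 2 * int L * j)\<bar>" by simp
  finally show ?thesis using j by (simp only: abs_minus_cancel)
qed

lemma td1_minus: "td1 L (- d) = td1 L d"
  using td1_minus_le[of L d] td1_minus_le[of L "- d"] by simp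

lemma td1_periodic_le: "td1 L (d + 2 * int L * k) \<le> td1 L d"
proof -
  obtain j where j: "td1 L d = \<bar>d + 2 * int L * j\<bar>" using td1_attained by metis
  have "td1 L (d + 2 * int L * k) \<le> \<bar>(d + 2 * int L * k) + 2 * int L * (j - k)\<bar>" by (rule td1_le)
  also have "(d + 2 * int L * k) + 2 * int L * (j - k) = d + 2 * int L * j" by (simp add: algebra_simps)
  finally show ?thesis using j by simp
qed

lemma td1_periodic: "td1 L (d + 2 * int L * k) = td1 L d"
  using td1_periodic_le[of L d k] td1_periodic_le[of L "d + 2 * int L * k" "- k"] by simp

lemma td1_small:
  assumes "\<bar>d\<bar> \<le> int L" shows "td1 L d = \<bar>d\<bar>"
proof -
  obtain j where j: "td1 L d = \<bar>d + 2 * int L * j\<bar>" using td1_attained by metis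
  have "\<bar>d\<bar> \<le> \<bar>d + 2 * int L * j\<bar>"
  proof (cases "j = 0")
    case False
    have "2 * int L * 1 \<le> 2 * int L * \<bar>j\<bar>" using False by (intro mult_left_mono) auto
    then have "2 * int L \<le> \<bar>2 * int L * j\<bar>" by (simp add: abs_mult)
    then show ?thesis using assms by linarith
  qed simp
  then show ?thesis using td1_le[of L d 0] j by simp
qed

lemma tdist_td1: "tdist nu L x y = (\<Sum>j<nu. td1 L (x ! j - y ! j))"
  by (simp add: tdist_def td1_def)

lemma tdist_nonneg: "0 \<le> tdist nu L x y" by (simp add: tdist_td1 sum_nonneg td1_nonneg)

lemma tdist_sym: "tdist nu L x y = tdist nu L y x"
  unfolding tdist_td1 by (rule sum.cong) (use td1_minus in \<open>metis minus_diff_eq\<close>)+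

lemma tdist_triangle: "tdist nu L x z \<le> tdist nu L x y + tdist nu L y z"
  unfolding tdist_td1 sum.distrib[symmetric]
proof (rule sum_mono)
  fix j show "td1 L (x ! j - z ! j) \<le> td1 L (x ! j - y ! j) + td1 L (y ! j - z ! j)"
    using td1_triangle[of L "x ! j - y ! j" "y ! j - z ! j"] by simp
qed

lemma tdist_self: "tdist nu L x x = 0"
  by (simp add: tdist_td1 td1_small)

lemma nbr_nth:
  assumes "x \<in> Lam nu L" "j < nu" "i < nu"
  shows "nbr L x j ! i = (if i = j then (if x ! j = int L then 1 - int L else x ! j + 1) else x ! i)"
  using assms by (auto simp: nbr_def Lam_def nth_list_update)

lemma tdist_nbr:
  assumes L: "1 \<le> L" and x: "x \<in> Lam nu L" and j: "j < nu"
  shows "tdist nu L x (nbr L x j) \<le> 1"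
proof -
  have "tdist nu L x (nbr L x j) = (\<Sum>i<nu. if i = j then td1 L (x ! j - nbr L x j ! j) else 0)"
    unfolding tdist_td1 by (intro sum.cong refl) (auto simp: nbr_nth[OF x j] td1_small)
  also have "\<dots> = td1 L (x ! j - nbr L x j ! j)" using j by simp
  also have "\<dots> \<le> 1"
  proof (cases "x ! j = int L")
    case True
    \<comment> \<open>Across the seam the hop goes from L to 1 - L; the difference 2 L - 1 is -1
      modulo the period 2 L.\<close>
    have "td1 L (x ! j - nbr L x j ! j) \<le> \<bar>x ! j - nbr L x j ! j + 2 * int L * (- 1)\<bar>" by (rule td1_le)
    then show ?thesis using True by (simp add: nbr_nth[OF x j j])
  next
    case False
    have "td1 L (x ! j - nbr L x j ! j) \<le> \<bar>x ! j - nbr L x j ! j + 2 * int L * 0\<bar>" by (rule td1_le)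
    then show ?thesis using False by (simp add: nbr_nth[OF x j j])
  qed
  finally show ?thesis .
qed

section \<open>Lattice translations and the harmonic matrix\<close>

lemma Lam_eqI: "x \<in> Lam nu L \<Longrightarrow> y \<in> Lam nu L \<Longrightarrow> (\<And>i. i < nu \<Longrightarrow> x ! i = y ! i) \<Longrightarrow> x = y"
  by (auto simp: Lam_def intro: nth_equalityI)

lemma Lam_range: "x \<in> Lam nu L \<Longrightarrow> i < nu \<Longrightarrow> - int L < x ! i \<and> x ! i \<le> int L"
  by (simp add: Lam_def)

text \<open>An injective self-map of a finite set permutes it; this is how translation invariance is
  used throughout.\<close>

lemma sum_Lam_inj:
  assumes "inj_on h (Lam nu L)" "\<And>x. x \<in> Lam nu L \<Longrightarrow> h x \<in> Lam nu L"
  shows "(\<Sum>x\<in>Lam nu L. \<phi> (h x)) = (\<Sum>x\<in>Lam nu L. \<phi> x)"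
proof -
  have "h ` Lam nu L = Lam nu L" using assms by (intro endo_inj_surj) auto
  then show ?thesis using sum.reindex[OF assms(1), of \<phi>] by simp
qed

lemma nbr_inj: assumes "1 \<le> L" "j < nu" shows "inj_on (\<lambda>x. nbr L x j) (Lam nu L)"
proof (rule inj_onI)
  fix x y assume x: "x \<in> Lam nu L" and y: "y \<in> Lam nu L" and eq: "nbr L x j = nbr L y j"
  show "x = y"
  proof (rule Lam_eqI[OF x y])
    fix i assume i: "i < nu"
    have "nbr L x j ! i = nbr L y j ! i" using eq by simp
    then show "x ! i = y ! i"
      using Lam_range[OF x assms(2)] Lam_range[OF y assms(2)]
      unfolding nbr_nth[OF x assms(2) i] nbr_nth[OF y assms(2) i] by (auto split: if_splits)
  qed
qed

lemma sum_nbr: "1 \<le> L \<Longrightarrow> j < nu \<Longrightarrow> (\<Sum>x\<in>Lam nu L. \<phi> (nbr L x j)) = (\<Sum>x\<in>Lam nu L. \<phi> x)"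
  by (intro sum_Lam_inj nbr_inj nbr_Lam)

text \<open>The matrix of the harmonic potential. Forward and backward hops are added separately, so
  for L = 1, where both neighbours in a direction coincide, the coupling correctly counts
  twice.\<close>

definition Amat :: "nat \<Rightarrow> real \<Rightarrow> (nat \<Rightarrow> real) \<Rightarrow> nat \<Rightarrow> int list \<Rightarrow> int list \<Rightarrow> real" where
  "Amat nu \<omega> lam L x y = (if x = y then \<omega>\<^sup>2 + 2 * (\<Sum>j<nu. lam j) else 0)
     - (\<Sum>j<nu. lam j * ((if nbr L x j = y then 1 else 0) + (if nbr L y j = x then 1 else 0)))"

lemma Amat_sym: "Amat nu \<omega> lam L x y = Amat nu \<omega> lam L y x"
  unfolding Amat_def by (auto simp: add.commute)

context
  fixes nu L :: nat and \<omega> :: real and lam :: "nat \<Rightarrow> real"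
  assumes L: "1 \<le> L" and lam: "\<And>j. j < nu \<Longrightarrow> 0 \<le> lam j"
begin

text \<open>Each site has one forward and one backward neighbour per direction; the backward one is
  counted through bijectivity of the translation.\<close>

lemma hop_sum:
  assumes x: "x \<in> Lam nu L"
  shows "(\<Sum>y\<in>Lam nu L. (\<Sum>j<nu. lam j * ((if nbr L x j = y then 1 else 0) + (if nbr L y j = x then 1 else 0)))) = 2 * (\<Sum>j<nu. lam j)"
proof -
  have "(\<Sum>y\<in>Lam nu L. (\<Sum>j<nu. lam j * ((if nbr L x j = y then 1 else 0) + (if nbr L y j = x then 1 else 0))))
      = (\<Sum>j<nu. lam j * ((\<Sum>y\<in>Lam nu L. if nbr L x j = y then 1 else 0) + (\<Sum>y\<in>Lam nu L. if nbr L y j = x then 1 else 0)))"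
    by (subst sum.swap) (simp only: sum_distrib_left[symmetric] sum.distrib)
  also have "\<dots> = (\<Sum>j<nu. lam j * (1 + 1))"
  proof (intro sum.cong refl)
    fix j assume "j \<in> {..<nu}" then have j: "j < nu" by simp
    have "(\<Sum>y\<in>Lam nu L. if nbr L y j = x then 1 else 0) = (\<Sum>y\<in>Lam nu L. if y = x then 1 else (0::real))"
      by (rule sum_nbr[OF L j, of "\<lambda>y. if y = x then 1 else 0"])
    then show "lam j * ((\<Sum>y\<in>Lam nu L. if nbr L x j = y then 1 else 0) + (\<Sum>y\<in>Lam nu L. if nbr L y j = x then 1 else 0)) = lam j * (1 + 1)"
      using x nbr_Lam[OF L x j] by simp
  qed
  finally show ?thesis by (simp add: sum_distrib_left mult.commute)
qed

lemma hop_nonneg: "0 \<le> (\<Sum>j<nu. lam j * ((if nbr L x j = y then 1 else 0) + (if nbr L y j = x then 1 else 0)))"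
  by (intro sum_nonneg mult_nonneg_nonneg lam) auto

lemma lam_sum_nonneg: "0 \<le> (\<Sum>j<nu. lam j)"
  by (intro sum_nonneg lam) auto

lemma Amat_offdiag: "x \<noteq> y \<Longrightarrow> Amat nu \<omega> lam L x y \<le> 0"
  using hop_nonneg[of x y] by (simp add: Amat_def)

lemma Amat_diag: "Amat nu \<omega> lam L x x \<le> \<omega>\<^sup>2 + 2 * (\<Sum>j<nu. lam j)"
  using hop_nonneg[of x x] by (simp add: Amat_def)

text \<open>Diagonal and hopping couplings cancel. The remaining omega^2 > 0 is the gap required by
  \<open>matrix_sqrt\<close>.\<close>

lemma Amat_row: "x \<in> Lam nu L \<Longrightarrow> (\<Sum>y\<in>Lam nu L. Amat nu \<omega> lam L x y) = \<omega>\<^sup>2"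
  unfolding Amat_def sum_subtractf by (subst hop_sum) auto

text \<open>With absolute values the couplings add up instead, which is the origin of the square of
  \<open>c_ol\<close>.\<close>

lemma Amat_abs_row: "x \<in> Lam nu L \<Longrightarrow> (\<Sum>y\<in>Lam nu L. \<bar>Amat nu \<omega> lam L x y\<bar>) \<le> \<omega>\<^sup>2 + 4 * (\<Sum>j<nu. lam j)"
proof -
  assume x: "x \<in> Lam nu L"
  have "(\<Sum>y\<in>Lam nu L. \<bar>Amat nu \<omega> lam L x y\<bar>) \<le> (\<Sum>y\<in>Lam nu L. (if x = y then \<omega>\<^sup>2 + 2 * (\<Sum>j<nu. lam j) else 0)
     + (\<Sum>j<nu. lam j * ((if nbr L x j = y then 1 else 0) + (if nbr L y j = x then 1 else 0))))"
  proof (rule sum_mono)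
    fix y
    have "0 \<le> (if x = y then \<omega>\<^sup>2 + 2 * (\<Sum>j<nu. lam j) else 0)" using lam_sum_nonneg by simp
    then show "\<bar>Amat nu \<omega> lam L x y\<bar> \<le> (if x = y then \<omega>\<^sup>2 + 2 * (\<Sum>j<nu. lam j) else 0)
      + (\<Sum>j<nu. lam j * ((if nbr L x j = y then 1 else 0) + (if nbr L y j = x then 1 else 0)))"
      using hop_nonneg[of x y] unfolding Amat_def by linarith
  qed
  also have "\<dots> = \<omega>\<^sup>2 + 4 * (\<Sum>j<nu. lam j)"
    unfolding sum.distrib hop_sum[OF x] using x by simp
  finally show ?thesis .
qed

lemma Amat_hop:
  assumes "x \<in> Lam nu L" "y \<in> Lam nu L" "Amat nu \<omega> lam L x y \<noteq> 0" shows "tdist nu L x y \<le> 1"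
proof (rule ccontr)
  assume far: "\<not> tdist nu L x y \<le> 1"
  then have "x \<noteq> y" using tdist_self[of nu L x] by auto
  moreover have "nbr L x j \<noteq> y" "nbr L y j \<noteq> x" if "j < nu" for j
    using tdist_nbr[OF L assms(1) that] tdist_nbr[OF L assms(2) that] far tdist_sym[of nu L x y] by auto
  ultimately have "Amat nu \<omega> lam L x y = 0" unfolding Amat_def by (auto intro!: sum.neutral)
  then show False using assms(3) by simp
qed

text \<open>Expanding the squares, translation invariance identifies the sum of q_(x+e_j)^2 with
  that of q_x^2; the mixed terms match the two kinds of hops.\<close>

lemma Amat_quadratic:
  "(\<Sum>x\<in>Lam nu L. \<omega>\<^sup>2 * (q x)\<^sup>2 + (\<Sum>j<nu. lam j * (q x - q (nbr L x j))\<^sup>2)) = (\<Sum>x\<in>Lam nu L. \<Sum>y\<in>Lam nu L. Amat nu \<omega> lam L x y * q x * q y)"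
proof -
  let ?I = "Lam nu L" and ?l = "\<Sum>j<nu. lam j" and ?S = "\<Sum>x\<in>Lam nu L. (q x)\<^sup>2"
  let ?C = "\<Sum>j<nu. lam j * (\<Sum>x\<in>Lam nu L. q x * q (nbr L x j))"
  have "(\<Sum>x\<in>?I. \<omega>\<^sup>2 * (q x)\<^sup>2 + (\<Sum>j<nu. lam j * (q x - q (nbr L x j))\<^sup>2))
     = \<omega>\<^sup>2 * ?S + (\<Sum>j<nu. lam j * (\<Sum>x\<in>?I. (q x - q (nbr L x j))\<^sup>2))"
    unfolding sum.distrib sum_distrib_left by (subst (2) sum.swap) simp
  also have "(\<Sum>j<nu. lam j * (\<Sum>x\<in>?I. (q x - q (nbr L x j))\<^sup>2)) = (\<Sum>j<nu. lam j * (2 * ?S - 2 * (\<Sum>x\<in>?I. q x * q (nbr L x j))))"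
  proof (intro sum.cong refl arg_cong2[where f = "(*)"])
    fix j assume "j \<in> {..<nu}" then have j: "j < nu" by simp
    have "(\<Sum>x\<in>?I. (q x - q (nbr L x j))\<^sup>2) = ?S + (\<Sum>x\<in>?I. (q (nbr L x j))\<^sup>2) - 2 * (\<Sum>x\<in>?I. q x * q (nbr L x j))"
      by (simp add: power2_diff sum.distrib sum_subtractf sum_distrib_left mult.assoc)
    then show "(\<Sum>x\<in>?I. (q x - q (nbr L x j))\<^sup>2) = 2 * ?S - 2 * (\<Sum>x\<in>?I. q x * q (nbr L x j))"
      using sum_nbr[OF L j, of "\<lambda>x. (q x)\<^sup>2"] by simp
  qed
  also have "\<dots> = 2 * ?l * ?S - 2 * ?C"
  proof -
    have "(\<Sum>j<nu. lam j * (2 * s - 2 * c j)) = 2 * ?l * s - 2 * (\<Sum>j<nu. lam j * c j)" for s c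
      by (simp add: right_diff_distrib sum_subtractf sum_distrib_left sum_distrib_right mult_ac)
    then show ?thesis .
  qed
  finally have lhs: "(\<Sum>x\<in>?I. \<omega>\<^sup>2 * (q x)\<^sup>2 + (\<Sum>j<nu. lam j * (q x - q (nbr L x j))\<^sup>2)) = (\<omega>\<^sup>2 + 2 * ?l) * ?S - 2 * ?C"
    by (simp add: algebra_simps)
  have "(\<Sum>x\<in>?I. \<Sum>y\<in>?I. Amat nu \<omega> lam L x y * q x * q y)
     = (\<Sum>x\<in>?I. \<Sum>y\<in>?I. (if x = y then (\<omega>\<^sup>2 + 2 * ?l) * (q x * q y) else 0)
        - (\<Sum>j<nu. lam j * ((if nbr L x j = y then q x * q y else 0) + (if nbr L y j = x then q x * q y else 0))))"
  proof (intro sum.cong refl)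
    fix x y
    have "Amat nu \<omega> lam L x y * q x * q y = (if x = y then \<omega>\<^sup>2 + 2 * ?l else 0) * (q x * q y)
      - (\<Sum>j<nu. lam j * ((if nbr L x j = y then 1 else 0) + (if nbr L y j = x then 1 else 0)) * (q x * q y))"
      unfolding Amat_def by (simp add: left_diff_distrib sum_distrib_right mult.assoc)
    also have "(\<Sum>j<nu. lam j * ((if nbr L x j = y then 1 else 0) + (if nbr L y j = x then 1 else 0)) * (q x * q y))
       = (\<Sum>j<nu. lam j * ((if nbr L x j = y then q x * q y else 0) + (if nbr L y j = x then q x * q y else 0)))"
      by (intro sum.cong refl) (simp add: algebra_simps)
    finally show "Amat nu \<omega> lam L x y * q x * q y = (if x = y then (\<omega>\<^sup>2 + 2 * ?l) * (q x * q y) else 0)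
        - (\<Sum>j<nu. lam j * ((if nbr L x j = y then q x * q y else 0) + (if nbr L y j = x then q x * q y else 0)))" by simp
  qed
  also have "\<dots> = (\<omega>\<^sup>2 + 2 * ?l) * ?S - (\<Sum>x\<in>?I. \<Sum>y\<in>?I. \<Sum>j<nu. lam j * ((if nbr L x j = y then q x * q y else 0) + (if nbr L y j = x then q x * q y else 0)))"
    by (simp add: sum_subtractf sum_distrib_left power2_eq_square)
  also have "(\<Sum>x\<in>?I. \<Sum>y\<in>?I. \<Sum>j<nu. lam j * ((if nbr L x j = y then q x * q y else 0) + (if nbr L y j = x then q x * q y else 0))) = 2 * ?C"
  proof -
    have "(\<Sum>x\<in>?I. \<Sum>y\<in>?I. \<Sum>j<nu. lam j * ((if nbr L x j = y then q x * q y else 0) + (if nbr L y j = x then q x * q y else 0)))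
      = (\<Sum>x\<in>?I. \<Sum>j<nu. \<Sum>y\<in>?I. lam j * ((if nbr L x j = y then q x * q y else 0) + (if nbr L y j = x then q x * q y else 0)))"
      by (intro sum.cong refl sum.swap)
    also have "\<dots> = (\<Sum>j<nu. \<Sum>x\<in>?I. \<Sum>y\<in>?I. lam j * ((if nbr L x j = y then q x * q y else 0) + (if nbr L y j = x then q x * q y else 0)))"
      by (rule sum.swap)
    also have "\<dots> = (\<Sum>j<nu. lam j * (2 * (\<Sum>x\<in>?I. q x * q (nbr L x j))))"
    proof (intro sum.cong refl)
      fix j assume "j \<in> {..<nu}" then have j: "j < nu" by simp
      have 1: "(\<Sum>x\<in>?I. \<Sum>y\<in>?I. if nbr L x j = y then q x * q y else 0) = (\<Sum>x\<in>?I. q x * q (nbr L x j))"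
        using nbr_Lam[OF L _ j] by (intro sum.cong refl) simp
      have 2: "(\<Sum>x\<in>?I. \<Sum>y\<in>?I. if nbr L y j = x then q x * q y else 0) = (\<Sum>x\<in>?I. q x * q (nbr L x j))"
        by (subst sum.swap) (use nbr_Lam[OF L _ j] in \<open>auto intro!: sum.cong simp: mult.commute\<close>)
      show "(\<Sum>x\<in>?I. \<Sum>y\<in>?I. lam j * ((if nbr L x j = y then q x * q y else 0) + (if nbr L y j = x then q x * q y else 0)))
        = lam j * (2 * (\<Sum>x\<in>?I. q x * q (nbr L x j)))"
        unfolding sum_distrib_left[symmetric] sum.distrib 1 2 by simp
    qed
    also have "\<dots> = 2 * ?C" by (simp add: sum_distrib_left mult_ac)
    finally show ?thesis .
  qed
  finally show ?thesis using lhs by simp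
qed

end

section \<open>Convolution estimate\<close>

text \<open>The representative of d modulo 2 L in the half-open range of the box; the shifts by one
  select (-L, L] instead of [-L, L).\<close>

definition wrap :: "nat \<Rightarrow> int \<Rightarrow> int" where
  "wrap L d = (d + int L - 1) mod (2 * int L) - int L + 1"

lemma wrap_range: "1 \<le> L \<Longrightarrow> - int L < wrap L d \<and> wrap L d \<le> int L"
proof -
  assume "1 \<le> L"
  then have "0 \<le> (d + int L - 1) mod (2 * int L)" "(d + int L - 1) mod (2 * int L) < 2 * int L" by simp_all
  then show ?thesis unfolding wrap_def by linarith
qed

lemma wrap_eq: "\<exists>k. wrap L d = d + 2 * int L * k"
proof
  have "(d + int L - 1) mod (2 * int L) = (d + int L - 1) - 2 * int L * ((d + int L - 1) div (2 * int L))"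
    by (simp add: minus_mult_div_eq_mod)
  then show "wrap L d = d + 2 * int L * (- ((d + int L - 1) div (2 * int L)))" by (simp add: wrap_def)
qed

lemma td1_wrap: assumes "1 \<le> L" shows "td1 L d = \<bar>wrap L d\<bar>"
proof -
  obtain k where k: "wrap L d = d + 2 * int L * k" using wrap_eq by blast
  have "td1 L d = td1 L (wrap L d)" unfolding k by (simp add: td1_periodic)
  moreover have "\<bar>wrap L d\<bar> \<le> int L" using wrap_range[OF assms, of d] by linarith
  ultimately show ?thesis by (simp add: td1_small)
qed

text \<open>Sending z to the wrapped difference x - z permutes the box and turns torus distance from
  x into the l1 norm, so such sums do not depend on x.\<close>

lemma sum_tdist:
  assumes L: "1 \<le> L" and x: "x \<in> Lam nu L"
  shows "(\<Sum>z\<in>Lam nu L. \<phi> (tdist nu L x z)) = (\<Sum>z\<in>Lam nu L. \<phi> (l1abs nu z))"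
proof -
  let ?h = "\<lambda>z. map (\<lambda>j. wrap L (x ! j - z ! j)) [0..<nu]"
  have "tdist nu L x z = l1abs nu (?h z)" for z
    unfolding tdist_td1 l1abs_def by (intro sum.cong refl) (simp add: td1_wrap[OF L])
  moreover have "(\<Sum>z\<in>Lam nu L. \<phi> (l1abs nu (?h z))) = (\<Sum>z\<in>Lam nu L. \<phi> (l1abs nu z))"
  proof (rule sum_Lam_inj[of ?h nu L "\<lambda>z. \<phi> (l1abs nu z)"])
    show "?h z \<in> Lam nu L" for z using wrap_range[OF L] by (simp add: Lam_def)
    show "inj_on ?h (Lam nu L)"
    proof (rule inj_onI)
      fix y z assume y: "y \<in> Lam nu L" and z: "z \<in> Lam nu L" and eq: "?h y = ?h z"
      show "y = z"
      proof (rule Lam_eqI[OF y z])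
        fix i assume i: "i < nu"
        have "?h y ! i = ?h z ! i" by (simp only: eq)
        then have "wrap L (x ! i - y ! i) = wrap L (x ! i - z ! i)" using i by simp
        then obtain k l where "x ! i - y ! i + 2 * int L * k = x ! i - z ! i + 2 * int L * l" using wrap_eq by metis
        then have d: "y ! i - z ! i = 2 * int L * (k - l)" by (simp add: algebra_simps)
        \<comment> \<open>Coordinates in the box differ by less than a full period, so a multiple of
          the period must be zero.\<close>
        have "\<bar>y ! i - z ! i\<bar> < 2 * int L" using Lam_range[OF y i] Lam_range[OF z i] by linarith
        then have "2 * int L * \<bar>k - l\<bar> < 2 * int L * 1" unfolding d by (simp add: abs_mult)
        then have "\<bar>k - l\<bar> < 1" by (simp only: mult_less_cancel_left)
        then show "y ! i = z ! i" using d by simp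
      qed
    qed
  qed
  ultimately show ?thesis by simp
qed

text \<open>Convexity of the power, proved by induction from (a - b)(a^n - b^n) >= 0.\<close>

lemma power_sum_le: "0 \<le> a \<Longrightarrow> 0 \<le> b \<Longrightarrow> (a + b) ^ Suc n \<le> 2 ^ n * (a ^ Suc n + (b::real) ^ Suc n)"
proof (induction n)
  case (Suc n)
  have "(a + b) ^ Suc (Suc n) = (a + b) * (a + b) ^ Suc n" by simp
  also have "\<dots> \<le> (a + b) * (2 ^ n * (a ^ Suc n + b ^ Suc n))" using Suc by (intro mult_left_mono) auto
  also have "\<dots> = 2 ^ n * (a ^ Suc (Suc n) + b ^ Suc (Suc n) + (a * b ^ Suc n + b * a ^ Suc n))" by (simp add: algebra_simps)
  also have "\<dots> \<le> 2 ^ n * (a ^ Suc (Suc n) + b ^ Suc (Suc n) + (a ^ Suc (Suc n) + b ^ Suc (Suc n)))"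
  proof -
    have "0 \<le> (a - b) * (a ^ Suc n - b ^ Suc n)"
    proof (cases "a \<le> b")
      case True
      then have "a ^ Suc n \<le> b ^ Suc n" using Suc.prems by (intro power_mono) auto
      then show ?thesis using True by (intro mult_nonpos_nonpos) auto
    next
      case False
      then have "b ^ Suc n \<le> a ^ Suc n" using Suc.prems by (intro power_mono) auto
      then show ?thesis using False by (intro mult_nonneg_nonneg) auto
    qed
    then have "a * b ^ Suc n + b * a ^ Suc n \<le> a ^ Suc (Suc n) + b ^ Suc (Suc n)" by (simp add: algebra_simps)
    then show ?thesis by (intro mult_left_mono) auto
  qed
  also have "\<dots> = 2 ^ Suc n * (a ^ Suc (Suc n) + b ^ Suc (Suc n))" by (simp add: distrib_left)
  finally show ?case .
qed simp

section \<open>The weights \<open>F_mu\<close> under convolution\<close>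

lemma F_mu_eq: "0 \<le> r \<Longrightarrow> F_mu nu \<mu> r = exp (- \<mu> * r) / (1 + r) ^ Suc nu"
  by (simp add: F_mu_def powr_minus powr_realpow divide_inverse del: of_nat_Suc flip: Suc_eq_plus1)

lemma C_nu_eq: "C_nu nu L = 2 ^ Suc nu * (\<Sum>z\<in>Lam nu L. 1 / (1 + real_of_int (l1abs nu z)) ^ Suc nu)"
proof -
  have "0 \<le> l1abs nu z" for z by (simp add: l1abs_def sum_nonneg)
  then have "0 < 1 + real_of_int (l1abs nu z)" for z by (simp add: add_pos_nonneg)
  then have "(1 + real_of_int (l1abs nu z)) powr (- real (nu + 1)) = 1 / (1 + real_of_int (l1abs nu z)) ^ Suc nu" for z
    by (simp only: powr_minus powr_realpow Suc_eq_plus1 divide_inverse mult_1_left)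
  then show ?thesis by (simp add: C_nu_def)
qed

text \<open>The triangle inequality handles the exponentials. For the powers, 1 + d(x,y) is at most
  the sum of the other two factors, so their reciprocal product is at most 2^nu over the power for
  (x,y), times the sum of both reciprocals; these two sums over z give the further factor 2 in
  \<open>C_nu\<close>.\<close>

lemma F_mu_convolution:
  assumes L: "1 \<le> L" and x: "x \<in> Lam nu L" and y: "y \<in> Lam nu L" and \<mu>: "0 \<le> \<mu>"
  shows "(\<Sum>z\<in>Lam nu L. F_mu nu \<mu> (tdist nu L x z) * F_mu nu \<mu> (tdist nu L z y)) \<le> C_nu nu L * F_mu nu \<mu> (tdist nu L x y)"
proof -
  let ?d = "\<lambda>x y. real_of_int (tdist nu L x y)" and ?G = "\<lambda>r::real. 1 / (1 + r) ^ Suc nu"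
  have d0: "0 \<le> ?d x y" for x y by (simp add: tdist_nonneg)
  have pt: "F_mu nu \<mu> (?d x z) * F_mu nu \<mu> (?d z y) \<le> (2 ^ nu * F_mu nu \<mu> (?d x y)) * (?G (?d x z) + ?G (?d y z))" for z
  proof -
    let ?a = "1 + ?d x z" and ?b = "1 + ?d z y" and ?c = "1 + ?d x y"
    have tri: "?d x y \<le> ?d x z + ?d z y" using tdist_triangle[of nu L x y z] by linarith
    have a: "0 < ?a" "0 < ?b" "0 < ?c" using d0[of x z] d0[of z y] d0[of x y] by linarith+
    have "?c ^ Suc nu \<le> (?a + ?b) ^ Suc nu" using tri a by (intro power_mono) auto
    also have "\<dots> \<le> 2 ^ nu * (?a ^ Suc nu + ?b ^ Suc nu)" using a by (intro power_sum_le) auto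
    finally have "?c ^ Suc nu / (?a ^ Suc nu * ?b ^ Suc nu) \<le> (2 ^ nu * (?a ^ Suc nu + ?b ^ Suc nu)) / (?a ^ Suc nu * ?b ^ Suc nu)"
      using a by (intro divide_right_mono) auto
    also have "\<dots> = 2 ^ nu * (?G (?d x z) + ?G (?d z y))" using a by (simp add: field_simps del: power_Suc)
    finally have "1 / (?a ^ Suc nu * ?b ^ Suc nu) \<le> 2 ^ nu * (?G (?d x z) + ?G (?d z y)) / ?c ^ Suc nu"
      using a by (simp add: pos_le_divide_eq del: power_Suc)
    moreover have "exp (- \<mu> * ?d x z) * exp (- \<mu> * ?d z y) \<le> exp (- \<mu> * ?d x y)"
      using mult_left_mono[OF tri \<mu>] by (simp add: exp_add[symmetric] algebra_simps)
    ultimately have "(exp (- \<mu> * ?d x z) * exp (- \<mu> * ?d z y)) * (1 / (?a ^ Suc nu * ?b ^ Suc nu))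
       \<le> exp (- \<mu> * ?d x y) * (2 ^ nu * (?G (?d x z) + ?G (?d z y)) / ?c ^ Suc nu)"
      using a by (intro mult_mono) auto
    then show ?thesis by (simp add: F_mu_eq[OF d0] tdist_sym[of nu L y z] mult_ac del: power_Suc)
  qed
  have "(\<Sum>z\<in>Lam nu L. F_mu nu \<mu> (?d x z) * F_mu nu \<mu> (?d z y)) \<le> (\<Sum>z\<in>Lam nu L. (2 ^ nu * F_mu nu \<mu> (?d x y)) * (?G (?d x z) + ?G (?d y z)))"
    by (intro sum_mono pt)
  also have "\<dots> = (2 ^ nu * F_mu nu \<mu> (?d x y)) * ((\<Sum>z\<in>Lam nu L. ?G (?d x z)) + (\<Sum>z\<in>Lam nu L. ?G (?d y z)))"
    by (simp only: sum_distrib_left[symmetric] sum.distrib)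
  also have "\<dots> = C_nu nu L * F_mu nu \<mu> (?d x y)"
    using sum_tdist[OF L x, of "\<lambda>r. ?G (real_of_int r)"] sum_tdist[OF L y, of "\<lambda>r. ?G (real_of_int r)"]
    by (simp add: C_nu_eq del: power_Suc) simp
  finally show ?thesis .
qed

text \<open>A single term of the exponential series at eps (1 + s) dominates the power of 1 +
  s.\<close>

lemma bdd_power_exp:
  assumes "0 < (\<epsilon>::real)" shows "bdd_above ((\<lambda>s. (1 + s) ^ n * exp (- \<epsilon> * s)) ` {0..})"
proof (rule bdd_aboveI2)
  fix s :: real assume s: "s \<in> {0..}"
  have "(\<Sum>k\<in>{n}. (\<epsilon> * (1 + s)) ^ k /\<^sub>R fact k) \<le> exp (\<epsilon> * (1 + s))"
    unfolding exp_def using assms s by (intro sum_le_suminf summable_exp_generic) auto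
  then have "\<epsilon> ^ n * (1 + s) ^ n \<le> fact n * exp (\<epsilon> * (1 + s))"
    by (simp add: power_mult_distrib[of \<epsilon> "1 + s"] inverse_eq_divide pos_divide_le_eq mult.commute[of "fact n"])
  then have "(1 + s) ^ n \<le> fact n / \<epsilon> ^ n * exp (\<epsilon> * (1 + s))"
    using assms by (simp add: pos_le_divide_eq mult.commute[of "\<epsilon> ^ n"])
  then have "(1 + s) ^ n * exp (- \<epsilon> * s) \<le> fact n / \<epsilon> ^ n * exp (\<epsilon> * (1 + s)) * exp (- \<epsilon> * s)"
    by (intro mult_right_mono) auto
  also have "\<dots> = fact n / \<epsilon> ^ n * exp \<epsilon>" by (simp add: mult.assoc exp_add[symmetric] algebra_simps)
  finally show "(1 + s) ^ n * exp (- \<epsilon> * s) \<le> fact n / \<epsilon> ^ n * exp \<epsilon>" .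
qed

text \<open>Here eps is spent: the excess decay exp(-eps r) is traded for the polynomial factor at
  the price of the supremum.\<close>

lemma exp_le_F_mu:
  assumes "0 < \<epsilon>" "0 \<le> r"
  shows "exp (- (\<mu> + \<epsilon>) * r) \<le> (SUP s\<in>{0::real..}. (1 + s) ^ (nu + 1) * exp (- \<epsilon> * s)) * F_mu nu \<mu> r"
proof -
  have "(1 + r) ^ (nu + 1) * exp (- \<epsilon> * r) \<le> (SUP s\<in>{0::real..}. (1 + s) ^ (nu + 1) * exp (- \<epsilon> * s))"
    using assms by (intro cSUP_upper bdd_power_exp) auto
  then have "((1 + r) ^ (nu + 1) * exp (- \<epsilon> * r)) * F_mu nu \<mu> r \<le> (SUP s\<in>{0::real..}. (1 + s) ^ (nu + 1) * exp (- \<epsilon> * s)) * F_mu nu \<mu> r"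
    by (intro mult_right_mono) (auto simp: F_mu_def)
  moreover have "((1 + r) ^ (nu + 1) * exp (- \<epsilon> * r)) * F_mu nu \<mu> r = exp (- (\<mu> + \<epsilon>) * r)"
  proof -
    have "(1 + r) ^ Suc nu \<noteq> 0" using assms by simp
    then have "((1 + r) ^ Suc nu * exp (- \<epsilon> * r)) * (exp (- \<mu> * r) / (1 + r) ^ Suc nu) = exp (- \<epsilon> * r) * exp (- \<mu> * r)"
      by (simp del: power_Suc)
    also have "\<dots> = exp (- (\<mu> + \<epsilon>) * r)" by (simp add: exp_add[symmetric] algebra_simps)
    finally show ?thesis using assms by (simp only: F_mu_eq Suc_eq_plus1[symmetric])
  qed
  ultimately show ?thesis by simp
qed

section \<open>The commutator bound\<close>

lemma sigma_finite_cfgM: "sigma_finite_measure (cfgM nu L)"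
proof -
  interpret finite_product_sigma_finite "\<lambda>_::int list. lborel :: real measure" "Lam nu L" by standard simp
  show ?thesis unfolding cfgM_def by (rule sigma_finite_measure_axioms)
qed

definition delta :: "int list \<Rightarrow> real \<Rightarrow> int list \<Rightarrow> complex" where
  "delta x w y = (if y = x then complex_of_real w else 0)"

lemma Weyl_delta:
  assumes x: "x \<in> Lam nu L" and q: "q \<in> space (cfgM nu L)"
  shows "Weyl nu L (delta x w) \<psi> q = iexp (w * q x) * \<psi> q"
proof -
  have "phase nu L (delta x w) q = w * q x"
    unfolding phase_def delta_def using x by (simp add: if_distrib[of Re] if_distrib[of Im] if_distrib[of "\<lambda>a. a * _"] cong: if_cong)
  moreover have "shift_by (Lam nu L) (\<lambda>y. Im (delta x w y)) q = q"
    using q by (auto simp: delta_def space_cfgM restrict_def PiE_def extensional_def)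
  ultimately show ?thesis by (simp only: Weyl_eq)
qed

lemma Weyl_ip:
  "\<phi> \<in> L2 (cfgM nu L) \<Longrightarrow> \<psi> \<in> L2 (cfgM nu L) \<Longrightarrow> ip (cfgM nu L) (Weyl nu L g \<phi>) (Weyl nu L g \<psi>) = ip (cfgM nu L) \<phi> \<psi>"
  by (rule isometry_ip) (simp_all add: Weyl_L2 Weyl_l2norm L2_measurable Weyl_lin)

lemma Weyl_adj:
  assumes \<phi>: "\<phi> \<in> L2 (cfgM nu L)" and \<psi>: "\<psi> \<in> L2 (cfgM nu L)"
  shows "ip (cfgM nu L) \<phi> (Weyl nu L g \<psi>) = ip (cfgM nu L) (Weyl nu L (\<lambda>x. - g x) \<phi>) \<psi>"
proof -
  let ?W = "Weyl nu L" and ?M = "cfgM nu L"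
  have inv: "?W (\<lambda>x. - g x) (?W g \<psi>) q = \<psi> q" if q: "q \<in> space ?M" for q
  proof -
    have "sympl nu L (\<lambda>x. - g x) g = 0" by (simp add: sympl_def mult.commute)
    moreover have "?W (\<lambda>x. - g x + g x) \<psi> q = \<psi> q"
    proof -
      have "shift_by (Lam nu L) (\<lambda>y. Im (- g y + g y)) q = q" using q by (auto simp: space_cfgM restrict_def PiE_def extensional_def)
      then show ?thesis unfolding Weyl_eq by (simp add: phase_def)
    qed
    ultimately show ?thesis by (simp add: Weyl_Weyl[OF q])
  qed
  have "ip ?M (?W (\<lambda>x. - g x) \<phi>) \<psi> = ip ?M (?W (\<lambda>x. - g x) \<phi>) (?W (\<lambda>x. - g x) (?W g \<psi>))"
    using inv by (intro ip_cong_AE L2_measurable Weyl_L2 \<phi> \<psi> AE_I2) simp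
  also have "\<dots> = ip ?M \<phi> (?W g \<psi>)" by (intro Weyl_ip Weyl_L2 \<phi> \<psi>)
  finally show ?thesis by simp
qed

text \<open>A Fourier multiplier in q_x is, in the weak sense, a superposition of Weyl operators.
  Fubini applies since |k| |phi psi| is integrable on the product. Integrability is part of the
  result so that two such integrals may later be subtracted.\<close>

lemma multiplier_Fubini:
  assumes x: "x \<in> Lam nu L" and \<phi>: "\<phi> \<in> L2 (cfgM nu L)" and \<psi>: "\<psi> \<in> L2 (cfgM nu L)" and k: "integrable lborel (k :: real \<Rightarrow> complex)"
  shows "(CLINT q|cfgM nu L. (cnj (\<phi> q) * \<psi> q) * (CLINT w|lborel. k w * iexp (w * q x)))
      = (CLINT w|lborel. k w * ip (cfgM nu L) \<phi> (Weyl nu L (delta x w) \<psi>))"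
    and "integrable lborel (\<lambda>w. k w * ip (cfgM nu L) \<phi> (Weyl nu L (delta x w) \<psi>))"
proof -
  let ?M = "cfgM nu L"
  interpret S: sigma_finite_measure ?M by (rule sigma_finite_cfgM)
  interpret pair_sigma_finite lborel ?M ..
  let ?f = "\<lambda>w q. k w * ((cnj (\<phi> q) * \<psi> q) * iexp (w * q x))"
  have [measurable]: "\<phi> \<in> borel_measurable ?M" "\<psi> \<in> borel_measurable ?M" "k \<in> borel_measurable borel" "(\<lambda>q. q x) \<in> borel_measurable ?M"
    using \<phi> \<psi> k measurable_cfgM_component[OF x] by (auto dest: L2_measurable)
  have i: "integrable (lborel \<Otimes>\<^sub>M ?M) (case_prod ?f)"
  proof (rule Fubini_integrable)
    have "(\<lambda>(w, q). ?f w q) \<in> borel_measurable (borel \<Otimes>\<^sub>M ?M)" by measurable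
    then show "case_prod ?f \<in> borel_measurable (lborel \<Otimes>\<^sub>M ?M)" by simp
    have e: "(LINT q|?M. norm (case_prod ?f (w, q))) = cmod (k w) * (LINT q|?M. cmod (cnj (\<phi> q) * \<psi> q))" for w
      by (simp add: norm_mult)
    show "integrable lborel (\<lambda>w. LINT q|?M. norm (case_prod ?f (w, q)))"
      unfolding e by (intro integrable_mult_left integrable_norm k)
    have "integrable ?M (\<lambda>q. (cnj (\<phi> q) * \<psi> q) * iexp (w * q x))" for w
      by (rule Bochner_Integration.integrable_bound[OF ip_integrable[OF \<phi> \<psi>]]) (auto simp: norm_mult)
    then show "AE w in lborel. integrable ?M (\<lambda>q. case_prod ?f (w, q))" by simp
  qed
  have ipw: "(CLINT q|?M. ?f w q) = k w * ip ?M \<phi> (Weyl nu L (delta x w) \<psi>)" for w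
  proof -
    have "(CLINT q|?M. (cnj (\<phi> q) * \<psi> q) * iexp (w * q x)) = ip ?M \<phi> (Weyl nu L (delta x w) \<psi>)"
      unfolding ip_def by (intro Bochner_Integration.integral_cong refl) (simp add: Weyl_delta[OF x] mult_ac)
    then show ?thesis by simp
  qed
  have "(CLINT q|?M. (cnj (\<phi> q) * \<psi> q) * (CLINT w|lborel. k w * iexp (w * q x))) = (CLINT q|?M. CLINT w|lborel. ?f w q)"
  proof (intro Bochner_Integration.integral_cong refl)
    fix q
    have "?f w q = (cnj (\<phi> q) * \<psi> q) * (k w * iexp (w * q x))" for w by (simp add: mult_ac)
    then show "(cnj (\<phi> q) * \<psi> q) * (CLINT w|lborel. k w * iexp (w * q x)) = (CLINT w|lborel. ?f w q)"
      by (simp only: integral_mult_right_zero)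
  qed
  also have "\<dots> = (CLINT w|lborel. CLINT q|?M. ?f w q)" by (rule Fubini_integral[OF i])
  finally show "(CLINT q|?M. (cnj (\<phi> q) * \<psi> q) * (CLINT w|lborel. k w * iexp (w * q x)))
      = (CLINT w|lborel. k w * ip ?M \<phi> (Weyl nu L (delta x w) \<psi>))" unfolding ipw .
  show "integrable lborel (\<lambda>w. k w * ip ?M \<phi> (Weyl nu L (delta x w) \<psi>))"
    using integrable_fst[OF i] unfolding ipw .
qed

text \<open>Isolates what is used of the lattice. \<open>ek\<close> is an exponential weight against
  which the harmonic matrix has bound \<open>a\<^sup>2\<close>; \<open>F\<close> is a weight that
  reproduces under convolution; \<open>ek_F\<close> passes from the first to the second.
  \<open>k\<close> is the transform of V', and \<open>p\<close> dominates the harmonic growth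
  rate.\<close>

locale lieb_robinson = anharmonic +
  fixes k :: "real \<Rightarrow> complex" and a p Cc Cn :: real and ek F :: "int list \<Rightarrow> int list \<Rightarrow> real"
  assumes k_int: "integrable lborel k" and k1_int: "integrable lborel (\<lambda>w. cmod (k w) * \<bar>w\<bar>)"
    and V_increment: "\<And>r s. of_real (V (r + s) - V r) = (CLINT w|lborel. k w * fkern s w * iexp (w * r))"
    and a_pos: "0 < a" and p_ge: "2 * a \<le> p" and Cc_nonneg: "0 \<le> Cc"
    and ek_nonneg: "\<And>x y. 0 \<le> ek x y" and ek_self: "\<And>x. 1 \<le> ek x x"
    and ek_hop: "\<And>x y. x \<in> Lam nu L \<Longrightarrow> y \<in> Lam nu L \<Longrightarrow>
        (\<Sum>z\<in>Lam nu L. \<bar>\<Sum>u\<in>Lam nu L. B x u * B u z\<bar> * ek z y) \<le> a\<^sup>2 * ek x y"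
    and ek_F: "\<And>x y. (2 + a + 1 / a) * ek x y \<le> Cc * F x y"
    and F_pos: "\<And>x y. 0 < F x y" and F_le_1: "\<And>x y. F x y \<le> 1" and F_sym: "\<And>x y. F x y = F y x"
    and F_conv: "\<And>x y. x \<in> Lam nu L \<Longrightarrow> y \<in> Lam nu L \<Longrightarrow> (\<Sum>z\<in>Lam nu L. F x z * F z y) \<le> Cn * F x y"
begin

definition \<kappa> :: real where "\<kappa> = (LINT w|lborel. cmod (k w) * \<bar>w\<bar>)"

lemma \<kappa>_nonneg: "0 \<le> \<kappa>" unfolding \<kappa>_def by (rule Bochner_Integration.integral_nonneg) simp

lemma BvBv: "Bv (Bv q) x = (\<Sum>z\<in>I. (\<Sum>u\<in>I. B x u * B u z) * q z)"
  unfolding Bv_def sum_distrib_left sum_distrib_right by (subst sum.swap) (simp add: mult.assoc)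

text \<open>The generator alternates: a real part comes from the harmonic matrix on the imaginary
  part at cost 2 a^2, an imaginary part from the real part at cost 2. The prefactors 1 + a and 1 +
  1/a are balanced so that either step multiplies by exactly 2 a.\<close>

lemma flow_bound:
  assumes X: "X \<subseteq> I" and supp: "\<And>y. y \<notin> X \<Longrightarrow> f y = 0" and fn: "\<And>y. cmod (f y) \<le> fn" and x: "x \<in> I"
  shows "\<bar>Re (flow f t x)\<bar> \<le> (fn * (1 + a) * (\<Sum>y\<in>X. ek x y)) * exp (2 * a * \<bar>t\<bar>)"
    and "\<bar>Im (flow f t x)\<bar> \<le> (fn * (1 + 1 / a) * (\<Sum>y\<in>X. ek x y)) * exp (2 * a * \<bar>t\<bar>)"
proof -
  let ?E = "\<lambda>x. \<Sum>y\<in>X. ek x y"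
  have finX: "finite X" using X finite_subset finite_Lam by blast
  have E0: "0 \<le> ?E x" for x by (intro sum_nonneg ek_nonneg)
  have fn0: "0 \<le> fn" using fn norm_ge_zero order_trans by blast
  have hop: "(\<Sum>z\<in>I. \<bar>\<Sum>u\<in>I. B x u * B u z\<bar> * ?E z) \<le> a\<^sup>2 * ?E x" if "x \<in> I" for x
  proof -
    have "(\<Sum>z\<in>I. \<bar>\<Sum>u\<in>I. B x u * B u z\<bar> * ?E z) = (\<Sum>y\<in>X. \<Sum>z\<in>I. \<bar>\<Sum>u\<in>I. B x u * B u z\<bar> * ek z y)"
      unfolding sum_distrib_left by (rule sum.swap)
    also have "\<dots> \<le> (\<Sum>y\<in>X. a\<^sup>2 * ek x y)" using X by (intro sum_mono ek_hop that) auto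
    finally show ?thesis by (simp add: sum_distrib_left)
  qed
  have *: "\<forall>x\<in>I. \<bar>Re ((Gop ^^ n) f x)\<bar> \<le> (fn * (1 + a) * ?E x) * (2 * a) ^ n \<and> \<bar>Im ((Gop ^^ n) f x)\<bar> \<le> (fn * (1 + 1 / a) * ?E x) * (2 * a) ^ n" for n
  proof (induction n)
    case 0
    have f: "cmod (f x) \<le> fn * ?E x" for x
    proof (cases "x \<in> X")
      case True
      have "1 \<le> ek x x" by (rule ek_self)
      also have "\<dots> \<le> ?E x" using True finX by (intro member_le_sum) (auto simp: ek_nonneg)
      finally have "fn * 1 \<le> fn * ?E x" using fn0 by (intro mult_left_mono) auto
      then show ?thesis using fn[of x] by simp
    qed (use supp fn0 E0 in simp)
    have e: "fn * ?E x \<le> fn * (1 + a) * ?E x" "fn * ?E x \<le> fn * (1 + 1 / a) * ?E x" for x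
      using fn0 E0[of x] a_pos by (simp_all add: algebra_simps)
    show ?case
      using order_trans[OF order_trans[OF abs_Re_le_cmod f] e(1)] order_trans[OF order_trans[OF abs_Im_le_cmod f] e(2)] by simp
  next
    case (Suc n)
    show ?case
    proof (intro ballI conjI)
      fix x assume x: "x \<in> I"
      let ?c = "fn * (1 + 1 / a) * (2 * a) ^ n"
      have c0: "0 \<le> ?c" using fn0 a_pos by simp
      have "\<bar>Bv (Bv (\<lambda>y. Im ((Gop ^^ n) f y))) x\<bar> \<le> (\<Sum>z\<in>I. \<bar>(\<Sum>u\<in>I. B x u * B u z) * Im ((Gop ^^ n) f z)\<bar>)"
        unfolding BvBv by (rule sum_abs)
      also have "\<dots> \<le> (\<Sum>z\<in>I. ?c * (\<bar>\<Sum>u\<in>I. B x u * B u z\<bar> * ?E z))"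
      proof (rule sum_mono)
        fix z assume "z \<in> I"
        then have "\<bar>Im ((Gop ^^ n) f z)\<bar> \<le> ?c * ?E z" using Suc by (simp add: mult_ac)
        from mult_left_mono[OF this abs_ge_zero[of "\<Sum>u\<in>I. B x u * B u z"]]
        show "\<bar>(\<Sum>u\<in>I. B x u * B u z) * Im ((Gop ^^ n) f z)\<bar> \<le> ?c * (\<bar>\<Sum>u\<in>I. B x u * B u z\<bar> * ?E z)"
          by (simp add: abs_mult mult_ac)
      qed
      also have "\<dots> \<le> ?c * (a\<^sup>2 * ?E x)" unfolding sum_distrib_left[symmetric] by (intro mult_left_mono hop x c0)
      finally have "\<bar>Re ((Gop ^^ Suc n) f x)\<bar> \<le> 2 * (?c * (a\<^sup>2 * ?E x))" by (simp add: Gop_def[of "(Gop ^^ n) f"] abs_mult)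
      also have "\<dots> = (fn * (1 + a) * ?E x) * (2 * a) ^ Suc n" using a_pos by (simp add: field_simps power2_eq_square)
      finally show "\<bar>Re ((Gop ^^ Suc n) f x)\<bar> \<le> (fn * (1 + a) * ?E x) * (2 * a) ^ Suc n" .
      have "\<bar>Im ((Gop ^^ Suc n) f x)\<bar> \<le> 2 * ((fn * (1 + a) * ?E x) * (2 * a) ^ n)"
        using Suc x by (simp add: Gop_def[of "(Gop ^^ n) f"] abs_mult)
      also have "\<dots> = (fn * (1 + 1 / a) * ?E x) * (2 * a) ^ Suc n" using a_pos by (simp add: field_simps)
      finally show "\<bar>Im ((Gop ^^ Suc n) f x)\<bar> \<le> (fn * (1 + 1 / a) * ?E x) * (2 * a) ^ Suc n" .
    qed
  qed
  show "\<bar>Re (flow f t x)\<bar> \<le> (fn * (1 + a) * ?E x) * exp (2 * a * \<bar>t\<bar>)"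
    unfolding flow_def complex.sel by (rule egf_bound) (use * x in blast)
  show "\<bar>Im (flow f t x)\<bar> \<le> (fn * (1 + 1 / a) * ?E x) * exp (2 * a * \<bar>t\<bar>)"
    unfolding flow_def complex.sel by (rule egf_bound) (use * x in blast)
qed

lemma flow_bound_F:
  assumes X: "X \<subseteq> I" and supp: "\<And>y. y \<notin> X \<Longrightarrow> f y = 0" and fn: "\<And>y. cmod (f y) \<le> fn" and x: "x \<in> I"
  shows "\<bar>Re (flow f t x)\<bar> + \<bar>Im (flow f t x)\<bar> \<le> Cc * fn * exp (p * \<bar>t\<bar>) * (\<Sum>y\<in>X. F x y)"
proof -
  have fn0: "0 \<le> fn" using fn norm_ge_zero order_trans by blast
  have "\<bar>Re (flow f t x)\<bar> + \<bar>Im (flow f t x)\<bar> \<le> (fn * (1 + a) * (\<Sum>y\<in>X. ek x y)) * exp (2 * a * \<bar>t\<bar>) + (fn * (1 + 1 / a) * (\<Sum>y\<in>X. ek x y)) * exp (2 * a * \<bar>t\<bar>)"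
    by (intro add_mono flow_bound assms)
  also have "\<dots> = fn * exp (2 * a * \<bar>t\<bar>) * (\<Sum>y\<in>X. (2 + a + 1 / a) * ek x y)"
    unfolding sum_distrib_left[symmetric] by (simp add: algebra_simps)
  also have "\<dots> \<le> fn * exp (2 * a * \<bar>t\<bar>) * (\<Sum>y\<in>X. Cc * F x y)"
    using fn0 by (intro mult_left_mono sum_mono ek_F) auto
  also have "\<dots> \<le> fn * exp (p * \<bar>t\<bar>) * (\<Sum>y\<in>X. Cc * F x y)"
    using fn0 p_ge Cc_nonneg F_pos
    by (intro mult_right_mono mult_left_mono sum_nonneg mult_nonneg_nonneg) (auto intro: mult_right_mono less_imp_le)
  finally show ?thesis by (simp only: sum_distrib_left[symmetric] mult_ac)
qed

lemma Ms_space: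
  assumes "q \<in> space M"
  shows "complex_of_real (Ms b q) = - (\<Sum>x\<in>I. CLINT w|lborel. (k w * fkern (b x) w) * iexp (w * q x))"
proof -
  have "complex_of_real (Ms b q) = - (\<Sum>x\<in>I. of_real (V (q x + b x) - V (q x)))"
    by (simp add: Ms_def Vs_def sum_subtractf sum_negf)
  then show ?thesis by (simp only: V_increment)
qed

lemma k_fkern_integrable: "integrable lborel (\<lambda>w. k w * fkern s w)"
proof (rule Bochner_Integration.integrable_bound)
  show "integrable lborel (\<lambda>w. \<bar>s\<bar> * cmod (k w))" using k_int by (intro integrable_mult_right integrable_norm)
  have [measurable]: "k \<in> borel_measurable borel" using k_int by auto
  show "(\<lambda>w. k w * fkern s w) \<in> borel_measurable lborel" unfolding fkern_def by measurable
  have "cmod (k w) * cmod (fkern s w) \<le> cmod (k w) * \<bar>s\<bar>" for w by (intro mult_left_mono fkern_bound) auto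
  then show "AE w in lborel. norm (k w * fkern s w) \<le> norm (\<bar>s\<bar> * cmod (k w))"
    by (simp add: norm_mult abs_mult mult.commute)
qed

text \<open>The Fourier representation of increments of V in weak form, which makes operator-valued
  integrals unnecessary.\<close>

lemma ip_Ms:
  assumes \<phi>: "\<phi> \<in> L2 M" and \<psi>: "\<psi> \<in> L2 M"
  shows "ip M \<phi> (\<lambda>q. (\<i> * of_real (Ms b q)) * \<psi> q) = - \<i> * (\<Sum>x\<in>I. CLINT w|lborel. (k w * fkern (b x) w) * ip M \<phi> (W (delta x w) \<psi>))"
proof -
  let ?h = "\<lambda>x q. (cnj (\<phi> q) * \<psi> q) * (CLINT w|lborel. (k w * fkern (b x) w) * iexp (w * q x))"
  have "ip M \<phi> (\<lambda>q. (\<i> * of_real (Ms b q)) * \<psi> q) = (CLINT q|M. - \<i> * (\<Sum>x\<in>I. ?h x q))"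
    unfolding ip_def
    by (intro Bochner_Integration.integral_cong refl) (simp add: Ms_space sum_distrib_left sum_negf mult_ac)
  also have "\<dots> = - \<i> * (CLINT q|M. \<Sum>x\<in>I. ?h x q)" by (rule integral_mult_right_zero)
  also have "(CLINT q|M. \<Sum>x\<in>I. ?h x q) = (\<Sum>x\<in>I. CLINT q|M. ?h x q)"
  proof (rule Bochner_Integration.integral_sum)
    fix x assume x: "x \<in> I"
    show "integrable M (?h x)"
    proof (rule Bochner_Integration.integrable_bound)
      show "integrable M (\<lambda>q. (2 * Vb) * cmod (cnj (\<phi> q) * \<psi> q))" by (intro integrable_mult_right integrable_norm ip_integrable \<phi> \<psi>)
      have h: "?h x q = (cnj (\<phi> q) * \<psi> q) * of_real (V (q x + b x) - V (q x))" for q by (simp only: V_increment)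
      have [measurable]: "\<phi> \<in> borel_measurable M" "\<psi> \<in> borel_measurable M" "(\<lambda>q. q x) \<in> borel_measurable M" "V \<in> borel_measurable borel"
        using \<phi> \<psi> measurable_cfgM_component[OF x] V_measurable by (auto dest: L2_measurable)
      show "?h x \<in> borel_measurable M" unfolding h by measurable
      have "\<bar>V (q x + b x) - V (q x)\<bar> \<le> 2 * Vb" for q :: "int list \<Rightarrow> real" using V_bound[of "q x + b x"] V_bound[of "q x"] by linarith
      then have "cmod (?h x q) \<le> cmod (cnj (\<phi> q) * \<psi> q) * (2 * Vb)" for q
        unfolding h norm_mult[of "cnj (\<phi> q) * \<psi> q"] norm_of_real by (intro mult_left_mono) auto
      then show "AE q in M. norm (?h x q) \<le> norm ((2 * Vb) * cmod (cnj (\<phi> q) * \<psi> q))"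
        by (intro AE_I2 order_trans[OF _ abs_ge_self, of _ "(2 * Vb) * cmod _", folded real_norm_def]) (simp add: mult.commute)
    qed
  qed
  also have "\<dots> = (\<Sum>x\<in>I. CLINT w|lborel. (k w * fkern (b x) w) * ip M \<phi> (W (delta x w) \<psi>))"
    by (intro sum.cong refl multiplier_Fubini(1) \<phi> \<psi> k_fkern_integrable)
  finally show ?thesis .
qed

text \<open>The commutator of \<open>Lop\<close> with \<open>W g\<close> is a superposition of
  commutators of evolved single-site Weyl operators, with weight at most |k w| |b x|. The profile
  \<open>\<gamma>\<close> is left open because it is taken as |w| in the main step and as 1 in the a
  priori bound.\<close>

lemma Lop_comm_bound:
  assumes \<xi>: "\<xi> \<in> L2 M" and \<gamma>: "integrable lborel (\<lambda>w. cmod (k w) * \<gamma> w)"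
    and \<theta>: "\<And>x. x \<in> I \<Longrightarrow> 0 \<le> \<theta> x" and \<gamma>0: "\<And>w. 0 \<le> \<gamma> w"
    and bd: "\<And>x w. x \<in> I \<Longrightarrow> N (comm g (\<lambda>_. delta x w) s \<xi>) \<le> \<theta> x * \<gamma> w * N \<xi>"
  shows "N (\<lambda>q. Lop b s (W g \<xi>) q - W g (Lop b s \<xi>) q) \<le> (\<Sum>x\<in>I. \<bar>b x\<bar> * \<theta> x) * (LINT w|lborel. cmod (k w) * \<gamma> w) * N \<xi>"
proof (rule l2norm_le_of_ip)
  let ?J = "LINT w|lborel. cmod (k w) * \<gamma> w"
  have J0: "0 \<le> ?J" using \<gamma>0 by (intro Bochner_Integration.integral_nonneg) auto
  have L: "Lop b s (W g \<xi>) \<in> L2 M" "W g (Lop b s \<xi>) \<in> L2 M" "Lop b s \<xi> \<in> L2 M" by (intro Lop_L2 Weyl_L2 \<xi>)+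
  show "(\<lambda>q. Lop b s (W g \<xi>) q - W g (Lop b s \<xi>) q) \<in> L2 M" by (intro L2_diff L)
  show "0 \<le> (\<Sum>x\<in>I. \<bar>b x\<bar> * \<theta> x) * ?J * N \<xi>" using \<theta> J0 by (intro mult_nonneg_nonneg sum_nonneg) auto
  fix \<phi> assume \<phi>: "\<phi> \<in> L2 M"
  let ?m = "\<lambda>x w. k w * fkern (b x) w" and ?\<phi> = "W (\<lambda>x. - g x) \<phi>"
  have W\<phi>: "?\<phi> \<in> L2 M" and Wg: "W g \<xi> \<in> L2 M" by (intro Weyl_L2 \<phi> \<xi>)+
  have LL: "ip M \<phi> (Lop b s \<psi>) = ip M (U s \<phi>) (\<lambda>q. (\<i> * of_real (Ms b q)) * U s \<psi> q)" if "\<phi> \<in> L2 M" "\<psi> \<in> L2 M" for \<phi> \<psi>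
    unfolding Lop_def using U_adj[OF that(1) Ms_mult_L2[OF U_L2[OF that(2)]], of "- s"] by simp
  have hh: "ip M (U s \<phi>) (W (delta x w) (U s \<psi>)) = ip M \<phi> (heis (\<lambda>_. delta x w) s \<psi>)" if "\<phi> \<in> L2 M" "\<psi> \<in> L2 M" for \<phi> \<psi> x w
    unfolding heis_def using U_adj[OF that(1) Weyl_L2[OF U_L2[OF that(2)]], of "- s"] by simp
  have 1: "ip M \<phi> (Lop b s (W g \<xi>)) = - \<i> * (\<Sum>x\<in>I. CLINT w|lborel. ?m x w * ip M \<phi> (heis (\<lambda>_. delta x w) s (W g \<xi>)))"
    unfolding LL[OF \<phi> Wg] ip_Ms[OF U_L2[OF \<phi>] U_L2[OF Wg]] hh[OF \<phi> Wg] ..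
  have "ip M \<phi> (W g (Lop b s \<xi>)) = ip M ?\<phi> (Lop b s \<xi>)" by (rule Weyl_adj[OF \<phi> L(3)])
  also have "\<dots> = - \<i> * (\<Sum>x\<in>I. CLINT w|lborel. ?m x w * ip M ?\<phi> (heis (\<lambda>_. delta x w) s \<xi>))"
    unfolding LL[OF W\<phi> \<xi>] ip_Ms[OF U_L2[OF W\<phi>] U_L2[OF \<xi>]] hh[OF W\<phi> \<xi>] ..
  also have "\<dots> = - \<i> * (\<Sum>x\<in>I. CLINT w|lborel. ?m x w * ip M \<phi> (W g (heis (\<lambda>_. delta x w) s \<xi>)))"
    by (simp only: Weyl_adj[OF \<phi> heis_L2[OF \<xi>]])
  finally have 2: "ip M \<phi> (W g (Lop b s \<xi>)) = - \<i> * (\<Sum>x\<in>I. CLINT w|lborel. ?m x w * ip M \<phi> (W g (heis (\<lambda>_. delta x w) s \<xi>)))" .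
  have i1: "integrable lborel (\<lambda>w. ?m x w * ip M \<phi> (heis (\<lambda>_. delta x w) s (W g \<xi>)))" if "x \<in> I" for x
    using multiplier_Fubini(2)[OF that U_L2[OF \<phi>, of s] U_L2[OF Wg, of s] k_fkern_integrable[of "b x"]] unfolding hh[OF \<phi> Wg] .
  have i2: "integrable lborel (\<lambda>w. ?m x w * ip M \<phi> (W g (heis (\<lambda>_. delta x w) s \<xi>)))" if "x \<in> I" for x
    using multiplier_Fubini(2)[OF that U_L2[OF W\<phi>, of s] U_L2[OF \<xi>, of s] k_fkern_integrable[of "b x"]] unfolding hh[OF W\<phi> \<xi>] Weyl_adj[OF \<phi> heis_L2[OF \<xi>]] .
  have cip: "ip M \<phi> (comm g (\<lambda>_. delta x w) s \<xi>) = ip M \<phi> (heis (\<lambda>_. delta x w) s (W g \<xi>)) - ip M \<phi> (W g (heis (\<lambda>_. delta x w) s \<xi>))" for x w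
    unfolding comm_def by (intro ip_diff_right \<phi> heis_L2 Weyl_L2 \<xi>)
  have "ip M \<phi> (\<lambda>q. Lop b s (W g \<xi>) q - W g (Lop b s \<xi>) q) = ip M \<phi> (Lop b s (W g \<xi>)) - ip M \<phi> (W g (Lop b s \<xi>))"
    by (rule ip_diff_right[OF \<phi> L(1,2)])
  also have "\<dots> = - \<i> * (\<Sum>x\<in>I. (CLINT w|lborel. ?m x w * ip M \<phi> (heis (\<lambda>_. delta x w) s (W g \<xi>))) - (CLINT w|lborel. ?m x w * ip M \<phi> (W g (heis (\<lambda>_. delta x w) s \<xi>))))"
    unfolding 1 2 sum_subtractf right_diff_distrib ..
  also have "\<dots> = - \<i> * (\<Sum>x\<in>I. CLINT w|lborel. ?m x w * ip M \<phi> (comm g (\<lambda>_. delta x w) s \<xi>))"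
    by (intro arg_cong2[where f = "(*)"] refl sum.cong)
       (simp only: cip right_diff_distrib Bochner_Integration.integral_diff[OF i1 i2])
  finally have "cmod (ip M \<phi> (\<lambda>q. Lop b s (W g \<xi>) q - W g (Lop b s \<xi>) q)) = cmod (\<Sum>x\<in>I. CLINT w|lborel. ?m x w * ip M \<phi> (comm g (\<lambda>_. delta x w) s \<xi>))"
    by (simp add: norm_mult)
  also have "\<dots> \<le> (\<Sum>x\<in>I. cmod (CLINT w|lborel. ?m x w * ip M \<phi> (comm g (\<lambda>_. delta x w) s \<xi>)))" by (rule norm_sum)
  also have "\<dots> \<le> (\<Sum>x\<in>I. \<bar>b x\<bar> * \<theta> x * N \<xi> * N \<phi> * ?J)"
  proof (rule sum_mono)
    fix x assume x: "x \<in> I"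
    let ?c = "\<bar>b x\<bar> * \<theta> x * N \<xi> * N \<phi>"
    have "cmod (CLINT w|lborel. ?m x w * ip M \<phi> (comm g (\<lambda>_. delta x w) s \<xi>)) \<le> (LINT w|lborel. cmod (?m x w * ip M \<phi> (comm g (\<lambda>_. delta x w) s \<xi>)))"
      by (rule integral_norm_bound)
    also have "\<dots> \<le> (LINT w|lborel. ?c * (cmod (k w) * \<gamma> w))"
    proof (rule integral_mono)
      show "integrable lborel (\<lambda>w. cmod (?m x w * ip M \<phi> (comm g (\<lambda>_. delta x w) s \<xi>)))"
        unfolding cip right_diff_distrib by (intro integrable_norm Bochner_Integration.integrable_diff i1 i2 x)
      show "integrable lborel (\<lambda>w. ?c * (cmod (k w) * \<gamma> w))" using \<gamma> by (rule integrable_mult_right)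
      fix w
      have Lc: "comm g (\<lambda>_. delta x w) s \<xi> \<in> L2 M" unfolding comm_def by (intro L2_diff heis_L2 Weyl_L2 \<xi>)
      have "cmod (ip M \<phi> (comm g (\<lambda>_. delta x w) s \<xi>)) \<le> N \<phi> * N (comm g (\<lambda>_. delta x w) s \<xi>)" by (rule ip_CS[OF \<phi> Lc])
      also have "\<dots> \<le> N \<phi> * (\<theta> x * \<gamma> w * N \<xi>)" by (intro mult_left_mono bd x) simp
      finally have "cmod (k w) * cmod (fkern (b x) w) * cmod (ip M \<phi> (comm g (\<lambda>_. delta x w) s \<xi>)) \<le> cmod (k w) * \<bar>b x\<bar> * (N \<phi> * (\<theta> x * \<gamma> w * N \<xi>))"
        by (intro mult_mono fkern_bound) auto
      then show "cmod (?m x w * ip M \<phi> (comm g (\<lambda>_. delta x w) s \<xi>)) \<le> ?c * (cmod (k w) * \<gamma> w)"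
        by (simp add: norm_mult mult_ac)
    qed
    also have "\<dots> = ?c * ?J" by simp
    finally show "cmod (CLINT w|lborel. ?m x w * ip M \<phi> (comm g (\<lambda>_. delta x w) s \<xi>)) \<le> ?c * ?J" .
  qed
  also have "\<dots> = (\<Sum>x\<in>I. \<bar>b x\<bar> * \<theta> x) * ?J * N \<xi> * N \<phi>" unfolding sum_distrib_right by (intro sum.cong refl) (simp add: mult_ac)
  finally show "cmod (ip M \<phi> (\<lambda>q. Lop b s (W g \<xi>) q - W g (Lop b s \<xi>) q)) \<le> (\<Sum>x\<in>I. \<bar>b x\<bar> * \<theta> x) * ?J * N \<xi> * N \<phi>" .
qed

end

section \<open>The integral inequality for the commutator\<close>

context lieb_robinson
begin

lemma sympl_bound:
  assumes Y: "Y \<subseteq> I" and supp: "\<And>y. y \<notin> Y \<Longrightarrow> g y = 0" and gn: "\<And>y. cmod (g y) \<le> gn"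
  shows "\<bar>sympl nu L f g\<bar> \<le> gn * (\<Sum>y\<in>Y. \<bar>Re (f y)\<bar> + \<bar>Im (f y)\<bar>)"
proof -
  have "sympl nu L f g = (\<Sum>x\<in>Y. Im (f x) * Re (g x) - Re (f x) * Im (g x))"
    unfolding sympl_def using Y supp by (intro sum.mono_neutral_right) auto
  then have "\<bar>sympl nu L f g\<bar> \<le> (\<Sum>x\<in>Y. \<bar>Im (f x) * Re (g x) - Re (f x) * Im (g x)\<bar>)" by simp
  also have "\<dots> \<le> (\<Sum>x\<in>Y. gn * (\<bar>Re (f x)\<bar> + \<bar>Im (f x)\<bar>))"
  proof (rule sum_mono)
    fix x
    have r: "\<bar>Re (g x)\<bar> \<le> gn" "\<bar>Im (g x)\<bar> \<le> gn" using gn[of x] abs_Re_le_cmod[of "g x"] abs_Im_le_cmod[of "g x"] by linarith+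
    have "\<bar>Im (f x) * Re (g x) - Re (f x) * Im (g x)\<bar> \<le> \<bar>Im (f x)\<bar> * \<bar>Re (g x)\<bar> + \<bar>Re (f x)\<bar> * \<bar>Im (g x)\<bar>"
      by (metis abs_mult abs_triangle_ineq4)
    also have "\<dots> \<le> \<bar>Im (f x)\<bar> * gn + \<bar>Re (f x)\<bar> * gn" by (intro add_mono mult_left_mono r) auto
    finally show "\<bar>Im (f x) * Re (g x) - Re (f x) * Im (g x)\<bar> \<le> gn * (\<bar>Re (f x)\<bar> + \<bar>Im (f x)\<bar>)" by (simp add: algebra_simps)
  qed
  finally show ?thesis by (simp add: sum_distrib_left)
qed

lemma comm_0:
  assumes \<xi>: "\<xi> \<in> L2 M"
  shows "N (comm g f 0 \<xi>) \<le> \<bar>sympl nu L (f 0) g\<bar> * N \<xi>"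
proof -
  have h: "AE q in M. heis f 0 \<psi> q = W (f 0) \<psi> q" if \<psi>: "\<psi> \<in> L2 M" for \<psi>
  proof -
    have "AE q in M. W (f 0) (U 0 \<psi>) q = W (f 0) \<psi> q" by (intro Weyl_cong U_L2 U_0 \<psi>)
    then show ?thesis using U_0[OF Weyl_L2[OF U_L2[OF \<psi>, of 0]], of "f 0"] unfolding heis_def by eventually_elim simp
  qed
  have "AE q in M. W g (heis f 0 \<xi>) q = W g (W (f 0) \<xi>) q" by (intro Weyl_cong heis_L2 Weyl_L2 h \<xi>)
  then have "N (comm g f 0 \<xi>) = N (\<lambda>q. W (f 0) (W g \<xi>) q - W g (W (f 0) \<xi>) q)"
    unfolding comm_def using h[OF Weyl_L2[OF \<xi>], of g] by (intro l2norm_cong_AE) (auto elim!: eventually_elim2)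
  then show ?thesis using Weyl_commutator_le[OF \<xi>, of "f 0" g] by simp
qed

lemma comm_le_2:
  assumes \<xi>: "\<xi> \<in> L2 M" shows "N (comm g f s \<xi>) \<le> 2 * N \<xi>"
proof -
  have "N (comm g f s \<xi>) \<le> N (heis f s (W g \<xi>)) + N (W g (heis f s \<xi>))"
    unfolding comm_def by (intro l2norm_diff_le heis_L2 Weyl_L2 \<xi>)
  then show ?thesis by (simp add: heis_norm Weyl_L2 heis_L2 Weyl_l2norm L2_measurable \<xi>)
qed

text \<open>The observable \<open>g\<close>, the time direction and the horizon are fixed because
  the inequality couples the commutators of all single-site labels with the same g. A nonempty
  \<open>Y\<close> keeps the profile \<open>EY\<close> strictly positive.\<close>

context
  fixes g :: "int list \<Rightarrow> complex" and gn :: real and Y :: "int list set" and \<sigma> T :: real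
  assumes Y: "Y \<subseteq> I" "Y \<noteq> {}" and g_supp: "\<And>y. y \<notin> Y \<Longrightarrow> g y = 0" and gn: "\<And>y. cmod (g y) \<le> gn"
    and \<sigma>: "\<bar>\<sigma>\<bar> = 1" and T: "0 \<le> T"
begin

definition EY :: "int list \<Rightarrow> real" where "EY x = (\<Sum>y\<in>Y. F x y)"

text \<open>The growth rate added by the potential; divided by mu + eps it is the second term of the
  velocity.\<close>

definition qq :: real where "qq = Cc * Cn * \<kappa>"

lemma finY: "finite Y" using Y(1) finite_subset finite_Lam by blast

lemma gn_nonneg: "0 \<le> gn" using gn norm_ge_zero order_trans by blast

lemma EY_pos: "0 < EY x"
  unfolding EY_def using Y finY F_pos by (intro sum_pos) auto

lemma EY_conv: assumes "x \<in> I" shows "(\<Sum>z\<in>I. F x z * EY z) \<le> Cn * EY x"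
proof -
  have "(\<Sum>z\<in>I. F x z * EY z) = (\<Sum>y\<in>Y. \<Sum>z\<in>I. F x z * F z y)"
    unfolding EY_def sum_distrib_left by (rule sum.swap)
  also have "\<dots> \<le> (\<Sum>y\<in>Y. Cn * F x y)" using Y by (intro sum_mono F_conv assms) auto
  finally show ?thesis by (simp add: EY_def sum_distrib_left)
qed

lemma Cn_nonneg: "0 \<le> Cn"
proof -
  obtain y where y: "y \<in> I" using Y by blast
  have "0 \<le> (\<Sum>z\<in>I. F y z * F z y)" by (intro sum_nonneg mult_nonneg_nonneg) (auto intro: less_imp_le F_pos)
  also have "\<dots> \<le> Cn * F y y" by (rule F_conv[OF y y])
  finally show ?thesis using F_pos[of y y] by (simp add: zero_le_mult_iff)
qed

lemma qq_nonneg: "0 \<le> qq"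
  unfolding qq_def by (intro mult_nonneg_nonneg Cc_nonneg Cn_nonneg \<kappa>_nonneg)

text \<open>The solution of \<open>sol\<close> that equals f at parameter
  \<open>\<sigma> * t\<close>. There \<open>heis\<close> is the fully evolved W(f), whereas at
  parameter 0 it carries the harmonically evolved label.\<close>

definition curve :: "(int list \<Rightarrow> complex) \<Rightarrow> real \<Rightarrow> real \<Rightarrow> int list \<Rightarrow> complex" where
  "curve f t s = flow f (- (\<sigma> * t) + s)"

lemma sol_curve: "sol (curve f t)"
  unfolding curve_def by (rule sol_shift[OF sol_flow])

lemma comm_curve: "comm g (curve f t) (\<sigma> * t) \<xi> = comm g (\<lambda>_. f) (\<sigma> * t) \<xi>"
  by (simp add: comm_def heis_def curve_def flow_0)

lemma abs_\<sigma>_diff: "s \<le> t \<Longrightarrow> \<bar>- (\<sigma> * t) + \<sigma> * s\<bar> = t - s"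
proof -
  assume "s \<le> t"
  have "- (\<sigma> * t) + \<sigma> * s = \<sigma> * (s - t)" by (simp add: algebra_simps)
  then show ?thesis using \<sigma> \<open>s \<le> t\<close> by (simp add: abs_mult)
qed

context
  fixes f :: "int list \<Rightarrow> complex" and fn :: real and X :: "int list set"
  assumes X: "X \<subseteq> I" and f_supp: "\<And>y. y \<notin> X \<Longrightarrow> f y = 0" and fn: "\<And>y. cmod (f y) \<le> fn"
begin

lemma fn_nonneg: "0 \<le> fn" using fn norm_ge_zero order_trans by blast

text \<open>At parameter 0 both operators are Weyl operators, so the commutator is governed by the
  symplectic form and hence by the decay of the harmonic flow.\<close>

lemma comm_initial:
  assumes \<xi>: "\<xi> \<in> L2 M" and t: "0 \<le> t"
  shows "N (comm g (curve f t) 0 \<xi>) \<le> Cc * fn * gn * exp (p * t) * (\<Sum>x\<in>X. EY x) * N \<xi>"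
proof -
  have "\<bar>sympl nu L (curve f t 0) g\<bar> \<le> gn * (\<Sum>y\<in>Y. \<bar>Re (curve f t 0 y)\<bar> + \<bar>Im (curve f t 0 y)\<bar>)"
    by (rule sympl_bound[OF Y(1) g_supp gn])
  also have "\<dots> \<le> gn * (\<Sum>y\<in>Y. Cc * fn * exp (p * t) * (\<Sum>x\<in>X. F y x))"
  proof (intro mult_left_mono[OF _ gn_nonneg] sum_mono)
    fix y assume "y \<in> Y"
    then have "y \<in> I" using Y by blast
    from flow_bound_F[where f = f and t = "- (\<sigma> * t)", OF X f_supp fn this]
    show "\<bar>Re (curve f t 0 y)\<bar> + \<bar>Im (curve f t 0 y)\<bar> \<le> Cc * fn * exp (p * t) * (\<Sum>x\<in>X. F y x)"
      using \<sigma> t by (simp add: curve_def abs_mult)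
  qed
  also have "\<dots> = Cc * fn * gn * exp (p * t) * (\<Sum>y\<in>Y. \<Sum>x\<in>X. F y x)"
    unfolding sum_distrib_left[symmetric] by (simp only: mult_ac)
  also have "(\<Sum>y\<in>Y. \<Sum>x\<in>X. F y x) = (\<Sum>x\<in>X. EY x)"
    unfolding EY_def by (subst sum.swap) (simp only: F_sym)
  finally have "\<bar>sympl nu L (curve f t 0) g\<bar> \<le> Cc * fn * gn * exp (p * t) * (\<Sum>x\<in>X. EY x)" .
  from mult_right_mono[OF this l2norm_nonneg[of M \<xi>]] comm_0[OF \<xi>, of g "curve f t"]
  show ?thesis by simp
qed

lemma curve_Im_bound:
  assumes "s \<le> t" "x \<in> I"
  shows "\<bar>Im (curve f t (\<sigma> * s) x)\<bar> \<le> Cc * fn * exp (p * (t - s)) * (\<Sum>y\<in>X. F x y)"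
  using flow_bound_F[where f = f and t = "- (\<sigma> * t) + \<sigma> * s", OF X f_supp fn assms(2)] unfolding abs_\<sigma>_diff[OF assms(1)] curve_def by linarith

text \<open>One Picard step. The rate at s contains exp(p (t - s)) exp((p + qq) s) = exp(p t) exp(qq
  s), and convolution contributes \<open>Cn\<close>; the constants combine to \<open>qq\<close>, so
  the rate is an exact derivative.\<close>

lemma comm_step:
  assumes \<Theta>0: "0 \<le> \<Theta>"
    and \<Theta>: "\<And>x w s \<xi>. x \<in> I \<Longrightarrow> 0 \<le> s \<Longrightarrow> s \<le> T \<Longrightarrow> \<xi> \<in> L2 M \<Longrightarrow>
        N (comm g (\<lambda>_. delta x w) (\<sigma> * s) \<xi>) \<le> \<Theta> * \<bar>w\<bar> * EY x * exp ((p + qq) * s) * N \<xi>"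
    and \<xi>: "\<xi> \<in> L2 M" and t: "0 \<le> t" "t \<le> T"
  shows "N (comm g (\<lambda>_. f) (\<sigma> * t) \<xi>) \<le> fn * (\<Sum>x\<in>X. EY x) * (Cc * gn * exp (p * t) + \<Theta> * (exp ((p + qq) * t) - exp (p * t))) * N \<xi>"
proof -
  let ?S = "\<Sum>x\<in>X. EY x"
  let ?P = "\<lambda>s. \<Theta> * fn * ?S * exp (p * t) * exp (qq * s)"
  let ?b = "\<lambda>s y. Im (curve f t (\<sigma> * s) y)"
  have "N (comm g (curve f t) (\<sigma> * t) \<xi>) \<le> N (comm g (curve f t) 0 \<xi>) + (?P t - ?P 0) * N \<xi>"
  proof (rule comm_growth[OF \<xi> sol_curve \<sigma> t(1)])
    show "(?P has_real_derivative \<Theta> * fn * ?S * exp (p * t) * (qq * exp (qq * s))) (at s)" for s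
      by (auto intro!: derivative_eq_intros)
    fix s \<xi> assume s: "0 \<le> s" "s \<le> t" and \<xi>: "\<xi> \<in> L2 M"
    have "N (\<lambda>q. Lop (?b s) (\<sigma> * s) (W g \<xi>) q - W g (Lop (?b s) (\<sigma> * s) \<xi>) q)
       \<le> (\<Sum>x\<in>I. \<bar>?b s x\<bar> * (\<Theta> * EY x * exp ((p + qq) * s))) * (LINT w|lborel. cmod (k w) * \<bar>w\<bar>) * N \<xi>"
    proof (rule Lop_comm_bound[OF \<xi> k1_int])
      show "0 \<le> \<Theta> * EY x * exp ((p + qq) * s)" for x using \<Theta>0 EY_pos[of x] by simp
      show "N (comm g (\<lambda>_. delta x w) (\<sigma> * s) \<xi>) \<le> \<Theta> * EY x * exp ((p + qq) * s) * \<bar>w\<bar> * N \<xi>" if "x \<in> I" for x w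
        using \<Theta>[OF that s(1) _ \<xi>, of w] s t by (simp add: mult_ac)
    qed simp
    also have "\<dots> \<le> (\<Theta> * fn * ?S * exp (p * t) * (qq * exp (qq * s))) * N \<xi>"
    proof (rule mult_right_mono[OF _ l2norm_nonneg])
      let ?c = "Cc * fn * exp (p * (t - s)) * (\<Theta> * exp ((p + qq) * s))"
      have c0: "0 \<le> ?c" using Cc_nonneg fn_nonneg \<Theta>0 by simp
      have "(\<Sum>x\<in>I. \<bar>?b s x\<bar> * (\<Theta> * EY x * exp ((p + qq) * s))) \<le> (\<Sum>x\<in>I. ?c * (\<Sum>y\<in>X. F x y * EY x))"
      proof (rule sum_mono)
        fix x assume x: "x \<in> I"
        have "\<bar>?b s x\<bar> * (\<Theta> * EY x * exp ((p + qq) * s)) \<le> (Cc * fn * exp (p * (t - s)) * (\<Sum>y\<in>X. F x y)) * (\<Theta> * EY x * exp ((p + qq) * s))"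
          using \<Theta>0 EY_pos[of x] by (intro mult_right_mono curve_Im_bound s x) simp
        also have "\<dots> = ?c * ((\<Sum>y\<in>X. F x y) * EY x)" by (simp only: mult_ac)
        finally show "\<bar>?b s x\<bar> * (\<Theta> * EY x * exp ((p + qq) * s)) \<le> ?c * (\<Sum>y\<in>X. F x y * EY x)" by (simp only: sum_distrib_right)
      qed
      also have "\<dots> = ?c * (\<Sum>y\<in>X. \<Sum>x\<in>I. F y x * EY x)"
        unfolding sum_distrib_left[symmetric] by (subst sum.swap) (simp only: F_sym)
      also have "\<dots> \<le> ?c * (\<Sum>y\<in>X. Cn * EY y)" using X by (intro mult_left_mono[OF _ c0] sum_mono EY_conv) auto
      also have "\<dots> = ?c * (Cn * ?S)" by (simp add: sum_distrib_left)
      finally have "(\<Sum>x\<in>I. \<bar>?b s x\<bar> * (\<Theta> * EY x * exp ((p + qq) * s))) * \<kappa> \<le> ?c * (Cn * ?S) * \<kappa>"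
        by (rule mult_right_mono[OF _ \<kappa>_nonneg])
      also have "\<dots> = \<Theta> * fn * ?S * (exp (p * (t - s)) * exp ((p + qq) * s)) * (Cc * Cn * \<kappa>)" by (simp only: mult_ac)
      also have "exp (p * (t - s)) * exp ((p + qq) * s) = exp (p * t) * exp (qq * s)"
        by (simp add: exp_add[symmetric] algebra_simps)
      finally show "(\<Sum>x\<in>I. \<bar>?b s x\<bar> * (\<Theta> * EY x * exp ((p + qq) * s))) * (LINT w|lborel. cmod (k w) * \<bar>w\<bar>)
          \<le> \<Theta> * fn * ?S * exp (p * t) * (qq * exp (qq * s))" unfolding \<kappa>_def[symmetric] qq_def[symmetric] by (simp only: mult_ac)
    qed
    finally show "N (\<lambda>q. Lop (?b s) (\<sigma> * s) (W g \<xi>) q - W g (Lop (?b s) (\<sigma> * s) \<xi>) q) \<le> (\<Theta> * fn * ?S * exp (p * t) * (qq * exp (qq * s))) * N \<xi>" .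
  qed
  also have "\<dots> \<le> Cc * fn * gn * exp (p * t) * ?S * N \<xi> + (?P t - ?P 0) * N \<xi>"
    by (intro add_right_mono comm_initial \<xi> t)
  also have "\<dots> = fn * ?S * (Cc * gn * exp (p * t) + \<Theta> * (exp (p * t) * exp (qq * t) - exp (p * t))) * N \<xi>"
    by (simp add: algebra_simps)
  also have "exp (p * t) * exp (qq * t) = exp ((p + qq) * t)" by (simp add: exp_add[symmetric] algebra_simps)
  finally show ?thesis unfolding comm_curve .
qed

text \<open>The trivial bound 2 on commutators is not proportional to the label, while the step
  needs bounds linear in |w|. One integration with the profile 1, using integrability of
  \<open>k\<close>, makes the bound proportional to \<open>fn\<close>, with a volume-dependent
  constant.\<close>

lemma comm_apriori:
  assumes \<xi>: "\<xi> \<in> L2 M" and t: "0 \<le> t" "t \<le> T"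
  shows "N (comm g (\<lambda>_. f) (\<sigma> * t) \<xi>)
     \<le> fn * (Cc * gn * exp (p * T) * (real (card X) * real (card Y)) + Cc * exp (p * T) * (real (card I) * real (card X)) * 2 * (LINT w|lborel. cmod (k w)) * T) * N \<xi>"
proof -
  let ?J = "LINT w|lborel. cmod (k w)"
  have J0: "0 \<le> ?J" by (intro Bochner_Integration.integral_nonneg) simp
  have p0: "0 \<le> p" using p_ge a_pos by linarith
  let ?D = "fn * (Cc * exp (p * T) * (real (card I) * real (card X)) * 2 * ?J)"
  have D0: "0 \<le> ?D" using fn_nonneg Cc_nonneg J0 by simp
  let ?b = "\<lambda>s y. Im (curve f t (\<sigma> * s) y)"
  have "N (comm g (curve f t) (\<sigma> * t) \<xi>) \<le> N (comm g (curve f t) 0 \<xi>) + (?D * t - ?D * 0) * N \<xi>"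
  proof (rule comm_growth[OF \<xi> sol_curve \<sigma> t(1)])
    show "((\<lambda>s. ?D * s) has_real_derivative ?D) (at s)" for s by (auto intro!: derivative_eq_intros)
    fix s \<xi> assume s: "0 \<le> s" "s \<le> t" and \<xi>: "\<xi> \<in> L2 M"
    have "N (\<lambda>q. Lop (?b s) (\<sigma> * s) (W g \<xi>) q - W g (Lop (?b s) (\<sigma> * s) \<xi>) q)
       \<le> (\<Sum>x\<in>I. \<bar>?b s x\<bar> * 2) * (LINT w|lborel. cmod (k w) * 1) * N \<xi>"
      by (rule Lop_comm_bound[OF \<xi>]) (use k_int comm_le_2[OF \<xi>] in auto)
    also have "\<dots> \<le> ?D * N \<xi>"
    proof (rule mult_right_mono[OF _ l2norm_nonneg])
      have "(\<Sum>x\<in>I. \<bar>?b s x\<bar> * 2) \<le> (\<Sum>x\<in>I. (Cc * fn * exp (p * T) * real (card X)) * 2)"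
      proof (intro sum_mono mult_right_mono)
        fix x assume x: "x \<in> I"
        have "(\<Sum>y\<in>X. F x y) \<le> (\<Sum>y\<in>X. 1)" by (intro sum_mono F_le_1)
        then have S: "(\<Sum>y\<in>X. F x y) \<le> real (card X)" by simp
        have "p * (t - s) \<le> p * T" using s t p0 by (intro mult_left_mono) auto
        then have e: "exp (p * (t - s)) \<le> exp (p * T)" by simp
        have "\<bar>?b s x\<bar> \<le> Cc * fn * exp (p * (t - s)) * (\<Sum>y\<in>X. F x y)" by (rule curve_Im_bound[OF s(2) x])
        also have "\<dots> \<le> Cc * fn * exp (p * T) * real (card X)"
          using S e Cc_nonneg fn_nonneg F_pos by (intro mult_mono mult_left_mono sum_nonneg) (auto intro: less_imp_le)
        finally show "\<bar>?b s x\<bar> \<le> Cc * fn * exp (p * T) * real (card X)" .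
      qed simp
      also have "\<dots> = fn * (Cc * exp (p * T) * (real (card I) * real (card X)) * 2)" by simp
      finally have "(\<Sum>x\<in>I. \<bar>?b s x\<bar> * 2) * ?J \<le> fn * (Cc * exp (p * T) * (real (card I) * real (card X)) * 2) * ?J"
        using J0 by (rule mult_right_mono)
      then show "(\<Sum>x\<in>I. \<bar>?b s x\<bar> * 2) * (LINT w|lborel. cmod (k w) * 1) \<le> ?D" by (simp only: mult_1_right mult.assoc)
    qed
    finally show "N (\<lambda>q. Lop (?b s) (\<sigma> * s) (W g \<xi>) q - W g (Lop (?b s) (\<sigma> * s) \<xi>) q) \<le> ?D * N \<xi>" .
  qed
  also have "(?D * t - ?D * 0) * N \<xi> \<le> ?D * T * N \<xi>"
    using mult_right_mono[OF mult_left_mono[OF t(2) D0] l2norm_nonneg[of M \<xi>]] by simp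
  also have "N (comm g (curve f t) 0 \<xi>) \<le> Cc * fn * gn * exp (p * T) * (real (card X) * real (card Y)) * N \<xi>"
  proof (rule order_trans[OF comm_initial[OF \<xi> t(1)] mult_right_mono[OF _ l2norm_nonneg]])
    have "EY x \<le> real (card Y)" for x
      unfolding EY_def using sum_mono[of Y "F x" "\<lambda>_. 1"] F_le_1 by simp
    then have S: "(\<Sum>x\<in>X. EY x) \<le> real (card X) * real (card Y)" using sum_mono[of X EY "\<lambda>_. real (card Y)"] by simp
    have "p * t \<le> p * T" using t p0 by (intro mult_left_mono) auto
    then have e: "exp (p * t) \<le> exp (p * T)" by simp
    show "Cc * fn * gn * exp (p * t) * (\<Sum>x\<in>X. EY x) \<le> Cc * fn * gn * exp (p * T) * (real (card X) * real (card Y))"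
      using S e Cc_nonneg fn_nonneg gn_nonneg EY_pos
      by (intro mult_mono mult_left_mono sum_nonneg mult_nonneg_nonneg) (auto intro: less_imp_le)
  qed
  finally show ?thesis unfolding comm_curve by (simp add: algebra_simps)
qed

end

lemma delta_props: "y \<notin> {x} \<Longrightarrow> delta x w y = 0" "cmod (delta x w y) \<le> \<bar>w\<bar>"
  by (auto simp: delta_def)

text \<open>The a priori bound supplies some constant \<open>\<Theta>\<close>, and each use of the step estimate contracts its
  excess over \<open>Cc * gn\<close> by the factor \<open>1 - exp (- qq * T) < 1\<close>.\<close>

lemma comm_delta:
  assumes x: "x \<in> I" and s: "0 \<le> s" "s \<le> T" and \<xi>: "\<xi> \<in> L2 M"
  shows "N (comm g (\<lambda>_. delta x w) (\<sigma> * s) \<xi>) \<le> (Cc * gn) * \<bar>w\<bar> * EY x * exp ((p + qq) * s) * N \<xi>"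
proof -
  let ?G = "Cc * gn"
  define bnd where "bnd \<Theta> \<longleftrightarrow> (\<forall>x\<in>I. \<forall>w s \<xi>. 0 \<le> s \<and> s \<le> T \<and> \<xi> \<in> L2 M \<longrightarrow>
        N (comm g (\<lambda>_. delta x w) (\<sigma> * s) \<xi>) \<le> \<Theta> * \<bar>w\<bar> * EY x * exp ((p + qq) * s) * N \<xi>)" for \<Theta>
  have G0: "0 \<le> ?G" using Cc_nonneg gn_nonneg by simp
  have p0: "0 \<le> p" using p_ge a_pos by linarith
  define D where "D = Cc * gn * exp (p * T) * (real (card {x}) * real (card Y)) + Cc * exp (p * T) * (real (card I) * real (card {x})) * 2 * (LINT w|lborel. cmod (k w)) * T"
  \<comment> \<open>In finite volume the profile has a positive minimum, which converts the constant
    bound \<open>D\<close> into one of the required spatial form.\<close>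
  define E where "E = Min (EY ` I)"
  have Ine: "I \<noteq> {}" using x by blast
  have E: "0 < E" "\<And>x. x \<in> I \<Longrightarrow> E \<le> EY x" unfolding E_def using Ine EY_pos by auto
  have D0: "0 \<le> D"
    unfolding D_def using Cc_nonneg gn_nonneg T by (intro add_nonneg_nonneg mult_nonneg_nonneg Bochner_Integration.integral_nonneg) auto
  define \<Theta>0 where "\<Theta>0 = max ?G (D / E)"
  have b0: "bnd \<Theta>0"
    unfolding bnd_def
  proof (intro ballI allI impI)
    fix x w s \<xi> assume x: "x \<in> I" and s: "0 \<le> s \<and> s \<le> T \<and> \<xi> \<in> L2 M"
    have "N (comm g (\<lambda>_. delta x w) (\<sigma> * s) \<xi>) \<le> \<bar>w\<bar> * D * N \<xi>"
      using comm_apriori[of "{x}" "delta x w" "\<bar>w\<bar>" \<xi> s] delta_props x s by (simp add: D_def)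
    also have "\<dots> \<le> \<bar>w\<bar> * (\<Theta>0 * EY x * exp ((p + qq) * s)) * N \<xi>"
    proof (intro mult_right_mono mult_left_mono)
      have "D \<le> D / E * EY x" using D0 E(1) E(2)[OF x] by (simp add: field_simps mult_left_mono)
      also have "\<dots> \<le> \<Theta>0 * EY x" using EY_pos[of x] by (intro mult_right_mono) (auto simp: \<Theta>0_def)
      also have "\<dots> \<le> \<Theta>0 * EY x * exp ((p + qq) * s)"
      proof -
        have "0 \<le> \<Theta>0 * EY x" using G0 EY_pos[of x] by (simp add: \<Theta>0_def max_def)
        moreover have "1 \<le> exp ((p + qq) * s)" using p0 qq_nonneg s by simp
        ultimately have "\<Theta>0 * EY x * 1 \<le> \<Theta>0 * EY x * exp ((p + qq) * s)" by (intro mult_left_mono)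
        then show ?thesis by simp
      qed
      finally show "D \<le> \<Theta>0 * EY x * exp ((p + qq) * s)" .
    qed auto
    finally show "N (comm g (\<lambda>_. delta x w) (\<sigma> * s) \<xi>) \<le> \<Theta>0 * \<bar>w\<bar> * EY x * exp ((p + qq) * s) * N \<xi>"
      by (simp add: mult_ac)
  qed
  define \<eta> where "\<eta> = 1 - exp (- qq * T)"
  have \<eta>: "0 \<le> \<eta>" "\<eta> < 1" using qq_nonneg T by (auto simp: \<eta>_def)
  have step: "bnd (?G + (\<Theta> - ?G) * \<eta>)" if \<Theta>: "bnd \<Theta>" "?G \<le> \<Theta>" for \<Theta>
    unfolding bnd_def
  proof (intro ballI allI impI)
    fix x w s \<xi> assume x: "x \<in> I" and s: "0 \<le> s \<and> s \<le> T \<and> \<xi> \<in> L2 M"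
    have "N (comm g (\<lambda>_. delta x w) (\<sigma> * s) \<xi>)
       \<le> \<bar>w\<bar> * (\<Sum>x\<in>{x}. EY x) * (Cc * gn * exp (p * s) + \<Theta> * (exp ((p + qq) * s) - exp (p * s))) * N \<xi>"
    proof (rule comm_step)
      show "0 \<le> \<Theta>" using G0 \<Theta>(2) by linarith
    qed (use x s \<Theta>(1) delta_props in \<open>auto simp: bnd_def\<close>)
    also have "\<dots> \<le> \<bar>w\<bar> * (\<Sum>x\<in>{x}. EY x) * ((?G + (\<Theta> - ?G) * \<eta>) * exp ((p + qq) * s)) * N \<xi>"
    proof (intro mult_right_mono mult_left_mono)
      have e: "exp (p * s) = exp ((p + qq) * s) * exp (- qq * s)" by (simp add: exp_add[symmetric] algebra_simps)
      have "- qq * T \<le> - qq * s" using qq_nonneg s by (simp add: mult_left_mono)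
      then have "(\<Theta> - ?G) * exp (- qq * T) \<le> (\<Theta> - ?G) * exp (- qq * s)" using \<Theta>(2) by (intro mult_left_mono) auto
      then have "?G * exp (- qq * s) + \<Theta> * (1 - exp (- qq * s)) \<le> ?G + (\<Theta> - ?G) * \<eta>" by (simp add: \<eta>_def algebra_simps)
      from mult_right_mono[OF this exp_ge_zero[of "(p + qq) * s"]]
      show "Cc * gn * exp (p * s) + \<Theta> * (exp ((p + qq) * s) - exp (p * s)) \<le> (?G + (\<Theta> - ?G) * \<eta>) * exp ((p + qq) * s)"
        unfolding e by (simp add: algebra_simps)
    qed (use EY_pos[of x] in auto)
    finally show "N (comm g (\<lambda>_. delta x w) (\<sigma> * s) \<xi>) \<le> (?G + (\<Theta> - ?G) * \<eta>) * \<bar>w\<bar> * EY x * exp ((p + qq) * s) * N \<xi>"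
      by (simp add: mult_ac)
  qed
  have it: "bnd (?G + (\<Theta>0 - ?G) * \<eta> ^ n)" for n
  proof (induction n)
    case (Suc n)
    have "?G \<le> ?G + (\<Theta>0 - ?G) * \<eta> ^ n" using \<eta> by (simp add: \<Theta>0_def)
    from step[OF Suc this] show ?case by (simp add: mult_ac)
  qed (use b0 in simp)
  have "(\<lambda>n. (?G + (\<Theta>0 - ?G) * \<eta> ^ n) * \<bar>w\<bar> * EY x * exp ((p + qq) * s) * N \<xi>)
      \<longlonglongrightarrow> (?G + (\<Theta>0 - ?G) * 0) * \<bar>w\<bar> * EY x * exp ((p + qq) * s) * N \<xi>"
    using \<eta> by (intro tendsto_intros LIMSEQ_realpow_zero)
  from LIMSEQ_le_const[OF this] show ?thesis using it x s \<xi> unfolding bnd_def by auto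
qed

text \<open>With the single-site constant equal to \<open>Cc * gn\<close>, the bracket in
  \<open>comm_step\<close> collapses to that constant times exp((p + qq) T).\<close>

lemma comm_bound:
  assumes X: "X \<subseteq> I" and f_supp: "\<And>y. y \<notin> X \<Longrightarrow> f y = 0" and fn: "\<And>y. cmod (f y) \<le> fn" and \<xi>: "\<xi> \<in> L2 M"
  shows "N (comm g (\<lambda>_. f) (\<sigma> * T) \<xi>) \<le> Cc * fn * gn * exp ((p + Cc * Cn * \<kappa>) * T) * (\<Sum>x\<in>X. \<Sum>y\<in>Y. F x y) * N \<xi>"
proof -
  have "N (comm g (\<lambda>_. f) (\<sigma> * T) \<xi>) \<le> fn * (\<Sum>x\<in>X. EY x) * (Cc * gn * exp (p * T) + (Cc * gn) * (exp ((p + qq) * T) - exp (p * T))) * N \<xi>"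
    using Cc_nonneg gn_nonneg by (intro comm_step X f_supp fn comm_delta \<xi> T) auto
  then show ?thesis by (simp add: EY_def qq_def algebra_simps)
qed

end

end

section \<open>The Lieb-Robinson bound\<close>

text \<open>Integrability of V' bounds every increment of V by the L^1 norm; this makes the
  perturbation a bounded operator.\<close>

lemma antiderivative_bounded:
  fixes V V' :: "real \<Rightarrow> real"
  assumes der: "\<And>x. (V has_real_derivative V' x) (at x)" and cont: "continuous_on UNIV V'" and L1: "integrable lborel V'"
  shows "\<bar>V r\<bar> \<le> \<bar>V 0\<bar> + (LINT q|lborel. \<bar>V' q\<bar>)"
proof -
  have *: "\<bar>V b - V a\<bar> \<le> (LINT q|lborel. \<bar>V' q\<bar>)" if "a \<le> b" for a b
  proof -
    have "V b - V a = (LINT q|lborel. V' q * indicator {a..b} q)"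
      using integral_FTC_Icc_real[OF that, of V V'] der cont by (simp add: continuous_on_eq_continuous_within)
    also have "\<bar>\<dots>\<bar> \<le> (LINT q|lborel. \<bar>V' q * indicator {a..b} q\<bar>)" using integral_norm_bound[of lborel "\<lambda>q. V' q * indicator {a..b} q"] by simp
    also have "\<dots> \<le> (LINT q|lborel. \<bar>V' q\<bar>)"
    proof (rule integral_mono)
      show "integrable lborel (\<lambda>q. \<bar>V' q * indicator {a..b} q\<bar>)"
        using integrable_abs[OF integrable_mult_indicator[OF _ L1, of "{a..b}"]] by (simp add: mult.commute)
      show "integrable lborel (\<lambda>q. \<bar>V' q\<bar>)" using L1 by (rule integrable_abs)
    qed (simp split: split_indicator)
    finally show ?thesis .
  qed
  show ?thesis using *[of 0 r] *[of r 0] by (cases "0 \<le> r") auto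
qed

lemma unitary_group_dynamics:
  assumes "is_dynamics nu \<omega> lam V L U" shows "unitary_group (cfgM nu L) U"
  using assms unfolding is_dynamics_def Let_def by unfold_locales blast+

theorem theorem4p1:
  fixes nu :: nat and \<omega> :: real and lam :: "nat \<Rightarrow> real"
    and V V' :: "real \<Rightarrow> real" and \<mu> \<epsilon> :: real
  assumes nu: "nu \<ge> 1" and om: "\<omega> > 0" and lam: "\<forall>j<nu. lam j \<ge> 0"
    and Vder: "\<forall>x. (V has_real_derivative V' x) (at x)" and V'cont: "continuous_on UNIV V'"
    and V'L1: "integrable lborel V'"
    and kappa_fin: "integrable lborel (\<lambda>w. cmod (Fourier V' w) * \<bar>w\<bar>)"
    and mu: "\<mu> \<ge> 1" and eps: "\<epsilon> > 0"
  shows "\<forall>X Y (L::nat) f g U t. finite X \<and> finite Y \<and> X \<subseteq> Zpts nu \<and> Y \<subseteq> Zpts nu \<and> L \<ge> 1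
      \<and> X \<subseteq> Lam nu L \<and> Y \<subseteq> Lam nu L
      \<and> (\<forall>x. x \<notin> X \<longrightarrow> f x = 0) \<and> (\<forall>y. y \<notin> Y \<longrightarrow> g y = 0)
      \<and> is_dynamics nu \<omega> lam V L U \<longrightarrow>
      (let c = c_ol nu \<omega> lam;
           \<kappa> = (LINT w|lborel. cmod (Fourier V' w) * \<bar>w\<bar>);
           C = (2 + c * exp ((\<mu> + \<epsilon>) / 2) + 1 / c)
               * (SUP s\<in>{0::real..}. (1 + s) ^ (nu + 1) * exp (- \<epsilon> * s));
           v = v_h nu \<omega> lam (\<mu> + \<epsilon>) + C * C_nu nu L * \<kappa> / (\<mu> + \<epsilon>);
           M = cfgM nu L
       in \<forall>\<psi>\<in>L2 M.
            l2norm M (\<lambda>q. U (- t) (Weyl nu L f (U t (Weyl nu L g \<psi>))) q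
                           - Weyl nu L g (U (- t) (Weyl nu L f (U t \<psi>))) q)
            \<le> C * supnorm nu L f * supnorm nu L g * exp ((\<mu> + \<epsilon>) * v * \<bar>t\<bar>)
              * (\<Sum>x\<in>X. \<Sum>y\<in>Y. F_mu nu \<mu> (real_of_int (tdist nu L x y))) * l2norm M \<psi>)"
proof (intro allI impI)
  fix X Y :: "int list set" and L :: nat and f g :: "int list \<Rightarrow> complex" and U and t :: real
  assume H: "finite X \<and> finite Y \<and> X \<subseteq> Zpts nu \<and> Y \<subseteq> Zpts nu \<and> L \<ge> 1
      \<and> X \<subseteq> Lam nu L \<and> Y \<subseteq> Lam nu L
      \<and> (\<forall>x. x \<notin> X \<longrightarrow> f x = 0) \<and> (\<forall>y. y \<notin> Y \<longrightarrow> g y = 0)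
      \<and> is_dynamics nu \<omega> lam V L U"
  then have L: "1 \<le> L" and X: "X \<subseteq> Lam nu L" and Y: "Y \<subseteq> Lam nu L"
    and fs: "\<And>x. x \<notin> X \<Longrightarrow> f x = 0" and gs: "\<And>y. y \<notin> Y \<Longrightarrow> g y = 0" and dyn: "is_dynamics nu \<omega> lam V L U"
    by blast+
  define c where "c = c_ol nu \<omega> lam"
  define \<mu>' where "\<mu>' = \<mu> + \<epsilon>"
  define S where "S = (SUP s\<in>{0::real..}. (1 + s) ^ (nu + 1) * exp (- \<epsilon> * s))"
  define C where "C = (2 + c * exp (\<mu>' / 2) + 1 / c) * S"
  define a where "a = c * exp (\<mu>' / 2)"
  define F where "F x y = F_mu nu \<mu> (real_of_int (tdist nu L x y))" for x y
  define \<kappa> where "\<kappa> = (LINT w|lborel. cmod (Fourier V' w) * \<bar>w\<bar>)"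
  let ?A = "Amat nu \<omega> lam L" and ?I = "Lam nu L" and ?l = "\<Sum>j<nu. lam j"
  have lam': "0 \<le> lam j" if "j < nu" for j using lam that by blast
  have l0: "0 \<le> ?l" using lam' by (intro sum_nonneg) auto
  have c2: "c\<^sup>2 = \<omega>\<^sup>2 + 4 * ?l" unfolding c_def c_ol_def using l0 by simp
  have c0: "0 < c" unfolding c_def c_ol_def using l0 om by (simp add: add_pos_nonneg)
  have \<mu>'1: "1 \<le> \<mu>'" using mu eps by (simp add: \<mu>'_def)
  have a0: "0 < a" using c0 by (simp add: a_def)
  have S1: "1 \<le> S" unfolding S_def using bdd_power_exp[OF eps, of "nu + 1"] by (intro cSUP_upper2[where x = 0]) auto
  have C0: "0 \<le> C" unfolding C_def using S1 c0 by (intro mult_nonneg_nonneg) auto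
  obtain B \<beta> where B: "0 < \<beta>" "\<And>x y. x \<in> ?I \<Longrightarrow> y \<in> ?I \<Longrightarrow> B x y = B y x"
    "\<And>x y. x \<in> ?I \<Longrightarrow> y \<in> ?I \<Longrightarrow> (\<Sum>z\<in>?I. B x z * B z y) = ?A x y"
    "\<And>q. \<beta> * (\<Sum>x\<in>?I. (q x)\<^sup>2) \<le> (\<Sum>x\<in>?I. \<Sum>y\<in>?I. B x y * q x * q y)"
  \<comment> \<open>The largest possible diagonal entry serves as scale, and the common row sum
    omega^2 as gap.\<close>
  proof (rule matrix_sqrt[of ?I ?A "\<omega>\<^sup>2 + 2 * ?l" "\<omega>\<^sup>2"])
    show "?A x y = ?A y x" for x y by (rule Amat_sym)
    show "?A x y \<le> 0" if "x \<noteq> y" for x y by (rule Amat_offdiag[where lam = lam, OF L lam' that])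
    show "?A x x \<le> \<omega>\<^sup>2 + 2 * ?l" for x by (rule Amat_diag[where lam = lam, OF L lam'])
    show "\<omega>\<^sup>2 \<le> (\<Sum>y\<in>?I. ?A x y)" if "x \<in> ?I" for x using Amat_row[where lam = lam and \<omega> = \<omega>, OF L lam' that] by simp
  qed (use l0 om in auto)
  have quad: "(\<Sum>x\<in>?I. (\<Sum>y\<in>?I. B x y * q y)\<^sup>2) = (\<Sum>x\<in>?I. \<Sum>y\<in>?I. ?A x y * q x * q y)" for q
  proof -
    have "(\<Sum>z\<in>?I. (\<Sum>y\<in>?I. B z y * q y)\<^sup>2) = (\<Sum>z\<in>?I. \<Sum>x\<in>?I. \<Sum>y\<in>?I. (B z x * B z y) * q x * q y)"
      unfolding power2_eq_square sum_product by (intro sum.cong refl) (simp add: mult_ac)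
    also have "\<dots> = (\<Sum>x\<in>?I. \<Sum>z\<in>?I. \<Sum>y\<in>?I. (B z x * B z y) * q x * q y)" by (rule sum.swap)
    also have "\<dots> = (\<Sum>x\<in>?I. \<Sum>y\<in>?I. \<Sum>z\<in>?I. (B z x * B z y) * q x * q y)" by (intro sum.cong refl sum.swap)
    also have "\<dots> = (\<Sum>x\<in>?I. \<Sum>y\<in>?I. ?A x y * q x * q y)"
      unfolding sum_distrib_right[symmetric] by (intro sum.cong refl) (simp add: B(3)[symmetric] B(2))
    finally show ?thesis .
  qed
  have d0: "0 \<le> real_of_int (tdist nu L x y)" for x y by (simp add: tdist_nonneg)
  have V: "\<And>x. (V has_real_derivative V' x) (at x)" using Vder by blast
  interpret unitary_group "cfgM nu L" U by (rule unitary_group_dynamics[OF dyn])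
  interpret LR: lieb_robinson nu L B \<beta> U \<omega> lam V "\<bar>V 0\<bar> + (LINT q|lborel. \<bar>V' q\<bar>)" "Fourier V'" a
    "\<mu>' * v_h nu \<omega> lam \<mu>'" C "C_nu nu L" "\<lambda>x y. exp (- \<mu>' * real_of_int (tdist nu L x y))" F
  proof unfold_locales
    show "0 < \<beta>" "1 \<le> L" by fact+
    show "B x y = B y x" if "x \<in> ?I" "y \<in> ?I" for x y by (rule B(2)[OF that])
    show "\<beta> * (\<Sum>x\<in>?I. (q x)\<^sup>2) \<le> (\<Sum>x\<in>?I. \<Sum>y\<in>?I. B x y * q x * q y)" for q by (rule B(4))
    show "((\<lambda>h. l2norm (cfgM nu L) (\<lambda>q. (U h \<psi> q - \<psi> q) / complex_of_real h + \<i> * Ham nu \<omega> lam V L \<psi> q)) \<longlongrightarrow> 0) (at 0)"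
      if "\<psi> \<in> core nu L" for \<psi> using dyn that unfolding is_dynamics_def Let_def by blast
    have "continuous_on UNIV V" using V by (meson DERIV_continuous_on has_field_derivative_at_within)
    then show "V \<in> borel_measurable borel" by (rule borel_measurable_continuous_onI)
    show "\<bar>V s\<bar> \<le> \<bar>V 0\<bar> + (LINT q|lborel. \<bar>V' q\<bar>)" for s by (rule antiderivative_bounded[OF V V'cont V'L1])
    show "(\<Sum>x\<in>?I. \<omega>\<^sup>2 * (q x)\<^sup>2 + (\<Sum>j<nu. lam j * (q x - q (nbr L x j))\<^sup>2)) = (\<Sum>x\<in>?I. (\<Sum>y\<in>?I. B x y * q y)\<^sup>2)" for q
      using Amat_quadratic[where lam = lam and \<omega> = \<omega> and q = q, OF L lam'] quad[of q] by simp
    show "integrable lborel (Fourier V')" by (rule Fourier_integrable[OF V'L1 kappa_fin])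
    show "integrable lborel (\<lambda>w. cmod (Fourier V' w) * \<bar>w\<bar>)" by fact
    show "of_real (V (r + s) - V r) = (CLINT w|lborel. Fourier V' w * fkern s w * iexp (w * r))" for r s
      by (rule increment_Fourier[OF V V'cont V'L1 kappa_fin])
    show "0 < a" "0 \<le> C" by fact+
    show "2 * a \<le> \<mu>' * v_h nu \<omega> lam \<mu>'"
    proof -
      \<comment> \<open>The factor exp 1 in \<open>v_h\<close> exceeds 2, and mu + eps is at least
        1; together they cover the rate 2 a.\<close>
      have "2 \<le> exp (1::real)" using exp_ge_add_one_self[of 1] by simp
      also have "\<dots> \<le> \<mu>' * exp 1" using \<mu>'1 by simp
      finally have "(c * exp (\<mu>' / 2)) * 2 \<le> (c * exp (\<mu>' / 2)) * (\<mu>' * exp 1)" using c0 by (intro mult_left_mono) auto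
      also have "\<dots> = \<mu>' * (c * exp (\<mu>' / 2 + 1))" by (simp add: exp_add)
      also have "\<dots> \<le> \<mu>' * (c * max (2 / \<mu>') (exp (\<mu>' / 2 + 1)))" using \<mu>'1 c0 by (intro mult_left_mono) auto
      finally show ?thesis by (simp add: a_def v_h_def c_def)
    qed
    show "0 \<le> exp (- \<mu>' * real_of_int (tdist nu L x y))" for x y by simp
    show "1 \<le> exp (- \<mu>' * real_of_int (tdist nu L x x))" for x by (simp add: tdist_self)
    show "(\<Sum>z\<in>?I. \<bar>\<Sum>u\<in>?I. B x u * B u z\<bar> * exp (- \<mu>' * real_of_int (tdist nu L z y))) \<le> a\<^sup>2 * exp (- \<mu>' * real_of_int (tdist nu L x y))"
      if xy: "x \<in> ?I" "y \<in> ?I" for x y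
    proof -
      have "(\<Sum>z\<in>?I. \<bar>\<Sum>u\<in>?I. B x u * B u z\<bar> * exp (- \<mu>' * real_of_int (tdist nu L z y)))
         \<le> (\<Sum>z\<in>?I. \<bar>?A x z\<bar> * (exp \<mu>' * exp (- \<mu>' * real_of_int (tdist nu L x y))))"
      proof (rule sum_mono)
        fix z assume z: "z \<in> ?I"
        show "\<bar>\<Sum>u\<in>?I. B x u * B u z\<bar> * exp (- \<mu>' * real_of_int (tdist nu L z y)) \<le> \<bar>?A x z\<bar> * (exp \<mu>' * exp (- \<mu>' * real_of_int (tdist nu L x y)))"
        proof (cases "?A x z = 0")
          case False
          \<comment> \<open>Nonzero entries join sites at distance at most one, so the exponential
            weight changes by at most exp(mu + eps) along a hop.\<close>
          have "tdist nu L x y \<le> 1 + tdist nu L z y"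
            using Amat_hop[where lam = lam, OF L lam' xy(1) z False] tdist_triangle[of nu L x y z] by linarith
          then have "real_of_int (tdist nu L x y) \<le> 1 + real_of_int (tdist nu L z y)" by linarith
          then have "\<mu>' * real_of_int (tdist nu L x y) \<le> \<mu>' * (1 + real_of_int (tdist nu L z y))" using \<mu>'1 by (intro mult_left_mono) auto
          then have "exp (- \<mu>' * real_of_int (tdist nu L z y)) \<le> exp \<mu>' * exp (- \<mu>' * real_of_int (tdist nu L x y))"
            by (simp add: exp_add[symmetric] algebra_simps)
          then show ?thesis unfolding B(3)[OF xy(1) z] by (intro mult_left_mono) auto
        qed (simp add: B(3)[OF xy(1) z])
      qed
      also have "\<dots> = (\<Sum>z\<in>?I. \<bar>?A x z\<bar>) * (exp \<mu>' * exp (- \<mu>' * real_of_int (tdist nu L x y)))" by (simp add: sum_distrib_right)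
      also have "\<dots> \<le> c\<^sup>2 * (exp \<mu>' * exp (- \<mu>' * real_of_int (tdist nu L x y)))"
        unfolding c2 by (intro mult_right_mono Amat_abs_row[where lam = lam, OF L lam' xy(1)]) auto
      also have "c\<^sup>2 * (exp \<mu>' * exp (- \<mu>' * real_of_int (tdist nu L x y))) = a\<^sup>2 * exp (- \<mu>' * real_of_int (tdist nu L x y))"
        by (simp add: a_def power_mult_distrib exp_double[symmetric])
      finally show ?thesis .
    qed
    show "(2 + a + 1 / a) * exp (- \<mu>' * real_of_int (tdist nu L x y)) \<le> C * F x y" for x y
    proof -
      \<comment> \<open>Since a >= c, the term 1/a is relaxed to the 1/c that appears in the stated
        constant.\<close>
      have "c * 1 \<le> c * exp (\<mu>' / 2)" using c0 \<mu>'1 by (intro mult_left_mono) auto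
      then have "1 / a \<le> 1 / c" using c0 by (intro divide_left_mono) (auto simp: a_def)
      then have "(2 + a + 1 / a) * exp (- \<mu>' * real_of_int (tdist nu L x y)) \<le> (2 + a + 1 / c) * (S * F x y)"
        using a0 c0 exp_le_F_mu[OF eps d0[of x y], of \<mu> nu] unfolding F_def S_def \<mu>'_def by (intro mult_mono) auto
      then show ?thesis by (simp add: C_def a_def mult.assoc)
    qed
    have Fe: "F x y = exp (- \<mu> * real_of_int (tdist nu L x y)) / (1 + real_of_int (tdist nu L x y)) ^ Suc nu" for x y
      unfolding F_def by (rule F_mu_eq[OF d0])
    have q0: "0 < 1 + real_of_int (tdist nu L x y)" for x y using d0[of x y] by linarith
    show "0 < F x y" for x y unfolding Fe using q0[of x y] by (intro divide_pos_pos) auto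
    show "F x y \<le> 1" for x y
    proof -
      have "exp (- \<mu> * real_of_int (tdist nu L x y)) \<le> 1" using mu d0[of x y] by simp
      also have "1 \<le> (1 + real_of_int (tdist nu L x y)) ^ Suc nu" using d0[of x y] by (intro one_le_power) simp
      finally show ?thesis unfolding Fe using q0[of x y] by (simp add: divide_le_eq)
    qed
    show "F x y = F y x" for x y unfolding F_def by (simp only: tdist_sym[of nu L x y])
    show "(\<Sum>z\<in>?I. F x z * F z y) \<le> C_nu nu L * F x y" if "x \<in> ?I" "y \<in> ?I" for x y
      unfolding F_def using mu by (intro F_mu_convolution L that) auto
  qed
  define fn where "fn = supnorm nu L f"
  define gn where "gn = supnorm nu L g"
  \<comment> \<open>The origin witnesses that the box is nonempty, so that the suprema defining the
    norms are meaningful.\<close>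
  define x0 :: "int list" where "x0 = replicate nu 0"
  have x0: "x0 \<in> ?I" using L by (auto simp: Lam_def x0_def)
  have sup: "cmod (h y) \<le> supnorm nu L h" if "\<And>x. x \<notin> Z \<Longrightarrow> h x = 0" "Z \<subseteq> ?I" for h Z y
  proof -
    have u: "cmod (h y) \<le> supnorm nu L h" if "y \<in> ?I" for y
      unfolding supnorm_def using that by (intro cSUP_upper) auto
    then show ?thesis using that u[OF x0] order_trans[OF norm_ge_zero u[OF x0]] by (cases "y \<in> Z") auto
  qed
  define \<sigma> :: real where "\<sigma> = (if 0 \<le> t then 1 else - 1)"
  have \<sigma>: "\<bar>\<sigma>\<bar> = 1" "\<sigma> * \<bar>t\<bar> = t" by (auto simp: \<sigma>_def)
  \<comment> \<open>The commutator estimate needs a nonempty support. If Y is empty then g = 0 and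
    its norm vanishes, so enlarging Y to one site leaves the bound unchanged.\<close>
  define Y' where "Y' = (if Y = {} then {x0} else Y)"
  have Y': "Y' \<subseteq> ?I" "Y' \<noteq> {}" "Y \<subseteq> Y'" using Y x0 by (auto simp: Y'_def)
  have gs': "g y = 0" if "y \<notin> Y'" for y using gs Y'(3) that by blast
  have gY: "gn * (\<Sum>x\<in>X. \<Sum>y\<in>Y'. F x y) = gn * (\<Sum>x\<in>X. \<Sum>y\<in>Y. F x y)"
  proof (cases "Y = {}")
    case True
    then have "gn = 0" unfolding gn_def supnorm_def using gs x0 by (simp cong: SUP_cong_simp) (metis cSUP_const empty_iff)
    then show ?thesis by simp
  qed (simp add: Y'_def)
  have main: "l2norm (cfgM nu L) (\<lambda>q. U (- t) (Weyl nu L f (U t (Weyl nu L g \<psi>))) q - Weyl nu L g (U (- t) (Weyl nu L f (U t \<psi>))) q)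
     \<le> C * fn * gn * exp (\<mu>' * (v_h nu \<omega> lam \<mu>' + C * C_nu nu L * \<kappa> / \<mu>') * \<bar>t\<bar>) * (\<Sum>x\<in>X. \<Sum>y\<in>Y. F x y) * l2norm (cfgM nu L) \<psi>"
    if \<psi>: "\<psi> \<in> L2 (cfgM nu L)" for \<psi>
  proof -
    have "l2norm (cfgM nu L) (LR.comm g (\<lambda>_. f) (\<sigma> * \<bar>t\<bar>) \<psi>)
       \<le> C * fn * gn * exp ((\<mu>' * v_h nu \<omega> lam \<mu>' + C * C_nu nu L * LR.\<kappa>) * \<bar>t\<bar>) * (\<Sum>x\<in>X. \<Sum>y\<in>Y'. F x y) * l2norm (cfgM nu L) \<psi>"
      unfolding fn_def gn_def
      by (rule LR.comm_bound[OF Y'(1,2) gs' sup[OF gs Y] \<sigma>(1) abs_ge_zero X fs sup[OF fs X] \<psi>])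
    also have "\<mu>' * v_h nu \<omega> lam \<mu>' + C * C_nu nu L * LR.\<kappa> = \<mu>' * (v_h nu \<omega> lam \<mu>' + C * C_nu nu L * \<kappa> / \<mu>')"
      using \<mu>'1 by (simp add: LR.\<kappa>_def \<kappa>_def distrib_left)
    also have "C * fn * gn * exp (\<mu>' * (v_h nu \<omega> lam \<mu>' + C * C_nu nu L * \<kappa> / \<mu>') * \<bar>t\<bar>) * (\<Sum>x\<in>X. \<Sum>y\<in>Y'. F x y)
       = C * fn * gn * exp (\<mu>' * (v_h nu \<omega> lam \<mu>' + C * C_nu nu L * \<kappa> / \<mu>') * \<bar>t\<bar>) * (\<Sum>x\<in>X. \<Sum>y\<in>Y. F x y)"
      using gY by (simp add: mult_ac)
    finally show ?thesis unfolding \<sigma>(2) LR.comm_def LR.heis_def .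
  qed
  show "let c = c_ol nu \<omega> lam;
           \<kappa> = (LINT w|lborel. cmod (Fourier V' w) * \<bar>w\<bar>);
           C = (2 + c * exp ((\<mu> + \<epsilon>) / 2) + 1 / c)
               * (SUP s\<in>{0::real..}. (1 + s) ^ (nu + 1) * exp (- \<epsilon> * s));
           v = v_h nu \<omega> lam (\<mu> + \<epsilon>) + C * C_nu nu L * \<kappa> / (\<mu> + \<epsilon>);
           M = cfgM nu L
       in \<forall>\<psi>\<in>L2 M.
            l2norm M (\<lambda>q. U (- t) (Weyl nu L f (U t (Weyl nu L g \<psi>))) q
                           - Weyl nu L g (U (- t) (Weyl nu L f (U t \<psi>))) q)
            \<le> C * supnorm nu L f * supnorm nu L g * exp ((\<mu> + \<epsilon>) * v * \<bar>t\<bar>)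
              * (\<Sum>x\<in>X. \<Sum>y\<in>Y. F_mu nu \<mu> (real_of_int (tdist nu L x y))) * l2norm M \<psi>"
    using main unfolding Let_def c_def \<kappa>_def C_def S_def \<mu>'_def F_def fn_def gn_def by blast
qed

end
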